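(* Let $\mathbf{x}=x_1,\ldots,x_s$ be a mixed multiplicity system of $N$ with respect to the ideals $J,\mathbf{I}$ of the type $(k_0,\mathbf{k})\in\mathbb{N}^{d+1}$. For each $1\le i\le s$, denote by $(m_i,\mathbf{h}_i)=(m_i,h_{i1},\ldots,h_{id})$ the type of the subsequence $x_1,\ldots,x_i$ of $\mathbf{x}$, and set $N_i=\dfrac{(x_1,\ldots,x_{i-1})N:x_i}{(x_1,\ldots,x_{i-1})N}$. Then $$e\big(J^{[k_0+1]},\mathbf{I}^{[\mathbf{k}]};N\big)=e\Big(J;\frac{N}{\mathbf{x}N:I^\infty}\Big)-\sum_{i=1}^s e\big(J^{[k_0-m_i+1]},\mathbf{I}^{[\mathbf{k}-\mathbf{h}_i]};N_i\big).$$
   Context: $\mathbb{N}$ denotes the nonnegative integers, $d\ge1$. $(R,\mathfrak{n})$ is a Noetherian local ring with infinite residue field, $N$ is a finitely generated $R$-module, $J,I_1,\ldots,I_d$ are ideals of $R$ with $J$ being $\mathfrak{n}$-primary. Put $\mathbf{I}=I_1,\ldots,I_d$, $I_0=J$, $I=JI_1\cdots I_d$, and $\mathbb{I}^{\mathbf{n}}=I_1^{n_1}\cdots I_d^{n_d}$. For submodules $L$ of a module $N$, $L:x=\{m\in N:xm\in L\}$ and $L:I^\infty=\bigcup_{t\ge0}\{m\in N: I^tm\subseteq L\}$; $N/\mathbf{x}N:I^\infty$ means $N/(\mathbf{x}N:I^\infty)$. "For all large $\mathbf{n}$" (or $\mathbf{n}\gg\mathbf{0}$) means every component is sufficiently large.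 $\dim 0=-\infty$. $e(J;Q)$ is the Hilbert–Samuel multiplicity of a finitely generated $R$-module $Q$ with respect to $J$ (in dimension $\dim Q$), with $e(J;0)=0$. Mixed multiplicities of ideals: for any finitely generated $R$-module $N$, let $T=\bigoplus_{n\ge0,\,\mathbf{n}\ge\mathbf{0}}J^n\mathbb{I}^{\mathbf{n}}/J^{n+1}\mathbb{I}^{\mathbf{n}}$, a standard $\mathbb{N}^{d+1}$-graded algebra over the Artinian local ring $R/J$, and $\mathcal{N}=\bigoplus_{n\ge0,\,\mathbf{n}\ge\mathbf{0}}J^n\mathbb{I}^{\mathbf{n}}N/J^{n+1}\mathbb{I}^{\mathbf{n}}N$, a finitely generated $\mathbb{N}^{d+1}$-graded $T$-module. For all large $(n_0,\mathbf{n})$ the length of $\mathcal{N}_{(n_0,\mathbf{n})}$ is given by a polynomial, written uniquely as $\sum_{(k_0,\mathbf{k})\in\mathbb{N}^{d+1}}e(\mathcal{N};k_0,\mathbf{k})\prod_{i=0}^d\binom{n_i+k_i}{k_i}$ with integer coefficients. The mixed multiplicity of $N$ with respect to $J,\mathbf{I}$ of type $(k_0,\mathbf{k})$ in this indexing is defined if $e(\mathcal{N};h_0,\mathbf{h})=0$ for all $(h_0,\mathbf{h})\ne(k_0,\mathbf{k})$ with $(h_0,\mathbf{h})\ge(k_0,\mathbf{k})$ componentwise; then $e(J^{[k_0+1]},\mathbf{I}^{[\mathbf{k}]};N):=e(\mathcal{N};k_0,\mathbf{k})$. Rees superficial sequences: an element $a\in R$ is a Rees superficial element of $N$ with respect to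 $J,\mathbf{I}$ if for some $i\in\{0,\ldots,d\}$, $a\in I_i$ and $aN\cap J^{n_0}\mathbb{I}^{\mathbf{n}}I_iN=aJ^{n_0}\mathbb{I}^{\mathbf{n}}N$ for all $(n_0,\mathbf{n})\gg\mathbf{0}$; it is then counted as an element of $I_i$. A sequence $x_1,\ldots,x_t$ is a Rees superficial sequence of $N$ if each $x_{j+1}$ is a Rees superficial element of $N/(x_1,\ldots,x_j)N$ ($0\le j<t$); it is of the type $(k_0,\mathbf{k})$ if it consists of $k_0$ elements of $J$, $k_1$ elements of $I_1$, ..., $k_d$ elements of $I_d$ (in any order). A Rees superficial sequence $\mathbf{x}$ of $N$ with respect to $J,\mathbf{I}$ of the type $(k_0,\mathbf{k})$ is a mixed multiplicity system of $N$ with respect to $J,\mathbf{I}$ of the type $(k_0,\mathbf{k})$ if $\dim N/(\mathbf{x}N:I^\infty)\le1$. *)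

theory Defs
  imports
    "HOL-Algebra.Module"
    "HOL-Algebra.QuotRing"
    "HOL-Algebra.Ideal_Product"
    "HOL-Algebra.Ring_Divisibility"
    "HOL-Library.Extended_Nat"
    "HOL-Library.Extended_Real"
    "HOL-Computational_Algebra.Polynomial"
begin

section \<open>Rings and ideals\<close>

definition noetherian_local_ring :: "('a, 'r) ring_scheme \<Rightarrow> 'a set \<Rightarrow> bool" where
  "noetherian_local_ring R \<nn> \<longleftrightarrow>
     cring R \<and> noetherian_ring R \<and> maximalideal \<nn> R \<and> (\<forall>\<mm>. maximalideal \<mm> R \<longrightarrow> \<mm> = \<nn>)"

definition ideal_radical :: "('a, 'r) ring_scheme \<Rightarrow> 'a set \<Rightarrow> 'a set" where
  "ideal_radical R Q = {a \<in> carrier R. \<exists>t::nat. a [^]\<^bsub>R\<^esub> t \<in> Q}"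

definition primary_ideal :: "('a, 'r) ring_scheme \<Rightarrow> 'a set \<Rightarrow> bool" where
  "primary_ideal R Q \<longleftrightarrow> ideal Q R \<and> Q \<noteq> carrier R \<and>
     (\<forall>a\<in>carrier R. \<forall>b\<in>carrier R. a \<otimes>\<^bsub>R\<^esub> b \<in> Q \<longrightarrow> a \<in> Q \<or> b \<in> ideal_radical R Q)"

text \<open>
  A family of ideals \<open>I\<^sub>0, \<dots>, I\<^sub>d\<close> (with \<open>I\<^sub>0 = J\<close>) is a function on \<open>nat\<close> of which only the
  values at \<open>i \<le> d\<close> matter. Products and powers are taken in the commutative monoid
  \<^term>\<open>ideals_set R\<close>. Thus \<open>ideal_monomial R d I n\<close> is \<open>J^{n\<^sub>0} I\<^sub>1^{n\<^sub>1} \<cdots> I\<^sub>d^{n\<^sub>d}\<close>.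
\<close>

definition ideal_monomial ::
  "('a, 'r) ring_scheme \<Rightarrow> nat \<Rightarrow> (nat \<Rightarrow> 'a set) \<Rightarrow> (nat \<Rightarrow> nat) \<Rightarrow> 'a set" where
  "ideal_monomial R d I n = (\<Otimes>\<^bsub>ideals_set R\<^esub> i \<in> {..d}. I i [^]\<^bsub>ideals_set R\<^esub> n i)"

section \<open>Modules\<close>

definition submodule_span ::
  "('a, 'r) ring_scheme \<Rightarrow> ('a, 'b, 'm) module_scheme \<Rightarrow> 'b set \<Rightarrow> 'b set" where
  "submodule_span R M S = \<Inter>{H. submodule H R M \<and> S \<subseteq> H}"

definition fin_gen_module ::
  "('a, 'r) ring_scheme \<Rightarrow> ('a, 'b, 'm) module_scheme \<Rightarrow> bool" where
  "fin_gen_module R M \<longleftrightarrow>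
     (\<exists>S. finite S \<and> S \<subseteq> carrier M \<and> submodule_span R M S = carrier M)"

text \<open>The submodule \<open>A M\<close> for an ideal \<open>A\<close>.\<close>

definition ideal_smult ::
  "('a, 'r) ring_scheme \<Rightarrow> ('a, 'b, 'm) module_scheme \<Rightarrow> 'a set \<Rightarrow> 'b set" where
  "ideal_smult R M A = submodule_span R M {a \<odot>\<^bsub>M\<^esub> m | a m. a \<in> A \<and> m \<in> carrier M}"

text \<open>
  The ring multiplication and unit fields of a \<open>module\<close> record play no role in the locale
  \<open>module\<close>, so they are left unspecified in the quotient \<open>M / L\<close>.
\<close>

definition quot_module ::
  "('a, 'b, 'm) module_scheme \<Rightarrow> 'b set \<Rightarrow> ('a, 'b set) module" where
  "quot_module M L =
     \<lparr>carrier = a_rcosets\<^bsub>M\<^esub> L, monoid.mult = undefined, one = undefined,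
      zero = L, add = set_add M,
      module.smult = (\<lambda>r X. \<Union>x\<in>X. L +>\<^bsub>M\<^esub> (r \<odot>\<^bsub>M\<^esub> x))\<rparr>"

text \<open>The quotient \<open>H / L\<close> of submodules \<open>L \<subseteq> H\<close> of \<open>M\<close>.\<close>

definition subquot_module ::
  "('a, 'b, 'm) module_scheme \<Rightarrow> 'b set \<Rightarrow> 'b set \<Rightarrow> ('a, 'b set) module" where
  "subquot_module M H L = quot_module (M\<lparr>carrier := H\<rparr>) L"

text \<open>\<open>L : x\<close> and \<open>L : A\<^sup>\<infinity>\<close>, for a submodule \<open>L\<close> of \<open>M\<close>.\<close>

definition colon_elem ::
  "('a, 'b, 'm) module_scheme \<Rightarrow> 'b set \<Rightarrow> 'a \<Rightarrow> 'b set" where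
  "colon_elem M L x = {m \<in> carrier M. x \<odot>\<^bsub>M\<^esub> m \<in> L}"

definition colon_sat ::
  "('a, 'r) ring_scheme \<Rightarrow> ('a, 'b, 'm) module_scheme \<Rightarrow> 'b set \<Rightarrow> 'a set \<Rightarrow> 'b set" where
  "colon_sat R M L A =
     (\<Union>t::nat. {m \<in> carrier M. \<forall>a \<in> A [^]\<^bsub>ideals_set R\<^esub> t. a \<odot>\<^bsub>M\<^esub> m \<in> L})"

definition module_length ::
  "('a, 'r) ring_scheme \<Rightarrow> ('a, 'b, 'm) module_scheme \<Rightarrow> enat" where
  "module_length R M = Sup {enat l | l.
     \<exists>H :: nat \<Rightarrow> 'b set. (\<forall>i\<le>l. submodule (H i) R M) \<and> (\<forall>i<l. H i \<subset> H (Suc i))}"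

definition annihilator ::
  "('a, 'r) ring_scheme \<Rightarrow> ('a, 'b, 'm) module_scheme \<Rightarrow> 'a set" where
  "annihilator R M = {a \<in> carrier R. \<forall>m\<in>carrier M. a \<odot>\<^bsub>M\<^esub> m = \<zero>\<^bsub>M\<^esub>}"

text \<open>
  Krull dimension of \<open>R / Ann M\<close>. For the zero module the supremum is over the empty set,
  which gives \<open>-\<infinity>\<close>.
\<close>

definition module_dim ::
  "('a, 'r) ring_scheme \<Rightarrow> ('a, 'b, 'm) module_scheme \<Rightarrow> ereal" where
  "module_dim R M = Sup {ereal (real l) | l.
     \<exists>P :: nat \<Rightarrow> 'a set. (\<forall>i\<le>l. primeideal (P i) R \<and> annihilator R M \<subseteq> P i) \<and>
                         (\<forall>i<l. P i \<subset> P (Suc i))}"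

section \<open>Hilbert--Samuel multiplicity\<close>

definition hilbert_samuel_poly ::
  "('a, 'r) ring_scheme \<Rightarrow> 'a set \<Rightarrow> ('a, 'b, 'm) module_scheme \<Rightarrow> rat poly" where
  "hilbert_samuel_poly R J Q = (THE p. \<exists>c. \<forall>n\<ge>c. \<exists>l::nat.
     module_length R (quot_module Q (ideal_smult R Q (J [^]\<^bsub>ideals_set R\<^esub> Suc n))) = enat l \<and>
     of_nat l = poly p (of_nat n))"

text \<open>
  \<open>e(J; Q)\<close> is \<open>D!\<close> times the coefficient of \<open>n^D\<close> in the Hilbert--Samuel polynomial, where
  \<open>D = dim Q\<close>. The description is only meaningful for \<open>Q \<noteq> 0\<close>.
\<close>

definition multiplicity_HS ::
  "('a, 'r) ring_scheme \<Rightarrow> 'a set \<Rightarrow> ('a, 'b, 'm) module_scheme \<Rightarrow> rat" where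
  "multiplicity_HS R J Q =
     (if carrier Q = {\<zero>\<^bsub>Q\<^esub>} then 0
      else let D = (THE D::nat. module_dim R Q = ereal (real D))
           in fact D * Polynomial.coeff (hilbert_samuel_poly R J Q) D)"

section \<open>Mixed multiplicities\<close>

text \<open>
  Elements of \<open>\<nat>\<^sup>d\<^sup>+\<^sup>1\<close> are functions \<open>h :: nat \<Rightarrow> nat\<close> vanishing beyond \<open>d\<close>, so that the pointwise
  order on functions is the componentwise order. For exponents \<open>n\<close> only the values at
  \<open>i \<le> d\<close> are used, and no such normalisation is imposed.
\<close>

definition multi_index :: "nat \<Rightarrow> (nat \<Rightarrow> nat) \<Rightarrow> bool" where
  "multi_index d h \<longleftrightarrow> (\<forall>i>d. h i = 0)"

definition for_all_large :: "nat \<Rightarrow> ((nat \<Rightarrow> nat) \<Rightarrow> bool) \<Rightarrow> bool" where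
  "for_all_large d P \<longleftrightarrow> (\<exists>c. \<forall>n. (\<forall>i\<le>d. c \<le> n i) \<longrightarrow> P n)"

text \<open>
  The component of degree \<open>n = (n\<^sub>0, \<dots>, n\<^sub>d)\<close> of the graded module
  \<open>\<Oplus> J^{n\<^sub>0} \<I>^{\<n>} M / J^{n\<^sub>0+1} \<I>^{\<n>} M\<close>, as an \<open>R\<close>-module. It is annihilated by
  \<open>J\<close>, and its submodules over \<open>R\<close> and over \<open>R/J\<close> are the same, hence so is its length.
\<close>

definition graded_component ::
  "('a, 'r) ring_scheme \<Rightarrow> nat \<Rightarrow> (nat \<Rightarrow> 'a set) \<Rightarrow> ('a, 'b, 'm) module_scheme \<Rightarrow>
   (nat \<Rightarrow> nat) \<Rightarrow> ('a, 'b set) module" where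
  "graded_component R d I M n =
     subquot_module M
       (ideal_smult R M (ideal_monomial R d I n))
       (ideal_smult R M (ideal_monomial R d I (n(0 := n 0 + 1))))"

definition has_hilbert_coeffs ::
  "('a, 'r) ring_scheme \<Rightarrow> nat \<Rightarrow> (nat \<Rightarrow> 'a set) \<Rightarrow> ('a, 'b, 'm) module_scheme \<Rightarrow>
   ((nat \<Rightarrow> nat) \<Rightarrow> int) \<Rightarrow> bool" where
  "has_hilbert_coeffs R d I M e \<longleftrightarrow>
     finite {h. e h \<noteq> 0} \<and> (\<forall>h. e h \<noteq> 0 \<longrightarrow> multi_index d h) \<and>
     for_all_large d (\<lambda>n. \<exists>l::nat.
       module_length R (graded_component R d I M n) = enat l \<and>
       int l = (\<Sum>h | e h \<noteq> 0. e h * (\<Prod>i\<le>d. int ((n i + h i) choose h i))))"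

definition hilbert_coeff ::
  "('a, 'r) ring_scheme \<Rightarrow> nat \<Rightarrow> (nat \<Rightarrow> 'a set) \<Rightarrow> ('a, 'b, 'm) module_scheme \<Rightarrow>
   (nat \<Rightarrow> nat) \<Rightarrow> int" where
  "hilbert_coeff R d I M = (THE e. has_hilbert_coeffs R d I M e)"

text \<open>
  With \<open>k = (k\<^sub>0, \<k>)\<close>, \<open>mixed_mult R d I M k\<close> is \<open>e(J^{[k\<^sub>0+1]}, \<I>^{[\<k>]}; M)\<close>; the
  shift by one in the first argument is not part of \<open>k\<close>. It is the mixed multiplicity only if
  \<open>mixed_mult_defined R d I M k\<close> holds.
\<close>

definition mixed_mult_defined ::
  "('a, 'r) ring_scheme \<Rightarrow> nat \<Rightarrow> (nat \<Rightarrow> 'a set) \<Rightarrow> ('a, 'b, 'm) module_scheme \<Rightarrow>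
   (nat \<Rightarrow> nat) \<Rightarrow> bool" where
  "mixed_mult_defined R d I M k \<longleftrightarrow> multi_index d k \<and>
     (\<forall>h. multi_index d h \<and> h \<noteq> k \<and> k \<le> h \<longrightarrow> hilbert_coeff R d I M h = 0)"

definition mixed_mult ::
  "('a, 'r) ring_scheme \<Rightarrow> nat \<Rightarrow> (nat \<Rightarrow> 'a set) \<Rightarrow> ('a, 'b, 'm) module_scheme \<Rightarrow>
   (nat \<Rightarrow> nat) \<Rightarrow> int" where
  "mixed_mult R d I M k = hilbert_coeff R d I M k"

section \<open>Rees superficial sequences and mixed multiplicity systems\<close>

text \<open>\<open>a\<close> is a Rees superficial element of \<open>M\<close>, counted as an element of \<open>I\<^sub>i\<close>.\<close>

definition rees_superficial_elem ::
  "('a, 'r) ring_scheme \<Rightarrow> nat \<Rightarrow> (nat \<Rightarrow> 'a set) \<Rightarrow> ('a, 'b, 'm) module_scheme \<Rightarrow>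
   nat \<Rightarrow> 'a \<Rightarrow> bool" where
  "rees_superficial_elem R d I M i a \<longleftrightarrow> i \<le> d \<and> a \<in> I i \<and>
     for_all_large d (\<lambda>n.
       (\<lambda>m. a \<odot>\<^bsub>M\<^esub> m) ` carrier M \<inter> ideal_smult R M (ideal_monomial R d I n \<cdot>\<^bsub>R\<^esub> I i) =
       (\<lambda>m. a \<odot>\<^bsub>M\<^esub> m) ` ideal_smult R M (ideal_monomial R d I n))"

text \<open>
  An element may lie in several of the ideals, so a sequence is a list of pairs \<open>(i, x)\<close> that
  records the ideal \<open>I\<^sub>i\<close> as an element of which \<open>x\<close> is counted.
\<close>

definition seq_submodule ::
  "('a, 'r) ring_scheme \<Rightarrow> ('a, 'b, 'm) module_scheme \<Rightarrow> (nat \<times> 'a) list \<Rightarrow> 'b set" where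
  "seq_submodule R M xs = ideal_smult R M (Idl\<^bsub>R\<^esub> (snd ` set xs))"

definition rees_superficial_seq ::
  "('a, 'r) ring_scheme \<Rightarrow> nat \<Rightarrow> (nat \<Rightarrow> 'a set) \<Rightarrow> ('a, 'b, 'm) module_scheme \<Rightarrow>
   (nat \<times> 'a) list \<Rightarrow> bool" where
  "rees_superficial_seq R d I M xs \<longleftrightarrow>
     (\<forall>j<length xs. rees_superficial_elem R d I
        (quot_module M (seq_submodule R M (take j xs))) (fst (xs ! j)) (snd (xs ! j)))"

definition seq_type :: "(nat \<times> 'a) list \<Rightarrow> nat \<Rightarrow> nat" where
  "seq_type xs = (\<lambda>i. count_list (map fst xs) i)"

text \<open>\<open>M / (\<x> M : (J I\<^sub>1 \<cdots> I\<^sub>d)\<^sup>\<infinity>)\<close>\<close>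

definition sat_quotient ::
  "('a, 'r) ring_scheme \<Rightarrow> nat \<Rightarrow> (nat \<Rightarrow> 'a set) \<Rightarrow> ('a, 'b, 'm) module_scheme \<Rightarrow>
   (nat \<times> 'a) list \<Rightarrow> ('a, 'b set) module" where
  "sat_quotient R d I M xs =
     quot_module M (colon_sat R M (seq_submodule R M xs) (\<Otimes>\<^bsub>ideals_set R\<^esub> i \<in> {..d}. I i))"

definition mixed_mult_system ::
  "('a, 'r) ring_scheme \<Rightarrow> nat \<Rightarrow> (nat \<Rightarrow> 'a set) \<Rightarrow> ('a, 'b, 'm) module_scheme \<Rightarrow>
   (nat \<Rightarrow> nat) \<Rightarrow> (nat \<times> 'a) list \<Rightarrow> bool" where
  "mixed_mult_system R d I M k xs \<longleftrightarrow>
     rees_superficial_seq R d I M xs \<and> seq_type xs = k \<and>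
     module_dim R (sat_quotient R d I M xs) \<le> 1"

text \<open>\<open>((x\<^sub>1, \<dots>, x\<^sub>i\<^sub>-\<^sub>1) M : x\<^sub>i) / (x\<^sub>1, \<dots>, x\<^sub>i\<^sub>-\<^sub>1) M\<close>, with \<open>i\<close> counted from 1.\<close>

definition colon_quotient ::
  "('a, 'r) ring_scheme \<Rightarrow> ('a, 'b, 'm) module_scheme \<Rightarrow> (nat \<times> 'a) list \<Rightarrow> nat \<Rightarrow>
   ('a, 'b set) module" where
  "colon_quotient R M xs i =
     (let L = seq_submodule R M (take (i - 1) xs)
      in subquot_module M (colon_elem M L (snd (xs ! (i - 1)))) L)"

end

theory Submission
  imports Defs
begin

text \<open>
  Everything is done inside the lattice of submodules of one module \<open>N\<close>. For submodules
  \<open>L \<subseteq> H\<close> let \<open>p(L,H)(n)\<close> be the length of the interval between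
  \<open>J^{n\<^sub>0+1} I\<^sub>1^{n\<^sub>1} \<cdots> I\<^sub>d^{n\<^sub>d} H + L\<close> and
  \<open>J^{n\<^sub>0} I\<^sub>1^{n\<^sub>1} \<cdots> I\<^sub>d^{n\<^sub>d} H + L\<close>; this is the Hilbert function that defines the mixed
  multiplicities of \<open>H/L\<close>. Write \<open>\<Delta>\<^sub>i p (n) = p (n + e\<^sub>i) - p n\<close>. If an iterated difference
  \<open>\<Delta>\<^sup>k p(L,H)\<close> is a constant \<open>e\<close> for all large \<open>n\<close>, then the mixed multiplicity of \<open>H/L\<close> of type
  \<open>k\<close> is defined and equals \<open>e\<close> (\<open>mixed_mult_const_diff\<close>). So definedness and value are
  handled together, as one statement \<open>const_diff\<close> about differences of Hilbert functions.

  The heart is one superficial element \<open>x \<in> I\<^sub>i\<close> of \<open>N/L\<close> (\<open>superficial_step\<close>). Put \<open>L' = xN + L\<close> and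
  \<open>K = L : x\<close>. Superficiality says that for large \<open>n\<close> the part of the \<open>(n + e\<^sub>i)\<close>-th piece of
  \<open>N/L\<close> inside \<open>L'/L\<close> is \<open>x\<close> times the \<open>n\<close>-th piece of \<open>N\<close>; since multiplication by \<open>x\<close> identifies
  \<open>N/K\<close> with \<open>L'/L\<close>, this yields
  \<open>p(L,N)(n + e\<^sub>i) = p(L',N)(n + e\<^sub>i) + p(K,N)(n)\<close>, while \<open>p(L,N)(n) = q(n) + p(K,N)(n)\<close> with
  \<open>q\<close> the Hilbert function of the filtration induced on \<open>K/L\<close>. Hence
  \<open>\<Delta>\<^sub>i p(L,N)(n) = p(L',N)(n + e\<^sub>i) - q(n)\<close>. By the Artin--Rees lemma \<open>q\<close> has the same constant
  differences as \<open>p(L,K)\<close>. Thus the multiplicity of \<open>N/L\<close> of type \<open>k\<close> is that of \<open>N/L'\<close> of type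
  \<open>k - e\<^sub>i\<close> minus that of \<open>K/L\<close> of type \<open>k - e\<^sub>i\<close>, and going through \<open>\<^bold>x\<close> from its end gives
  the formula with \<open>p(\<^bold>xN, N)\<close> in place of the last term.

  For the last term, \<open>\<^bold>xN\<close> may be replaced by its saturation \<open>S\<close>, as a power of the product of the
  ideals kills \<open>S/\<^bold>xN\<close> (\<open>const_saturation\<close>). Since \<open>N/S\<close> has dimension at most one, filtering it by
  cyclic modules \<open>R/P\<close> shows that \<open>p(S,N)\<close> is bounded, hence eventually constant
  (\<open>const_dim_le1\<close>). The constant does not change when only powers of \<open>J\<close> are used: for a fixed large
  \<open>c\<close> some power of \<open>J\<close> maps \<open>N\<close> into \<open>(I\<^sub>1 \<cdots> I\<^sub>d)^c N + S\<close>, because no prime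
  other than the maximal ideal contains both the annihilator of \<open>N/S\<close> and \<open>J I\<^sub>1 \<cdots> I\<^sub>d\<close>
  (\<open>const_value\<close>). In dimension one this constant is \<open>e(J; N/S)\<close>, the leading coefficient of a
  linear polynomial.

  Two general facts carry the induction. Hilbert functions are sums of products of
  one-variable functions that are eventually polynomial and have eventually nonnegative
  differences of every order (\<open>stable_families_hilbert\<close>); therefore, when a sum of two of them has
  a constant difference, so has each summand (\<open>const_diff_split\<close>), and multiplicities descend to
  quotients and to submodules (\<open>const_quotient\<close>, \<open>const_submodule\<close>). The latter is what makes the terms
  \<open>K/L\<close> defined: for large \<open>t\<close> the modules \<open>K/L\<close> and \<open>(x^t N + L)/L\<close> meet in zero, so \<open>K/L\<close>
  embeds into \<open>N/(x^t N + L)\<close>, which is an iterated extension of quotients of \<open>N/L'\<close>.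
\<close>

section \<open>Lengths of intervals of submodules\<close>

text \<open>
  The length of \<open>B/A\<close>, read off from the chains of submodules between \<open>A\<close> and \<open>B\<close>. All
  lengths in the proof are lengths of such intervals in one fixed module, so that quotient
  modules, which would live on types of cosets, enter only when the final statement is
  translated.
\<close>

definition interval_length ::
  "('a, 'r) ring_scheme \<Rightarrow> ('a, 'b, 'm) module_scheme \<Rightarrow> 'b set \<Rightarrow> 'b set \<Rightarrow> enat" where
  "interval_length R M A B = Sup {enat l | l. \<exists>H :: nat \<Rightarrow> 'b set.
     (\<forall>i\<le>l. submodule (H i) R M \<and> A \<subseteq> H i \<and> H i \<subseteq> B) \<and> (\<forall>i<l. H i \<subset> H (Suc i))}"

lemma interval_length_le:
  assumes f: "\<And>Z. submodule Z R M \<Longrightarrow> A \<subseteq> Z \<Longrightarrow> Z \<subseteq> B \<Longrightarrow>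
      submodule (f Z) R' M' \<and> A' \<subseteq> f Z \<and> f Z \<subseteq> B'"
    and mono: "\<And>Z W. submodule Z R M \<Longrightarrow> submodule W R M \<Longrightarrow> A \<subseteq> Z \<Longrightarrow> Z \<subset> W \<Longrightarrow> W \<subseteq> B \<Longrightarrow> f Z \<subset> f W"
  shows "interval_length R M A B \<le> interval_length R' M' A' B'"
  unfolding interval_length_def
proof (rule Sup_least)
  fix x
  assume "x \<in> {enat l |l. \<exists>H. (\<forall>i\<le>l. submodule (H i) R M \<and> A \<subseteq> H i \<and> H i \<subseteq> B) \<and> (\<forall>i<l. H i \<subset> H (Suc i))}"
  then obtain l H where x: "x = enat l" and H: "\<forall>i\<le>l. submodule (H i) R M \<and> A \<subseteq> H i \<and> H i \<subseteq> B"
    "\<forall>i<l. H i \<subset> H (Suc i)"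
    by (elim CollectE exE conjE)
  define G where "G = (\<lambda>i. f (H i))"
  have G1: "\<forall>i\<le>l. submodule (G i) R' M' \<and> A' \<subseteq> G i \<and> G i \<subseteq> B'"
    unfolding G_def using H(1) f by presburger
  have G2: "\<forall>i<l. G i \<subset> G (Suc i)"
  proof (intro allI impI)
    fix i assume i: "i < l"
    then have "i \<le> l" "Suc i \<le> l" by simp_all
    note * = H(1)[rule_format, OF this(1)] H(1)[rule_format, OF this(2)] H(2)[rule_format, OF i]
    show "G i \<subset> G (Suc i)" unfolding G_def by (rule mono) (use * in simp_all)
  qed
  show "x \<le> Sup {enat l |l. \<exists>G. (\<forall>i\<le>l. submodule (G i) R' M' \<and> A' \<subseteq> G i \<and> G i \<subseteq> B') \<and> (\<forall>i<l. G i \<subset> G (Suc i))}"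
    by (rule Sup_upper, rule CollectI, rule exI[of _ l], rule conjI, rule x, rule exI[of _ G],
        rule conjI, rule G1, rule G2)
qed

text \<open>
  The length depends only on the interval as an ordered set, even across different modules.
  The isomorphism theorems and the passage to quotients are all instances.
\<close>

lemma interval_length_eq:
  assumes f: "\<And>Z. submodule Z R M \<Longrightarrow> A \<subseteq> Z \<Longrightarrow> Z \<subseteq> B \<Longrightarrow>
      submodule (f Z) R' M' \<and> A' \<subseteq> f Z \<and> f Z \<subseteq> B' \<and> g (f Z) = Z"
    and g: "\<And>Z. submodule Z R' M' \<Longrightarrow> A' \<subseteq> Z \<Longrightarrow> Z \<subseteq> B' \<Longrightarrow>
      submodule (g Z) R M \<and> A \<subseteq> g Z \<and> g Z \<subseteq> B \<and> f (g Z) = Z"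
    and mf: "\<And>Z W. Z \<subseteq> W \<Longrightarrow> f Z \<subseteq> f W" and mg: "\<And>Z W. Z \<subseteq> W \<Longrightarrow> g Z \<subseteq> g W"
  shows "interval_length R M A B = interval_length R' M' A' B'"
proof (rule antisym)
  show "interval_length R M A B \<le> interval_length R' M' A' B'"
  proof (rule interval_length_le[where f = f])
    fix Z assume "submodule Z R M" "A \<subseteq> Z" "Z \<subseteq> B"
    from f[OF this] show "submodule (f Z) R' M' \<and> A' \<subseteq> f Z \<and> f Z \<subseteq> B'" by (elim conjE) (intro conjI)
  next
    fix Z W assume Z: "submodule Z R M" "submodule W R M" "A \<subseteq> Z" "Z \<subset> W" "W \<subseteq> B"
    have "Z \<subseteq> W" using Z(4) by (rule psubset_imp_subset)
    have "g (f Z) = Z \<and> g (f W) = W"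
      using f[OF Z(1,3) order_trans[OF \<open>Z \<subseteq> W\<close> Z(5)]] f[OF Z(2) order_trans[OF Z(3) \<open>Z \<subseteq> W\<close>] Z(5)]
      by (elim conjE) (intro conjI)
    then have "f Z \<noteq> f W" using Z(4) by (metis psubset_eq)
    then show "f Z \<subset> f W" using mf[OF \<open>Z \<subseteq> W\<close>] by (rule psubsetI[rotated])
  qed
  show "interval_length R' M' A' B' \<le> interval_length R M A B"
  proof (rule interval_length_le[where f = g])
    fix Z assume "submodule Z R' M'" "A' \<subseteq> Z" "Z \<subseteq> B'"
    from g[OF this] show "submodule (g Z) R M \<and> A \<subseteq> g Z \<and> g Z \<subseteq> B" by (elim conjE) (intro conjI)
  next
    fix Z W assume Z: "submodule Z R' M'" "submodule W R' M'" "A' \<subseteq> Z" "Z \<subset> W" "W \<subseteq> B'"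
    have "Z \<subseteq> W" using Z(4) by (rule psubset_imp_subset)
    have "f (g Z) = Z \<and> f (g W) = W"
      using g[OF Z(1,3) order_trans[OF \<open>Z \<subseteq> W\<close> Z(5)]] g[OF Z(2) order_trans[OF Z(3) \<open>Z \<subseteq> W\<close>] Z(5)]
      by (elim conjE) (intro conjI)
    then have "g Z \<noteq> g W" using Z(4) by (metis psubset_eq)
    then show "g Z \<subset> g W" using mg[OF \<open>Z \<subseteq> W\<close>] by (rule psubsetI[rotated])
  qed
qed

context module
begin

abbreviation sub :: "'c set \<Rightarrow> bool" where "sub U \<equiv> submodule U R M"
abbreviation len :: "'c set \<Rightarrow> 'c set \<Rightarrow> enat" where "len \<equiv> interval_length R M"
abbreviation plus_sub (infixl \<open>\<^bold>+\<close> 65) where "U \<^bold>+ V \<equiv> U <+>\<^bsub>M\<^esub> V"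
abbreviation scale :: "'a \<Rightarrow> 'c set \<Rightarrow> 'c set" (infixr \<open>\<^bold>*\<close> 75) where "a \<^bold>* U \<equiv> (\<lambda>m. a \<odot>\<^bsub>M\<^esub> m) ` U"
abbreviation colon (infixl \<open>\<^bold>:\<close> 70) where "U \<^bold>: a \<equiv> colon_elem M U a"

lemma sub_carrier: "sub U \<Longrightarrow> x \<in> U \<Longrightarrow> x \<in> carrier M"
  using submoduleE(1) by blast

lemma sub_zero [simp]: "sub U \<Longrightarrow> \<zero>\<^bsub>M\<^esub> \<in> U"
  using subgroup.one_closed[OF submodule.axioms(1)] by simp

lemma sub_addD: "sub U \<Longrightarrow> x \<in> U \<Longrightarrow> y \<in> U \<Longrightarrow> x \<oplus>\<^bsub>M\<^esub> y \<in> U"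
  by (rule submoduleE(5))

lemma sub_minusD: "sub U \<Longrightarrow> x \<in> U \<Longrightarrow> \<ominus>\<^bsub>M\<^esub> x \<in> U"
  by (rule submoduleE(6))

lemma sub_smultD: "sub U \<Longrightarrow> a \<in> carrier R \<Longrightarrow> x \<in> U \<Longrightarrow> a \<odot>\<^bsub>M\<^esub> x \<in> U"
  by (rule submoduleE(4))

lemma sub_diffD: "sub U \<Longrightarrow> x \<in> carrier M \<Longrightarrow> y \<in> U \<Longrightarrow> x \<oplus>\<^bsub>M\<^esub> y \<in> U \<Longrightarrow> x \<in> U"
proof -
  assume U: "sub U" and x: "x \<in> carrier M" and y: "y \<in> U" and xy: "x \<oplus>\<^bsub>M\<^esub> y \<in> U"
  have "x = (x \<oplus>\<^bsub>M\<^esub> y) \<oplus>\<^bsub>M\<^esub> (\<ominus>\<^bsub>M\<^esub> y)"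
    using x sub_carrier[OF U y] by (simp add: M.a_assoc M.r_neg)
  then show "x \<in> U" using sub_addD[OF U xy sub_minusD[OF U y]] by simp
qed

lemma sub_diffD2: "sub U \<Longrightarrow> x \<in> carrier M \<Longrightarrow> y \<in> U \<Longrightarrow> y \<oplus>\<^bsub>M\<^esub> x \<in> U \<Longrightarrow> x \<in> U"
  by (metis M.a_comm sub_carrier sub_diffD)

lemma plusE: "x \<in> U \<^bold>+ V \<Longrightarrow> (\<And>u v. u \<in> U \<Longrightarrow> v \<in> V \<Longrightarrow> x = u \<oplus>\<^bsub>M\<^esub> v \<Longrightarrow> P) \<Longrightarrow> P"
  unfolding set_add_def' by blast

lemma plusI: "u \<in> U \<Longrightarrow> v \<in> V \<Longrightarrow> u \<oplus>\<^bsub>M\<^esub> v \<in> U \<^bold>+ V"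
  unfolding set_add_def' by blast

lemma sub_plus [intro]:
  assumes U: "sub U" and V: "sub V" shows "sub (U \<^bold>+ V)"
proof (rule submoduleI)
  show "U \<^bold>+ V \<subseteq> carrier M"
    using sub_carrier[OF U] sub_carrier[OF V] by (auto elim!: plusE)
  have "\<zero>\<^bsub>M\<^esub> \<oplus>\<^bsub>M\<^esub> \<zero>\<^bsub>M\<^esub> \<in> U \<^bold>+ V" using U V by (intro plusI) auto
  then show "\<zero>\<^bsub>M\<^esub> \<in> U \<^bold>+ V" by simp
next
  fix a assume "a \<in> U \<^bold>+ V"
  then obtain u v where uv: "u \<in> U" "v \<in> V" "a = u \<oplus>\<^bsub>M\<^esub> v" by (rule plusE)
  have "\<ominus>\<^bsub>M\<^esub> a = (\<ominus>\<^bsub>M\<^esub> u) \<oplus>\<^bsub>M\<^esub> (\<ominus>\<^bsub>M\<^esub> v)"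
    using uv sub_carrier[OF U] sub_carrier[OF V] by (simp add: M.minus_add)
  then show "\<ominus>\<^bsub>M\<^esub> a \<in> U \<^bold>+ V"
    using uv sub_minusD U V by (metis plusI)
next
  fix a b assume "a \<in> U \<^bold>+ V" "b \<in> U \<^bold>+ V"
  then obtain u v u' v' where uv: "u \<in> U" "v \<in> V" "a = u \<oplus>\<^bsub>M\<^esub> v"
      "u' \<in> U" "v' \<in> V" "b = u' \<oplus>\<^bsub>M\<^esub> v'" by (metis plusE)
  have "a \<oplus>\<^bsub>M\<^esub> b = (u \<oplus>\<^bsub>M\<^esub> u') \<oplus>\<^bsub>M\<^esub> (v \<oplus>\<^bsub>M\<^esub> v')"
    using uv sub_carrier[OF U] sub_carrier[OF V] by (simp add: M.a_ac)
  then show "a \<oplus>\<^bsub>M\<^esub> b \<in> U \<^bold>+ V"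
    using uv sub_addD U V by (metis plusI)
next
  fix a x assume a: "a \<in> carrier R" and "x \<in> U \<^bold>+ V"
  then obtain u v where uv: "u \<in> U" "v \<in> V" "x = u \<oplus>\<^bsub>M\<^esub> v" by (metis plusE)
  have "a \<odot>\<^bsub>M\<^esub> x = a \<odot>\<^bsub>M\<^esub> u \<oplus>\<^bsub>M\<^esub> a \<odot>\<^bsub>M\<^esub> v"
    using uv a sub_carrier[OF U] sub_carrier[OF V] by (simp add: smult_r_distr)
  then show "a \<odot>\<^bsub>M\<^esub> x \<in> U \<^bold>+ V"
    using uv a sub_smultD U V by (metis plusI)
qed

lemma plus_upper1: "sub U \<Longrightarrow> sub V \<Longrightarrow> U \<subseteq> U \<^bold>+ V"
proof
  fix x assume "sub U" "sub V" "x \<in> U"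
  then have "x \<oplus>\<^bsub>M\<^esub> \<zero>\<^bsub>M\<^esub> \<in> U \<^bold>+ V" by (intro plusI) auto
  then show "x \<in> U \<^bold>+ V" using sub_carrier[OF \<open>sub U\<close> \<open>x \<in> U\<close>] by simp
qed

lemma plus_upper2: "sub U \<Longrightarrow> sub V \<Longrightarrow> V \<subseteq> U \<^bold>+ V"
proof
  fix x assume "sub U" "sub V" "x \<in> V"
  then have "\<zero>\<^bsub>M\<^esub> \<oplus>\<^bsub>M\<^esub> x \<in> U \<^bold>+ V" by (intro plusI) auto
  then show "x \<in> U \<^bold>+ V" using sub_carrier[OF \<open>sub V\<close> \<open>x \<in> V\<close>] by simp
qed

lemma plus_least: "sub W \<Longrightarrow> U \<subseteq> W \<Longrightarrow> V \<subseteq> W \<Longrightarrow> U \<^bold>+ V \<subseteq> W"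
  by (auto elim!: plusE intro: sub_addD)

lemma plus_mono: "U \<subseteq> U' \<Longrightarrow> V \<subseteq> V' \<Longrightarrow> U \<^bold>+ V \<subseteq> U' \<^bold>+ V'"
  by (auto elim!: plusE intro!: plusI)

lemma plus_absorb1: "sub U \<Longrightarrow> sub V \<Longrightarrow> V \<subseteq> U \<Longrightarrow> U \<^bold>+ V = U"
  by (meson equalityI order_refl plus_least plus_upper1)

lemma plus_absorb2: "sub U \<Longrightarrow> sub V \<Longrightarrow> U \<subseteq> V \<Longrightarrow> U \<^bold>+ V = V"
  by (meson equalityI order_refl plus_least plus_upper2)

lemma plus_comm: "sub U \<Longrightarrow> sub V \<Longrightarrow> U \<^bold>+ V = V \<^bold>+ U"
  by (intro equalityI plus_least sub_plus plus_upper1 plus_upper2)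

lemma plus_assoc: "sub U \<Longrightarrow> sub V \<Longrightarrow> sub W \<Longrightarrow> U \<^bold>+ V \<^bold>+ W = U \<^bold>+ (V \<^bold>+ W)"
proof (rule equalityI)
  assume s: "sub U" "sub V" "sub W"
  note u = plus_upper1 plus_upper2 sub_plus
  have "U \<subseteq> U \<^bold>+ (V \<^bold>+ W)" "V \<subseteq> U \<^bold>+ (V \<^bold>+ W)" "W \<subseteq> U \<^bold>+ (V \<^bold>+ W)"
    using s u[of U "V \<^bold>+ W"] u[of V W] by blast+
  then show "U \<^bold>+ V \<^bold>+ W \<subseteq> U \<^bold>+ (V \<^bold>+ W)" using s by (intro plus_least sub_plus)
  have "U \<subseteq> U \<^bold>+ V \<^bold>+ W" "V \<subseteq> U \<^bold>+ V \<^bold>+ W" "W \<subseteq> U \<^bold>+ V \<^bold>+ W"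
    using s u[of "U \<^bold>+ V" W] u[of U V] by blast+
  then show "U \<^bold>+ (V \<^bold>+ W) \<subseteq> U \<^bold>+ V \<^bold>+ W" using s by (intro plus_least sub_plus)
qed

lemma sub_int [intro]: "sub U \<Longrightarrow> sub V \<Longrightarrow> sub (U \<inter> V)"
  by (rule submoduleI) (simp_all add: sub_minusD sub_addD sub_smultD sub_carrier subset_iff)

text \<open>
  The modular law; it is what makes the length additive.
\<close>

lemma modular:
  assumes "sub U" "sub V" "sub W" "U \<subseteq> W"
  shows "(U \<^bold>+ V) \<inter> W = U \<^bold>+ (V \<inter> W)"
proof
  show "(U \<^bold>+ V) \<inter> W \<subseteq> U \<^bold>+ (V \<inter> W)"
  proof
    fix x assume "x \<in> (U \<^bold>+ V) \<inter> W"
    then obtain u v where uv: "u \<in> U" "v \<in> V" "x = u \<oplus>\<^bsub>M\<^esub> v" "x \<in> W" by (auto elim: plusE)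
    then have "v \<in> W"
      using sub_diffD2[OF assms(3), of v u] assms sub_carrier by blast
    then show "x \<in> U \<^bold>+ (V \<inter> W)" using uv plusI by auto
  qed
  show "U \<^bold>+ (V \<inter> W) \<subseteq> (U \<^bold>+ V) \<inter> W"
    using assms by (meson Int_greatest Int_lower1 Int_lower2 order_refl plus_least plus_mono)
qed

lemma sub_scale [intro]:
  assumes a: "a \<in> carrier R" and U: "sub U" shows "sub (a \<^bold>* U)"
proof (rule submoduleI)
  show "a \<^bold>* U \<subseteq> carrier M" using a sub_carrier[OF U] by auto
  show "\<zero>\<^bsub>M\<^esub> \<in> a \<^bold>* U" using a U by (metis image_eqI smult_r_null sub_zero)
next
  fix x assume "x \<in> a \<^bold>* U"
  then show "\<ominus>\<^bsub>M\<^esub> x \<in> a \<^bold>* U"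
    using a U sub_carrier[OF U] sub_minusD[OF U] by (auto simp: smult_r_minus[symmetric])
next
  fix x y assume "x \<in> a \<^bold>* U" "y \<in> a \<^bold>* U"
  then show "x \<oplus>\<^bsub>M\<^esub> y \<in> a \<^bold>* U"
    using a U sub_carrier[OF U] sub_addD[OF U] by (auto simp: smult_r_distr[symmetric])
next
  fix b x assume b: "b \<in> carrier R" and "x \<in> a \<^bold>* U"
  then obtain u where u: "u \<in> U" "x = a \<odot>\<^bsub>M\<^esub> u" by auto
  have "b \<odot>\<^bsub>M\<^esub> x = a \<odot>\<^bsub>M\<^esub> (b \<odot>\<^bsub>M\<^esub> u)"
    using u a b sub_carrier[OF U] by (simp add: smult_assoc1[symmetric] R.m_comm)
  then show "b \<odot>\<^bsub>M\<^esub> x \<in> a \<^bold>* U" using u b U sub_smultD by auto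
qed

lemma sub_colon [intro]:
  assumes a: "a \<in> carrier R" and U: "sub U" shows "sub (U \<^bold>: a)"
  unfolding colon_elem_def
proof (rule submoduleI)
  show "\<zero>\<^bsub>M\<^esub> \<in> {m \<in> carrier M. a \<odot>\<^bsub>M\<^esub> m \<in> U}" using a U by simp
  fix x assume "x \<in> {m \<in> carrier M. a \<odot>\<^bsub>M\<^esub> m \<in> U}"
  then show "\<ominus>\<^bsub>M\<^esub> x \<in> {m \<in> carrier M. a \<odot>\<^bsub>M\<^esub> m \<in> U}"
    using a U sub_minusD by (simp add: smult_r_minus)
next
  fix x y assume "x \<in> {m \<in> carrier M. a \<odot>\<^bsub>M\<^esub> m \<in> U}" "y \<in> {m \<in> carrier M. a \<odot>\<^bsub>M\<^esub> m \<in> U}"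
  then show "x \<oplus>\<^bsub>M\<^esub> y \<in> {m \<in> carrier M. a \<odot>\<^bsub>M\<^esub> m \<in> U}"
    using a U sub_addD by (simp add: smult_r_distr)
next
  fix b x assume "b \<in> carrier R" "x \<in> {m \<in> carrier M. a \<odot>\<^bsub>M\<^esub> m \<in> U}"
  then show "b \<odot>\<^bsub>M\<^esub> x \<in> {m \<in> carrier M. a \<odot>\<^bsub>M\<^esub> m \<in> U}"
    using a U sub_smultD[of U b "a \<odot>\<^bsub>M\<^esub> x"]
    by (auto simp: smult_assoc1[symmetric] R.m_comm)
qed auto

lemma colon_iff: "m \<in> U \<^bold>: a \<longleftrightarrow> m \<in> carrier M \<and> a \<odot>\<^bsub>M\<^esub> m \<in> U"
  unfolding colon_elem_def by simp

lemma scale_subset: "a \<in> carrier R \<Longrightarrow> sub U \<Longrightarrow> a \<^bold>* U \<subseteq> U"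
  by (auto intro: sub_smultD)

lemma scale_plus:
  assumes a: "a \<in> carrier R" and U: "sub U" and V: "sub V"
  shows "a \<^bold>* (U \<^bold>+ V) = a \<^bold>* U \<^bold>+ a \<^bold>* V"
proof
  show "a \<^bold>* (U \<^bold>+ V) \<subseteq> a \<^bold>* U \<^bold>+ a \<^bold>* V"
    using a sub_carrier[OF U] sub_carrier[OF V] by (auto elim!: plusE simp: smult_r_distr intro!: plusI)
  show "a \<^bold>* U \<^bold>+ a \<^bold>* V \<subseteq> a \<^bold>* (U \<^bold>+ V)"
    using assms by (intro plus_least sub_scale sub_plus) (auto dest!: subsetD[OF plus_upper1[OF U V]] subsetD[OF plus_upper2[OF U V]])
qed

lemma scale_scale: "a \<in> carrier R \<Longrightarrow> b \<in> carrier R \<Longrightarrow> sub U \<Longrightarrow> a \<^bold>* b \<^bold>* U = (a \<otimes> b) \<^bold>* U"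
  unfolding image_image by (rule image_cong) (simp_all add: smult_assoc1 sub_carrier)

lemma scale_one: "sub U \<Longrightarrow> \<one> \<^bold>* U = U"
  by (simp add: sub_carrier cong: image_cong_simp)

lemma colon_mono: "U \<subseteq> V \<Longrightarrow> U \<^bold>: a \<subseteq> V \<^bold>: a"
  unfolding colon_elem_def by auto

lemma subset_colon: "a \<in> carrier R \<Longrightarrow> sub U \<Longrightarrow> U \<subseteq> U \<^bold>: a"
  by (simp add: subset_iff colon_iff sub_carrier sub_smultD)

definition chain_in :: "'c set \<Rightarrow> 'c set \<Rightarrow> nat \<Rightarrow> (nat \<Rightarrow> 'c set) \<Rightarrow> bool" where
  "chain_in A B l H \<longleftrightarrow> (\<forall>i\<le>l. sub (H i) \<and> A \<subseteq> H i \<and> H i \<subseteq> B) \<and> (\<forall>i<l. H i \<subset> H (Suc i))"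

text \<open>
  The length is a supremum of numbers \<open>enat l\<close>, but the set of these \<open>l\<close> is closed
  downwards, so a chain of every length below the supremum exists, also if it is infinite.
\<close>

lemma le_len_iff:
  assumes "sub A" "A \<subseteq> B"
  shows "enat l \<le> len A B \<longleftrightarrow> (\<exists>H. chain_in A B l H)"
proof
  assume l: "enat l \<le> len A B"
  show "\<exists>H. chain_in A B l H"
  proof (cases l)
    case 0
    then show ?thesis using assms by (intro exI[of _ "\<lambda>_. A"]) (auto simp: chain_in_def)
  next
    case (Suc l')
    then have "enat l' < len A B" using l by (metis Suc_ile_eq)
    then obtain x H where "enat l' < enat x" "chain_in A B x H"
      unfolding interval_length_def less_Sup_iff chain_in_def by auto
    then have "chain_in A B l H" unfolding chain_in_def Suc by auto
    then show ?thesis by blast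
  qed
next
  assume "\<exists>H. chain_in A B l H"
  then show "enat l \<le> len A B"
    unfolding interval_length_def by (intro Sup_upper) (auto simp: chain_in_def)
qed

lemma enat_le_by_nat: "(\<And>l. enat l \<le> x \<Longrightarrow> enat l \<le> (y::enat)) \<Longrightarrow> x \<le> y"
  by (metis enat_ord_code(3) not_infinity_eq Suc_ile_eq leD linorder_not_le order_refl)

lemma enat_add_le_by_nat:
  assumes "\<And>l l'. enat l \<le> x \<Longrightarrow> enat l' \<le> y \<Longrightarrow> enat (l + l') \<le> (z::enat)"
  shows "x + y \<le> z"
proof (cases "x = \<infinity> \<or> y = \<infinity>")
  case True
  have "enat n \<le> z" for n
    using True assms[of n 0] assms[of 0 n] by (auto simp: zero_enat_def[symmetric])
  then show ?thesis by (metis enat_le_by_nat)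
next
  case False
  then obtain a b where "x = enat a" "y = enat b" by auto
  then show ?thesis using assms[of a b] by simp
qed

lemma len_mono:
  assumes "sub A" "A \<subseteq> A'" "A' \<subseteq> B'" "B' \<subseteq> B"
  shows "len A' B' \<le> len A B"
  by (rule interval_length_le[where f = "\<lambda>Z. Z"]) (use assms in auto)

lemma len_same: "sub A \<Longrightarrow> len A A = 0"
proof -
  assume A: "sub A"
  have "\<not> enat 1 \<le> len A A"
    by (subst le_len_iff) (use A in \<open>auto simp: chain_in_def\<close>)
  then show ?thesis by (metis One_nat_def Suc_ile_eq not_gr_zero zero_enat_def)
qed

lemma len_super:
  assumes "sub A" "sub B" "sub C" "A \<subseteq> B" "B \<subseteq> C"
  shows "len A B + len B C \<le> len A C"
proof (rule enat_add_le_by_nat)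
  fix l l' assume "enat l \<le> len A B" "enat l' \<le> len B C"
  then obtain H H' where H: "chain_in A B l H" "chain_in B C l' H'"
    using assms by (auto simp: le_len_iff)
  define G where "G = (\<lambda>i. if i < l then H i else if i = l then B else H' (i - l))"
  have "chain_in A C (l + l') G"
    unfolding chain_in_def
  proof (intro conjI allI impI)
    fix i assume i: "i \<le> l + l'"
    consider "i < l" | "i = l" | "l < i" "i - l \<le> l'" using i by linarith
    then have "sub (G i) \<and> A \<subseteq> G i \<and> G i \<subseteq> C"
    proof cases
      case 1
      then have "sub (H i) \<and> A \<subseteq> H i \<and> H i \<subseteq> B" using H(1) unfolding chain_in_def by auto
      then show ?thesis using 1 assms unfolding G_def by auto
    next
      case 2
      then show ?thesis using assms unfolding G_def by auto
    next
      case 3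
      then have "sub (H' (i - l)) \<and> B \<subseteq> H' (i - l) \<and> H' (i - l) \<subseteq> C"
        using H(2) unfolding chain_in_def by blast
      then show ?thesis using 3 assms unfolding G_def by auto
    qed
    then show "sub (G i)" "A \<subseteq> G i" "G i \<subseteq> C" by auto
  next
    fix i assume i: "i < l + l'"
    consider "Suc i < l" | "Suc i = l" | "i = l" | "l < i" by linarith
    then show "G i \<subset> G (Suc i)"
    proof cases
      case 1 then show ?thesis using H unfolding G_def chain_in_def by auto
    next
      case 2 
      then have "H i \<subset> H l" "H l \<subseteq> B" using H(1) unfolding chain_in_def by auto
      then show ?thesis using 2 unfolding G_def by auto
    next
      case 3
      then have "H' 0 \<subset> H' (Suc 0)" "B \<subseteq> H' 0" using H(2) i unfolding chain_in_def by auto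
      then show ?thesis using 3 unfolding G_def by auto
    next
      case 4 
      then have "H' (i - l) \<subset> H' (Suc (i - l))" using H(2) i unfolding chain_in_def by auto
      then show ?thesis using 4 unfolding G_def by (auto simp: Suc_diff_le)
    qed
  qed
  then show "enat (l + l') \<le> len A C" using assms by (subst le_len_iff) auto
qed

lemma len_strict:
  assumes "sub A" "sub B" "A \<subset> B" shows "1 \<le> len A B"
proof -
  have "chain_in A B 1 (\<lambda>i. if i = 0 then A else B)"
    using assms unfolding chain_in_def by auto
  then have "enat 1 \<le> len A B" using assms by (subst le_len_iff) auto
  then show ?thesis by (simp add: one_enat_def)
qed

text \<open>
  A chain from \<open>A\<close> to \<open>C\<close> is cut into a chain below \<open>B\<close>, by intersecting with \<open>B\<close>, and one
  above \<open>B\<close>, by adding \<open>B\<close>. By the modular law no step of the given chain can become trivial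
  in both.
\<close>

lemma len_additive:
  assumes "sub A" "sub B" "sub C" "A \<subseteq> B" "B \<subseteq> C"
  shows "len A C = len A B + len B C"
proof (rule antisym)
  show "len A B + len B C \<le> len A C" using assms by (rule len_super)
  have *: "enat l \<le> len A (H l \<inter> B) + len B (H l \<^bold>+ B)" if "chain_in A C l H" for l H
    using that
  proof (induction l)
    case 0
    show ?case by (simp add: zero_enat_def[symmetric])
  next
    case (Suc l)
    then have IH: "enat l \<le> len A (H l \<inter> B) + len B (H l \<^bold>+ B)"
      unfolding chain_in_def by simp
    have H: "sub (H l)" "sub (H (Suc l))" "A \<subseteq> H l" "A \<subseteq> H (Suc l)" "H l \<subset> H (Suc l)"
      using Suc.prems unfolding chain_in_def by auto
    have s1: "H l \<inter> B \<subseteq> H (Suc l) \<inter> B" "H l \<^bold>+ B \<subseteq> H (Suc l) \<^bold>+ B"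
      using H plus_mono[of "H l" "H (Suc l)" B B] by auto
    have B1: "B \<subseteq> H l \<^bold>+ B" "B \<subseteq> H (Suc l) \<^bold>+ B" using H assms by (simp_all add: plus_upper2)
    consider "H l \<inter> B \<subset> H (Suc l) \<inter> B" | "H l \<^bold>+ B \<subset> H (Suc l) \<^bold>+ B"
    proof -
      have False if "H l \<inter> B = H (Suc l) \<inter> B" "H l \<^bold>+ B = H (Suc l) \<^bold>+ B"
      proof -
        have "H (Suc l) = (H l \<^bold>+ B) \<inter> H (Suc l)"
          using that plus_upper1[OF H(2) assms(2)] by auto
        also have "\<dots> = H l \<^bold>+ (B \<inter> H (Suc l))" using H assms by (intro modular) auto
        also have "\<dots> = H l" using that H assms by (intro plus_absorb1) auto
        finally show False using H by simp
      qed
      then show ?thesis using that s1 by blast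
    qed
    then show ?case
    proof cases
      case 1
      have "len A (H l \<inter> B) + 1 \<le> len A (H l \<inter> B) + len (H l \<inter> B) (H (Suc l) \<inter> B)"
        using H assms 1 by (intro add_mono len_strict) auto
      also have "\<dots> \<le> len A (H (Suc l) \<inter> B)"
        using H assms s1 by (intro len_super) auto
      finally have "len A (H l \<inter> B) + 1 \<le> len A (H (Suc l) \<inter> B)" .
      moreover have "len B (H l \<^bold>+ B) \<le> len B (H (Suc l) \<^bold>+ B)"
        using H assms s1 B1 by (intro len_mono) auto
      ultimately have "len A (H l \<inter> B) + 1 + len B (H l \<^bold>+ B) \<le> len A (H (Suc l) \<inter> B) + len B (H (Suc l) \<^bold>+ B)"
        by (rule add_mono)
      moreover have "enat (Suc l) \<le> len A (H l \<inter> B) + 1 + len B (H l \<^bold>+ B)"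
        using add_right_mono[OF IH, of 1] by (simp add: one_enat_def ac_simps)
      ultimately show ?thesis by (rule order_trans[rotated])
    next
      case 2
      have "len B (H l \<^bold>+ B) + 1 \<le> len B (H l \<^bold>+ B) + len (H l \<^bold>+ B) (H (Suc l) \<^bold>+ B)"
        using H assms 2 by (intro add_mono len_strict) auto
      also have "\<dots> \<le> len B (H (Suc l) \<^bold>+ B)"
        using H assms s1 B1 by (intro len_super) auto
      finally have "len B (H l \<^bold>+ B) + 1 \<le> len B (H (Suc l) \<^bold>+ B)" .
      moreover have "len A (H l \<inter> B) \<le> len A (H (Suc l) \<inter> B)"
        using H assms s1 by (intro len_mono) auto
      ultimately have "len B (H l \<^bold>+ B) + 1 + len A (H l \<inter> B) \<le> len B (H (Suc l) \<^bold>+ B) + len A (H (Suc l) \<inter> B)"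
        by (rule add_mono)
      moreover have "enat (Suc l) \<le> len B (H l \<^bold>+ B) + 1 + len A (H l \<inter> B)"
        using add_right_mono[OF IH, of 1] by (simp add: one_enat_def ac_simps)
      ultimately show ?thesis by (simp add: ac_simps)
    qed
  qed
  show "len A C \<le> len A B + len B C"
  proof (rule enat_le_by_nat)
    fix l assume "enat l \<le> len A C"
    then obtain H where H: "chain_in A C l H" using assms by (auto simp: le_len_iff)
    then have Hl: "sub (H l)" "A \<subseteq> H l" "H l \<subseteq> C" unfolding chain_in_def by auto
    have "len A (H l \<inter> B) \<le> len A B" "len B (H l \<^bold>+ B) \<le> len B C"
      using Hl assms by (simp_all add: len_mono plus_least plus_upper2)
    then show "enat l \<le> len A B + len B C"
      using *[OF H] by (meson add_mono order_trans)
  qed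
qed

lemma len_plus_eq_len_int:
  assumes "sub U" "sub V"
  shows "len V (U \<^bold>+ V) = len (U \<inter> V) U"
proof (rule interval_length_eq[where f = "\<lambda>Z. U \<inter> Z" and g = "\<lambda>Z. Z \<^bold>+ V"])
  fix Z assume Z: "sub Z" "V \<subseteq> Z" "Z \<subseteq> U \<^bold>+ V"
  have "(V \<^bold>+ U) \<inter> Z = V \<^bold>+ (U \<inter> Z)" using assms Z by (intro modular) auto
  then have "U \<inter> Z \<^bold>+ V = Z" using assms Z
    by (metis (no_types, lifting) inf.absorb_iff2 plus_comm sub_int)
  then show "sub (U \<inter> Z) \<and> U \<inter> V \<subseteq> U \<inter> Z \<and> U \<inter> Z \<subseteq> U \<and> U \<inter> Z \<^bold>+ V = Z"
    using Z assms by auto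
next
  fix Z assume Z: "sub Z" "U \<inter> V \<subseteq> Z" "Z \<subseteq> U"
  have "(Z \<^bold>+ V) \<inter> U = Z \<^bold>+ (V \<inter> U)" using assms Z by (intro modular) auto
  also have "\<dots> = Z" using assms Z by (intro plus_absorb1) auto
  finally have "U \<inter> (Z \<^bold>+ V) = Z" by auto
  then show "sub (Z \<^bold>+ V) \<and> V \<subseteq> Z \<^bold>+ V \<and> Z \<^bold>+ V \<subseteq> U \<^bold>+ V \<and> U \<inter> (Z \<^bold>+ V) = Z"
    using Z assms plus_mono[of Z U V V] plus_upper2[of Z V] by auto
next
  show "\<And>Z W. Z \<subseteq> W \<Longrightarrow> Z \<^bold>+ V \<subseteq> W \<^bold>+ V" by (intro plus_mono) auto
qed auto

lemma len_int_plus: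
  assumes "sub U" "sub V" "sub F" "U \<subseteq> V"
  shows "len U V = len (U \<inter> F) (V \<inter> F) + len (U \<^bold>+ F) (V \<^bold>+ F)"
proof -
  let ?T = "U \<^bold>+ (V \<inter> F)"
  have T: "?T \<subseteq> V" using assms by (intro plus_least) auto
  have "len U V = len U ?T + len ?T V"
    using assms T by (intro len_additive plus_upper1) auto
  also have "len U ?T = len (U \<inter> F) (V \<inter> F)"
    using len_plus_eq_len_int[of "V \<inter> F" U] assms
    by (metis (no_types, lifting) inf.absorb_iff1 inf.commute inf.left_commute plus_comm sub_int)
  also have "len ?T V = len (U \<^bold>+ F) (V \<^bold>+ F)"
  proof -
    have "V \<^bold>+ (U \<^bold>+ F) = V \<^bold>+ F"
      using assms by (metis plus_absorb1 plus_assoc)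
    moreover have "V \<inter> (U \<^bold>+ F) = ?T"
      using modular[of U F V] assms by (auto simp: Int_commute)
    ultimately show ?thesis
      using len_plus_eq_len_int[of V "U \<^bold>+ F"] assms by (auto simp: sub_plus)
  qed
  finally show ?thesis .
qed

text \<open>
  Multiplication by \<open>y\<close> induces a surjection from \<open>X'/X\<close> onto \<open>(F + yX')/(F + yX)\<close>; the last
  hypothesis makes it injective.
\<close>

lemma len_scale:
  assumes "y \<in> carrier R" "sub F" "sub X" "sub X'" "X \<subseteq> X'" "(F \<^bold>: y) \<inter> X' \<subseteq> X"
  shows "len (F \<^bold>+ y \<^bold>* X) (F \<^bold>+ y \<^bold>* X') = len X X'"
proof (rule interval_length_eq[where f = "\<lambda>Z. (Z \<^bold>: y) \<inter> X'" and g = "\<lambda>Z. F \<^bold>+ y \<^bold>* Z"])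
  have car: "X' \<subseteq> carrier M" using assms sub_carrier by blast
  fix Z assume Z: "sub Z" "F \<^bold>+ y \<^bold>* X \<subseteq> Z" "Z \<subseteq> F \<^bold>+ y \<^bold>* X'"
  have F: "F \<subseteq> Z" "y \<^bold>* X \<subseteq> Z"
    using Z(2) plus_upper1[OF assms(2) sub_scale[OF assms(1,3)]] plus_upper2[OF assms(2) sub_scale[OF assms(1,3)]]
    by blast+
  have "Z \<subseteq> F \<^bold>+ y \<^bold>* ((Z \<^bold>: y) \<inter> X')"
  proof
    fix z assume z: "z \<in> Z"
    then obtain f x where fx: "f \<in> F" "x \<in> X'" "z = f \<oplus>\<^bsub>M\<^esub> y \<odot>\<^bsub>M\<^esub> x"
      using Z(3) by (auto elim!: plusE)
    then have "y \<odot>\<^bsub>M\<^esub> x \<in> Z"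
      using sub_diffD2[OF Z(1), of "y \<odot>\<^bsub>M\<^esub> x" f] F(1) z assms(1) car by auto
    then have "x \<in> (Z \<^bold>: y) \<inter> X'" using fx car by (auto simp: colon_iff)
    then show "z \<in> F \<^bold>+ y \<^bold>* ((Z \<^bold>: y) \<inter> X')" using fx by (auto intro!: plusI)
  qed
  moreover have "F \<^bold>+ y \<^bold>* ((Z \<^bold>: y) \<inter> X') \<subseteq> Z"
    using F Z by (intro plus_least) (auto simp: colon_iff)
  ultimately have "F \<^bold>+ y \<^bold>* ((Z \<^bold>: y) \<inter> X') = Z" by blast
  moreover have "X \<subseteq> (Z \<^bold>: y) \<inter> X'" unfolding colon_elem_def using assms(5) F(2) car by blast
  ultimately show "sub ((Z \<^bold>: y) \<inter> X') \<and> X \<subseteq> (Z \<^bold>: y) \<inter> X' \<and> (Z \<^bold>: y) \<inter> X' \<subseteq> X' \<and> F \<^bold>+ y \<^bold>* ((Z \<^bold>: y) \<inter> X') = Z"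
    using assms(1,4) Z(1) by (simp add: sub_int sub_colon)
next
  have car: "X' \<subseteq> carrier M" using assms sub_carrier by blast
  fix Z assume Z: "sub Z" "X \<subseteq> Z" "Z \<subseteq> X'"
  have "((F \<^bold>+ y \<^bold>* Z) \<^bold>: y) \<inter> X' \<subseteq> Z"
  proof
    fix m assume "m \<in> ((F \<^bold>+ y \<^bold>* Z) \<^bold>: y) \<inter> X'"
    then have m: "m \<in> X'" "y \<odot>\<^bsub>M\<^esub> m \<in> F \<^bold>+ y \<^bold>* Z" by (auto simp: colon_iff)
    then obtain f z where fz: "f \<in> F" "z \<in> Z" "y \<odot>\<^bsub>M\<^esub> m = f \<oplus>\<^bsub>M\<^esub> y \<odot>\<^bsub>M\<^esub> z" by (auto elim!: plusE)
    have c: "m \<in> carrier M" "z \<in> carrier M" "f \<in> carrier M" "z \<in> X'"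
      using m(1) fz(1,2) Z(3) assms(2) car sub_carrier by blast+
    have "y \<odot>\<^bsub>M\<^esub> (m \<oplus>\<^bsub>M\<^esub> \<ominus>\<^bsub>M\<^esub> z) = f"
      using c assms(1) fz(3) by (simp add: smult_r_distr smult_r_minus M.a_assoc M.r_neg)
    then have "m \<oplus>\<^bsub>M\<^esub> \<ominus>\<^bsub>M\<^esub> z \<in> (F \<^bold>: y) \<inter> X'"
      using c m(1) fz(1) sub_addD[OF assms(4) m(1) sub_minusD[OF assms(4) c(4)]] by (simp add: colon_iff)
    then have "m \<oplus>\<^bsub>M\<^esub> \<ominus>\<^bsub>M\<^esub> z \<in> Z" using assms(6) Z(2) by blast
    then show "m \<in> Z" using sub_diffD[OF Z(1) c(1) sub_minusD[OF Z(1) fz(2)]] by simp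
  qed
  moreover have "Z \<subseteq> ((F \<^bold>+ y \<^bold>* Z) \<^bold>: y) \<inter> X'"
    unfolding colon_elem_def
    using Z(3) car plus_upper2[OF assms(2) sub_scale[OF assms(1) Z(1)]] by blast
  ultimately have "((F \<^bold>+ y \<^bold>* Z) \<^bold>: y) \<inter> X' = Z" by blast
  moreover have "F \<^bold>+ y \<^bold>* X \<subseteq> F \<^bold>+ y \<^bold>* Z" "F \<^bold>+ y \<^bold>* Z \<subseteq> F \<^bold>+ y \<^bold>* X'"
    by (rule plus_mono[OF order_refl image_mono[OF Z(2)]], rule plus_mono[OF order_refl image_mono[OF Z(3)]])
  ultimately show "sub (F \<^bold>+ y \<^bold>* Z) \<and> F \<^bold>+ y \<^bold>* X \<subseteq> F \<^bold>+ y \<^bold>* Z \<and> F \<^bold>+ y \<^bold>* Z \<subseteq> F \<^bold>+ y \<^bold>* X' \<and> ((F \<^bold>+ y \<^bold>* Z) \<^bold>: y) \<inter> X' = Z"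
    using assms(1,2) Z(1) by (simp add: sub_plus sub_scale)
next
  show "\<And>Z W. Z \<subseteq> W \<Longrightarrow> (Z \<^bold>: y) \<inter> X' \<subseteq> (W \<^bold>: y) \<inter> X'" by (auto simp: colon_iff)
  show "\<And>Z W. Z \<subseteq> W \<Longrightarrow> F \<^bold>+ y \<^bold>* Z \<subseteq> F \<^bold>+ y \<^bold>* W"
    by (intro plus_mono order_refl image_mono)
qed

end

section \<open>Numerical functions of Hilbert type\<close>

definition diff :: "(nat \<Rightarrow> int) \<Rightarrow> nat \<Rightarrow> int" where
  "diff f n = f (Suc n) - f n"

lemma diff_Suc: "(diff ^^ Suc k) f n = (diff ^^ k) f (Suc n) - (diff ^^ k) f n"
  unfolding funpow.simps o_apply diff_def[of "(diff ^^ k) f"] by (rule refl)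

text \<open>
  Polynomial values for large arguments, expanded in the polynomials \<open>(n + j) choose j\<close>:
  this is the basis in which Hilbert coefficients are defined, and cumulative summation just
  shifts it.
\<close>

definition ev_poly :: "(nat \<Rightarrow> int) \<Rightarrow> bool" where
  "ev_poly f \<longleftrightarrow> (\<exists>m c. \<forall>\<^sub>F n in sequentially. f n = (\<Sum>j\<le>m. c j * int ((n + j) choose j)))"

lemma ev_poly_cong: "ev_poly f \<Longrightarrow> \<forall>\<^sub>F n in sequentially. g n = f n \<Longrightarrow> ev_poly g"
proof -
  assume "ev_poly f" and g: "\<forall>\<^sub>F n in sequentially. g n = f n"
  then obtain m c where "\<forall>\<^sub>F n in sequentially. f n = (\<Sum>j\<le>m. c j * int ((n + j) choose j))"
    unfolding ev_poly_def by blast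
  with g have "\<forall>\<^sub>F n in sequentially. g n = (\<Sum>j\<le>m. c j * int ((n + j) choose j))"
    by eventually_elim simp
  then show ?thesis unfolding ev_poly_def by (intro exI)
qed

lemma ev_poly_extend:
  assumes "\<forall>\<^sub>F n in sequentially. f n = (\<Sum>j\<le>m. c j * int ((n + j) choose j))" "m \<le> m'"
  shows "\<forall>\<^sub>F n in sequentially. f n = (\<Sum>j\<le>m'. (if j \<le> m then c j else 0) * int ((n + j) choose j))"
  using assms(1)
proof eventually_elim
  case (elim n)
  have "(\<Sum>j\<le>m'. (if j \<le> m then c j else 0) * int ((n + j) choose j)) = (\<Sum>j\<le>m. c j * int ((n + j) choose j))"
    using assms(2) by (intro sum.mono_neutral_cong_right) auto
  then show ?case using elim by simp
qed

lemma ev_poly_add: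
  assumes "ev_poly f" "ev_poly g" shows "ev_poly (\<lambda>n. f n + g n)"
proof -
  obtain m c m' c' where
    "\<forall>\<^sub>F n in sequentially. f n = (\<Sum>j\<le>m. c j * int ((n + j) choose j))"
    "\<forall>\<^sub>F n in sequentially. g n = (\<Sum>j\<le>m'. c' j * int ((n + j) choose j))"
    using assms unfolding ev_poly_def by blast
  note * = ev_poly_extend[OF this(1), of "max m m'"] ev_poly_extend[OF this(2), of "max m m'"]
  have "\<forall>\<^sub>F n in sequentially. f n + g n = (\<Sum>j\<le>max m m'. ((if j \<le> m then c j else 0) +
      (if j \<le> m' then c' j else 0)) * int ((n + j) choose j))"
    using *(1)[OF max.cobounded1] *(2)[OF max.cobounded2]
    by eventually_elim (simp only: sum.distrib distrib_right)
  then show ?thesis unfolding ev_poly_def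
    by (intro exI[of _ "max m m'"] exI[of _ "\<lambda>j. (if j \<le> m then c j else 0) + (if j \<le> m' then c' j else 0)"])
qed

lemma ev_poly_scale: "ev_poly f \<Longrightarrow> ev_poly (\<lambda>n. a * f n)"
proof -
  assume "ev_poly f"
  then obtain m c where "\<forall>\<^sub>F n in sequentially. f n = (\<Sum>j\<le>m. c j * int ((n + j) choose j))"
    unfolding ev_poly_def by blast
  then have "\<forall>\<^sub>F n in sequentially. a * f n = (\<Sum>j\<le>m. (a * c j) * int ((n + j) choose j))"
    by eventually_elim (simp add: sum_distrib_left mult.assoc)
  then show ?thesis unfolding ev_poly_def by (intro exI[of _ m] exI[of _ "\<lambda>j. a * c j"])
qed

lemma ev_poly_choose: "ev_poly (\<lambda>n. int ((n + j) choose j))"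
proof -
  have "\<forall>\<^sub>F n in sequentially. int ((n + j) choose j) = (\<Sum>i\<le>j. (if i = j then 1 else 0) * int ((n + i) choose i))"
    by (simp add: if_distrib[of "\<lambda>x. x * _"] cong: if_cong)
  then show ?thesis unfolding ev_poly_def by (intro exI)
qed

lemma ev_poly_const: "ev_poly (\<lambda>n. a)"
  using ev_poly_scale[OF ev_poly_choose[of 0], of a] by simp

lemma ev_poly_sum: "finite A \<Longrightarrow> (\<And>j. j \<in> A \<Longrightarrow> ev_poly (f j)) \<Longrightarrow> ev_poly (\<lambda>n. \<Sum>j\<in>A. f j n)"
  by (induction A rule: finite_induct) (auto simp: ev_poly_const ev_poly_add)

lemma eventually_shift_back:
  "\<forall>\<^sub>F n in sequentially. P n \<Longrightarrow> \<forall>\<^sub>F n in sequentially. P (n - (t::nat))"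
  unfolding eventually_sequentially by (metis add_le_imp_le_diff)

lemma eventually_shift_up:
  "\<forall>\<^sub>F n in sequentially. P n \<Longrightarrow> \<forall>\<^sub>F n in sequentially. P (Suc n)"
  by (subst eventually_sequentially_Suc)

text \<open>
  By Pascal's rule \<open>(n - 1 + j) choose j\<close> is the difference of two consecutive basis
  polynomials at \<open>n\<close>.
\<close>

lemma ev_poly_choose_pred: "ev_poly (\<lambda>n. int ((n - 1 + j) choose j))"
proof (cases j)
  case (Suc i)
  have "ev_poly (\<lambda>n. int ((n + j) choose j) + (-1) * int ((n + i) choose i))"
    by (intro ev_poly_add ev_poly_scale ev_poly_choose)
  then show ?thesis
  proof (rule ev_poly_cong)
    show "\<forall>\<^sub>F n in sequentially. int ((n - 1 + j) choose j) = int ((n + j) choose j) + (-1) * int ((n + i) choose i)"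
      using eventually_gt_at_top[of 0]
    proof eventually_elim
      case (elim n)
      then obtain n' where "n = Suc n'" by (cases n) auto
      then show ?case by (simp add: Suc)
    qed
  qed
qed (simp add: ev_poly_const)

lemma ev_poly_pred:
  assumes "ev_poly f" shows "ev_poly (\<lambda>n. f (n - 1))"
proof -
  obtain m c where "\<forall>\<^sub>F n in sequentially. f n = (\<Sum>j\<le>m. c j * int ((n + j) choose j))"
    using assms unfolding ev_poly_def by blast
  note * = eventually_shift_back[OF this, of 1]
  have "ev_poly (\<lambda>n. \<Sum>j\<le>m. c j * int ((n - 1 + j) choose j))"
    by (intro ev_poly_sum ev_poly_scale ev_poly_choose_pred) simp
  then show ?thesis by (rule ev_poly_cong) (rule *)
qed

lemma ev_poly_shift:
  assumes "ev_poly f" shows "ev_poly (\<lambda>n. f (n - t))"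
proof (induction t)
  case (Suc t)
  from ev_poly_pred[OF this] show ?case by simp
qed (use assms in simp)

lemma ev_poly_cumulative:
  assumes "ev_poly f" shows "ev_poly (\<lambda>n. \<Sum>s\<le>n. f s)"
proof -
  obtain m c N where f: "\<And>n. n \<ge> N \<Longrightarrow> f n = (\<Sum>j\<le>m. c j * int ((n + j) choose j))"
    using assms unfolding ev_poly_def eventually_sequentially by blast
  let ?g = "\<lambda>n. \<Sum>j\<le>m. c j * int ((n + j) choose j)"
  have cum: "(\<Sum>s\<le>n. ?g s) = (\<Sum>j\<le>m. c j * int ((n + Suc j) choose Suc j))" for n
  proof (induction n)
    case (Suc n)
    have "(\<Sum>s\<le>Suc n. ?g s) = (\<Sum>j\<le>m. c j * int ((n + Suc j) choose Suc j) + c j * int ((Suc n + j) choose j))"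
      unfolding sum.distrib Suc[symmetric] by simp
    also have "\<dots> = (\<Sum>j\<le>m. c j * int ((Suc n + Suc j) choose Suc j))"
      by (intro sum.cong refl) (simp add: distrib_left[symmetric])
    finally show ?case .
  qed simp
  have eq: "(\<Sum>s\<le>n. f s) = (\<Sum>s<N. f s - ?g s) + (\<Sum>j\<le>m. c j * int ((n + Suc j) choose Suc j))" if "n \<ge> N" for n
  proof -
    have "(\<Sum>s\<le>n. f s - ?g s) = (\<Sum>s<N. f s - ?g s)"
      using that f by (intro sum.mono_neutral_right) auto
    then show ?thesis unfolding cum[symmetric] by (simp add: sum_subtractf)
  qed
  have "ev_poly (\<lambda>n. (\<Sum>s<N. f s - ?g s) + (\<Sum>j\<le>m. c j * int ((n + Suc j) choose Suc j)))"
    by (intro ev_poly_add ev_poly_const ev_poly_sum ev_poly_scale ev_poly_choose) simp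
  then show ?thesis
    by (rule ev_poly_cong) (use eq in \<open>auto simp: eventually_sequentially\<close>)
qed

definition ev_diff_nonneg :: "(nat \<Rightarrow> int) \<Rightarrow> bool" where
  "ev_diff_nonneg f \<longleftrightarrow> (\<forall>k. \<forall>\<^sub>F n in sequentially. 0 \<le> (diff ^^ k) f n)"

text \<open>
  Adding one ring generator changes a Hilbert function by shifts and cumulative sums, and
  this class is closed under both. That all differences are eventually nonnegative is the
  property that makes constant differences pass to summands later on.
\<close>

definition hilbert_fun1 :: "(nat \<Rightarrow> nat) \<Rightarrow> bool" where
  "hilbert_fun1 f \<longleftrightarrow> ev_poly (\<lambda>n. int (f n)) \<and> ev_diff_nonneg (\<lambda>n. int (f n))"

lemma diff_funpow_shift: "(\<And>n. n \<ge> N \<Longrightarrow> f n = g (n - t)) \<Longrightarrow> n \<ge> N + t \<Longrightarrow> (diff ^^ k) f n = (diff ^^ k) g (n - t)"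
proof (induction k arbitrary: n)
  case (Suc k)
  then have "(diff ^^ k) f n = (diff ^^ k) g (n - t)" "(diff ^^ k) f (Suc n) = (diff ^^ k) g (Suc n - t)"
    by auto
  moreover have "Suc n - t = Suc (n - t)" using Suc.prems by simp
  ultimately show ?case by (simp only: diff_Suc)
qed simp

lemma ev_diff_nonneg_shift:
  assumes "ev_diff_nonneg g" "\<And>n. n \<ge> N \<Longrightarrow> f n = g (n - t)"
  shows "ev_diff_nonneg f"
  unfolding ev_diff_nonneg_def
proof
  fix k
  have "\<forall>\<^sub>F n in sequentially. 0 \<le> (diff ^^ k) g (n - t)"
    by (rule eventually_shift_back) (use assms(1) in \<open>simp add: ev_diff_nonneg_def\<close>)
  then show "\<forall>\<^sub>F n in sequentially. 0 \<le> (diff ^^ k) f n"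
    using eventually_ge_at_top[of "N + t"]
    by eventually_elim (subst diff_funpow_shift[of N f g t]; use assms(2) in simp)
qed

lemma hilbert_fun1_delta: "hilbert_fun1 (\<lambda>n. if n = 0 then a else 0)"
proof -
  have z: "ev_diff_nonneg (\<lambda>n. 0)"
  proof -
    have "(diff ^^ k) (\<lambda>n. 0) = (\<lambda>n. 0)" for k
      by (induction k) (auto simp: diff_Suc fun_eq_iff simp del: funpow.simps(2))
    then show ?thesis by (simp add: ev_diff_nonneg_def)
  qed
  have "ev_diff_nonneg (\<lambda>n. int (if n = 0 then a else 0))"
    by (rule ev_diff_nonneg_shift[OF z, of 1]) auto
  moreover have "ev_poly (\<lambda>n. int (if n = 0 then a else 0))"
    by (rule ev_poly_cong[OF ev_poly_const[of 0]]) (auto simp: eventually_sequentially intro!: exI[of _ 1])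
  ultimately show ?thesis unfolding hilbert_fun1_def by blast
qed

lemma hilbert_fun1_shift:
  assumes "hilbert_fun1 f" shows "hilbert_fun1 (\<lambda>n. if t \<le> n then f (n - t) else 0)"
  unfolding hilbert_fun1_def
proof
  have "ev_poly (\<lambda>n. int (f (n - t)))"
    using assms ev_poly_shift[of "\<lambda>n. int (f n)" t] unfolding hilbert_fun1_def by blast
  then show "ev_poly (\<lambda>n. int (if t \<le> n then f (n - t) else 0))"
    by (rule ev_poly_cong) (simp add: eventually_sequentially, rule exI[of _ t], simp)
  have "ev_diff_nonneg (\<lambda>n. int (f n))" using assms unfolding hilbert_fun1_def by blast
  then show "ev_diff_nonneg (\<lambda>n. int (if t \<le> n then f (n - t) else 0))"
    by (rule ev_diff_nonneg_shift[where N = t and t = t]) simp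
qed

lemma hilbert_fun1_cumulative:
  assumes "hilbert_fun1 f" shows "hilbert_fun1 (\<lambda>n. \<Sum>s\<le>n. f s)"
  unfolding hilbert_fun1_def
proof
  have *: "(\<lambda>n. int (\<Sum>s\<le>n. f s)) = (\<lambda>n. \<Sum>s\<le>n. int (f s))" by simp
  show "ev_poly (\<lambda>n. int (\<Sum>s\<le>n. f s))"
    unfolding * using assms by (intro ev_poly_cumulative) (simp add: hilbert_fun1_def)
  have d: "(diff ^^ Suc k) (\<lambda>n. int (\<Sum>s\<le>n. f s)) = (\<lambda>n. (diff ^^ k) (\<lambda>n. int (f n)) (Suc n))" for k
  proof (induction k)
    case 0 show ?case by (auto simp: diff_Suc simp del: funpow.simps(2))
  next
    case (Suc k)
    show ?case unfolding diff_Suc[of "Suc k"] Suc diff_Suc[of k] fun_eq_iff by (rule allI refl)+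
  qed
  show "ev_diff_nonneg (\<lambda>n. int (\<Sum>s\<le>n. f s))"
    unfolding ev_diff_nonneg_def
  proof
    fix k
    show "\<forall>\<^sub>F n in sequentially. 0 \<le> (diff ^^ k) (\<lambda>n. int (\<Sum>s\<le>n. f s)) n"
    proof (cases k)
      case (Suc k')
      have "\<forall>\<^sub>F n in sequentially. 0 \<le> (diff ^^ k') (\<lambda>n. int (f n)) n"
        using assms unfolding hilbert_fun1_def ev_diff_nonneg_def by blast
      then have "\<forall>\<^sub>F n in sequentially. 0 \<le> (diff ^^ k') (\<lambda>n. int (f n)) (Suc n)"
        by (rule eventually_shift_up)
      then show ?thesis unfolding Suc d .
    qed (simp del: of_nat_sum)
  qed
qed

definition hilbert_fun :: "nat \<Rightarrow> ((nat \<Rightarrow> nat) \<Rightarrow> nat) \<Rightarrow> bool" where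
  "hilbert_fun d p \<longleftrightarrow> (\<exists>\<Phi>. (\<forall>\<phi>\<in>set \<Phi>. \<forall>i. hilbert_fun1 (\<phi> i)) \<and>
     (\<forall>n. p n = (\<Sum>\<phi>\<leftarrow>\<Phi>. \<Prod>i\<le>d. \<phi> i (n i))))"

lemma hilbert_fun_zero: "hilbert_fun d (\<lambda>n. 0)"
  unfolding hilbert_fun_def by (intro exI[of _ "[]"]) simp

lemma hilbert_fun_add: "hilbert_fun d p \<Longrightarrow> hilbert_fun d q \<Longrightarrow> hilbert_fun d (\<lambda>n. p n + q n)"
  unfolding hilbert_fun_def
proof (elim exE conjE)
  fix \<Phi> \<Psi>
  assume "\<forall>\<phi>\<in>set \<Phi>. \<forall>i. hilbert_fun1 (\<phi> i)" "\<forall>n. p n = (\<Sum>\<phi>\<leftarrow>\<Phi>. \<Prod>i\<le>d. \<phi> i (n i))"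
    "\<forall>\<phi>\<in>set \<Psi>. \<forall>i. hilbert_fun1 (\<phi> i)" "\<forall>n. q n = (\<Sum>\<phi>\<leftarrow>\<Psi>. \<Prod>i\<le>d. \<phi> i (n i))"
  then show "\<exists>\<Phi>. (\<forall>\<phi>\<in>set \<Phi>. \<forall>i. hilbert_fun1 (\<phi> i)) \<and> (\<forall>n. p n + q n = (\<Sum>\<phi>\<leftarrow>\<Phi>. \<Prod>i\<le>d. \<phi> i (n i)))"
    by (intro exI[of _ "\<Phi> @ \<Psi>"]) auto
qed

lemma hilbert_fun_sum: "finite A \<Longrightarrow> (\<And>j. j \<in> A \<Longrightarrow> hilbert_fun d (f j)) \<Longrightarrow> hilbert_fun d (\<lambda>n. \<Sum>j\<in>A. f j n)"
  by (induction A rule: finite_induct) (auto simp: hilbert_fun_zero hilbert_fun_add)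

text \<open>
  An operation on functions of one variable that is a finite sum of shifts extends to the
  \<open>g\<close>-th variable of a function of several variables, because it acts on one factor of each
  product.
\<close>

lemma hilbert_fun_slot:
  assumes g: "g \<le> d" and p: "hilbert_fun d p"
    and T: "\<And>\<phi>. hilbert_fun1 \<phi> \<Longrightarrow> hilbert_fun1 (\<lambda>m. \<Sum>t\<in>A m. \<phi> (m - t))" and fin: "\<And>m. finite (A m)"
  shows "hilbert_fun d (\<lambda>n. \<Sum>t\<in>A (n g). p (n(g := n g - t)))"
proof -
  obtain \<Phi> where \<Phi>: "\<forall>\<phi>\<in>set \<Phi>. \<forall>i. hilbert_fun1 (\<phi> i)"
    and pn: "\<And>n. p n = (\<Sum>\<phi>\<leftarrow>\<Phi>. \<Prod>i\<le>d. \<phi> i (n i))"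
    using p unfolding hilbert_fun_def by blast
  let ?t = "\<lambda>\<phi>. \<phi>(g := (\<lambda>m. \<Sum>t\<in>A m. \<phi> g (m - t)))"
  have prod: "(\<Sum>t\<in>A (n g). \<Prod>i\<le>d. \<phi> i ((n(g := n g - t)) i)) = (\<Prod>i\<le>d. (?t \<phi>) i (n i))" for n :: "nat \<Rightarrow> nat" and \<phi> :: "nat \<Rightarrow> nat \<Rightarrow> nat"
  proof -
    have "(\<Prod>i\<le>d. (?t \<phi>) i (n i)) = (\<Sum>t\<in>A (n g). \<phi> g (n g - t)) * (\<Prod>i\<in>{..d}-{g}. \<phi> i (n i))"
      using g by (subst prod.remove[of _ g]) (auto intro!: prod.cong)
    also have "\<dots> = (\<Sum>t\<in>A (n g). \<phi> g (n g - t) * (\<Prod>i\<in>{..d}-{g}. \<phi> i (n i)))"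
      by (rule sum_distrib_right)
    also have "\<dots> = (\<Sum>t\<in>A (n g). \<Prod>i\<le>d. \<phi> i ((n(g := n g - t)) i))"
      using g by (intro sum.cong refl, subst prod.remove[of _ g]) (auto intro!: prod.cong)
    finally show ?thesis by simp
  qed
  have "(\<Sum>t\<in>A (n g). p (n(g := n g - t))) = (\<Sum>\<phi>\<leftarrow>map ?t \<Phi>. \<Prod>i\<le>d. \<phi> i (n i))" for n
  proof -
    have "(\<Sum>t\<in>A (n g). p (n(g := n g - t))) = (\<Sum>\<phi>\<leftarrow>\<Phi>. \<Sum>t\<in>A (n g). \<Prod>i\<le>d. \<phi> i ((n(g := n g - t)) i))"
      unfolding pn by (induction \<Phi>) (simp_all add: sum.distrib)
    then show ?thesis unfolding prod by (simp add: comp_def)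
  qed
  moreover have "\<forall>\<phi>\<in>set (map ?t \<Phi>). \<forall>i. hilbert_fun1 (\<phi> i)"
    using \<Phi> T by auto
  ultimately show ?thesis unfolding hilbert_fun_def by blast
qed

text \<open>
  If \<open>p t\<close> is the Hilbert function of the coefficients of the \<open>t\<close>-th power of a new
  generator of degree \<open>e\<^sub>g\<close>, this sum is the Hilbert function of the whole. As \<open>p t\<close>
  stabilises at \<open>t = c\<close>, it is finitely many shifts plus one shifted cumulative sum.
\<close>

lemma hilbert_fun_convolve:
  assumes g: "g \<le> d" and p: "\<And>t. hilbert_fun d (p t)" and c: "\<And>t. t \<ge> c \<Longrightarrow> p t = p c"
  shows "hilbert_fun d (\<lambda>n. \<Sum>t\<le>n g. p t (n(g := n g - t)))"
proof -
  have 1: "hilbert_fun d (\<lambda>n. \<Sum>t'\<in>(if t \<le> n g then {t} else {}). p t (n(g := n g - t')))" for t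
  proof (rule hilbert_fun_slot[OF g p])
    fix \<phi> assume "hilbert_fun1 \<phi>"
    from hilbert_fun1_shift[OF this, of t]
    show "hilbert_fun1 (\<lambda>m. \<Sum>t'\<in>(if t \<le> m then {t} else {}). \<phi> (m - t'))"
      by (rule back_subst[of hilbert_fun1]) auto
  qed auto
  have 2: "hilbert_fun d (\<lambda>n. \<Sum>t\<in>{c..n g}. p c (n(g := n g - t)))"
  proof (rule hilbert_fun_slot[OF g p])
    fix \<phi> assume "hilbert_fun1 \<phi>"
    from hilbert_fun1_shift[OF hilbert_fun1_cumulative[OF this], of c]
    show "hilbert_fun1 (\<lambda>m. \<Sum>t\<in>{c..m}. \<phi> (m - t))"
    proof (rule back_subst[of hilbert_fun1], intro ext)
      fix m
      show "(if c \<le> m then \<Sum>s\<le>m - c. \<phi> s else 0) = (\<Sum>t\<in>{c..m}. \<phi> (m - t))"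
      proof (cases "c \<le> m")
        case True
        have "(\<Sum>s\<le>m - c. \<phi> s) = (\<Sum>t\<in>{c..m}. \<phi> (m - t))"
          by (rule sum.reindex_bij_witness[of _ "\<lambda>t. m - t" "\<lambda>s. m - s"]) (use True in auto)
        then show ?thesis using True by simp
      qed auto
    qed
  qed auto
  have "hilbert_fun d (\<lambda>n. (\<Sum>t<c. \<Sum>t'\<in>(if t \<le> n g then {t} else {}). p t (n(g := n g - t')))
      + (\<Sum>t\<in>{c..n g}. p c (n(g := n g - t))))"
    by (intro hilbert_fun_add hilbert_fun_sum 1 2) simp
  moreover have "(\<Sum>t<c. \<Sum>t'\<in>(if t \<le> n g then {t} else {}). p t (n(g := n g - t')))
      + (\<Sum>t\<in>{c..n g}. p c (n(g := n g - t))) = (\<Sum>t\<le>n g. p t (n(g := n g - t)))" for n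
  proof -
    have "(\<Sum>t\<le>n g. p t (n(g := n g - t))) = (\<Sum>t\<in>{..n g} \<inter> {..<c} \<union> {c..n g}. p t (n(g := n g - t)))"
      by (intro sum.cong) auto
    also have "\<dots> = (\<Sum>t\<in>{..n g} \<inter> {..<c}. p t (n(g := n g - t))) + (\<Sum>t\<in>{c..n g}. p t (n(g := n g - t)))"
      by (rule sum.union_disjoint) auto
    also have "(\<Sum>t\<in>{c..n g}. p t (n(g := n g - t))) = (\<Sum>t\<in>{c..n g}. p c (n(g := n g - t)))"
      by (rule sum.cong[OF refl]) (subst c, auto)
    also have "(\<Sum>t\<in>{..n g} \<inter> {..<c}. p t (n(g := n g - t))) = (\<Sum>t<c. if t \<le> n g then p t (n(g := n g - t)) else 0)"
      by (intro sum.mono_neutral_cong_left) auto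
    also have "\<dots> = (\<Sum>t<c. \<Sum>t'\<in>(if t \<le> n g then {t} else {}). p t (n(g := n g - t')))"
      by (intro sum.cong) auto
    finally show ?thesis by (rule sym)
  qed
  ultimately show ?thesis by simp
qed

lemma hilbert_fun_delta: "hilbert_fun d (\<lambda>n. if \<forall>i\<le>d. n i = 0 then a else 0)"
proof -
  define \<phi> where "\<phi> = (\<lambda>(i::nat) (n::nat). if n = 0 then (if i = 0 then a else 1) else (0::nat))"
  have "hilbert_fun1 (\<phi> i)" for i :: nat unfolding \<phi>_def by (rule hilbert_fun1_delta)
  moreover have "(if \<forall>i\<le>d. n i = 0 then a else 0) = (\<Prod>i\<le>d. \<phi> i (n i))" for n :: "nat \<Rightarrow> nat"
  proof (cases "\<forall>i\<le>d. n i = 0")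
    case True
    then have "(\<Prod>i\<le>d. \<phi> i (n i)) = (\<Prod>i\<le>d. if i = 0 then a else 1)"
      by (intro prod.cong) (auto simp: \<phi>_def)
    also have "\<dots> = a" by (simp add: prod.delta)
    finally show ?thesis using True by simp
  next
    case False
    then obtain i where i: "i \<le> d" "n i \<noteq> 0" by blast
    have "(\<Prod>i\<le>d. \<phi> i (n i)) = 0"
      by (rule prod_zero[OF finite_atMost], rule bexI[of _ i]) (use i in \<open>simp_all add: \<phi>_def\<close>)
    then show ?thesis unfolding if_not_P[OF False] by (rule sym)
  qed
  ultimately show ?thesis unfolding hilbert_fun_def by (intro exI[of _ "[\<phi>]"]) auto
qed

definition mdiff :: "nat \<Rightarrow> ((nat \<Rightarrow> nat) \<Rightarrow> int) \<Rightarrow> (nat \<Rightarrow> nat) \<Rightarrow> int" where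
  "mdiff i p n = p (n(i := Suc (n i))) - p n"

primrec mdiffs :: "nat list \<Rightarrow> ((nat \<Rightarrow> nat) \<Rightarrow> int) \<Rightarrow> (nat \<Rightarrow> nat) \<Rightarrow> int" where
  "mdiffs [] p = p"
| "mdiffs (i # ks) p = mdiffs ks (mdiff i p)"

lemma mdiffs_append: "mdiffs (ks @ ls) p = mdiffs ls (mdiffs ks p)"
  by (induction ks arbitrary: p) auto

lemma mdiffs_add: "mdiffs ks (\<lambda>n. p n + q n) n = mdiffs ks p n + mdiffs ks q n"
proof (induction ks arbitrary: p q)
  case (Cons i ks)
  have "mdiff i (\<lambda>n. p n + q n) = (\<lambda>n. mdiff i p n + mdiff i q n)" by (auto simp: mdiff_def)
  then show ?case using Cons by simp
qed simp

lemma mdiffs_diff: "mdiffs ks (\<lambda>n. p n - q n) n = mdiffs ks p n - mdiffs ks q n"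
proof (induction ks arbitrary: p q)
  case (Cons i ks)
  have "mdiff i (\<lambda>n. p n - q n) = (\<lambda>n. mdiff i p n - mdiff i q n)" by (auto simp: mdiff_def)
  then show ?case using Cons by simp
qed simp

lemma mdiffs_zero: "mdiffs ks (\<lambda>n. 0) n = 0"
  using mdiffs_diff[of ks "\<lambda>n. 0" "\<lambda>n. 0" n] by simp

lemma mdiffs_sum: "mdiffs ks (\<lambda>n. \<Sum>j\<in>A. p j n) n = (\<Sum>j\<in>A. mdiffs ks (p j) n)"
  by (induction A rule: infinite_finite_induct) (auto simp: mdiffs_zero mdiffs_add)

lemma mdiffs_sum_list: "mdiffs ks (\<lambda>n. \<Sum>j\<leftarrow>xs. p j n) n = (\<Sum>j\<leftarrow>xs. mdiffs ks (p j) n)"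
  by (induction xs) (auto simp: mdiffs_zero mdiffs_add)

lemma mdiffs_shift: "mdiffs ks (\<lambda>n. p (\<lambda>i. n i + m i)) n = mdiffs ks p (\<lambda>i. n i + m i)"
proof (induction ks arbitrary: p)
  case (Cons j ks)
  have "mdiff j (\<lambda>n. p (\<lambda>i. n i + m i)) = (\<lambda>n. mdiff j p (\<lambda>i. n i + m i))"
  proof
    fix n
    have "(\<lambda>i. (n(j := Suc (n j))) i + m i) = (\<lambda>i. n i + m i)(j := Suc (n j + m j))" by auto
    then show "mdiff j (\<lambda>n. p (\<lambda>i. n i + m i)) n = mdiff j p (\<lambda>i. n i + m i)"
      by (simp add: mdiff_def)
  qed
  then show ?case using Cons by simp
qed simp

lemma for_all_large_mono: "for_all_large d P \<Longrightarrow> (\<And>n. P n \<Longrightarrow> Q n) \<Longrightarrow> for_all_large d Q"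
  unfolding for_all_large_def by blast

lemma for_all_large_conj: "for_all_large d P \<Longrightarrow> for_all_large d Q \<Longrightarrow> for_all_large d (\<lambda>n. P n \<and> Q n)"
  unfolding for_all_large_def
proof (elim exE)
  fix c c' assume "\<forall>n. (\<forall>i\<le>d. c \<le> n i) \<longrightarrow> P n" "\<forall>n. (\<forall>i\<le>d. c' \<le> n i) \<longrightarrow> Q n"
  then show "\<exists>c. \<forall>n. (\<forall>i\<le>d. c \<le> n i) \<longrightarrow> P n \<and> Q n"
    by (intro exI[of _ "max c c'"]) auto
qed

lemma for_all_large_True: "(\<And>n. P n) \<Longrightarrow> for_all_large d P"
  unfolding for_all_large_def by blast

lemma for_all_large_ex: "for_all_large d P \<Longrightarrow> \<exists>n. P n"
proof -
  assume "for_all_large d P"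
  then obtain c where "\<forall>n. (\<forall>i\<le>d. c \<le> n i) \<longrightarrow> P n" unfolding for_all_large_def by blast
  then have "P (\<lambda>_. c)" by simp
  then show ?thesis by (rule exI[where x = "\<lambda>_. c"])
qed

lemma for_all_large_Suc: "for_all_large d P \<Longrightarrow> for_all_large d (\<lambda>n. P (n(i := Suc (n i))))"
  unfolding for_all_large_def
proof (elim exE)
  fix c assume c: "\<forall>n. (\<forall>i\<le>d. c \<le> n i) \<longrightarrow> P n"
  show "\<exists>c. \<forall>n. (\<forall>j\<le>d. c \<le> n j) \<longrightarrow> P (n(i := Suc (n i)))"
  proof (intro exI[of _ c] allI impI)
    fix n :: "nat \<Rightarrow> nat" assume n: "\<forall>j\<le>d. c \<le> n j"
    show "P (n(i := Suc (n i)))" by (rule c[rule_format]) (use n in \<open>auto intro: le_SucI\<close>)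
  qed
qed

lemma for_all_large_shift: "for_all_large d P \<Longrightarrow> for_all_large d (\<lambda>n. P (\<lambda>i. n i + m i))"
  unfolding for_all_large_def by (meson trans_le_add1)

lemma mdiffs_cong_large:
  assumes "for_all_large d (\<lambda>n. p n = q n)"
  shows "for_all_large d (\<lambda>n. mdiffs ks p n = mdiffs ks q n)"
  using assms
proof (induction ks arbitrary: p q)
  case (Cons i ks)
  have "for_all_large d (\<lambda>n. mdiff i p n = mdiff i q n)"
    by (rule for_all_large_mono[OF for_all_large_conj[OF Cons.prems for_all_large_Suc[OF Cons.prems, of i]]])
      (simp only: mdiff_def)
  from Cons.IH[OF this] show ?case by simp
qed simp

lemma mdiffs_prod:
  assumes "set ks \<subseteq> {..d}"
  shows "mdiffs ks (\<lambda>n. \<Prod>i\<le>d. \<phi> i (n i)) n = (\<Prod>i\<le>d. (diff ^^ count_list ks i) (\<phi> i) (n i))"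
  using assms
proof (induction ks arbitrary: \<phi>)
  case (Cons k ks)
  have k: "k \<le> d" using Cons by simp
  have "mdiff k (\<lambda>n. \<Prod>i\<le>d. \<phi> i (n i)) = (\<lambda>n. \<Prod>i\<le>d. (\<phi>(k := diff (\<phi> k))) i (n i))"
  proof
    fix n :: "nat \<Rightarrow> nat"
    have r: "(\<Prod>i\<le>d. \<psi> i) = \<psi> k * (\<Prod>i\<in>{..d}-{k}. \<psi> i)" for \<psi> :: "nat \<Rightarrow> int"
      using k by (intro prod.remove) auto
    have "(\<Prod>i\<in>{..d}-{k}. \<phi> i ((n(k := Suc (n k))) i)) = (\<Prod>i\<in>{..d}-{k}. \<phi> i (n i))"
      "(\<Prod>i\<in>{..d}-{k}. (\<phi>(k := diff (\<phi> k))) i (n i)) = (\<Prod>i\<in>{..d}-{k}. \<phi> i (n i))"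
      by (auto intro!: prod.cong)
    then show "mdiff k (\<lambda>n. \<Prod>i\<le>d. \<phi> i (n i)) n = (\<Prod>i\<le>d. (\<phi>(k := diff (\<phi> k))) i (n i))"
      unfolding mdiff_def r by (simp add: diff_def left_diff_distrib)
  qed
  then have "mdiffs (k # ks) (\<lambda>n. \<Prod>i\<le>d. \<phi> i (n i)) n
      = (\<Prod>i\<le>d. (diff ^^ count_list ks i) ((\<phi>(k := diff (\<phi> k))) i) (n i))"
    using Cons by simp
  also have "\<dots> = (\<Prod>i\<le>d. (diff ^^ count_list (k # ks) i) (\<phi> i) (n i))"
    by (intro prod.cong) (auto simp: funpow_swap1)
  finally show ?case .
qed simp

lemma for_all_large_prod:
  assumes "\<And>i. i \<le> d \<Longrightarrow> \<forall>\<^sub>F m in sequentially. P i m"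
  shows "for_all_large d (\<lambda>n. \<forall>i\<le>d. P i (n i))"
proof -
  have "\<forall>\<^sub>F m in sequentially. \<forall>i\<in>{..d}. P i m"
    using assms by (intro eventually_ball_finite) auto
  then obtain c where c: "\<And>m i. m \<ge> c \<Longrightarrow> i \<le> d \<Longrightarrow> P i m" by (auto simp: eventually_sequentially)
  then show ?thesis unfolding for_all_large_def by (intro exI[of _ c]) auto
qed

lemma for_all_large_list:
  "(\<And>x. x \<in> set xs \<Longrightarrow> for_all_large d (P x)) \<Longrightarrow> for_all_large d (\<lambda>n. \<forall>x\<in>set xs. P x n)"
proof (induction xs)
  case (Cons x xs)
  have "for_all_large d (\<lambda>n. P x n \<and> (\<forall>x\<in>set xs. P x n))"
    using Cons by (intro for_all_large_conj) auto
  then show ?case by simp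
qed (auto intro: for_all_large_True)

text \<open>
  A difference of a product of functions in separate variables is the product of the
  differences, each of which is eventually nonnegative.
\<close>

lemma hilbert_fun_mdiffs_nonneg:
  assumes "hilbert_fun d p" "set ks \<subseteq> {..d}"
  shows "for_all_large d (\<lambda>n. 0 \<le> mdiffs ks (\<lambda>n. int (p n)) n)"
proof -
  obtain \<Phi> where \<Phi>: "\<And>\<phi> i. \<phi> \<in> set \<Phi> \<Longrightarrow> hilbert_fun1 (\<phi> i)"
    and pn: "\<And>n. p n = (\<Sum>\<phi>\<leftarrow>\<Phi>. \<Prod>i\<le>d. \<phi> i (n i))"
    using assms unfolding hilbert_fun_def by blast
  have "for_all_large d (\<lambda>n. \<forall>\<phi>\<in>set \<Phi>. \<forall>i\<le>d. 0 \<le> (diff ^^ count_list ks i) (\<lambda>m. int (\<phi> i m)) (n i))"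
    using \<Phi> unfolding hilbert_fun1_def ev_diff_nonneg_def
    by (intro for_all_large_list for_all_large_prod) auto
  then show ?thesis
  proof (rule for_all_large_mono)
    fix n assume *: "\<forall>\<phi>\<in>set \<Phi>. \<forall>i\<le>d. 0 \<le> (diff ^^ count_list ks i) (\<lambda>m. int (\<phi> i m)) (n i)"
    have "(\<lambda>n. int (p n)) = (\<lambda>n. \<Sum>\<phi>\<leftarrow>\<Phi>. \<Prod>i\<le>d. int (\<phi> i (n i)))"
      unfolding pn by (induction \<Phi>) (auto simp: fun_eq_iff)
    then have "mdiffs ks (\<lambda>n. int (p n)) n = (\<Sum>\<phi>\<leftarrow>\<Phi>. \<Prod>i\<le>d. (diff ^^ count_list ks i) (\<lambda>m. int (\<phi> i m)) (n i))"
      using mdiffs_prod[OF assms(2), of "\<lambda>i m. int (_ i m)"] by (simp add: mdiffs_sum_list)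
    also have "\<dots> \<ge> 0" using * by (intro sum_list_nonneg) (auto intro!: prod_nonneg)
    finally show "0 \<le> mdiffs ks (\<lambda>n. int (p n)) n" .
  qed
qed

section \<open>Hilbert coefficients and constant differences\<close>

text \<open>
  This is the expansion in \<open>has_hilbert_coeffs\<close>, for an arbitrary numerical function in
  place of the length of graded components.
\<close>

definition has_coeffs :: "nat \<Rightarrow> ((nat \<Rightarrow> nat) \<Rightarrow> int) \<Rightarrow> ((nat \<Rightarrow> nat) \<Rightarrow> int) \<Rightarrow> bool" where
  "has_coeffs d p e \<longleftrightarrow> finite {h. e h \<noteq> 0} \<and> (\<forall>h. e h \<noteq> 0 \<longrightarrow> multi_index d h) \<and>
     for_all_large d (\<lambda>n. p n = (\<Sum>h | e h \<noteq> 0. e h * (\<Prod>i\<le>d. int ((n i + h i) choose h i))))"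

lemma finite_multi_index: "finite {h. multi_index d h \<and> (\<forall>i. h i \<le> m)}"
proof -
  have "{h. multi_index d h \<and> (\<forall>i. h i \<le> m)} \<subseteq> {h. \<forall>i. (i \<in> {..d} \<longrightarrow> h i \<in> {..m}) \<and> (i \<notin> {..d} \<longrightarrow> h i = 0)}"
    by (auto simp: multi_index_def)
  then show ?thesis
    by (rule finite_subset) (rule finite_set_of_finite_funs; simp)
qed

lemma prod_sum_multi_index:
  fixes f :: "nat \<Rightarrow> nat \<Rightarrow> int"
  shows "(\<Prod>i\<le>d. \<Sum>j\<le>m. f i j) = (\<Sum>h | multi_index d h \<and> (\<forall>i. h i \<le> m). \<Prod>i\<le>d. f i (h i))"
proof -
  have "(\<Prod>i\<le>d. \<Sum>j\<le>m. f i j) = (\<Sum>h\<in>PiE {..d} (\<lambda>_. {..m}). \<Prod>i\<le>d. f i (h i))"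
    by (rule prod_sum_PiE) auto
  also have "\<dots> = (\<Sum>h | multi_index d h \<and> (\<forall>i. h i \<le> m). \<Prod>i\<le>d. f i (h i))"
    by (rule sum.reindex_bij_witness[of _ "\<lambda>h. restrict h {..d}" "\<lambda>h i. if i \<le> d then h i else 0"])
      (auto simp: multi_index_def PiE_def Pi_def extensional_def fun_eq_iff intro!: prod.cong)
  finally show ?thesis .
qed

lemma has_coeffs_sum_list:
  assumes "\<And>\<phi>. \<phi> \<in> set \<Phi> \<Longrightarrow> \<exists>e. has_coeffs d (p \<phi>) e"
  shows "\<exists>e. has_coeffs d (\<lambda>n. \<Sum>\<phi>\<leftarrow>\<Phi>. p \<phi> n) e"
  using assms
proof (induction \<Phi>)
  case Nil
  show ?case by (intro exI[of _ "\<lambda>_. 0"]) (simp add: has_coeffs_def for_all_large_True)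
next
  case (Cons \<phi> \<Phi>)
  obtain e e' where e: "has_coeffs d (p \<phi>) e" "has_coeffs d (\<lambda>n. \<Sum>\<phi>\<leftarrow>\<Phi>. p \<phi> n) e'"
    using Cons.IH Cons.prems by (metis list.set_intros(1) list.set_intros(2))
  let ?B = "\<lambda>n h. \<Prod>i\<le>d. int ((n i + h i) choose h i)"
  let ?S = "{h. e h \<noteq> 0} \<union> {h. e' h \<noteq> 0}"
  have fin: "finite ?S" using e by (simp add: has_coeffs_def)
  have 1: "(\<Sum>h | e h \<noteq> 0. e h * ?B n h) = (\<Sum>h\<in>?S. e h * ?B n h)" for n
    using fin by (intro sum.mono_neutral_left) auto
  have 2: "(\<Sum>h | e' h \<noteq> 0. e' h * ?B n h) = (\<Sum>h\<in>?S. e' h * ?B n h)" for n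
    using fin by (intro sum.mono_neutral_left) auto
  have 3: "(\<Sum>h | e h + e' h \<noteq> 0. (e h + e' h) * ?B n h) = (\<Sum>h\<in>?S. (e h + e' h) * ?B n h)" for n
    using fin by (intro sum.mono_neutral_left) auto
  have l1: "for_all_large d (\<lambda>n. p \<phi> n = (\<Sum>h\<in>?S. e h * ?B n h))"
    using e(1) unfolding has_coeffs_def 1 by blast
  have l2: "for_all_large d (\<lambda>n. (\<Sum>\<phi>\<leftarrow>\<Phi>. p \<phi> n) = (\<Sum>h\<in>?S. e' h * ?B n h))"
    using e(2) unfolding has_coeffs_def 2 by blast
  have "for_all_large d (\<lambda>n. (\<Sum>\<phi>\<leftarrow>\<phi> # \<Phi>. p \<phi> n) = (\<Sum>h\<in>?S. (e h + e' h) * ?B n h))"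
    by (rule for_all_large_mono[OF for_all_large_conj[OF l1 l2]]) (simp add: distrib_right sum.distrib)
  moreover have "finite {h. e h + e' h \<noteq> 0}" using fin by (rule finite_subset[rotated]) auto
  moreover have "\<forall>h. e h + e' h \<noteq> 0 \<longrightarrow> multi_index d h" using e unfolding has_coeffs_def by force
  ultimately have "has_coeffs d (\<lambda>n. \<Sum>\<phi>\<leftarrow>\<phi> # \<Phi>. p \<phi> n) (\<lambda>h. e h + e' h)"
    unfolding has_coeffs_def 3 by blast
  then show ?case by blast
qed

lemma hilbert_fun1_coeffs:
  assumes "\<And>i. i \<le> d \<Longrightarrow> hilbert_fun1 (\<phi> i)"
  shows "\<exists>e. has_coeffs d (\<lambda>n. \<Prod>i\<le>d. int (\<phi> i (n i))) e"
proof -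
  have "\<forall>i\<in>{..d}. \<exists>m c. \<forall>\<^sub>F n in sequentially. int (\<phi> i n) = (\<Sum>j\<le>m. c j * int ((n + j) choose j))"
    using assms unfolding hilbert_fun1_def ev_poly_def by blast
  then obtain m where "\<forall>i\<in>{..d}. \<exists>c. \<forall>\<^sub>F n in sequentially. int (\<phi> i n) = (\<Sum>j\<le>m i. c j * int ((n + j) choose j))"
    by (rule bchoice[THEN exE])
  then obtain c where c: "\<forall>i\<in>{..d}. \<forall>\<^sub>F n in sequentially. int (\<phi> i n) = (\<Sum>j\<le>m i. c i j * int ((n + j) choose j))"
    by (rule bchoice[THEN exE])
  define M where "M = Max (m ` {..d})"
  define c' where "c' = (\<lambda>i j. if j \<le> m i then c i j else 0)"
  have M: "m i \<le> M" if "i \<le> d" for i unfolding M_def using that by (intro Max_ge) auto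
  have "\<forall>\<^sub>F n in sequentially. int (\<phi> i n) = (\<Sum>j\<le>M. c' i j * int ((n + j) choose j))" if "i \<le> d" for i
    using ev_poly_extend[OF c[rule_format] M] that unfolding c'_def by simp
  then have large: "for_all_large d (\<lambda>n. \<forall>i\<le>d. int (\<phi> i (n i)) = (\<Sum>j\<le>M. c' i j * int ((n i + j) choose j)))"
    by (rule for_all_large_prod)
  let ?H = "{h. multi_index d h \<and> (\<forall>i. h i \<le> M)}"
  let ?B = "\<lambda>n h. \<Prod>i\<le>d. int ((n i + h i) choose h i)"
  define e where "e = (\<lambda>h. if h \<in> ?H then \<Prod>i\<le>d. c' i (h i) else 0)"
  have fin: "finite ?H" by (rule finite_multi_index)
  have "(\<Sum>h | e h \<noteq> 0. e h * ?B n h) = (\<Sum>h\<in>?H. e h * ?B n h)" for n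
    using fin by (intro sum.mono_neutral_left) (auto simp: e_def)
  also have "\<dots> n = (\<Prod>i\<le>d. \<Sum>j\<le>M. c' i j * int ((n i + j) choose j))" for n
    unfolding prod_sum_multi_index by (intro sum.cong refl) (simp add: e_def prod.distrib)
  finally have eq: "(\<Sum>h | e h \<noteq> 0. e h * ?B n h) = (\<Prod>i\<le>d. \<Sum>j\<le>M. c' i j * int ((n i + j) choose j))" for n .
  have "has_coeffs d (\<lambda>n. \<Prod>i\<le>d. int (\<phi> i (n i))) e"
    unfolding has_coeffs_def eq
  proof (intro conjI allI impI)
    show "finite {h. e h \<noteq> 0}" using fin by (rule finite_subset[rotated]) (auto simp: e_def)
    show "multi_index d h" if "e h \<noteq> 0" for h using that by (auto simp: e_def split: if_splits)
    show "for_all_large d (\<lambda>n. (\<Prod>i\<le>d. int (\<phi> i (n i))) = (\<Prod>i\<le>d. \<Sum>j\<le>M. c' i j * int (n i + j choose j)))"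
      using large by (rule for_all_large_mono) (auto intro!: prod.cong)
  qed
  then show ?thesis by (rule exI[of _ e])
qed

lemma hilbert_fun_coeffs:
  assumes "hilbert_fun d p" shows "\<exists>e. has_coeffs d (\<lambda>n. int (p n)) e"
proof -
  obtain \<Phi> where \<Phi>: "\<And>\<phi> i. \<phi> \<in> set \<Phi> \<Longrightarrow> hilbert_fun1 (\<phi> i)"
    and pn: "\<And>n. p n = (\<Sum>\<phi>\<leftarrow>\<Phi>. \<Prod>i\<le>d. \<phi> i (n i))"
    using assms unfolding hilbert_fun_def by blast
  have "(\<lambda>n. int (p n)) = (\<lambda>n. \<Sum>\<phi>\<leftarrow>\<Phi>. \<Prod>i\<le>d. int (\<phi> i (n i)))"
    unfolding pn by (induction \<Phi>) (auto simp: fun_eq_iff)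
  then show ?thesis
    using has_coeffs_sum_list[of \<Phi> d "\<lambda>\<phi> n. \<Prod>i\<le>d. int (\<phi> i (n i))"] hilbert_fun1_coeffs \<Phi> by metis
qed

lemma diff_choose:
  "(diff ^^ k) (\<lambda>n. int ((n + h) choose h)) = (\<lambda>n. if k \<le> h then int ((n + h) choose (h - k)) else 0)"
proof (induction k)
  case (Suc k)
  show ?case
  proof
    fix n
    have "(diff ^^ Suc k) (\<lambda>n. int ((n + h) choose h)) n =
        (if k \<le> h then int ((Suc n + h) choose (h - k)) else 0) - (if k \<le> h then int ((n + h) choose (h - k)) else 0)"
      unfolding diff_Suc Suc by (rule refl)
    also have "\<dots> = (if Suc k \<le> h then int ((n + h) choose (h - Suc k)) else 0)"
    proof (cases "Suc k \<le> h")
      case True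
      then have "h - k = Suc (h - Suc k)" by simp
      then show ?thesis using True by simp
    next
      case False
      then show ?thesis by (cases "k = h") auto
    qed
    finally show "(diff ^^ Suc k) (\<lambda>n. int ((n + h) choose h)) n = (if Suc k \<le> h then int ((n + h) choose (h - Suc k)) else 0)" .
  qed
qed simp

text \<open>
  Differencing lowers the lower index: the difference of \<open>(n + h) choose h\<close> is
  \<open>(n + h) choose (h - 1)\<close>.
\<close>

lemma mdiffs_coeffs:
  assumes "has_coeffs d p e" "set ks \<subseteq> {..d}"
  shows "for_all_large d (\<lambda>n. mdiffs ks p n = (\<Sum>h | e h \<noteq> 0 \<and> count_list ks \<le> h.
     e h * (\<Prod>i\<le>d. int ((n i + h i) choose (h i - count_list ks i)))))"
proof -
  have fin: "finite {h. e h \<noteq> 0}" and mi: "\<And>h. e h \<noteq> 0 \<Longrightarrow> multi_index d h"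
    and large: "for_all_large d (\<lambda>n. p n = (\<Sum>h | e h \<noteq> 0. e h * (\<Prod>i\<le>d. int ((n i + h i) choose h i))))"
    using assms(1) unfolding has_coeffs_def by auto
  have scale: "mdiffs ks (\<lambda>n. a * q n) n = a * mdiffs ks q n" for a q n
  proof (induction ks arbitrary: q)
    case (Cons i ks)
    have "mdiff i (\<lambda>n. a * q n) = (\<lambda>n. a * mdiff i q n)" by (auto simp: mdiff_def right_diff_distrib)
    then show ?case using Cons by simp
  qed simp
  from mdiffs_cong_large[OF large, of ks] show ?thesis
  proof (rule for_all_large_mono)
    fix n
    assume "mdiffs ks p n = mdiffs ks (\<lambda>n. \<Sum>h | e h \<noteq> 0. e h * (\<Prod>i\<le>d. int ((n i + h i) choose h i))) n"
    also have "\<dots> = (\<Sum>h | e h \<noteq> 0. e h * (\<Prod>i\<le>d. if count_list ks i \<le> h i then int ((n i + h i) choose (h i - count_list ks i)) else 0))"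
      unfolding mdiffs_sum scale
      by (subst mdiffs_prod[OF assms(2), of "\<lambda>i m. int ((m + _ i) choose _ i)"]) (simp add: diff_choose)
    also have "\<dots> = (\<Sum>h | e h \<noteq> 0 \<and> count_list ks \<le> h. e h * (\<Prod>i\<le>d. int ((n i + h i) choose (h i - count_list ks i))))"
    proof (rule sum.mono_neutral_cong_right)
      show "\<forall>h\<in>{h. e h \<noteq> 0} - {h. e h \<noteq> 0 \<and> count_list ks \<le> h}.
        e h * (\<Prod>i\<le>d. if count_list ks i \<le> h i then int (n i + h i choose (h i - count_list ks i)) else 0) = 0"
      proof
        fix h assume "h \<in> {h. e h \<noteq> 0} - {h. e h \<noteq> 0 \<and> count_list ks \<le> h}"
        then obtain i where i: "\<not> count_list ks i \<le> h i" by (auto simp: le_fun_def)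
        then have "i \<in> set ks" by (metis count_notin le0)
        then have "i \<le> d" using assms(2) by auto
        then have "(\<Prod>i\<le>d. if count_list ks i \<le> h i then int (n i + h i choose (h i - count_list ks i)) else 0) = 0"
          using i by (intro prod_zero) auto
        then show "e h * (\<Prod>i\<le>d. if count_list ks i \<le> h i then int (n i + h i choose (h i - count_list ks i)) else 0) = 0"
          by simp
      qed
    qed (use fin in \<open>auto simp: le_fun_def intro!: prod.cong\<close>)
    finally show "mdiffs ks p n = \<dots>" .
  qed
qed

definition total :: "nat \<Rightarrow> (nat \<Rightarrow> nat) \<Rightarrow> nat" where "total d h = (\<Sum>i\<le>d. h i)"

lemma multi_index_le_total_eq:
  assumes "h \<le> h'" "multi_index d h" "multi_index d h'" "total d h' \<le> total d h" shows "h' = h"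
proof
  fix i
  show "h' i = h i"
  proof (cases "i \<le> d")
    case True
    have "h j = h' j" if "j \<in> {..d}" for j
      using sum_mono_inv[of h "{..d}" h' j] assms(1,4) that sum_mono[of "{..d}" h h']
      unfolding total_def le_fun_def by (simp add: antisym)
    then show ?thesis using True by simp
  qed (use assms in \<open>simp add: multi_index_def\<close>)
qed

lemma list_of_multi_index:
  assumes "multi_index d h" shows "\<exists>ks. set ks \<subseteq> {..d} \<and> count_list ks = h"
proof -
  let ?ks = "concat (map (\<lambda>i. replicate (h i) i) [0..<Suc d])"
  have rep: "count_list (replicate m i) j = (if i = j then m else 0)" for m and i j :: nat by (induction m) auto
  have app: "count_list (concat (map (\<lambda>i. replicate (h i) i) [0..<m])) j = (if j < m then h j else 0)" for m j
    by (induction m) (auto simp: rep)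
  have "count_list ?ks = h" using assms unfolding app by (auto simp: multi_index_def fun_eq_iff)
  moreover have "set ?ks \<subseteq> {..d}" by auto
  ultimately show ?thesis by blast
qed

text \<open>
  If no larger index has a nonzero coefficient, only the term of index \<open>count_list ks\<close>
  survives, with all binomials equal to 1.
\<close>

lemma coeff_eq_mdiffs:
  assumes e: "has_coeffs d p e" and ks: "set ks \<subseteq> {..d}"
    and top: "\<And>h. e h \<noteq> 0 \<Longrightarrow> count_list ks \<le> h \<Longrightarrow> h = count_list ks"
  shows "for_all_large d (\<lambda>n. mdiffs ks p n = e (count_list ks))"
proof (rule for_all_large_mono[OF mdiffs_coeffs[OF e ks]])
  fix n
  assume *: "mdiffs ks p n = (\<Sum>h | e h \<noteq> 0 \<and> count_list ks \<le> h. e h * (\<Prod>i\<le>d. int ((n i + h i) choose (h i - count_list ks i))))"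
  show "mdiffs ks p n = e (count_list ks)"
  proof (cases "e (count_list ks) = 0")
    case True
    then have "{h. e h \<noteq> 0 \<and> count_list ks \<le> h} = {}" using top by auto
    then show ?thesis using * True by (simp only: sum.empty)
  next
    case False
    then have "{h. e h \<noteq> 0 \<and> count_list ks \<le> h} = {count_list ks}" using top by auto
    then show ?thesis using * by simp
  qed
qed

lemma count_list_multi_index: "set ks \<subseteq> {..d} \<Longrightarrow> multi_index d (count_list ks)"
  unfolding multi_index_def by (metis atMost_iff count_notin not_le subsetD)

text \<open>
  Suppose some \<open>h\<close> properly above \<open>count_list ks\<close> has a nonzero coefficient, and take one of
  maximal total degree. Differencing further, up to \<open>h\<close>, gives the value \<open>e h\<close>, but a
  further difference of a constant is zero.
\<close>

lemma mdiffs_const_coeffs: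
  assumes e: "has_coeffs d p e" and ks: "set ks \<subseteq> {..d}"
    and const: "for_all_large d (\<lambda>n. mdiffs ks p n = a)"
  shows "e (count_list ks) = a" "\<And>h. count_list ks \<le> h \<Longrightarrow> h \<noteq> count_list ks \<Longrightarrow> e h = 0"
proof -
  have fin: "finite {h. e h \<noteq> 0}" and mi: "\<And>h. e h \<noteq> 0 \<Longrightarrow> multi_index d h"
    using e unfolding has_coeffs_def by auto
  show *: "e h = 0" if h: "count_list ks \<le> h" "h \<noteq> count_list ks" for h
  proof (rule ccontr)
    assume "e h \<noteq> 0"
    let ?S = "{h. e h \<noteq> 0 \<and> count_list ks \<le> h \<and> h \<noteq> count_list ks}"
    have "finite ?S" using fin by (rule finite_subset[rotated]) auto
    moreover have "?S \<noteq> {}" using h \<open>e h \<noteq> 0\<close> by auto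
    ultimately obtain h0 where h0: "h0 \<in> ?S" and max: "\<And>h. h \<in> ?S \<Longrightarrow> total d h \<le> total d h0"
      using Max_in[of "total d ` ?S"] Max_ge[of "total d ` ?S"]
      by (smt (verit) finite_imageI image_iff image_is_empty)
    have mi0: "multi_index d h0" using h0 mi by auto
    have "multi_index d (\<lambda>i. h0 i - count_list ks i)" using mi0 by (simp add: multi_index_def)
    then obtain ls where ls: "set ls \<subseteq> {..d}" "count_list ls = (\<lambda>i. h0 i - count_list ks i)"
      using list_of_multi_index by blast
    have cnt: "count_list (ks @ ls) = h0"
      using h0 ls(2) by (auto simp: fun_eq_iff le_fun_def)
    have "for_all_large d (\<lambda>n. mdiffs (ks @ ls) p n = e (count_list (ks @ ls)))"
    proof (rule coeff_eq_mdiffs[OF e])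
      show "set (ks @ ls) \<subseteq> {..d}" using ks ls by auto
      fix h assume h: "e h \<noteq> 0" "count_list (ks @ ls) \<le> h"
      then have "h0 \<le> h" using cnt by simp
      moreover have "h \<in> ?S"
        using h0 h(1) \<open>h0 \<le> h\<close> by (auto intro: order_trans antisym)
      ultimately show "h = count_list (ks @ ls)"
        unfolding cnt using mi0 mi h(1) max by (intro multi_index_le_total_eq) auto
    qed
    moreover have "for_all_large d (\<lambda>n. mdiffs (ks @ ls) p n = 0)"
    proof -
      have "ls \<noteq> []" using ls(2) h0 by (auto simp: fun_eq_iff le_fun_def intro: antisym)
      then obtain l ls' where "ls = l # ls'" by (cases ls) auto
      moreover have "mdiff l (\<lambda>n. a) = (\<lambda>n. 0)" by (auto simp: mdiff_def)
      ultimately have "mdiffs ls (\<lambda>n. a) n = 0" for n by (simp add: mdiffs_zero)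
      then show ?thesis
        using mdiffs_cong_large[OF const, of ls] unfolding mdiffs_append by simp
    qed
    ultimately have "for_all_large d (\<lambda>n. mdiffs (ks @ ls) p n = e h0 \<and> mdiffs (ks @ ls) p n = 0)"
      unfolding cnt by (rule for_all_large_conj)
    then show False using h0 for_all_large_ex by fastforce
  qed
  have "for_all_large d (\<lambda>n. mdiffs ks p n = e (count_list ks))"
    using * by (intro coeff_eq_mdiffs[OF e ks]) auto
  from for_all_large_conj[OF this const] show "e (count_list ks) = a"
    using for_all_large_ex by fastforce
qed

text \<open>
  The difference of two expansions expands the zero function, all of whose differences are
  constantly zero, so each of its coefficients vanishes.
\<close>

lemma has_coeffs_unique:
  assumes "has_coeffs d p e" "has_coeffs d p e'" shows "e = e'"
proof (rule ccontr)
  assume "e \<noteq> e'"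
  let ?S = "{h. e h \<noteq> e' h}"
  have fin: "finite {h. e h \<noteq> 0}" "finite {h. e' h \<noteq> 0}"
    and mi: "\<And>h. e h \<noteq> 0 \<or> e' h \<noteq> 0 \<Longrightarrow> multi_index d h"
    using assms unfolding has_coeffs_def by auto
  let ?T = "{h. e h \<noteq> 0} \<union> {h. e' h \<noteq> 0}"
  let ?B = "\<lambda>n h. \<Prod>i\<le>d. int ((n i + h i) choose h i)"
  have 1: "(\<Sum>h | e h \<noteq> 0. e h * ?B n h) = (\<Sum>h\<in>?T. e h * ?B n h)" for n
    using fin by (intro sum.mono_neutral_left) auto
  have 2: "(\<Sum>h | e' h \<noteq> 0. e' h * ?B n h) = (\<Sum>h\<in>?T. e' h * ?B n h)" for n
    using fin by (intro sum.mono_neutral_left) auto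
  have 3: "(\<Sum>h | e h - e' h \<noteq> 0. (e h - e' h) * ?B n h) = (\<Sum>h\<in>?T. (e h - e' h) * ?B n h)" for n
    using fin by (intro sum.mono_neutral_left) auto
  have l1: "for_all_large d (\<lambda>n. p n = (\<Sum>h\<in>?T. e h * ?B n h))"
    using assms(1) unfolding has_coeffs_def 1 by blast
  have l2: "for_all_large d (\<lambda>n. p n = (\<Sum>h\<in>?T. e' h * ?B n h))"
    using assms(2) unfolding has_coeffs_def 2 by blast
  have l3: "for_all_large d (\<lambda>n. 0 = (\<Sum>h\<in>?T. (e h - e' h) * ?B n h))"
    by (rule for_all_large_mono[OF for_all_large_conj[OF l1 l2]]) (simp add: left_diff_distrib sum_subtractf)
  have zero: "has_coeffs d (\<lambda>n. 0) (\<lambda>h. e h - e' h)"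
    unfolding has_coeffs_def 3
  proof (intro conjI allI impI l3)
    show "finite {h. e h - e' h \<noteq> 0}" using fin by (rule_tac finite_subset[of _ ?T]) auto
    show "multi_index d h" if "e h - e' h \<noteq> 0" for h using that by (intro mi) auto
  qed
  obtain h where h: "e h \<noteq> e' h" using \<open>e \<noteq> e'\<close> by auto
  then have "multi_index d h" by (intro mi) auto
  then obtain ks where ks: "set ks \<subseteq> {..d}" "count_list ks = h" using list_of_multi_index by blast
  have "for_all_large d (\<lambda>n. mdiffs ks (\<lambda>n. 0) n = 0)"
    by (rule for_all_large_True) (rule mdiffs_zero)
  from mdiffs_const_coeffs(1)[OF zero ks(1) this] ks h show False by simp
qed

text \<open>
  The working form of ``the mixed multiplicity of type \<open>k\<close> is defined and equals \<open>a\<close>'',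
  where \<open>k\<close> counts the occurrences in \<open>ks\<close>. A list is used because the induction on a
  superficial sequence adds one index at a time.
\<close>

definition const_diff :: "nat \<Rightarrow> nat list \<Rightarrow> ((nat \<Rightarrow> nat) \<Rightarrow> nat) \<Rightarrow> int \<Rightarrow> bool" where
  "const_diff d ks p a \<longleftrightarrow> for_all_large d (\<lambda>n. mdiffs ks (\<lambda>n. int (p n)) n = a)"

lemma const_diff_unique: "const_diff d ks p a \<Longrightarrow> const_diff d ks p b \<Longrightarrow> a = b"
  unfolding const_diff_def using for_all_large_conj for_all_large_ex by fastforce

lemma const_diff_nonneg: "hilbert_fun d p \<Longrightarrow> set ks \<subseteq> {..d} \<Longrightarrow> const_diff d ks p a \<Longrightarrow> 0 \<le> a"
  unfolding const_diff_def
  using for_all_large_ex[OF for_all_large_conj[OF hilbert_fun_mdiffs_nonneg]] by fastforce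

lemma const_diff_cong:
  "const_diff d ks p a \<Longrightarrow> for_all_large d (\<lambda>n. p n = q n) \<Longrightarrow> const_diff d ks q a"
proof -
  assume p: "const_diff d ks p a" and eq: "for_all_large d (\<lambda>n. p n = q n)"
  have "for_all_large d (\<lambda>n. int (p n) = int (q n))" using eq by (rule for_all_large_mono) simp
  from for_all_large_conj[OF p[unfolded const_diff_def] mdiffs_cong_large[OF this, of ks]]
  show ?thesis unfolding const_diff_def by (rule for_all_large_mono) simp
qed

lemma const_diff_shift: "const_diff d ks p a \<Longrightarrow> const_diff d ks (\<lambda>n. p (\<lambda>i. n i + m i)) a"
  unfolding const_diff_def mdiffs_shift[of ks "\<lambda>n. int (p n)" m] by (rule for_all_large_shift)

lemma const_diff_add: "const_diff d ks p a \<Longrightarrow> const_diff d ks q b \<Longrightarrow> const_diff d ks (\<lambda>n. p n + q n) (a + b)"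
  unfolding const_diff_def of_nat_add mdiffs_add
  by (rule for_all_large_mono[OF for_all_large_conj], assumption, assumption) simp

lemma const_diff_zero: "const_diff d ks (\<lambda>n. 0) 0"
  unfolding const_diff_def by (rule for_all_large_True) (simp add: mdiffs_zero)

lemma const_diff_sum:
  "finite A \<Longrightarrow> (\<And>j. j \<in> A \<Longrightarrow> const_diff d ks (p j) (a j)) \<Longrightarrow> const_diff d ks (\<lambda>n. \<Sum>j\<in>A. p j n) (\<Sum>j\<in>A. a j)"
  by (induction A rule: finite_induct) (auto simp: const_diff_zero const_diff_add)

lemma for_all_large_ball:
  assumes "\<And>i. i \<le> d \<Longrightarrow> for_all_large d (P i)"
  shows "for_all_large d (\<lambda>n. \<forall>i\<in>{..d}. P i n)"
proof -
  have "for_all_large d (\<lambda>n. \<forall>i\<in>set [0..<Suc d]. P i n)"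
    by (rule for_all_large_list) (use assms in auto)
  moreover have "set [0..<Suc d] = {..d}" by auto
  ultimately show ?thesis by (simp only:)
qed

text \<open>
  One bound works for all \<open>d + 1\<close> directions, and any two large points are joined by unit
  steps, changing the coordinates one after the other.
\<close>

lemma large_mono_const:
  fixes f :: "(nat \<Rightarrow> nat) \<Rightarrow> int"
  assumes "\<And>i. i \<le> d \<Longrightarrow> for_all_large d (\<lambda>n. f (n(i := Suc (n i))) = f n)"
    and ext: "\<And>n n'. (\<forall>i\<le>d. n i = n' i) \<Longrightarrow> f n = f n'"
  shows "\<exists>a. for_all_large d (\<lambda>n. f n = a)"
proof -
  have "for_all_large d (\<lambda>n. \<forall>i\<in>{..d}. f (n(i := Suc (n i))) = f n)"
    by (rule for_all_large_ball) (rule assms(1))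
  then obtain c where c0: "\<forall>n. (\<forall>i\<le>d. c \<le> n i) \<longrightarrow> (\<forall>i\<in>{..d}. f (n(i := Suc (n i))) = f n)"
    unfolding for_all_large_def by blast
  have c: "f (n(i := Suc (n i))) = f n" if "\<forall>i\<le>d. c \<le> n i" "i \<le> d" for n i
    using c0 that by blast
  have up: "f (n(i := n i + m)) = f n" if "\<forall>i\<le>d. c \<le> n i" "i \<le> d" for n i m
  proof (induction m)
    case (Suc m)
    have "f ((n(i := n i + m))(i := Suc ((n(i := n i + m)) i))) = f (n(i := n i + m))"
      by (rule c) (use that in \<open>auto intro: trans_le_add1\<close>)
    then show ?case using Suc by (simp only: fun_upd_upd fun_upd_same add_Suc_right)
  qed simp
  have "f (\<lambda>i. if i < j then n i else c) = f (\<lambda>_. c)" if n: "\<forall>i\<le>d. c \<le> n i" "j \<le> Suc d" for n j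
    using n(2)
  proof (induction j)
    case (Suc j)
    let ?m = "\<lambda>i. if i < j then n i else c"
    have "f (?m(j := ?m j + (n j - c))) = f ?m"
      by (rule up) (use n Suc.prems in auto)
    moreover have "?m(j := ?m j + (n j - c)) = (\<lambda>i. if i < Suc j then n i else c)"
      using n Suc.prems by (auto simp: fun_eq_iff less_Suc_eq)
    ultimately show ?case using Suc by simp
  qed simp
  note * = this
  have "f n = f (\<lambda>_. c)" if n: "\<forall>i\<le>d. c \<le> n i" for n
  proof -
    have "f n = f (\<lambda>i. if i < Suc d then n i else c)" by (rule ext) auto
    then show ?thesis using *[OF n, of "Suc d"] by simp
  qed
  then show ?thesis unfolding for_all_large_def by blast
qed

lemma mdiffs_ext:
  assumes "\<And>n n'. (\<forall>i\<le>d. n i = n' i) \<Longrightarrow> p n = p n'" "\<forall>i\<le>d. n i = n' i"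
  shows "mdiffs ks p n = mdiffs ks p n'"
  using assms
proof (induction ks arbitrary: p)
  case (Cons k ks)
  have "mdiff k p n = mdiff k p n'" if "\<forall>i\<le>d. n i = n' i" for n n'
  proof -
    have "p n = p n'" "p (n(k := Suc (n k))) = p (n'(k := Suc (n' k)))" if "k \<le> d"
      by (rule Cons.prems(1); use \<open>\<forall>i\<le>d. n i = n' i\<close> that in simp)+
    moreover have "p n = p n'" "p (n(k := Suc (n k))) = p (n'(k := Suc (n' k)))" if "\<not> k \<le> d"
      by (rule Cons.prems(1); use \<open>\<forall>i\<le>d. n i = n' i\<close> that in auto)+
    ultimately show ?thesis unfolding mdiff_def by metis
  qed
  from Cons.IH[of "mdiff k p", OF this] Cons.prems(2) show ?case by simp
qed simp

lemma hilbert_fun_ext: "hilbert_fun d p \<Longrightarrow> (\<forall>i\<le>d. n i = n' i) \<Longrightarrow> p n = p n'"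
proof -
  assume "hilbert_fun d p" and n: "\<forall>i\<le>d. n i = n' i"
  then obtain \<Phi> where pn: "\<And>n. p n = (\<Sum>\<phi>\<leftarrow>\<Phi>. \<Prod>i\<le>d. \<phi> i (n i))"
    unfolding hilbert_fun_def by blast
  have "(\<Prod>i\<le>d. \<phi> i (n i)) = (\<Prod>i\<le>d. \<phi> i (n' i))" for \<phi> :: "nat \<Rightarrow> nat \<Rightarrow> nat"
    using n by (intro prod.cong) auto
  then show ?thesis unfolding pn by simp
qed

text \<open>
  Differencing once more, the sum becomes zero while both summands stay eventually
  nonnegative; so both further differences vanish for large arguments, in every direction.
\<close>

lemma const_diff_split:
  assumes p: "hilbert_fun d p" and q: "hilbert_fun d q" and ks: "set ks \<subseteq> {..d}"
    and a: "const_diff d ks (\<lambda>n. p n + q n) a"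
  shows "\<exists>b\<ge>0. \<exists>c\<ge>0. const_diff d ks p b \<and> const_diff d ks q c \<and> a = b + c"
proof -
  have step: "for_all_large d (\<lambda>n. mdiffs ks (\<lambda>n. int (p n)) (n(i := Suc (n i))) = mdiffs ks (\<lambda>n. int (p n)) n
      \<and> mdiffs ks (\<lambda>n. int (q n)) (n(i := Suc (n i))) = mdiffs ks (\<lambda>n. int (q n)) n)" if i: "i \<le> d" for i
  proof -
    let ?ls = "ks @ [i]"
    have ls: "set ?ls \<subseteq> {..d}" using ks i by auto
    have app: "mdiffs ?ls r n = mdiffs ks r (n(i := Suc (n i))) - mdiffs ks r n" for r n
      by (simp add: mdiffs_append mdiff_def)
    have "for_all_large d (\<lambda>n. mdiffs ks (\<lambda>n. int (p n)) n + mdiffs ks (\<lambda>n. int (q n)) n = a)"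
      using a unfolding const_diff_def of_nat_add mdiffs_add .
    from for_all_large_conj[OF for_all_large_conj[OF this for_all_large_Suc[OF this, of i]]
        for_all_large_conj[OF hilbert_fun_mdiffs_nonneg[OF p ls] hilbert_fun_mdiffs_nonneg[OF q ls]]]
    show ?thesis
      by (rule for_all_large_mono) (unfold app, linarith)
  qed
  have "\<exists>b. for_all_large d (\<lambda>n. mdiffs ks (\<lambda>n. int (p n)) n = b)"
  proof (rule large_mono_const)
    show "for_all_large d (\<lambda>n. mdiffs ks (\<lambda>n. int (p n)) (n(i := Suc (n i))) = mdiffs ks (\<lambda>n. int (p n)) n)" if "i \<le> d" for i
      using step[OF that] by (rule for_all_large_mono) blast
    show "mdiffs ks (\<lambda>n. int (p n)) n = mdiffs ks (\<lambda>n. int (p n)) n'" if "\<forall>i\<le>d. n i = n' i" for n n'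
      by (rule mdiffs_ext[OF _ that]) (simp add: hilbert_fun_ext[OF p])
  qed
  moreover have "\<exists>b. for_all_large d (\<lambda>n. mdiffs ks (\<lambda>n. int (q n)) n = b)"
  proof (rule large_mono_const)
    show "for_all_large d (\<lambda>n. mdiffs ks (\<lambda>n. int (q n)) (n(i := Suc (n i))) = mdiffs ks (\<lambda>n. int (q n)) n)" if "i \<le> d" for i
      using step[OF that] by (rule for_all_large_mono) blast
    show "mdiffs ks (\<lambda>n. int (q n)) n = mdiffs ks (\<lambda>n. int (q n)) n'" if "\<forall>i\<le>d. n i = n' i" for n n'
      by (rule mdiffs_ext[OF _ that]) (simp add: hilbert_fun_ext[OF q])
  qed
  ultimately obtain b c where bc: "const_diff d ks p b" "const_diff d ks q c"
    unfolding const_diff_def by blast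
  moreover have "a = b + c" using const_diff_unique[OF a const_diff_add[OF bc]] .
  moreover have "0 \<le> b" "0 \<le> c" using const_diff_nonneg ks p q bc by blast+
  ultimately show ?thesis by blast
qed

text \<open>
  First differences are eventually nonnegative, and a bounded nondecreasing function with
  natural values is constant beyond a point where it attains its maximum.
\<close>

lemma hilbert_fun_bounded_const:
  assumes p: "hilbert_fun d p" and B: "for_all_large d (\<lambda>n. p n \<le> B)"
  shows "\<exists>a. const_diff d [] p a"
proof -
  have "for_all_large d (\<lambda>n. \<forall>i\<in>{..d}. p n \<le> p (n(i := Suc (n i))))"
  proof (rule for_all_large_ball)
    fix i assume "i \<le> d"
    then show "for_all_large d (\<lambda>n. p n \<le> p (n(i := Suc (n i))))"
      using hilbert_fun_mdiffs_nonneg[OF p, of "[i]"] by (auto simp: mdiff_def)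
  qed
  from for_all_large_conj[OF B this]
  obtain c where c0: "\<forall>n. (\<forall>i\<le>d. c \<le> n i) \<longrightarrow> p n \<le> B \<and> (\<forall>i\<in>{..d}. p n \<le> p (n(i := Suc (n i))))"
    unfolding for_all_large_def by blast
  have c: "p n \<le> B" if "\<forall>i\<le>d. c \<le> n i" for n
    using c0 that by blast
  have up: "p n \<le> p (n(i := Suc (n i)))" if "\<forall>i\<le>d. c \<le> n i" "i \<le> d" for n i
    using c0 that by blast
  let ?V = "p ` {n. \<forall>i\<le>d. c \<le> n i}"
  have "finite ?V" by (rule finite_subset[of _ "{..B}"]) (use c in auto)
  have "?V \<noteq> {}" by (auto intro: exI[of _ "\<lambda>_. c"])
  then have "Max ?V \<in> ?V" using \<open>finite ?V\<close> by (intro Max_in)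
  then obtain m where m: "\<forall>i\<le>d. c \<le> m i" "p m = Max ?V" by (elim imageE) simp
  have max: "p n \<le> p m" if "\<forall>i\<le>d. c \<le> n i" for n
    unfolding m(2) using \<open>finite ?V\<close> that by (intro Max_ge) auto
  note m = m(1)
  have mono1: "p n \<le> p (n(i := n i + t))" if "\<forall>i\<le>d. c \<le> n i" "i \<le> d" for n i t
  proof (induction t)
    case (Suc t)
    have "p (n(i := n i + t)) \<le> p ((n(i := n i + t))(i := Suc ((n(i := n i + t)) i)))"
      by (rule up) (use that in \<open>auto intro: trans_le_add1\<close>)
    then have "p (n(i := n i + t)) \<le> p (n(i := n i + Suc t))"
      by (simp only: fun_upd_upd fun_upd_same add_Suc_right)
    with Suc show ?case by (rule order_trans)
  qed simp
  have mono: "p m \<le> p (\<lambda>i. if i < j then n i else m i)" if n: "\<forall>i\<le>d. m i \<le> n i" "j \<le> Suc d" for n j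
    using n(2)
  proof (induction j)
    case (Suc j)
    let ?m = "\<lambda>i. if i < j then n i else m i"
    have "p ?m \<le> p (?m(j := ?m j + (n j - m j)))"
    proof (rule mono1)
      have "c \<le> n i" if "i \<le> d" for i using n(1) m that by (meson order_trans)
      then show "\<forall>i\<le>d. c \<le> ?m i" using m by auto
      show "j \<le> d" using Suc.prems by simp
    qed
    moreover have "?m(j := ?m j + (n j - m j)) = (\<lambda>i. if i < Suc j then n i else m i)"
      using n Suc.prems by (auto simp: fun_eq_iff less_Suc_eq)
    ultimately show ?case using Suc by simp
  qed simp
  have "p n = p m" if n: "\<forall>i\<le>d. m i \<le> n i" for n
  proof -
    have "p n = p (\<lambda>i. if i < Suc d then n i else m i)" by (rule hilbert_fun_ext[OF p]) auto
    then have "p m \<le> p n" using mono[OF n, of "Suc d"] by simp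
    moreover have "p n \<le> p m" by (rule max) (use n m in \<open>auto intro: order_trans\<close>)
    ultimately show ?thesis by simp
  qed
  note const = this
  have "for_all_large d (\<lambda>n. p n = p m)"
    unfolding for_all_large_def
  proof (intro exI[of _ "Max (m ` {..d})"] allI impI const)
    fix n i assume "\<forall>i\<le>d. Max (m ` {..d}) \<le> n i" "i \<le> d"
    then have "Max (m ` {..d}) \<le> n i" "m i \<le> Max (m ` {..d})" by (auto intro: Max_ge)
    then show "m i \<le> n i" by (rule order_trans[rotated])
  qed
  then have "for_all_large d (\<lambda>n. mdiffs [] (\<lambda>n. int (p n)) n = int (p m))"
    by (rule for_all_large_mono) simp
  then show ?thesis unfolding const_diff_def by (rule exI[of _ "int (p m)"])
qed

section \<open>Families of submodules stable under finitely many ring elements\<close>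

text \<open>
  The ascending chain condition for countable chains is the form in which Noetherianity is
  used; the module hypotheses of the theorem provide it through \<open>fin_gen_noetherian\<close>.
\<close>

locale noetherian_module = module R M for R (structure) and M (structure) +
  assumes ascending_chain: "\<And>f :: nat \<Rightarrow> _. (\<And>i. submodule (f i) R M) \<Longrightarrow> (\<And>i. f i \<subseteq> f (Suc i)) \<Longrightarrow> \<exists>c. \<forall>i\<ge>c. f i = f c"

context module
begin

text \<open>
  The elements of degree \<open>n\<close> that are polynomials of degree less than \<open>t\<close> in the generator
  \<open>a\<close>, which itself has degree \<open>e\<^sub>g\<close>, with coefficients in \<open>B\<close>: this is
  \<open>L + B n + a B (n - e\<^sub>g) + \<cdots> + a^{t-1} B (n - (t-1) e\<^sub>g)\<close>, of interest for \<open>t \<le> n\<^sub>g + 1\<close>.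
\<close>

primrec partial_sum :: "'c set \<Rightarrow> ((nat \<Rightarrow> nat) \<Rightarrow> 'c set) \<Rightarrow> nat \<Rightarrow> 'a \<Rightarrow> nat \<Rightarrow> (nat \<Rightarrow> nat) \<Rightarrow> 'c set" where
  "partial_sum L B g a 0 n = L"
| "partial_sum L B g a (Suc t) n = partial_sum L B g a t n \<^bold>+ (a [^] t) \<^bold>* B (n(g := n g - t))"

text \<open>
  \<open>L\<close> plus the products of \<open>H\<close> with all monomials of degree \<open>n\<close> in the generators \<open>gs\<close>,
  where the pair \<open>(g, a)\<close> stands for the generator \<open>a\<close> of degree \<open>e\<^sub>g\<close>. It is the graded
  module that the multi-Rees algebra generates from \<open>H\<close>, built up one generator at a time.
\<close>

fun generated :: "'c set \<Rightarrow> 'c set \<Rightarrow> (nat \<times> 'a) list \<Rightarrow> (nat \<Rightarrow> nat) \<Rightarrow> 'c set" where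
  "generated L H [] n = (if \<forall>i. n i = 0 then H else L)"
| "generated L H ((g, a) # gs) n = partial_sum L (generated L H gs) g a (Suc (n g)) n"

definition stable_family :: "'c set \<Rightarrow> (nat \<times> 'a) list \<Rightarrow> ((nat \<Rightarrow> nat) \<Rightarrow> 'c set) \<Rightarrow> bool" where
  "stable_family L gs V \<longleftrightarrow> (\<forall>n. sub (V n) \<and> L \<subseteq> V n) \<and>
     (\<forall>(g, a) \<in> set gs. \<forall>n. a \<^bold>* V n \<subseteq> V (n(g := Suc (n g))))"

text \<open>
  The coefficients of \<open>a^t\<close>, in degree \<open>n\<close>, of the elements of \<open>V\<close> that are polynomials in
  \<open>a\<close> of degree at most \<open>t\<close>. These play the part of the modules of leading coefficients in
  Hilbert's basis theorem.
\<close>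

definition leading :: "'c set \<Rightarrow> ((nat \<Rightarrow> nat) \<Rightarrow> 'c set) \<Rightarrow> nat \<Rightarrow> 'a \<Rightarrow> ((nat \<Rightarrow> nat) \<Rightarrow> 'c set) \<Rightarrow> nat \<Rightarrow> (nat \<Rightarrow> nat) \<Rightarrow> 'c set" where
  "leading L B g a V t n =
     ((V (n(g := n g + t)) \<^bold>+ partial_sum L B g a t (n(g := n g + t))) \<^bold>: (a [^] t)) \<inter> B n"

lemma stable_familyD:
  assumes "stable_family L gs V"
  shows "sub (V n)" "L \<subseteq> V n" "(g, a) \<in> set gs \<Longrightarrow> a \<^bold>* V n \<subseteq> V (n(g := Suc (n g)))"
proof -
  show "sub (V n)" "L \<subseteq> V n" using assms unfolding stable_family_def by blast+
  assume "(g, a) \<in> set gs"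
  from bspec[OF conjunct2[OF assms[unfolded stable_family_def]] this]
  show "a \<^bold>* V n \<subseteq> V (n(g := Suc (n g)))" by (simp only: prod.case)
qed

lemma sub_partial_sum:
  assumes "sub L" "a \<in> carrier R" "\<And>n. sub (B n)" shows "sub (partial_sum L B g a t n)"
  by (induction t) (use assms in \<open>auto intro!: sub_plus sub_scale\<close>)

lemma partial_sum_mono:
  assumes "sub L" "a \<in> carrier R" "\<And>n. sub (B n)" and "t \<le> t'"
  shows "partial_sum L B g a t n \<subseteq> partial_sum L B g a t' n"
  using assms(4)
proof (induction t' rule: dec_induct)
  case (step t')
  have "partial_sum L B g a t' n \<subseteq> partial_sum L B g a (Suc t') n"
    using assms(1-3) by (simp add: plus_upper1 sub_partial_sum sub_scale)
  with step show ?case by blast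
qed simp

lemma scale_mono: "U \<subseteq> V \<Longrightarrow> a \<^bold>* U \<subseteq> a \<^bold>* V"
  by (rule image_mono)

lemma scale_comm:
  "a \<in> carrier R \<Longrightarrow> b \<in> carrier R \<Longrightarrow> sub U \<Longrightarrow> a \<^bold>* b \<^bold>* U = b \<^bold>* a \<^bold>* U"
  by (simp add: scale_scale R.m_comm)

lemma scale_pow_Suc:
  "a \<in> carrier R \<Longrightarrow> sub U \<Longrightarrow> a \<^bold>* (a [^] (t::nat)) \<^bold>* U = (a [^] Suc t) \<^bold>* U"
  by (simp add: scale_scale R.m_comm)

lemma scale_plus_le:
  assumes "a \<in> carrier R" "sub U" "sub V" "a \<^bold>* U \<subseteq> U'" "a \<^bold>* V \<subseteq> V'"
  shows "a \<^bold>* (U \<^bold>+ V) \<subseteq> U' \<^bold>+ V'"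
  unfolding scale_plus[OF assms(1-3)] by (rule plus_mono[OF assms(4,5)])

lemma partial_sum_head:
  assumes L: "sub L" and a: "a \<in> carrier R" and B: "\<And>n. sub (B n)" "\<And>n. L \<subseteq> B n"
  shows "a \<^bold>* partial_sum L B g a t n \<subseteq> partial_sum L B g a (Suc t) (n(g := Suc (n g)))"
proof (induction t)
  case 0
  have "a \<^bold>* L \<subseteq> L" using a L by (rule scale_subset)
  also have "\<dots> \<subseteq> partial_sum L B g a (Suc 0) (n(g := Suc (n g)))"
    unfolding partial_sum.simps using L a B by (intro plus_upper1 sub_scale R.nat_pow_closed)
  finally show ?case unfolding partial_sum.simps(1) .
next
  case (Suc t)
  have eq: "(n(g := Suc (n g)))(g := Suc (n g) - Suc t) = n(g := n g - t)" by simp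
  have "a \<^bold>* (partial_sum L B g a t n \<^bold>+ (a [^] t) \<^bold>* B (n(g := n g - t)))
    \<subseteq> partial_sum L B g a (Suc t) (n(g := Suc (n g))) \<^bold>+ (a [^] Suc t) \<^bold>* B (n(g := n g - t))"
    using L a B(1) by (intro scale_plus_le sub_partial_sum sub_scale R.nat_pow_closed Suc) (simp_all only: scale_pow_Suc order_refl)
  then show ?case
    unfolding partial_sum.simps(2)[of _ _ _ _ "Suc t"] partial_sum.simps(2)[of _ _ _ _ t n] fun_upd_same eq .
qed

lemma partial_sum_tail:
  assumes L: "sub L" and a: "a \<in> carrier R" and b: "b \<in> carrier R"
    and B: "\<And>n. sub (B n)" "\<And>n. L \<subseteq> B n" and bB: "\<And>n. b \<^bold>* B n \<subseteq> B (n(h := Suc (n h)))"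
    and t: "t \<le> Suc (n g)"
  shows "b \<^bold>* partial_sum L B g a t n \<subseteq> partial_sum L B g a t (n(h := Suc (n h)))"
  using t
proof (induction t)
  case 0
  show ?case using scale_subset[OF b L] by simp
next
  case (Suc t)
  let ?n = "n(h := Suc (n h))"
  have eq: "(n(g := n g - t))(h := Suc ((n(g := n g - t)) h)) = ?n(g := ?n g - t)"
    using Suc.prems by (auto simp: fun_eq_iff Suc_diff_le)
  have "b \<^bold>* (a [^] t) \<^bold>* B (n(g := n g - t)) = (a [^] t) \<^bold>* b \<^bold>* B (n(g := n g - t))"
    using a b B by (intro scale_comm) auto
  also have "\<dots> \<subseteq> (a [^] t) \<^bold>* B (?n(g := ?n g - t))"
    using bB[of "n(g := n g - t)"] unfolding eq by (rule scale_mono)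
  finally have "b \<^bold>* (a [^] t) \<^bold>* B (n(g := n g - t)) \<subseteq> (a [^] t) \<^bold>* B (?n(g := ?n g - t))" .
  then show ?case
    unfolding partial_sum.simps using L a b B Suc.IH Suc.prems
    by (intro scale_plus_le sub_partial_sum sub_scale R.nat_pow_closed) (simp_all only: Suc_leD)
qed

lemma stable_generated:
  assumes L: "sub L" and H: "sub H" "L \<subseteq> H" and gs: "\<forall>(g, a)\<in>set gs. a \<in> carrier R"
  shows "stable_family L gs (generated L H gs)"
  using gs
proof (induction gs)
  case Nil
  then show ?case using L H by (auto simp: stable_family_def)
next
  case (Cons ga gs)
  obtain g a where ga: "ga = (g, a)" by (cases ga)
  let ?B = "generated L H gs"
  have a: "a \<in> carrier R" and gs: "\<forall>(g, a)\<in>set gs. a \<in> carrier R" using Cons.prems ga by auto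
  then have IH: "stable_family L gs ?B" using Cons.IH by blast
  then have B: "\<And>n. sub (?B n)" "\<And>n. L \<subseteq> ?B n" by (auto simp: stable_family_def)
  show ?case unfolding ga stable_family_def
  proof (intro conjI allI ballI)
    fix n
    show "sub (generated L H ((g, a) # gs) n)" by (simp add: sub_plus sub_partial_sum sub_scale L a B)
    have "partial_sum L ?B g a 0 n \<subseteq> partial_sum L ?B g a (Suc (n g)) n"
      by (rule partial_sum_mono[OF L a B(1)]) simp
    then show "L \<subseteq> generated L H ((g, a) # gs) n" by simp
  next
    fix hb assume hb: "hb \<in> set ((g, a) # gs)"
    obtain h b where hb': "hb = (h, b)" by (cases hb)
    have "b \<^bold>* generated L H ((g, a) # gs) n \<subseteq> generated L H ((g, a) # gs) (n(h := Suc (n h)))" for n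
    proof (cases "hb = (g, a)")
      case True
      then have *: "h = g" "b = a" using hb' by auto
      show ?thesis unfolding * generated.simps
        unfolding fun_upd_same by (rule partial_sum_head[OF L a B])
    next
      case False
      then have "hb \<in> set gs" using hb by simp
      then have b: "b \<in> carrier R" and bB: "\<And>n. b \<^bold>* ?B n \<subseteq> ?B (n(h := Suc (n h)))"
        using gs IH unfolding hb' stable_family_def by blast+
      let ?n = "n(h := Suc (n h))"
      have "b \<^bold>* partial_sum L ?B g a (Suc (n g)) n \<subseteq> partial_sum L ?B g a (Suc (n g)) ?n"
        by (rule partial_sum_tail[OF L a b B]) (rule bB, simp)
      also have "\<dots> \<subseteq> partial_sum L ?B g a (Suc (?n g)) ?n"
        by (rule partial_sum_mono[OF L a B(1)]) simp
      finally show ?thesis unfolding generated.simps .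
    qed
    then show "case hb of (g', a') \<Rightarrow> \<forall>n. a' \<^bold>* generated L H ((g, a) # gs) n
        \<subseteq> generated L H ((g, a) # gs) (n(g' := Suc (n g')))"
      unfolding hb' by simp
  qed
qed

text \<open>
  Multiplying a polynomial in \<open>a\<close> by another generator multiplies its leading coefficient,
  so the leading coefficients form a stable family over the remaining generators.
\<close>

lemma stable_leading:
  assumes L: "sub L" and a: "a \<in> carrier R" and gs: "\<forall>(g, a)\<in>set gs. a \<in> carrier R"
    and B: "stable_family L gs B" and V: "stable_family L ((g, a) # gs) V"
  shows "stable_family L gs (leading L B g a V t)"
proof -
  have B': "\<And>n. sub (B n)" "\<And>n. L \<subseteq> B n" and V': "\<And>n. sub (V n)" "\<And>n. L \<subseteq> V n"
    using B V by (auto simp: stable_family_def)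
  have at: "a [^] t \<in> carrier R" using a by simp
  note F = sub_partial_sum[OF L a B'(1)]
  have "sub (leading L B g a V t n)" for n
    unfolding leading_def using V' B' F at by (intro sub_int sub_colon sub_plus)
  moreover have "L \<subseteq> leading L B g a V t n" for n
  proof -
    have "L \<subseteq> L \<^bold>: (a [^] t)" using at L by (rule subset_colon)
    also have "L \<^bold>: (a [^] t) \<subseteq> (V (n(g := n g + t)) \<^bold>+ partial_sum L B g a t (n(g := n g + t))) \<^bold>: (a [^] t)"
      by (rule colon_mono[OF order_trans[OF V'(2) plus_upper1[OF V'(1) F]]])
    finally show ?thesis unfolding leading_def using B'(2) by blast
  qed
  moreover have "b \<^bold>* leading L B g a V t n \<subseteq> leading L B g a V t (n(h := Suc (n h)))" if hb: "(h, b) \<in> set gs" for h b n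
  proof -
    have b: "b \<in> carrier R" and bB: "\<And>n. b \<^bold>* B n \<subseteq> B (n(h := Suc (n h)))"
      and bV: "\<And>n. b \<^bold>* V n \<subseteq> V (n(h := Suc (n h)))"
      using hb gs stable_familyD(3)[OF B hb] stable_familyD(3)[OF V, of h b] by auto
    let ?n = "n(g := n g + t)" let ?n' = "n(h := Suc (n h))"
    have eq: "?n(h := Suc (?n h)) = ?n'(g := ?n' g + t)" by (auto simp: fun_eq_iff)
    have step: "b \<^bold>* (V ?n \<^bold>+ partial_sum L B g a t ?n) \<subseteq> V (?n'(g := ?n' g + t)) \<^bold>+ partial_sum L B g a t (?n'(g := ?n' g + t))"
      unfolding eq[symmetric]
      by (rule scale_plus_le[OF b V'(1) F bV], rule partial_sum_tail[OF L a b B']) (rule bB, simp)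
    show ?thesis
    proof
      fix x assume "x \<in> b \<^bold>* leading L B g a V t n"
      then obtain m where m: "m \<in> leading L B g a V t n" and x: "x = b \<odot>\<^bsub>M\<^esub> m" by blast
      have mc: "m \<in> carrier M" "m \<in> B n" "(a [^] t) \<odot>\<^bsub>M\<^esub> m \<in> V ?n \<^bold>+ partial_sum L B g a t ?n"
        using m unfolding leading_def colon_elem_def by auto
      have "(a [^] t) \<odot>\<^bsub>M\<^esub> x = b \<odot>\<^bsub>M\<^esub> ((a [^] t) \<odot>\<^bsub>M\<^esub> m)"
        unfolding x using at b mc(1) by (simp add: smult_assoc1[symmetric] R.m_comm)
      then have "(a [^] t) \<odot>\<^bsub>M\<^esub> x \<in> V (?n'(g := ?n' g + t)) \<^bold>+ partial_sum L B g a t (?n'(g := ?n' g + t))"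
        using step mc(3) by blast
      moreover have "x \<in> B ?n'" using bB mc(2) x by blast
      moreover have "x \<in> carrier M" using x b mc(1) by simp
      ultimately show "x \<in> leading L B g a V t ?n'"
        unfolding leading_def colon_elem_def by blast
    qed
  qed
  ultimately show ?thesis unfolding stable_family_def by blast
qed

lemma leading_le: "leading L B g a V t n \<subseteq> B n"
  unfolding leading_def by blast

lemma leading_mono: "(\<And>n. U n \<subseteq> V n) \<Longrightarrow> leading L B g a U t n \<subseteq> leading L B g a V t n"
  unfolding leading_def by (intro Int_mono colon_mono plus_mono order_refl)

text \<open>
  Multiply by \<open>a\<close>: the coefficient of \<open>a^t\<close> becomes that of \<open>a^{t+1}\<close>.
\<close>

lemma leading_Suc:
  assumes L: "sub L" and a: "a \<in> carrier R" and B: "\<And>n. sub (B n)" "\<And>n. L \<subseteq> B n"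
    and V: "\<And>n. sub (V n)" "\<And>n. a \<^bold>* V n \<subseteq> V (n(g := Suc (n g)))"
  shows "leading L B g a V t n \<subseteq> leading L B g a V (Suc t) n"
proof
  fix m assume "m \<in> leading L B g a V t n"
  let ?n = "n(g := n g + t)"
  have mc: "m \<in> carrier M" "m \<in> B n" "(a [^] t) \<odot>\<^bsub>M\<^esub> m \<in> V ?n \<^bold>+ partial_sum L B g a t ?n"
    using \<open>m \<in> _\<close> unfolding leading_def colon_elem_def by auto
  have eq: "?n(g := Suc (?n g)) = n(g := n g + Suc t)" by (auto simp: fun_eq_iff)
  have "a \<^bold>* (V ?n \<^bold>+ partial_sum L B g a t ?n) \<subseteq> V (n(g := n g + Suc t)) \<^bold>+ partial_sum L B g a (Suc t) (n(g := n g + Suc t))"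
    unfolding eq[symmetric]
    by (rule scale_plus_le[OF a V(1) sub_partial_sum[OF L a B(1)] V(2) partial_sum_head[OF L a B]])
  moreover have "(a [^] Suc t) \<odot>\<^bsub>M\<^esub> m = a \<odot>\<^bsub>M\<^esub> ((a [^] t) \<odot>\<^bsub>M\<^esub> m)"
    using a mc(1) by (simp add: smult_assoc1[symmetric] R.m_comm)
  ultimately have "(a [^] Suc t) \<odot>\<^bsub>M\<^esub> m \<in> V (n(g := n g + Suc t)) \<^bold>+ partial_sum L B g a (Suc t) (n(g := n g + Suc t))"
    using mc(3) by blast
  then show "m \<in> leading L B g a V (Suc t) n"
    using mc unfolding leading_def colon_elem_def by blast
qed

text \<open>
  Filter \<open>V n / U n\<close> by the degree in \<open>a\<close>. The \<open>t\<close>-th subquotient is the image under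
  multiplication by \<open>a^t\<close> of the quotient of leading coefficients.
\<close>

lemma len_leading:
  assumes L: "sub L" and a: "a \<in> carrier R" and B: "\<And>n. sub (B n)" "\<And>n. L \<subseteq> B n"
    and U: "\<And>n. sub (U n)" "\<And>n. L \<subseteq> U n" and V: "\<And>n. sub (V n)" and UV: "\<And>n. U n \<subseteq> V n"
    and VB: "V n \<subseteq> partial_sum L B g a (Suc (n g)) n"
  shows "len (U n) (V n) = (\<Sum>t\<le>n g. len (leading L B g a U t (n(g := n g - t))) (leading L B g a V t (n(g := n g - t))))"
proof -
  let ?F = "\<lambda>t. partial_sum L B g a t n"
  let ?l = "\<lambda>t. len (leading L B g a U t (n(g := n g - t))) (leading L B g a V t (n(g := n g - t)))"
  have F: "sub (?F t)" for t by (rule sub_partial_sum[OF L a B(1)])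
  have step: "len (U n \<inter> ?F (Suc t)) (V n \<inter> ?F (Suc t)) = len (U n \<inter> ?F t) (V n \<inter> ?F t) + ?l t"
    if t: "t \<le> n g" for t
  proof -
    let ?B = "B (n(g := n g - t))" let ?y = "a [^] t"
    have y: "?y \<in> carrier R" using a by simp
    have FS: "?F t \<subseteq> ?F (Suc t)" by (rule partial_sum_mono[OF L a B(1)]) simp
    have lead: "leading L B g a W t (n(g := n g - t)) = ((W n \<^bold>+ ?F t) \<^bold>: ?y) \<inter> ?B" for W
      using t unfolding leading_def by simp
    \<comment> \<open>the part of \<open>W\<close> of degree at most \<open>t\<close> in \<open>a\<close>, modulo lower degree, is \<open>a^t\<close> times
      its leading coefficients\<close>
    have plus: "W \<inter> ?F (Suc t) \<^bold>+ ?F t = ?F t \<^bold>+ ?y \<^bold>* (((W \<^bold>+ ?F t) \<^bold>: ?y) \<inter> ?B)" if W: "sub W" for W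
    proof (rule equalityI)
      have WF: "sub (W \<^bold>+ ?F t)" using W F by (rule sub_plus)
      have X: "sub (((W \<^bold>+ ?F t) \<^bold>: ?y) \<inter> ?B)" using y WF B by (intro sub_int sub_colon)
      note up = plus_upper1[OF F[of t] sub_scale[OF y X]] plus_upper2[OF F[of t] sub_scale[OF y X]]
      have "W \<inter> ?F (Suc t) \<subseteq> ?F t \<^bold>+ ?y \<^bold>* (((W \<^bold>+ ?F t) \<^bold>: ?y) \<inter> ?B)"
      proof
        fix x assume x: "x \<in> W \<inter> ?F (Suc t)"
        then obtain f m where fm: "f \<in> ?F t" "m \<in> ?B" "x = f \<oplus>\<^bsub>M\<^esub> ?y \<odot>\<^bsub>M\<^esub> m"
          by (auto elim!: plusE)
        have mc: "m \<in> carrier M" using fm(2) B(1) sub_carrier by blast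
        have "?y \<odot>\<^bsub>M\<^esub> m \<in> W \<^bold>+ ?F t"
        proof (rule sub_diffD2[OF WF])
          show "?y \<odot>\<^bsub>M\<^esub> m \<in> carrier M" using y mc by simp
          show "f \<in> W \<^bold>+ ?F t" using fm(1) plus_upper2[OF W F[of t]] by blast
          show "f \<oplus>\<^bsub>M\<^esub> ?y \<odot>\<^bsub>M\<^esub> m \<in> W \<^bold>+ ?F t" using x fm(3) plus_upper1[OF W F[of t]] by blast
        qed
        then show "x \<in> ?F t \<^bold>+ ?y \<^bold>* (((W \<^bold>+ ?F t) \<^bold>: ?y) \<inter> ?B)"
          unfolding fm(3) using fm mc by (intro plusI imageI) (auto simp: colon_iff)
      qed
      then show "W \<inter> ?F (Suc t) \<^bold>+ ?F t \<subseteq> ?F t \<^bold>+ ?y \<^bold>* (((W \<^bold>+ ?F t) \<^bold>: ?y) \<inter> ?B)"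
        using F X y up by (intro plus_least sub_plus sub_scale)
      have "?y \<^bold>* (((W \<^bold>+ ?F t) \<^bold>: ?y) \<inter> ?B) \<subseteq> (W \<^bold>+ ?F t) \<inter> ?F (Suc t)"
      proof -
        have "?y \<^bold>* ?B \<subseteq> ?F (Suc t)"
          using plus_upper2[OF F[of t] sub_scale[OF y B(1)]] by simp
        then show ?thesis unfolding colon_elem_def by blast
      qed
      also have "\<dots> = ?F t \<^bold>+ (W \<inter> ?F (Suc t))"
        unfolding plus_comm[OF W F] by (rule modular[OF F W F FS])
      also have "\<dots> = W \<inter> ?F (Suc t) \<^bold>+ ?F t" using W F by (intro plus_comm sub_int)
      finally show "?F t \<^bold>+ ?y \<^bold>* (((W \<^bold>+ ?F t) \<^bold>: ?y) \<inter> ?B) \<subseteq> W \<inter> ?F (Suc t) \<^bold>+ ?F t"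
        using W F by (intro plus_least sub_plus sub_int plus_upper2)
    qed
    have "len (U n \<inter> ?F (Suc t)) (V n \<inter> ?F (Suc t)) =
      len (U n \<inter> ?F (Suc t) \<inter> ?F t) (V n \<inter> ?F (Suc t) \<inter> ?F t) +
      len (U n \<inter> ?F (Suc t) \<^bold>+ ?F t) (V n \<inter> ?F (Suc t) \<^bold>+ ?F t)"
      by (rule len_int_plus[OF sub_int[OF U(1) F] sub_int[OF V F] F Int_mono[OF UV order_refl]])
    moreover have "W \<inter> ?F (Suc t) \<inter> ?F t = W \<inter> ?F t" for W using FS by blast
    moreover have "len (U n \<inter> ?F (Suc t) \<^bold>+ ?F t) (V n \<inter> ?F (Suc t) \<^bold>+ ?F t) = ?l t"
      unfolding plus[OF U(1)] plus[OF V] lead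
    proof (rule len_scale[OF y F])
      show "sub (((U n \<^bold>+ ?F t) \<^bold>: ?y) \<inter> ?B)" "sub (((V n \<^bold>+ ?F t) \<^bold>: ?y) \<inter> ?B)"
        using U V F y B by (intro sub_int sub_colon sub_plus; simp)+
      show "((U n \<^bold>+ ?F t) \<^bold>: ?y) \<inter> ?B \<subseteq> ((V n \<^bold>+ ?F t) \<^bold>: ?y) \<inter> ?B"
        using UV by (intro Int_mono colon_mono plus_mono order_refl)
      have "?F t \<^bold>: ?y \<subseteq> (U n \<^bold>+ ?F t) \<^bold>: ?y"
        by (rule colon_mono[OF plus_upper2[OF U(1) F]])
      then show "(?F t \<^bold>: ?y) \<inter> (((V n \<^bold>+ ?F t) \<^bold>: ?y) \<inter> ?B) \<subseteq> ((U n \<^bold>+ ?F t) \<^bold>: ?y) \<inter> ?B" by blast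
    qed
    ultimately show ?thesis by simp
  qed
  have "len (U n \<inter> ?F t) (V n \<inter> ?F t) = (\<Sum>s<t. ?l s)" if "t \<le> Suc (n g)" for t
    using that
  proof (induction t)
    case 0
    have "U n \<inter> L = L" "V n \<inter> L = L" using U UV by blast+
    then show ?case using L by (simp add: len_same)
  next
    case (Suc t)
    then have t: "t \<le> n g" "t \<le> Suc (n g)" by simp_all
    show ?case unfolding step[OF t(1)] Suc.IH[OF t(2)] sum.lessThan_Suc by (rule refl)
  qed
  from this[of "Suc (n g)"] have "len (U n \<inter> ?F (Suc (n g))) (V n \<inter> ?F (Suc (n g))) = (\<Sum>t\<le>n g. ?l t)"
    by (simp only: lessThan_Suc_atMost order_refl)
  moreover have "U n \<inter> ?F (Suc (n g)) = U n" "V n \<inter> ?F (Suc (n g)) = V n" using UV VB by blast+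
  ultimately show ?thesis by simp
qed

lemma len_zeroD: "sub U \<Longrightarrow> sub V \<Longrightarrow> U \<subseteq> V \<Longrightarrow> len U V = 0 \<Longrightarrow> U = V"
  using len_strict[of U V] by fastforce

end

lemma chain_mono:
  fixes f :: "nat \<Rightarrow> 'x set"
  shows "(\<And>i. f i \<subseteq> f (Suc i)) \<Longrightarrow> i \<le> j \<Longrightarrow> f i \<subseteq> f j"
  by (rule lift_Suc_mono_le)

context noetherian_module
begin

text \<open>
  The argument of Hilbert's basis theorem, by induction on the generators: the families of
  leading coefficients \<open>X s t\<close> increase in \<open>s\<close> and in \<open>t\<close>. The diagonal stabilises at some
  \<open>c\<close>, which settles all \<open>t \<ge> c\<close>; the finitely many remaining \<open>t\<close> are treated one by one.
  Families with the same leading coefficients are equal because the length between them is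
  zero. The bound \<open>c\<close> is uniform in the degree \<open>n\<close>.
\<close>

theorem stable_families_noetherian:
  assumes L: "sub L" and H: "sub H" "L \<subseteq> H" and gs: "\<forall>(g, a)\<in>set gs. a \<in> carrier R"
    and W: "\<And>s. stable_family L gs (W s)" "\<And>s n. W s n \<subseteq> generated L H gs n"
      "\<And>s n. W s n \<subseteq> W (Suc s) n"
  shows "\<exists>c. \<forall>s\<ge>c. \<forall>n. W s n = W c n"
  using gs W
proof (induction gs arbitrary: W)
  case Nil
  have sub: "sub (W s n)" "L \<subseteq> W s n" for s n using Nil.prems(2)[of s] by (auto simp: stable_family_def)
  obtain c where c: "\<forall>s\<ge>c. W s (\<lambda>_. 0) = W c (\<lambda>_. 0)"
    using ascending_chain[of "\<lambda>s. W s (\<lambda>_. 0)"] sub Nil.prems(4) by blast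
  have "W s n = W c n" if "s \<ge> c" for s n
  proof (cases "n = (\<lambda>_. 0)")
    case False
    then have "generated L H [] n = L" by (auto simp: fun_eq_iff)
    then have "W s n = L" for s
      using Nil.prems(3)[of s n] sub(2)[of s n] by (metis subset_antisym)
    then show ?thesis by metis
  next
    case True
    show ?thesis unfolding True using c[rule_format, OF that] .
  qed
  then show ?case by (intro exI[of _ c] allI impI)
next
  case (Cons ga gs)
  obtain g a where ga: "ga = (g, a)" by (cases ga)
  have a: "a \<in> carrier R" and gs: "\<forall>(g, a)\<in>set gs. a \<in> carrier R" using Cons.prems ga by auto
  let ?B = "generated L H gs"
  have Bst: "stable_family L gs ?B" by (rule stable_generated[OF L H gs])
  then have B: "\<And>n. sub (?B n)" "\<And>n. L \<subseteq> ?B n" by (auto simp: stable_family_def)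
  have Wst: "\<And>s. stable_family L ((g, a) # gs) (W s)" using Cons.prems(2) ga by simp
  have W: "\<And>s n. sub (W s n)" "\<And>s n. L \<subseteq> W s n" "\<And>s n. a \<^bold>* W s n \<subseteq> W s (n(g := Suc (n g)))"
    using Wst by (auto simp: stable_family_def)
  define X where "X = (\<lambda>s t. leading L ?B g a (W s) t)"
  have Xst: "stable_family L gs (X s t)" for s t
    unfolding X_def by (rule stable_leading[OF L a gs Bst Wst])
  have XB: "X s t n \<subseteq> ?B n" for s t n unfolding X_def by (rule leading_le)
  have Xs: "X s t n \<subseteq> X (Suc s) t n" for s t n
    unfolding X_def by (rule leading_mono) (rule Cons.prems(4))
  have Xt: "X s t n \<subseteq> X s (Suc t) n" for s t n
    unfolding X_def by (rule leading_Suc[OF L a B W(1)]) (rule W(3))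
  have Xmono: "X s t n \<subseteq> X s' t' n" if "s \<le> s'" "t \<le> t'" for s s' t t' n
  proof -
    have "X s t n \<subseteq> X s' t n" by (rule chain_mono[of "\<lambda>s. X s t n", OF Xs that(1)])
    also have "\<dots> \<subseteq> X s' t' n" by (rule chain_mono[of "\<lambda>t. X s' t n", OF Xt that(2)])
    finally show ?thesis .
  qed
  have "\<exists>c. \<forall>s\<ge>c. \<forall>n. X s s n = X c c n"
    by (rule Cons.IH[OF gs Xst XB]) (rule Xmono; simp)
  then obtain c where c: "\<And>s n. s \<ge> c \<Longrightarrow> X s s n = X c c n" by blast
  \<comment> \<open>the square with corners \<open>(c, c)\<close> and \<open>(max s t, max s t)\<close> squeezes \<open>X s t\<close>\<close>
  have big: "X s t n = X c c n" if "s \<ge> c" "t \<ge> c" for s t n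
    using Xmono[of c s c t n] Xmono[of s "max s t" t "max s t" n] c[of "max s t" n] that by auto
  have "\<exists>ct. \<forall>s\<ge>ct. \<forall>n. X s t n = X ct t n" for t
    by (rule Cons.IH[OF gs]) (rule Xst, rule XB, rule Xs)
  then have "\<forall>t. \<exists>ct. \<forall>s\<ge>ct. \<forall>n. X s t n = X ct t n" by (rule allI)
  then obtain ct where ct0: "\<forall>t. \<forall>s\<ge>ct t. \<forall>n. X s t n = X (ct t) t n" by (rule choice[THEN exE])
  then have ct: "\<And>t s n. s \<ge> ct t \<Longrightarrow> X s t n = X (ct t) t n" by blast
  \<comment> \<open>beyond \<open>C\<close> every \<open>t\<close> is settled, either by the diagonal or by its own bound\<close>
  define C where "C = Max (insert c (ct ` {..c}))"
  have C: "c \<le> C" "\<And>t. t \<le> c \<Longrightarrow> ct t \<le> C" unfolding C_def by (rule Max_ge; simp)+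
  have XC: "X s t n = X C t n" if s: "s \<ge> C" for s t n
  proof (cases "t \<le> c")
    case True
    then have "ct t \<le> C" "ct t \<le> s" using C s by (auto intro: order_trans)
    then show ?thesis using ct by metis
  next
    case False
    then show ?thesis using big[of s t n] big[of C t n] C s by simp
  qed
  have "W s n = W C n" if s: "s \<ge> C" for s n
  proof -
    have le: "W C n \<subseteq> W s n" for n by (rule chain_mono[of "\<lambda>s. W s n", OF Cons.prems(4) s])
    have "W s n \<subseteq> partial_sum L ?B g a (Suc (n g)) n" using Cons.prems(3)[of s n] ga by simp
    then have "len (W C n) (W s n) = (\<Sum>t\<le>n g. len (X C t (n(g := n g - t))) (X s t (n(g := n g - t))))"
      unfolding X_def by (intro len_leading[where U = "W C" and V = "W s"] L a B W(1,2) le)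
    also have "\<dots> = (\<Sum>t\<le>n g. 0)"
    proof (rule sum.cong[OF refl])
      fix t
      have "sub (X C t (n(g := n g - t)))" using Xst by (auto simp: stable_family_def)
      then show "len (X C t (n(g := n g - t))) (X s t (n(g := n g - t))) = 0"
        unfolding XC[OF s, of t] by (rule len_same)
    qed
    finally have "len (W C n) (W s n) = 0" by simp
    from len_zeroD[OF W(1) W(1) le this] show ?thesis by (rule sym)
  qed
  then show ?case by (intro exI[of _ C] allI impI)
qed

text \<open>
  Induction on the generators. By \<open>len_leading\<close> the length is a convolution of the Hilbert
  functions of the leading coefficient families, which become independent of \<open>t\<close> by
  \<open>stable_families_noetherian\<close>, so \<open>hilbert_fun_convolve\<close> applies. Without generators the
  families are \<open>L\<close> outside degree 0.
\<close>

theorem stable_families_hilbert: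
  assumes L: "sub L" and H: "sub H" "L \<subseteq> H" and gs: "\<forall>(g, a)\<in>set gs. a \<in> carrier R \<and> g \<le> d"
    and U: "stable_family L gs U" and V: "stable_family L gs V" and UV: "\<And>n. U n \<subseteq> V n"
    and VB: "\<And>n. V n \<subseteq> generated L H gs n"
    and fin: "\<And>n. multi_index d n \<Longrightarrow> len (U n) (V n) \<noteq> \<infinity>"
  shows "\<exists>p. hilbert_fun d p \<and> (\<forall>n. multi_index d n \<longrightarrow> len (U n) (V n) = enat (p n))"
  using gs U V UV VB fin
proof (induction gs arbitrary: U V)
  case Nil
  have sub: "sub (U n)" "L \<subseteq> U n" "sub (V n)" "L \<subseteq> V n" for n
    using Nil.prems(2,3) by (auto simp: stable_family_def)
  obtain l where l: "len (U (\<lambda>_. 0)) (V (\<lambda>_. 0)) = enat l"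
    using Nil.prems(6)[of "\<lambda>_. 0"] by (auto simp: multi_index_def)
  have "len (U n) (V n) = enat (if \<forall>i\<le>d. n i = 0 then l else 0)" if n: "multi_index d n" for n
  proof (cases "\<forall>i\<le>d. n i = 0")
    case True
    then have "n i = 0" for i using n by (cases "i \<le> d") (auto simp: multi_index_def)
    then have "n = (\<lambda>_. 0)" by (rule ext)
    then show ?thesis using l True by simp
  next
    case False
    then have "generated L H [] n = L" by auto
    then have "U n = L" "V n = L"
      using Nil.prems(5)[of n] Nil.prems(4)[of n] sub(2,4)[of n] by (metis subset_antisym order_trans)+
    then show ?thesis using False L by (auto simp: len_same zero_enat_def)
  qed
  then show ?case using hilbert_fun_delta by blast
next
  case (Cons ga gs)
  obtain g a where ga: "ga = (g, a)" by (cases ga)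
  have a: "a \<in> carrier R" and g: "g \<le> d" and gs: "\<forall>(g, a)\<in>set gs. a \<in> carrier R \<and> g \<le> d"
    using Cons.prems(1) ga by auto
  have gs': "\<forall>(g, a)\<in>set gs. a \<in> carrier R" using gs by auto
  let ?B = "generated L H gs"
  have Bst: "stable_family L gs ?B" by (rule stable_generated[OF L H gs'])
  then have B: "\<And>n. sub (?B n)" "\<And>n. L \<subseteq> ?B n" by (auto simp: stable_family_def)
  have st: "stable_family L ((g, a) # gs) U" "stable_family L ((g, a) # gs) V" using Cons.prems(2,3) ga by auto
  then have U: "\<And>n. sub (U n)" "\<And>n. L \<subseteq> U n" "\<And>n. a \<^bold>* U n \<subseteq> U (n(g := Suc (n g)))"
    and V: "\<And>n. sub (V n)" "\<And>n. L \<subseteq> V n" "\<And>n. a \<^bold>* V n \<subseteq> V (n(g := Suc (n g)))"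
    by (auto simp: stable_family_def)
  define X where "X = leading L ?B g a U" define Y where "Y = leading L ?B g a V"
  have XY: "stable_family L gs (X t)" "stable_family L gs (Y t)" for t
    unfolding X_def Y_def by (rule stable_leading[OF L a gs' Bst st(1)] stable_leading[OF L a gs' Bst st(2)])+
  have XYB: "X t n \<subseteq> ?B n" "Y t n \<subseteq> ?B n" for t n unfolding X_def Y_def by (rule leading_le)+
  have XYt: "X t n \<subseteq> X (Suc t) n" "Y t n \<subseteq> Y (Suc t) n" for t n
    unfolding X_def Y_def by (rule leading_Suc[OF L a B U(1)], rule U(3)) (rule leading_Suc[OF L a B V(1)], rule V(3))
  have XleY: "X t n \<subseteq> Y t n" for t n
    unfolding X_def Y_def by (rule leading_mono) (rule Cons.prems(4))
  have "\<exists>c. \<forall>s\<ge>c. \<forall>n. X s n = X c n"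
    by (rule stable_families_noetherian[OF L H gs']) (rule XY(1), rule XYB(1), rule XYt(1))
  moreover have "\<exists>c. \<forall>s\<ge>c. \<forall>n. Y s n = Y c n"
    by (rule stable_families_noetherian[OF L H gs']) (rule XY(2), rule XYB(2), rule XYt(2))
  ultimately obtain c1 c2 where c1: "\<And>t n. t \<ge> c1 \<Longrightarrow> X t n = X c1 n" and c2: "\<And>t n. t \<ge> c2 \<Longrightarrow> Y t n = Y c2 n"
    by blast
  define c where "c = max c1 c2"
  have c: "X t n = X c n" "Y t n = Y c n" if "t \<ge> c" for t n
    using that c1[of t n] c1[of c n] c2[of t n] c2[of c n] by (auto simp: c_def)
  have sum: "len (U n) (V n) = (\<Sum>t\<le>n g. len (X t (n(g := n g - t))) (Y t (n(g := n g - t))))" for n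
  proof -
    have "V n \<subseteq> partial_sum L ?B g a (Suc (n g)) n" using Cons.prems(5)[of n] ga by simp
    then show ?thesis unfolding X_def Y_def
      by (intro len_leading[where U = U and V = V] L a B U(1,2) V(1) Cons.prems(4))
  qed
  have fin: "len (X t n) (Y t n) \<noteq> \<infinity>" if n: "multi_index d n" for t n
  proof
    assume inf: "len (X t n) (Y t n) = \<infinity>"
    let ?n = "n(g := n g + t)"
    have "?n(g := ?n g - t) = n" by simp
    then have "len (X t n) (Y t n) \<le> (\<Sum>t\<le>?n g. len (X t (?n(g := ?n g - t))) (Y t (?n(g := ?n g - t))))"
      using member_le_sum[of t "{..?n g}" "\<lambda>t. len (X t (?n(g := ?n g - t))) (Y t (?n(g := ?n g - t)))"] by simp
    then have "len (U ?n) (V ?n) = \<infinity>" unfolding sum inf by simp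
    moreover have "multi_index d ?n" using n g by (simp add: multi_index_def)
    ultimately show False using Cons.prems(6) by blast
  qed
  have "\<exists>p. hilbert_fun d p \<and> (\<forall>n. multi_index d n \<longrightarrow> len (X t n) (Y t n) = enat (p n))" for t
    by (rule Cons.IH[OF gs XY XleY XYB(2) fin])
  then obtain p where p: "\<And>t. hilbert_fun d (p t)"
    and pn: "\<And>t n. multi_index d n \<Longrightarrow> len (X t n) (Y t n) = enat (p t n)" by metis
  \<comment> \<open>the functions \<open>p t\<close> are only determined on multi-indices, so they are made literally
    constant beyond \<open>c\<close>\<close>
  define q where "q = (\<lambda>t. p (min t c))"
  have qn: "len (X t n) (Y t n) = enat (q t n)" if n: "multi_index d n" for t n
  proof (cases "t \<le> c")
    case False
    then have "len (X t n) (Y t n) = len (X c n) (Y c n)" using c[of t n] by simp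
    then show ?thesis using pn[OF n] False by (simp add: q_def min_def)
  qed (simp add: q_def min_def pn[OF n])
  have "hilbert_fun d (\<lambda>n. \<Sum>t\<le>n g. q t (n(g := n g - t)))"
    by (rule hilbert_fun_convolve[OF g, of _ c]) (auto simp: q_def p min_def)
  moreover have "len (U n) (V n) = enat (\<Sum>t\<le>n g. q t (n(g := n g - t)))" if n: "multi_index d n" for n
  proof -
    have "multi_index d (n(g := m))" for m using n g by (simp add: multi_index_def)
    then have "len (U n) (V n) = (\<Sum>t\<le>n g. enat (q t (n(g := n g - t))))"
      unfolding sum by (intro sum.cong refl qn)
    also have "\<dots> = enat (\<Sum>t\<le>n g. q t (n(g := n g - t)))"
      using of_nat_sum[where 'a = enat, of "\<lambda>t. q t (n(g := n g - t))" "{..n g}"] by (simp add: of_nat_eq_enat)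
    finally show ?thesis .
  qed
  ultimately show ?case by blast
qed

end

section \<open>Ideals acting on submodules\<close>

context module
begin

text \<open>
  The submodule \<open>A U\<close> for a submodule \<open>U\<close>, of which \<open>ideal_smult\<close> is the case where \<open>U\<close> is
  the whole module.
\<close>

definition ideal_act :: "'a set \<Rightarrow> 'c set \<Rightarrow> 'c set" where
  "ideal_act A U = submodule_span R M {a \<odot>\<^bsub>M\<^esub> m | a m. a \<in> A \<and> m \<in> U}"

text \<open>
  The ideal \<open>W : U\<close>. For \<open>W \<subseteq> U\<close> it is the annihilator of \<open>U/W\<close>.
\<close>

definition residual :: "'c set \<Rightarrow> 'c set \<Rightarrow> 'a set" where
  "residual W U = {a \<in> carrier R. a \<^bold>* U \<subseteq> W}"

lemma sub_Inter: "(\<And>U. U \<in> \<U> \<Longrightarrow> sub U) \<Longrightarrow> \<U> \<noteq> {} \<Longrightarrow> sub (\<Inter>\<U>)"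
proof (rule submoduleI)
  assume U: "\<And>U. U \<in> \<U> \<Longrightarrow> sub U" and ne: "\<U> \<noteq> {}"
  then obtain V where "V \<in> \<U>" "sub V" by blast
  then show "\<Inter>\<U> \<subseteq> carrier M" using submoduleE(1) by blast
qed (use sub_zero sub_minusD sub_addD sub_smultD in \<open>meson InterI InterD\<close>)+

lemma sub_span: "S \<subseteq> carrier M \<Longrightarrow> sub (submodule_span R M S)"
  unfolding submodule_span_def
  by (rule sub_Inter) (use carrier_is_submodule in blast)+

lemma span_superset: "S \<subseteq> submodule_span R M S"
  unfolding submodule_span_def by blast

lemma span_least: "sub W \<Longrightarrow> S \<subseteq> W \<Longrightarrow> submodule_span R M S \<subseteq> W"
  unfolding submodule_span_def by blast

lemma sub_ideal_act [intro]:
  assumes "A \<subseteq> carrier R" "sub U" shows "sub (ideal_act A U)"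
  unfolding ideal_act_def
  by (rule sub_span) (use assms submoduleE(1)[OF assms(2)] in blast)

lemma ideal_actI: "a \<in> A \<Longrightarrow> m \<in> U \<Longrightarrow> a \<odot>\<^bsub>M\<^esub> m \<in> ideal_act A U"
  unfolding ideal_act_def by (rule subsetD[OF span_superset]) blast

lemma ideal_act_least: "sub W \<Longrightarrow> (\<And>a. a \<in> A \<Longrightarrow> a \<^bold>* U \<subseteq> W) \<Longrightarrow> ideal_act A U \<subseteq> W"
  unfolding ideal_act_def by (rule span_least) blast+

lemma scale_le_ideal_act: "a \<in> A \<Longrightarrow> a \<^bold>* U \<subseteq> ideal_act A U"
  using ideal_actI by blast

lemma ideal_act_mono: "A \<subseteq> A' \<Longrightarrow> U \<subseteq> U' \<Longrightarrow> A' \<subseteq> carrier R \<Longrightarrow> sub U' \<Longrightarrow> ideal_act A U \<subseteq> ideal_act A' U'"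
  by (rule ideal_act_least[OF sub_ideal_act], assumption, assumption)
    (rule order_trans[OF image_mono scale_le_ideal_act], assumption, erule (1) subsetD)

lemma ideal_act_subset: "A \<subseteq> carrier R \<Longrightarrow> sub U \<Longrightarrow> ideal_act A U \<subseteq> U"
  by (rule ideal_act_least, assumption) (rule scale_subset, erule (1) subsetD)

lemma ideal_act_carrier: "sub U \<Longrightarrow> ideal_act (carrier R) U = U"
  using ideal_act_subset[of "carrier R" U] scale_le_ideal_act[of \<one> "carrier R" U] scale_one[of U]
  by (intro equalityI) (simp_all only: R.one_closed order_refl)

lemma residual_ideal:
  assumes "sub W" "sub U" shows "ideal (residual W U) R"
proof (rule idealI)
  show "ring R" by (rule R.ring_axioms)
  have Uc: "U \<subseteq> carrier M" using assms submoduleE(1) by blast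
  show "subgroup (residual W U) (add_monoid R)"
  proof (rule R.add.subgroupI)
    show "residual W U \<subseteq> carrier R" unfolding residual_def by blast
    have "\<zero> \<odot>\<^bsub>M\<^esub> u \<in> W" if "u \<in> U" for u using that Uc assms by (simp add: subset_iff)
    then show "residual W U \<noteq> {}" unfolding residual_def by blast
  next
    fix a assume "a \<in> residual W U"
    then have a: "a \<in> carrier R" "\<And>u. u \<in> U \<Longrightarrow> a \<odot>\<^bsub>M\<^esub> u \<in> W" unfolding residual_def by blast+
    have "(\<ominus> a) \<odot>\<^bsub>M\<^esub> u \<in> W" if "u \<in> U" for u
      using a that Uc sub_minusD[OF assms(1) a(2)[OF that]] by (simp add: smult_l_minus subset_iff)
    then show "\<ominus> a \<in> residual W U"
      using a(1) unfolding residual_def by blast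
  next
    fix a b assume "a \<in> residual W U" "b \<in> residual W U"
    then have a: "a \<in> carrier R" "\<And>u. u \<in> U \<Longrightarrow> a \<odot>\<^bsub>M\<^esub> u \<in> W"
      and b: "b \<in> carrier R" "\<And>u. u \<in> U \<Longrightarrow> b \<odot>\<^bsub>M\<^esub> u \<in> W" unfolding residual_def by blast+
    have "(a \<oplus> b) \<odot>\<^bsub>M\<^esub> u \<in> W" if "u \<in> U" for u
      using a b that Uc sub_addD[OF assms(1) a(2)[OF that] b(2)[OF that]] by (simp add: smult_l_distr subset_iff)
    then show "a \<oplus> b \<in> residual W U"
      using a(1) b(1) unfolding residual_def by blast
  qed
next
  fix a x assume "a \<in> residual W U" and x: "x \<in> carrier R"
  then have a: "a \<in> carrier R" "\<And>u. u \<in> U \<Longrightarrow> a \<odot>\<^bsub>M\<^esub> u \<in> W" unfolding residual_def by blast+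
  have Uc: "U \<subseteq> carrier M" using assms submoduleE(1) by blast
  have "(x \<otimes> a) \<odot>\<^bsub>M\<^esub> u \<in> W" if "u \<in> U" for u
    using a x that Uc sub_smultD[OF assms(1) x a(2)[OF that]] by (simp add: smult_assoc1 subset_iff)
  then show "x \<otimes> a \<in> residual W U" using a x unfolding residual_def by blast
  then show "a \<otimes> x \<in> residual W U" using a x by (simp add: R.m_comm)
qed

text \<open>
  The elements that multiply \<open>U\<close> into \<open>W\<close> form an ideal, so only generators have to be
  tested.
\<close>

lemma ideal_act_genideal_le:
  assumes "S \<subseteq> carrier R" "sub W" "sub U" "\<And>a. a \<in> S \<Longrightarrow> a \<^bold>* U \<subseteq> W"
  shows "ideal_act (Idl S) U \<subseteq> W"
proof -
  have "S \<subseteq> residual W U" using assms unfolding residual_def by blast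
  then have "Idl S \<subseteq> residual W U" by (rule R.genideal_minimal[OF residual_ideal[OF assms(2,3)]])
  then show ?thesis using assms(2) unfolding residual_def by (intro ideal_act_least) blast+
qed

lemma ideal_act_plus:
  assumes A: "A \<subseteq> carrier R" and U: "sub U" and V: "sub V"
  shows "ideal_act A (U \<^bold>+ V) = ideal_act A U \<^bold>+ ideal_act A V"
proof (rule equalityI)
  note s = sub_ideal_act[OF A U] sub_ideal_act[OF A V]
  show "ideal_act A (U \<^bold>+ V) \<subseteq> ideal_act A U \<^bold>+ ideal_act A V"
  proof (rule ideal_act_least[OF sub_plus[OF s]])
    fix a assume a: "a \<in> A"
    then show "a \<^bold>* (U \<^bold>+ V) \<subseteq> ideal_act A U \<^bold>+ ideal_act A V"
      using A U V by (intro scale_plus_le scale_le_ideal_act) auto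
  qed
  show "ideal_act A U \<^bold>+ ideal_act A V \<subseteq> ideal_act A (U \<^bold>+ V)"
    using A U V by (intro plus_least sub_ideal_act sub_plus ideal_act_mono plus_upper1 plus_upper2 order_refl)
qed

lemma ideal_act_prod:
  assumes A: "ideal A R" and B: "ideal B R" and U: "sub U"
  shows "ideal_act (A \<cdot>\<^bsub>R\<^esub> B) U = ideal_act A (ideal_act B U)"
proof (rule equalityI)
  have Ac: "A \<subseteq> carrier R" and Bc: "B \<subseteq> carrier R" by (rule additive_subgroup.a_subset[OF ideal.axioms(1)[OF A]], rule additive_subgroup.a_subset[OF ideal.axioms(1)[OF B]])
  have ABc: "A \<cdot>\<^bsub>R\<^esub> B \<subseteq> carrier R" by (rule R.ideal_prod_in_carrier[OF A B])
  have Uc: "\<And>u. u \<in> U \<Longrightarrow> u \<in> carrier M" by (rule sub_carrier[OF U])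
  have W: "sub (ideal_act A (ideal_act B U))" using Ac Bc U by blast
  show "ideal_act (A \<cdot>\<^bsub>R\<^esub> B) U \<subseteq> ideal_act A (ideal_act B U)"
  proof (rule ideal_act_least[OF W])
    fix s assume "s \<in> A \<cdot>\<^bsub>R\<^esub> B"
    then have "s \<in> residual (ideal_act A (ideal_act B U)) U"
    proof (induction s rule: ideal_prod.induct)
      case (prod a b)
      have c: "a \<in> carrier R" "b \<in> carrier R" using prod Ac Bc by auto
      have "(a \<otimes> b) \<odot>\<^bsub>M\<^esub> u \<in> ideal_act A (ideal_act B U)" if "u \<in> U" for u
        using that c Uc prod by (simp add: smult_assoc1 ideal_actI)
      then show ?case using c unfolding residual_def by blast
    next
      case (sum s t)
      then show ?case
        using additive_subgroup.a_closed[OF ideal.axioms(1)[OF residual_ideal[OF W U]]] by blast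
    qed
    then show "s \<^bold>* U \<subseteq> ideal_act A (ideal_act B U)" unfolding residual_def by blast
  qed
  have V: "sub (ideal_act (A \<cdot>\<^bsub>R\<^esub> B) U)" using ABc U by blast
  show "ideal_act A (ideal_act B U) \<subseteq> ideal_act (A \<cdot>\<^bsub>R\<^esub> B) U"
  proof (rule ideal_act_least[OF V])
    fix a assume a: "a \<in> A"
    then have ac: "a \<in> carrier R" using Ac by blast
    have "ideal_act B U \<subseteq> ideal_act (A \<cdot>\<^bsub>R\<^esub> B) U \<^bold>: a"
    proof (rule ideal_act_least[OF sub_colon[OF ac V]])
      fix b assume b: "b \<in> B"
      then have bc: "b \<in> carrier R" using Bc by blast
      have "a \<odot>\<^bsub>M\<^esub> (b \<odot>\<^bsub>M\<^esub> u) \<in> ideal_act (A \<cdot>\<^bsub>R\<^esub> B) U" if "u \<in> U" for u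
        using ideal_actI[OF ideal_prod.prod[OF a b, of R] that] ac bc Uc[OF that] by (simp add: smult_assoc1)
      then show "b \<^bold>* U \<subseteq> ideal_act (A \<cdot>\<^bsub>R\<^esub> B) U \<^bold>: a"
        unfolding colon_elem_def using bc Uc by blast
    qed
    then show "a \<^bold>* ideal_act B U \<subseteq> ideal_act (A \<cdot>\<^bsub>R\<^esub> B) U" unfolding colon_elem_def by blast
  qed
qed

end

context cring
begin

lemma ideals_set_simps: "carrier (ideals_set R) = {A. ideal A R}" "monoid.mult (ideals_set R) = ideal_prod R"
  "one (ideals_set R) = carrier R"
  by (simp_all add: ideals_set_def)

lemma ideal_power: "ideal A R \<Longrightarrow> ideal (A [^]\<^bsub>ideals_set R\<^esub> (n::nat)) R"
proof -
  interpret S: comm_monoid "ideals_set R" by (rule ideals_set_is_comm_monoid)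
  assume "ideal A R"
  then show ?thesis using S.nat_pow_closed[of A n] by (simp add: ideals_set_simps)
qed

lemma ideal_power_Suc: "A [^]\<^bsub>ideals_set R\<^esub> Suc n = (A [^]\<^bsub>ideals_set R\<^esub> n) \<cdot> A"
proof -
  interpret S: comm_monoid "ideals_set R" by (rule ideals_set_is_comm_monoid)
  show ?thesis by (simp add: ideals_set_simps)
qed

lemma ideal_monomial_ideal:
  assumes "\<And>i. i \<le> d \<Longrightarrow> ideal (I i) R" shows "ideal (ideal_monomial R d I n) R"
proof -
  interpret S: comm_monoid "ideals_set R" by (rule ideals_set_is_comm_monoid)
  have "ideal_monomial R d I n \<in> carrier (ideals_set R)"
    unfolding ideal_monomial_def by (rule S.finprod_closed) (auto simp: ideals_set_simps ideal_power assms)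
  then show ?thesis by (simp add: ideals_set_simps)
qed

lemma ideal_monomial_cong:
  assumes "\<And>i. i \<le> d \<Longrightarrow> ideal (I i) R" "\<And>i. i \<le> d \<Longrightarrow> n i = m i"
  shows "ideal_monomial R d I n = ideal_monomial R d I m"
proof -
  interpret S: comm_monoid "ideals_set R" by (rule ideals_set_is_comm_monoid)
  show ?thesis unfolding ideal_monomial_def
    by (rule S.finprod_cong') (auto simp: ideals_set_simps ideal_power assms)
qed

lemma ideal_monomial_zero: "ideal_monomial R d I (\<lambda>_. 0) = carrier R"
proof -
  interpret S: comm_monoid "ideals_set R" by (rule ideals_set_is_comm_monoid)
  have "(\<Otimes>\<^bsub>ideals_set R\<^esub>i\<in>{..d}. I i [^]\<^bsub>ideals_set R\<^esub> (0::nat)) = \<one>\<^bsub>ideals_set R\<^esub>"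
    by (simp add: S.finprod_one)
  then show ?thesis by (simp add: ideal_monomial_def ideals_set_simps)
qed

lemma ideal_monomial_Suc:
  assumes I: "\<And>i. i \<le> d \<Longrightarrow> ideal (I i) R" and i: "i \<le> d"
  shows "ideal_monomial R d I (n(i := Suc (n i))) = ideal_monomial R d I n \<cdot> I i"
proof -
  interpret S: comm_monoid "ideals_set R" by (rule ideals_set_is_comm_monoid)
  have Ic: "\<And>j m. j \<le> d \<Longrightarrow> I j [^]\<^bsub>ideals_set R\<^esub> (m::nat) \<in> carrier (ideals_set R)" "I i \<in> carrier (ideals_set R)"
    using I i by (auto simp: ideals_set_simps ideal_power)
  have e: "ideal_monomial R d I m = I i [^]\<^bsub>ideals_set R\<^esub> m i \<otimes>\<^bsub>ideals_set R\<^esub>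
      (\<Otimes>\<^bsub>ideals_set R\<^esub>j\<in>{..d}-{i}. I j [^]\<^bsub>ideals_set R\<^esub> m j)" for m
  proof -
    have "{..d} = insert i ({..d}-{i})" using i by auto
    then have "ideal_monomial R d I m = (\<Otimes>\<^bsub>ideals_set R\<^esub>j\<in>insert i ({..d}-{i}). I j [^]\<^bsub>ideals_set R\<^esub> m j)"
      unfolding ideal_monomial_def by simp
    also have "\<dots> = I i [^]\<^bsub>ideals_set R\<^esub> m i \<otimes>\<^bsub>ideals_set R\<^esub>
      (\<Otimes>\<^bsub>ideals_set R\<^esub>j\<in>{..d}-{i}. I j [^]\<^bsub>ideals_set R\<^esub> m j)"
      using Ic i by (intro S.finprod_insert) auto
    finally show ?thesis .
  qed
  let ?P = "\<Otimes>\<^bsub>ideals_set R\<^esub>j\<in>{..d}-{i}. I j [^]\<^bsub>ideals_set R\<^esub> n j"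
  have P: "?P \<in> carrier (ideals_set R)" using Ic by (intro S.finprod_closed) auto
  have P': "(\<Otimes>\<^bsub>ideals_set R\<^esub>j\<in>{..d}-{i}. I j [^]\<^bsub>ideals_set R\<^esub> (n(i := Suc (n i))) j) = ?P"
    using Ic by (intro S.finprod_cong') auto
  have "ideal_monomial R d I (n(i := Suc (n i))) = (I i [^]\<^bsub>ideals_set R\<^esub> n i \<otimes>\<^bsub>ideals_set R\<^esub> I i) \<otimes>\<^bsub>ideals_set R\<^esub> ?P"
    unfolding e[of "n(i := Suc (n i))"] P' by simp
  also have "\<dots> = (I i [^]\<^bsub>ideals_set R\<^esub> n i \<otimes>\<^bsub>ideals_set R\<^esub> ?P) \<otimes>\<^bsub>ideals_set R\<^esub> I i"
    using Ic i P by (simp add: S.m_ac)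
  finally show ?thesis unfolding e[of n] by (simp add: ideals_set_simps)
qed

end

section \<open>Filtrations by several ideals: Hilbert functions and the Artin--Rees lemma\<close>

lemma index_induct [consumes 1, case_names zero Suc]:
  assumes "multi_index d n"
    and "P (\<lambda>_. 0)" "\<And>n i. i \<le> d \<Longrightarrow> multi_index d n \<Longrightarrow> P n \<Longrightarrow> P (n(i := Suc (n i)))"
  shows "P n"
  using assms(1)
proof (induction "total d n" arbitrary: n)
  case 0
  then have "n i = 0" for i by (cases "i \<le> d") (auto simp: total_def multi_index_def)
  then have "n = (\<lambda>_. 0)" by (rule ext)
  then show ?case using assms(2) by (simp only:)
next
  case (Suc k)
  have "(\<Sum>i\<le>d. n i) \<noteq> 0" using Suc.hyps(2) unfolding total_def by linarith
  then obtain i where i: "i \<le> d" "n i \<noteq> 0" by (metis atMost_iff sum.neutral)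
  define m where "m = n(i := n i - 1)"
  have n: "n = m(i := Suc (m i))" unfolding m_def using i by simp
  have mi: "multi_index d m" using Suc.prems i unfolding m_def multi_index_def by simp
  have split: "(\<Sum>j\<le>d. f j) = f i + (\<Sum>j\<in>{..d}-{i}. f j)" for f :: "nat \<Rightarrow> nat"
    using i by (intro sum.remove) auto
  have "(\<Sum>j\<in>{..d}-{i}. m j) = (\<Sum>j\<in>{..d}-{i}. n j)" unfolding m_def by (intro sum.cong) auto
  moreover have "m i = n i - 1" unfolding m_def by simp
  ultimately have "Suc (total d m) = total d n" using i unfolding total_def split[of m] split[of n] by simp
  then have "P m" using Suc.hyps mi by (metis Suc_inject)
  then show ?case using assms(3)[OF i(1) mi] n by simp
qed

text \<open>
  Only the values at \<open>i \<le> d\<close> of an exponent matter; setting the others to zero gives the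
  representative on which induction over unit steps is possible.
\<close>

definition restrict_index :: "nat \<Rightarrow> (nat \<Rightarrow> nat) \<Rightarrow> nat \<Rightarrow> nat" where
  "restrict_index d n = (\<lambda>i. if i \<le> d then n i else 0)"

lemma multi_index_restrict [simp]: "multi_index d (restrict_index d n)"
  by (simp add: multi_index_def restrict_index_def)

lemma restrict_index_id: "multi_index d n \<Longrightarrow> restrict_index d n = n"
proof
  fix i assume "multi_index d n"
  then show "restrict_index d n i = n i" by (simp add: multi_index_def restrict_index_def)
qed

lemma restrict_index_Suc:
  "i \<le> d \<Longrightarrow> restrict_index d (n(i := Suc (n i))) = (restrict_index d n)(i := Suc (restrict_index d n i))"
  by (rule ext) (simp add: restrict_index_def)

lemma restrict_index_add:
  "restrict_index d (\<lambda>i. n i + m i) = (\<lambda>i. restrict_index d n i + restrict_index d m i)"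
  by (rule ext) (simp add: restrict_index_def)

lemma multi_index_upd: "multi_index d n \<Longrightarrow> i \<le> d \<Longrightarrow> multi_index d (n(i := m))"
  by (simp add: multi_index_def)

lemma multi_index_add: "multi_index d n \<Longrightarrow> multi_index d m \<Longrightarrow> multi_index d (\<lambda>i. n i + m i)"
  by (simp add: multi_index_def)

lemma add_Suc_upd: "(\<lambda>j. (n(i := Suc (n i))) j + m j) = (\<lambda>j. n j + m j)(i := Suc (n i + m i))"
  by (rule ext) simp

lemma add_Suc_upd': "(\<lambda>j. m j + (n(i := Suc (n i))) j) = (\<lambda>j. m j + n j)(i := Suc (m i + n i))"
  by (rule ext) simp

text \<open>
  In the theory of Hilbert functions the \<open>\<nn>\<close>-primary ideal \<open>J = I 0\<close> enters through the last
  assumption: it makes the graded components, which are killed by \<open>I 0\<close>, have finite length.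
\<close>

locale ideal_family = noetherian_module R M for R (structure) and M (structure) +
  fixes d :: nat and I :: "nat \<Rightarrow> _ set"
  assumes I_ideal: "\<And>i. i \<le> d \<Longrightarrow> ideal (I i) R"
    and I_fin_gen: "\<And>i. i \<le> d \<Longrightarrow> \<exists>S. finite S \<and> S \<subseteq> carrier R \<and> I i = Idl S"
    and finite_length: "\<And>U V. submodule U R M \<Longrightarrow> submodule V R M \<Longrightarrow> U \<subseteq> V \<Longrightarrow> ideal_act (I 0) V \<subseteq> U \<Longrightarrow>
      interval_length R M U V \<noteq> \<infinity>"
begin

abbreviation act :: "nat \<Rightarrow> 'c set \<Rightarrow> 'c set" where "act i U \<equiv> ideal_act (I i) U"
definition pw :: "(nat \<Rightarrow> nat) \<Rightarrow> 'c set \<Rightarrow> 'c set" where "pw n U = ideal_act (ideal_monomial R d I n) U"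

lemma I_carrier: "i \<le> d \<Longrightarrow> I i \<subseteq> carrier R"
  by (rule additive_subgroup.a_subset[OF ideal.axioms(1)[OF I_ideal]])

lemma monomial_ideal: "ideal (ideal_monomial R d I n) R"
  by (rule R.ideal_monomial_ideal) (rule I_ideal)

lemma monomial_carrier: "ideal_monomial R d I n \<subseteq> carrier R"
  by (rule additive_subgroup.a_subset[OF ideal.axioms(1)[OF monomial_ideal]])

lemma act_le: "i \<le> d \<Longrightarrow> sub U \<Longrightarrow> act i U \<subseteq> U"
  by (rule ideal_act_subset[OF I_carrier])

lemma act_mono: "i \<le> d \<Longrightarrow> sub V \<Longrightarrow> U \<subseteq> V \<Longrightarrow> act i U \<subseteq> act i V"
  by (rule ideal_act_mono[OF order_refl _ I_carrier])

lemma act_plus: "i \<le> d \<Longrightarrow> sub U \<Longrightarrow> sub V \<Longrightarrow> act i (U \<^bold>+ V) = act i U \<^bold>+ act i V"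
  by (rule ideal_act_plus[OF I_carrier])

lemma sub_pw: "sub U \<Longrightarrow> sub (pw n U)"
  unfolding pw_def by (rule sub_ideal_act[OF monomial_carrier])

lemma pw_le: "sub U \<Longrightarrow> pw n U \<subseteq> U"
  unfolding pw_def by (rule ideal_act_subset[OF monomial_carrier])

lemma pw_mono: "sub V \<Longrightarrow> U \<subseteq> V \<Longrightarrow> pw n U \<subseteq> pw n V"
  unfolding pw_def by (rule ideal_act_mono[OF order_refl _ monomial_carrier])

lemma pw_plus: "sub U \<Longrightarrow> sub V \<Longrightarrow> pw n (U \<^bold>+ V) = pw n U \<^bold>+ pw n V"
  unfolding pw_def by (rule ideal_act_plus[OF monomial_carrier])

lemma pw_zero: "sub U \<Longrightarrow> pw (\<lambda>_. 0) U = U"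
  unfolding pw_def R.ideal_monomial_zero by (rule ideal_act_carrier)

lemma pw_restrict: "pw (restrict_index d n) U = pw n U"
  unfolding pw_def by (subst R.ideal_monomial_cong[where m = n]) (auto simp: I_ideal restrict_index_def)

lemma pw_Suc: "i \<le> d \<Longrightarrow> sub U \<Longrightarrow> pw (n(i := Suc (n i))) U = act i (pw n U)"
proof -
  assume i: "i \<le> d" and U: "sub U"
  have "ideal_monomial R d I (n(i := Suc (n i))) = ideal_monomial R d I n \<cdot>\<^bsub>R\<^esub> I i"
    by (rule R.ideal_monomial_Suc[OF _ i]) (rule I_ideal)
  also have "\<dots> = I i \<cdot>\<^bsub>R\<^esub> ideal_monomial R d I n"
    by (rule R.ideal_prod_commute[OF monomial_ideal I_ideal[OF i]])
  finally show ?thesis unfolding pw_def by (simp only: ideal_act_prod[OF I_ideal[OF i] monomial_ideal U])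
qed

lemma pw_Suc': "i \<le> d \<Longrightarrow> sub U \<Longrightarrow> pw (n(i := Suc (n i))) U = pw n (act i U)"
proof -
  assume i: "i \<le> d" and U: "sub U"
  have "ideal_monomial R d I (n(i := Suc (n i))) = ideal_monomial R d I n \<cdot>\<^bsub>R\<^esub> I i"
    by (rule R.ideal_monomial_Suc[OF _ i]) (rule I_ideal)
  then show ?thesis unfolding pw_def by (simp only: ideal_act_prod[OF monomial_ideal I_ideal[OF i] U])
qed

lemma pw_add:
  assumes U: "sub U" shows "pw (\<lambda>i. n i + m i) U = pw n (pw m U)"
proof -
  have "pw (\<lambda>i. n i + m i) U = pw n (pw m U)" if "multi_index d n" for n
    using that
  proof (induction rule: index_induct)
    case zero
    then show ?case by (simp add: pw_zero sub_pw U)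
  next
    case (Suc n i)
    show ?case unfolding add_Suc_upd
      using pw_Suc[OF Suc(1) U, of "\<lambda>j. n j + m j"] pw_Suc[OF Suc(1) sub_pw[OF U, of m], of n] Suc(3) by (simp only:)
  qed
  from this[of "restrict_index d n"] have *: "pw (\<lambda>i. restrict_index d n i + m i) U = pw n (pw m U)"
    by (simp add: pw_restrict)
  have "restrict_index d (\<lambda>i. restrict_index d n i + m i) = restrict_index d (\<lambda>i. n i + m i)"
    by (rule ext) (simp add: restrict_index_def)
  then show ?thesis using * pw_restrict by metis
qed

text \<open>
  A graded submodule over the multi-Rees algebra of \<open>I\<close>, all of whose components contain
  \<open>L\<close>.
\<close>

definition family :: "'c set \<Rightarrow> ((nat \<Rightarrow> nat) \<Rightarrow> 'c set) \<Rightarrow> bool" where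
  "family L V \<longleftrightarrow> (\<forall>n. multi_index d n \<longrightarrow> sub (V n) \<and> L \<subseteq> V n \<and> (\<forall>i\<le>d. act i (V n) \<subseteq> V (n(i := Suc (n i)))))"

lemma familyI:
  assumes "\<And>n. multi_index d n \<Longrightarrow> sub (V n)" "\<And>n. multi_index d n \<Longrightarrow> L \<subseteq> V n"
    "\<And>n i. multi_index d n \<Longrightarrow> i \<le> d \<Longrightarrow> act i (V n) \<subseteq> V (n(i := Suc (n i)))"
  shows "family L V"
  unfolding family_def using assms by simp

lemma familyD:
  assumes "family L V" "multi_index d n"
  shows "sub (V n)" "L \<subseteq> V n" "i \<le> d \<Longrightarrow> act i (V n) \<subseteq> V (n(i := Suc (n i)))"
  using assms unfolding family_def by simp_all

lemma family_pw:
  assumes V: "family L V" and m: "multi_index d m" and n: "multi_index d n"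
  shows "pw n (V m) \<subseteq> V (\<lambda>i. n i + m i)"
  using n
proof (induction rule: index_induct)
  case zero
  show ?case using familyD(1)[OF V m] by (simp add: pw_zero)
next
  case (Suc n i)
  have nm: "multi_index d (\<lambda>i. n i + m i)" using Suc m by (intro multi_index_add)
  have "pw (n(i := Suc (n i))) (V m) = act i (pw n (V m))"
    by (rule pw_Suc[OF Suc(1) familyD(1)[OF V m]])
  also have "\<dots> \<subseteq> act i (V (\<lambda>i. n i + m i))" by (rule act_mono[OF Suc(1) familyD(1)[OF V nm] Suc(3)])
  also have "\<dots> \<subseteq> V (\<lambda>j. (n(i := Suc (n i))) j + m j)" unfolding add_Suc_upd
    by (rule familyD(3)[OF V nm Suc(1)])
  finally show ?case .
qed

lemma family_int:
  assumes V: "family L V" and W: "family L W" shows "family L (\<lambda>n. V n \<inter> W n)"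
proof (rule familyI)
  fix n assume n: "multi_index d n"
  show "sub (V n \<inter> W n)" by (rule sub_int[OF familyD(1)[OF V n] familyD(1)[OF W n]])
  show "L \<subseteq> V n \<inter> W n" using familyD(2)[OF V n] familyD(2)[OF W n] by simp
  fix i assume i: "i \<le> d"
  have "act i (V n \<inter> W n) \<subseteq> act i (V n)" by (rule act_mono[OF i familyD(1)[OF V n]]) simp
  moreover have "act i (V n \<inter> W n) \<subseteq> act i (W n)" by (rule act_mono[OF i familyD(1)[OF W n]]) simp
  ultimately show "act i (V n \<inter> W n) \<subseteq> V (n(i := Suc (n i))) \<inter> W (n(i := Suc (n i)))"
    using familyD(3)[OF V n i] familyD(3)[OF W n i] by (meson Int_greatest order_trans)
qed

lemma family_plus:
  assumes V: "family L V" and W: "family L W" shows "family L (\<lambda>n. V n \<^bold>+ W n)"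
proof (rule familyI)
  fix n assume n: "multi_index d n"
  note V1 = familyD(1)[OF V n] and W1 = familyD(1)[OF W n]
  show "sub (V n \<^bold>+ W n)" by (rule sub_plus[OF V1 W1])
  show "L \<subseteq> V n \<^bold>+ W n" by (rule order_trans[OF familyD(2)[OF V n] plus_upper1[OF V1 W1]])
  fix i assume i: "i \<le> d"
  show "act i (V n \<^bold>+ W n) \<subseteq> V (n(i := Suc (n i))) \<^bold>+ W (n(i := Suc (n i)))"
    unfolding act_plus[OF i V1 W1] by (rule plus_mono[OF familyD(3)[OF V n i] familyD(3)[OF W n i]])
qed

lemma family_const: "sub W \<Longrightarrow> L \<subseteq> W \<Longrightarrow> family L (\<lambda>n. W)"
  by (rule familyI) (simp_all add: act_le)

lemma family_add:
  assumes V: "family L V" and m: "multi_index d m"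
  shows "family L (\<lambda>n. V (\<lambda>i. n i + m i))"
proof (rule familyI)
  fix n assume "multi_index d n"
  then have nm: "multi_index d (\<lambda>i. n i + m i)" using m by (rule multi_index_add)
  show "sub (V (\<lambda>i. n i + m i))" "L \<subseteq> V (\<lambda>i. n i + m i)" by (rule familyD[OF V nm])+
  fix i assume i: "i \<le> d"
  show "act i (V (\<lambda>i. n i + m i)) \<subseteq> V (\<lambda>j. (n(i := Suc (n i))) j + m j)"
    unfolding add_Suc_upd by (rule familyD(3)[OF V nm i])
qed

lemma family_Suc:
  assumes V: "family L V" and j: "j \<le> d"
  shows "family L (\<lambda>n. V (n(j := Suc (n j))))"
proof (rule familyI)
  fix n assume n: "multi_index d n"
  then have nm: "multi_index d (n(j := Suc (n j)))" using j by (rule multi_index_upd)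
  show "sub (V (n(j := Suc (n j))))" "L \<subseteq> V (n(j := Suc (n j)))" by (rule familyD[OF V nm])+
  fix i assume i: "i \<le> d"
  have eq: "(n(i := Suc (n i)))(j := Suc ((n(i := Suc (n i))) j)) = (n(j := Suc (n j)))(i := Suc ((n(j := Suc (n j))) i))"
    by (rule ext) simp
  show "act i (V (n(j := Suc (n j)))) \<subseteq> V ((n(i := Suc (n i)))(j := Suc ((n(i := Suc (n i))) j)))"
    unfolding eq by (rule familyD(3)[OF V nm i])
qed

definition fil :: "'c set \<Rightarrow> 'c set \<Rightarrow> (nat \<Rightarrow> nat) \<Rightarrow> 'c set" where "fil L H n = pw n H \<^bold>+ L"

lemma sub_fil: "sub L \<Longrightarrow> sub H \<Longrightarrow> sub (fil L H n)"
  unfolding fil_def by (rule sub_plus[OF sub_pw])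

lemma fil_family: "sub L \<Longrightarrow> sub H \<Longrightarrow> family L (fil L H)"
proof (rule familyI)
  assume L: "sub L" and H: "sub H"
  fix n
  show "sub (fil L H n)" by (rule sub_fil[OF L H])
  show "L \<subseteq> fil L H n" unfolding fil_def by (rule plus_upper2[OF sub_pw[OF H] L])
  fix i assume i: "i \<le> d"
  show "act i (fil L H n) \<subseteq> fil L H (n(i := Suc (n i)))"
    unfolding fil_def act_plus[OF i sub_pw[OF H] L] pw_Suc[OF i H]
    by (rule plus_mono[OF order_refl act_le[OF i L]])
qed

lemma fil_le: "sub L \<Longrightarrow> sub H \<Longrightarrow> L \<subseteq> H \<Longrightarrow> fil L H n \<subseteq> H"
  unfolding fil_def by (rule plus_least) (simp_all add: pw_le)

lemma fil_antimono: "sub L \<Longrightarrow> sub H \<Longrightarrow> i \<le> d \<Longrightarrow> fil L H (n(i := Suc (n i))) \<subseteq> fil L H n"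
  unfolding fil_def pw_Suc by (rule plus_mono[OF act_le order_refl]) (simp_all add: sub_pw)

lemma fil_restrict: "fil L H (restrict_index d n) = fil L H n"
  unfolding fil_def pw_restrict by (rule refl)

lemma generators:
  obtains gs where "\<forall>(g, a)\<in>set gs. a \<in> carrier R \<and> g \<le> d" "\<And>i a. (i, a) \<in> set gs \<Longrightarrow> a \<in> I i"
    "\<And>i. i \<le> d \<Longrightarrow> I i = Idl {a. (i, a) \<in> set gs}"
proof -
  have "\<forall>i\<in>{..d}. \<exists>S. finite S \<and> S \<subseteq> carrier R \<and> I i = Idl S" using I_fin_gen by simp
  then obtain S where S: "\<forall>i\<in>{..d}. finite (S i) \<and> S i \<subseteq> carrier R \<and> I i = Idl (S i)"
    by (rule bchoice[THEN exE])
  then have "finite (Sigma {..d} S)" by (intro finite_SigmaI) simp_all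
  then obtain gs where gs: "set gs = Sigma {..d} S" using finite_list by blast
  show thesis
  proof (rule that[of gs])
    show "\<forall>(g, a)\<in>set gs. a \<in> carrier R \<and> g \<le> d" unfolding gs using S by fastforce
    show "a \<in> I i" if "(i, a) \<in> set gs" for i a
      using that S R.genideal_self[of "S i"] unfolding gs by auto
    show "I i = Idl {a. (i, a) \<in> set gs}" if "i \<le> d" for i
      using S that unfolding gs by simp
  qed
qed

text \<open>
  Generators of the ideals, each placed in the degree of its ideal, generate the filtration
  by the monomials in the ideals.
\<close>

lemma fil_generated:
  assumes L: "sub L" and H: "sub H" "L \<subseteq> H"
    and gs: "\<forall>(g, a)\<in>set gs. a \<in> carrier R" and gen: "\<And>i. i \<le> d \<Longrightarrow> I i = Idl {a. (i, a) \<in> set gs}"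
    and n: "multi_index d n"
  shows "fil L H n \<subseteq> generated L H gs n"
proof -
  have st: "stable_family L gs (generated L H gs)" by (rule stable_generated[OF L H gs])
  have base: "H \<subseteq> generated L H gs (\<lambda>_. 0)" using gs
  proof (induction gs)
    case (Cons ga gs)
    obtain g a where ga: "ga = (g, a)" by (cases ga)
    have B: "stable_family L gs (generated L H gs)" using Cons.prems by (intro stable_generated[OF L H]) simp
    note sB = stable_familyD(1)[OF B]
    have "generated L H ((g, a) # gs) (\<lambda>_. 0) = L \<^bold>+ \<one> \<^bold>* generated L H gs (\<lambda>_. 0)"
    proof -
      have "(\<lambda>_. 0::nat)(g := 0) = (\<lambda>_. 0)" by (rule ext) simp
      then show ?thesis by (simp only: generated.simps partial_sum.simps diff_zero R.nat_pow_0)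
    qed
    then show ?case unfolding ga scale_one[OF sB]
      using Cons plus_upper2[OF L sB[of "\<lambda>_. 0"]] by auto
  qed simp
  have "pw n H \<subseteq> generated L H gs n" using n
  proof (induction rule: index_induct)
    case zero
    show ?case unfolding pw_zero[OF H(1)] by (rule base)
  next
    case (Suc n i)
    have "act i (pw n H) \<subseteq> generated L H gs (n(i := Suc (n i)))"
      unfolding gen[OF Suc(1)]
    proof (rule ideal_act_genideal_le[OF _ stable_familyD(1)[OF st] sub_pw[OF H(1)]])
      show "{a. (i, a) \<in> set gs} \<subseteq> carrier R" using gs by auto
      fix a assume "a \<in> {a. (i, a) \<in> set gs}"
      then have "a \<^bold>* generated L H gs n \<subseteq> generated L H gs (n(i := Suc (n i)))"
        using stable_familyD(3)[OF st] by blast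
      then show "a \<^bold>* pw n H \<subseteq> generated L H gs (n(i := Suc (n i)))"
        using scale_mono[OF Suc(3), of a] by (rule order_trans[rotated])
    qed
    then show ?case unfolding pw_Suc[OF Suc(1) H(1)] .
  qed
  then show ?thesis unfolding fil_def
    by (rule plus_least[OF stable_familyD(1)[OF st] _ stable_familyD(2)[OF st]])
qed

text \<open>
  A stable family is defined in all degrees, so a family over multi-indices is completed by
  \<open>L\<close> elsewhere.
\<close>

lemma stable_extension:
  assumes L: "sub L" and V: "family L V" and gs: "\<forall>(g, a)\<in>set gs. a \<in> carrier R \<and> g \<le> d"
    and gsI: "\<And>i a. (i, a) \<in> set gs \<Longrightarrow> a \<in> I i"
  shows "stable_family L gs (\<lambda>n. if multi_index d n then V n else L)"
proof -
  have "a \<^bold>* (if multi_index d n then V n else L) \<subseteq>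
      (if multi_index d (n(g := Suc (n g))) then V (n(g := Suc (n g))) else L)" if ga: "(g, a) \<in> set gs" for g a n
  proof -
    have g: "g \<le> d" "a \<in> carrier R" "a \<in> I g" using ga gs gsI by auto
    have iff: "multi_index d (n(g := Suc (n g))) \<longleftrightarrow> multi_index d n" using g by (auto simp: multi_index_def)
    show ?thesis
    proof (cases "multi_index d n")
      case True
      have "a \<^bold>* V n \<subseteq> act g (V n)" using g(3) by (rule scale_le_ideal_act)
      then show ?thesis using True iff familyD(3)[OF V True g(1)] by (simp add: subset_trans)
    qed (use iff scale_subset[OF g(2) L] in simp)
  qed
  moreover have "sub (if multi_index d n then V n else L) \<and> L \<subseteq> (if multi_index d n then V n else L)" for n
    using L familyD(1,2)[OF V] by simp
  ultimately show ?thesis unfolding stable_family_def by blast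
qed

text \<open>
  The length of \<open>V n / U n\<close> as a natural number. Restricting the index makes two such
  functions equal as soon as the lengths agree on multi-indices, and \<open>the_enat\<close> is harmless
  as the lengths considered are finite.
\<close>

definition hlen :: "((nat \<Rightarrow> nat) \<Rightarrow> 'c set) \<Rightarrow> ((nat \<Rightarrow> nat) \<Rightarrow> 'c set) \<Rightarrow> (nat \<Rightarrow> nat) \<Rightarrow> nat" where
  "hlen U V n = the_enat (len (U (restrict_index d n)) (V (restrict_index d n)))"

theorem family_hilbert:
  assumes L: "sub L" and H: "sub H" "L \<subseteq> H" and U: "family L U" and V: "family L V"
    and UV: "\<And>n. multi_index d n \<Longrightarrow> U n \<subseteq> V n" and VH: "\<And>n. multi_index d n \<Longrightarrow> V n \<subseteq> fil L H n"
    and fin: "\<And>n. multi_index d n \<Longrightarrow> len (U n) (V n) \<noteq> \<infinity>"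
  shows "hilbert_fun d (hlen U V)" "\<And>n. multi_index d n \<Longrightarrow> len (U n) (V n) = enat (hlen U V n)"
proof -
  obtain gs where gs: "\<forall>(g, a)\<in>set gs. a \<in> carrier R \<and> g \<le> d" "\<And>i a. (i, a) \<in> set gs \<Longrightarrow> a \<in> I i"
    "\<And>i. i \<le> d \<Longrightarrow> I i = Idl {a. (i, a) \<in> set gs}" by (rule generators) blast
  have gs': "\<forall>(g, a)\<in>set gs. a \<in> carrier R" using gs(1) by auto
  note gL = stable_familyD(2)[OF stable_generated[OF L H gs']]
  let ?U = "\<lambda>n. if multi_index d n then U n else L" let ?V = "\<lambda>n. if multi_index d n then V n else L"
  have "\<exists>p. hilbert_fun d p \<and> (\<forall>n. multi_index d n \<longrightarrow> len (?U n) (?V n) = enat (p n))"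
  proof (rule stable_families_hilbert[OF L H gs(1)])
    show "stable_family L gs ?U" by (rule stable_extension[OF L U gs(1,2)])
    show "stable_family L gs ?V" by (rule stable_extension[OF L V gs(1,2)])
    show "?U n \<subseteq> ?V n" for n using UV by simp
    show "?V n \<subseteq> generated L H gs n" for n
      using VH[of n] fil_generated[OF L H gs' gs(3), of n] gL[of n] by (auto split: if_splits)
    show "len (?U n) (?V n) \<noteq> \<infinity>" if "multi_index d n" for n using fin[OF that] that by simp
  qed
  then obtain p where p: "hilbert_fun d p" and pn: "\<And>n. multi_index d n \<Longrightarrow> len (U n) (V n) = enat (p n)" by auto
  have "hlen U V n = p n" for n
  proof -
    have "hlen U V n = p (restrict_index d n)" unfolding hlen_def pn[OF multi_index_restrict] by simp
    also have "\<dots> = p n" by (rule hilbert_fun_ext[OF p]) (simp add: restrict_index_def)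
    finally show ?thesis .
  qed
  then have eq: "hlen U V = p" by (rule ext)
  show "hilbert_fun d (hlen U V)" unfolding eq by (rule p)
  show "len (U n) (V n) = enat (hlen U V n)" if "multi_index d n" for n unfolding eq by (rule pn[OF that])
qed

theorem family_noetherian:
  assumes L: "sub L" and H: "sub H" "L \<subseteq> H" and W: "\<And>s. family L (W s)"
    and WH: "\<And>s n. multi_index d n \<Longrightarrow> W s n \<subseteq> fil L H n" and Ws: "\<And>s n. multi_index d n \<Longrightarrow> W s n \<subseteq> W (Suc s) n"
  shows "\<exists>c. \<forall>s\<ge>c. \<forall>n. multi_index d n \<longrightarrow> W s n = W c n"
proof -
  obtain gs where gs: "\<forall>(g, a)\<in>set gs. a \<in> carrier R \<and> g \<le> d" "\<And>i a. (i, a) \<in> set gs \<Longrightarrow> a \<in> I i"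
    "\<And>i. i \<le> d \<Longrightarrow> I i = Idl {a. (i, a) \<in> set gs}" by (rule generators) blast
  have gs': "\<forall>(g, a)\<in>set gs. a \<in> carrier R" using gs(1) by auto
  note gL = stable_familyD(2)[OF stable_generated[OF L H gs']]
  let ?W = "\<lambda>s n. if multi_index d n then W s n else L"
  have "\<exists>c. \<forall>s\<ge>c. \<forall>n. ?W s n = ?W c n"
  proof (rule stable_families_noetherian[OF L H gs'])
    show "stable_family L gs (?W s)" for s by (rule stable_extension[OF L W gs(1,2)])
    show "?W s n \<subseteq> generated L H gs n" for s n
      using WH[of n s] fil_generated[OF L H gs' gs(3), of n] gL[of n] by (auto split: if_splits)
    show "?W s n \<subseteq> ?W (Suc s) n" for s n using Ws by simp
  qed
  then obtain c where c: "\<forall>s\<ge>c. \<forall>n. ?W s n = ?W c n" by blast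
  have "W s n = W c n" if "s \<ge> c" "multi_index d n" for s n
    using c[rule_format, OF that(1), of n] that(2) by simp
  then show ?thesis by (intro exI[of _ c] allI impI)
qed

text \<open>
  Let \<open>W s\<close> be the subfamily of \<open>V\<close> generated in degrees with all entries at most \<open>s\<close>. These
  subfamilies increase and exhaust \<open>V\<close>, so by \<open>family_noetherian\<close> some \<open>W c\<close> is all of \<open>V\<close>.
  In degrees \<open>n + (c, \<dots>, c)\<close> each generator of \<open>W c\<close> can first be raised to degree
  \<open>(c, \<dots>, c)\<close>.
\<close>

theorem artin_rees:
  assumes L: "sub L" and H: "sub H" "L \<subseteq> H" and V: "family L V"
    and VH: "\<And>n. multi_index d n \<Longrightarrow> V n \<subseteq> fil L H n"
  obtains c where "multi_index d c" "\<And>n. multi_index d n \<Longrightarrow> V (\<lambda>i. n i + c i) = fil L (V c) n"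
proof -
  define G where "G = (\<lambda>s n. L \<union> (\<Union>m\<in>{m. multi_index d m \<and> m \<le> n \<and> (\<forall>i. m i \<le> s)}. pw (\<lambda>i. n i - m i) (V m)))"
  define W where "W = (\<lambda>s n. submodule_span R M (G s n))"
  note sV = familyD(1)[OF V]
  have Gc: "G s n \<subseteq> carrier M" for s n
    unfolding G_def using submoduleE(1)[OF L] submoduleE(1)[OF sub_pw[OF sV]] by blast
  have sW: "sub (W s n)" for s n unfolding W_def by (rule sub_span[OF Gc])
  have GW: "G s n \<subseteq> W s n" for s n unfolding W_def by (rule span_superset)
  have pwW: "pw (\<lambda>i. n i - m i) (V m) \<subseteq> W s n" if "multi_index d m" "m \<le> n" "\<And>i. m i \<le> s" for m n s
    using GW[of s n] that unfolding G_def by blast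
  have LW: "L \<subseteq> W s n" for s n using GW[of s n] unfolding G_def by blast
  have Wle: "W s n \<subseteq> X" if "sub X" "L \<subseteq> X"
    "\<And>m. multi_index d m \<Longrightarrow> m \<le> n \<Longrightarrow> (\<And>i. m i \<le> s) \<Longrightarrow> pw (\<lambda>i. n i - m i) (V m) \<subseteq> X" for X s n
    unfolding W_def by (rule span_least[OF that(1)]) (use that(2,3) in \<open>auto simp: G_def\<close>)
  have WV: "W s n \<subseteq> V n" if n: "multi_index d n" for s n
  proof (rule Wle[OF sV[OF n] familyD(2)[OF V n]])
    fix m assume m: "multi_index d m" "m \<le> n"
    have nm: "multi_index d (\<lambda>i. n i - m i)" using n by (simp add: multi_index_def)
    have "(\<lambda>i. n i - m i + m i) = n" using m(2) by (auto simp: le_fun_def)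
    then show "pw (\<lambda>i. n i - m i) (V m) \<subseteq> V n" using family_pw[OF V m(1) nm] by simp
  qed
  have "family L (W s)" for s
  proof (rule familyI)
    fix n i assume n: "multi_index d n" and i: "i \<le> d"
    let ?n = "n(i := Suc (n i))"
    show "act i (W s n) \<subseteq> W s ?n"
    proof (rule ideal_act_least[OF sW])
      fix a assume a: "a \<in> I i"
      then have ac: "a \<in> carrier R" using I_carrier[OF i] by blast
      have "W s n \<subseteq> W s ?n \<^bold>: a"
      proof (rule Wle[OF sub_colon[OF ac sW]])
        show "L \<subseteq> W s ?n \<^bold>: a" by (rule order_trans[OF subset_colon[OF ac L] colon_mono[OF LW]])
        fix m assume m: "multi_index d m" "m \<le> n" "\<And>i. m i \<le> s"
        have eq: "(\<lambda>j. ?n j - m j) = (\<lambda>j. n j - m j)(i := Suc (n i - m i))"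
          using m(2) by (auto simp: le_fun_def Suc_diff_le)
        have "m \<le> ?n" using m(2) by (auto simp: le_fun_def intro: le_SucI)
        from pwW[OF m(1) this m(3)] have "act i (pw (\<lambda>j. n j - m j) (V m)) \<subseteq> W s ?n"
          unfolding eq pw_Suc[OF i sV[OF m(1)], of "\<lambda>j. n j - m j"] .
        then have "a \<^bold>* pw (\<lambda>j. n j - m j) (V m) \<subseteq> W s ?n"
          by (rule order_trans[OF scale_le_ideal_act[OF a]])
        then show "pw (\<lambda>j. n j - m j) (V m) \<subseteq> W s ?n \<^bold>: a"
          unfolding colon_elem_def using submoduleE(1)[OF sub_pw[OF sV[OF m(1)]]] by blast
      qed
      then show "a \<^bold>* W s n \<subseteq> W s ?n" unfolding colon_elem_def by blast
    qed
  qed (rule sW LW)+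
  moreover have "W s n \<subseteq> fil L H n" if "multi_index d n" for s n
    by (rule order_trans[OF WV[OF that] VH[OF that]])
  moreover have "W s n \<subseteq> W (Suc s) n" for s n
    by (rule Wle[OF sW LW]) (rule pwW, assumption, assumption, rule le_SucI, assumption)
  ultimately have "\<exists>c. \<forall>s\<ge>c. \<forall>n. multi_index d n \<longrightarrow> W s n = W c n"
    by (intro family_noetherian[OF L H])
  then obtain c where c: "\<forall>s\<ge>c. \<forall>n. multi_index d n \<longrightarrow> W s n = W c n" by blast
  have VW: "V n \<subseteq> W c n" if n: "multi_index d n" for n
  proof -
    define s where "s = max c (Max (n ` {..d}))"
    have ns: "n i \<le> s" for i
    proof (cases "i \<le> d")
      case True
      then have "n i \<le> Max (n ` {..d})" by (intro Max_ge) auto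
      then show ?thesis unfolding s_def by simp
    qed (use n in \<open>simp add: multi_index_def\<close>)
    have "pw (\<lambda>i. n i - n i) (V n) \<subseteq> W s n" by (rule pwW[OF n order_refl ns])
    moreover have "(\<lambda>i. n i - n i) = (\<lambda>_. 0)" by simp
    ultimately have "V n \<subseteq> W s n" using pw_zero[OF sV[OF n]] by simp
    also have "W s n = W c n" using c[rule_format, of s n] n unfolding s_def by simp
    finally show ?thesis .
  qed
  define cc where "cc = (\<lambda>i. if i \<le> d then c else 0)"
  have mcc: "multi_index d cc" unfolding cc_def multi_index_def by simp
  show thesis
  proof (rule that[OF mcc])
    fix n assume n: "multi_index d n"
    have mn: "multi_index d (\<lambda>i. n i + cc i)" by (rule multi_index_add[OF n mcc])
    show "V (\<lambda>i. n i + cc i) = fil L (V cc) n"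
    proof (rule equalityI)
      show "fil L (V cc) n \<subseteq> V (\<lambda>i. n i + cc i)"
        unfolding fil_def by (rule plus_least[OF sV[OF mn] family_pw[OF V mcc n] familyD(2)[OF V mn]])
      have sX: "sub (fil L (V cc) n)" by (rule sub_fil[OF L sV[OF mcc]])
      have "W c (\<lambda>i. n i + cc i) \<subseteq> fil L (V cc) n"
      proof (rule Wle[OF sX])
        show "L \<subseteq> fil L (V cc) n" unfolding fil_def by (rule plus_upper2[OF sub_pw[OF sV[OF mcc]] L])
        fix m assume m: "multi_index d m" "\<And>i. m i \<le> c"
        have mc: "m i \<le> cc i" for i using m unfolding cc_def multi_index_def by simp
        have "(\<lambda>i. n i + cc i - m i) = (\<lambda>i. n i + (cc i - m i))" using mc by (simp add: fun_eq_iff)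
        then have "pw (\<lambda>i. n i + cc i - m i) (V m) = pw n (pw (\<lambda>i. cc i - m i) (V m))"
          using pw_add[OF sV[OF m(1)], of n "\<lambda>i. cc i - m i"] by simp
        also have "\<dots> \<subseteq> pw n (V cc)"
        proof (rule pw_mono[OF sV[OF mcc]])
          have "multi_index d (\<lambda>i. cc i - m i)" using mcc by (simp add: multi_index_def)
          moreover have "(\<lambda>i. cc i - m i + m i) = cc" using mc by (simp add: fun_eq_iff)
          ultimately show "pw (\<lambda>i. cc i - m i) (V m) \<subseteq> V cc" using family_pw[OF V m(1)] by metis
        qed
        also have "\<dots> \<subseteq> fil L (V cc) n" unfolding fil_def by (rule plus_upper1[OF sub_pw[OF sV[OF mcc]] L])
        finally show "pw (\<lambda>i. n i + cc i - m i) (V m) \<subseteq> fil L (V cc) n" .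
      qed
      then show "V (\<lambda>i. n i + cc i) \<subseteq> fil L (V cc) n" by (rule order_trans[OF VW[OF mn]])
    qed
  qed
qed

end

section \<open>Constant differences along exact sequences and superficial elements\<close>

lemma const_diff_cancel:
  assumes "const_diff d ks (\<lambda>n. p n + q n) (a + b)" "const_diff d ks q b" shows "const_diff d ks p a"
  unfolding const_diff_def
  by (rule for_all_large_mono[OF for_all_large_conj[OF assms[unfolded const_diff_def of_nat_add mdiffs_add]]]) simp

text \<open>
  Every large \<open>n\<close> is of the form \<open>n' + m\<close> with \<open>n'\<close> large; \<open>n'\<close> has to agree with \<open>n\<close> beyond
  \<open>d\<close>, which holds as \<open>m\<close> vanishes there.
\<close>

lemma for_all_large_shift_back:
  assumes "for_all_large d (\<lambda>n. P (\<lambda>i. n i + m i))" "multi_index d m"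
  shows "for_all_large d P"
proof -
  obtain c where c: "\<forall>n. (\<forall>i\<le>d. c \<le> n i) \<longrightarrow> P (\<lambda>i. n i + m i)"
    using assms(1) unfolding for_all_large_def by blast
  have "P n" if n: "\<forall>i\<le>d. c + Max (m ` {..d}) \<le> n i" for n
  proof -
    have m: "m i \<le> Max (m ` {..d})" if "i \<le> d" for i using that by (intro Max_ge) simp_all
    have le: "c \<le> n i - m i \<and> m i \<le> n i" if "i \<le> d" for i
      using n[rule_format, OF that] m[OF that] by linarith
    have "(\<lambda>i. n i - m i + m i) = n"
    proof
      fix i show "n i - m i + m i = n i"
        using le[of i] assms(2) by (cases "i \<le> d") (simp_all add: multi_index_def)
    qed
    moreover have "P (\<lambda>i. n i - m i + m i)" using c[rule_format, of "\<lambda>i. n i - m i"] le by blast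
    ultimately show ?thesis by simp
  qed
  then show ?thesis unfolding for_all_large_def by (intro exI[of _ "c + Max (m ` {..d})"]) blast
qed

lemma const_diff_shift_iff:
  assumes "multi_index d m"
  shows "const_diff d ks (\<lambda>n. p (\<lambda>i. n i + m i)) a \<longleftrightarrow> const_diff d ks p a"
proof
  assume "const_diff d ks (\<lambda>n. p (\<lambda>i. n i + m i)) a"
  then show "const_diff d ks p a"
    unfolding const_diff_def mdiffs_shift[of ks "\<lambda>n. int (p n)" m] by (rule for_all_large_shift_back) (rule assms)
qed (rule const_diff_shift)

lemma const_diff_Suc:
  "const_diff d ks p a \<Longrightarrow> const_diff d ks (\<lambda>n. p (n(i := Suc (n i)))) a"
proof -
  have "(\<lambda>j. n j + (if j = i then 1 else 0)) = n(i := Suc (n i))" for n :: "nat \<Rightarrow> nat" by (rule ext) simp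
  then show "const_diff d ks p a \<Longrightarrow> const_diff d ks (\<lambda>n. p (n(i := Suc (n i)))) a"
    using const_diff_shift[of d ks p a "\<lambda>j. if j = i then 1 else 0"] by simp
qed

context module
begin

lemma ideal_act_scale:
  assumes A: "A \<subseteq> carrier R" and y: "y \<in> carrier R" and U: "sub U"
  shows "ideal_act A (y \<^bold>* U) = y \<^bold>* ideal_act A U"
proof (rule equalityI)
  have yU: "sub (y \<^bold>* U)" using y U by (rule sub_scale)
  show "ideal_act A (y \<^bold>* U) \<subseteq> y \<^bold>* ideal_act A U"
  proof (rule ideal_act_least[OF sub_scale[OF y sub_ideal_act[OF A U]]])
    fix a assume a: "a \<in> A"
    then have ac: "a \<in> carrier R" using A by blast
    show "a \<^bold>* y \<^bold>* U \<subseteq> y \<^bold>* ideal_act A U"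
      unfolding scale_comm[OF ac y U] by (rule scale_mono[OF scale_le_ideal_act[OF a]])
  qed
  have "ideal_act A U \<subseteq> ideal_act A (y \<^bold>* U) \<^bold>: y"
  proof (rule ideal_act_least[OF sub_colon[OF y sub_ideal_act[OF A yU]]])
    fix a assume a: "a \<in> A"
    then have ac: "a \<in> carrier R" using A by blast
    have "y \<^bold>* a \<^bold>* U \<subseteq> ideal_act A (y \<^bold>* U)"
      unfolding scale_comm[OF y ac U] by (rule scale_le_ideal_act[OF a])
    moreover have "a \<^bold>* U \<subseteq> carrier M" by (rule submoduleE(1)[OF sub_scale[OF ac U]])
    ultimately show "a \<^bold>* U \<subseteq> ideal_act A (y \<^bold>* U) \<^bold>: y" unfolding colon_elem_def by blast
  qed
  then show "y \<^bold>* ideal_act A U \<subseteq> ideal_act A (y \<^bold>* U)" unfolding colon_elem_def by blast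
qed

text \<open>
  Multiplication by \<open>y\<close> identifies \<open>N/(L : y)\<close> with \<open>(yN + L)/L\<close>.
\<close>

lemma len_scale_colon:
  assumes y: "y \<in> carrier R" and L: "sub L" and A: "sub A" and B: "sub B" and AB: "A \<subseteq> B"
  shows "len (y \<^bold>* A \<^bold>+ L) (y \<^bold>* B \<^bold>+ L) = len (A \<^bold>+ (L \<^bold>: y)) (B \<^bold>+ (L \<^bold>: y))"
proof -
  have C: "sub (L \<^bold>: y)" using y L by (rule sub_colon)
  have eq: "y \<^bold>* X \<^bold>+ L = L \<^bold>+ y \<^bold>* (X \<^bold>+ (L \<^bold>: y))" if X: "sub X" for X
  proof (rule equalityI)
    have yX: "sub (y \<^bold>* X)" and yC: "sub (y \<^bold>* (L \<^bold>: y))" and yXC: "sub (y \<^bold>* (X \<^bold>+ (L \<^bold>: y)))"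
      using y X C by (simp_all add: sub_scale sub_plus)
    show "y \<^bold>* X \<^bold>+ L \<subseteq> L \<^bold>+ y \<^bold>* (X \<^bold>+ (L \<^bold>: y))"
    proof (rule plus_least[OF sub_plus[OF L yXC] _ plus_upper1[OF L yXC]])
      show "y \<^bold>* X \<subseteq> L \<^bold>+ y \<^bold>* (X \<^bold>+ (L \<^bold>: y))"
        by (rule order_trans[OF scale_mono[OF plus_upper1[OF X C]] plus_upper2[OF L yXC]])
    qed
    show "L \<^bold>+ y \<^bold>* (X \<^bold>+ (L \<^bold>: y)) \<subseteq> y \<^bold>* X \<^bold>+ L"
    proof (rule plus_least[OF sub_plus[OF yX L] plus_upper2[OF yX L]])
      have "y \<^bold>* (L \<^bold>: y) \<subseteq> L" unfolding colon_elem_def by blast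
      then show "y \<^bold>* (X \<^bold>+ (L \<^bold>: y)) \<subseteq> y \<^bold>* X \<^bold>+ L"
        unfolding scale_plus[OF y X C] by (rule plus_mono[OF order_refl])
    qed
  qed
  show ?thesis unfolding eq[OF A] eq[OF B]
  proof (rule len_scale[OF y L sub_plus[OF A C] sub_plus[OF B C] plus_mono[OF AB order_refl]])
    show "(L \<^bold>: y) \<inter> (B \<^bold>+ (L \<^bold>: y)) \<subseteq> A \<^bold>+ (L \<^bold>: y)" using plus_upper2[OF A C] by blast
  qed
qed

end

context ideal_family
begin

abbreviation up :: "(nat \<Rightarrow> nat) \<Rightarrow> nat \<Rightarrow> nat" where "up n \<equiv> n(0 := Suc (n 0))"

text \<open>
  The Hilbert function of \<open>H/L\<close>: the length of the \<open>n\<close>-th graded component, see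
  \<open>graded_length\<close>.
\<close>

definition hf :: "'c set \<Rightarrow> 'c set \<Rightarrow> (nat \<Rightarrow> nat) \<Rightarrow> nat" where
  "hf L H = hlen (\<lambda>n. fil L H (up n)) (fil L H)"

lemma mi_up: "multi_index d n \<Longrightarrow> multi_index d (up n)"
  by (rule multi_index_upd) simp_all

lemma family_up: "family L V \<Longrightarrow> family L (\<lambda>n. V (up n))"
  by (rule family_Suc) simp_all

lemma family_up_le: "family L V \<Longrightarrow> multi_index d n \<Longrightarrow> act 0 (V n) \<subseteq> V (up n)"
  by (rule familyD(3)) simp_all

lemma hlen_eqI:
  assumes "\<And>n. multi_index d n \<Longrightarrow> len (U n) (V n) = enat (p n)" "\<And>n. p (restrict_index d n) = p n"
  shows "hlen U V = p"
proof
  fix n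
  show "hlen U V n = p n" unfolding hlen_def assms(1)[OF multi_index_restrict] using assms(2) by simp
qed

lemma hlen_restrict: "hlen U V (restrict_index d n) = hlen U V n"
  unfolding hlen_def by (simp add: restrict_index_id)

lemma hlen_add: "multi_index d m \<Longrightarrow> hlen U V (\<lambda>i. n i + m i) = hlen (\<lambda>n. U (\<lambda>i. n i + m i)) (\<lambda>n. V (\<lambda>i. n i + m i)) n"
  unfolding hlen_def restrict_index_add by (simp add: restrict_index_id)

lemma hlen_cong: "(\<And>n. multi_index d n \<Longrightarrow> len (U n) (V n) = len (U' n) (V' n)) \<Longrightarrow> hlen U V = hlen U' V'"
  unfolding hlen_def by (simp only: multi_index_restrict)

text \<open>
  If \<open>I 0\<close> kills \<open>V n / U n\<close>, these quotients have finite length.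
\<close>

lemma family_hilbert_act:
  assumes L: "sub L" and H: "sub H" "L \<subseteq> H" and U: "family L U" and V: "family L V"
    and UV: "\<And>n. multi_index d n \<Longrightarrow> U n \<subseteq> V n" and VH: "\<And>n. multi_index d n \<Longrightarrow> V n \<subseteq> fil L H n"
    and kill: "\<And>n. multi_index d n \<Longrightarrow> act 0 (V n) \<subseteq> U n"
  shows "hilbert_fun d (hlen U V)" "\<And>n. multi_index d n \<Longrightarrow> len (U n) (V n) = enat (hlen U V n)"
proof -
  have fin: "len (U n) (V n) \<noteq> \<infinity>" if n: "multi_index d n" for n
    by (rule finite_length[OF familyD(1)[OF U n] familyD(1)[OF V n] UV[OF n] kill[OF n]])
  show "hilbert_fun d (hlen U V)" "\<And>n. multi_index d n \<Longrightarrow> len (U n) (V n) = enat (hlen U V n)"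
    by (rule family_hilbert[OF L H U V UV VH fin]; assumption)+
qed

lemma hf_hilbert:
  assumes L: "sub L" and H: "sub H" "L \<subseteq> H"
  shows "hilbert_fun d (hf L H)" "\<And>n. multi_index d n \<Longrightarrow> len (fil L H (up n)) (fil L H n) = enat (hf L H n)"
proof -
  note F = fil_family[OF L H(1)]
  have a: "fil L H (up n) \<subseteq> fil L H n" for n by (rule fil_antimono[OF L H(1)]) simp
  show "hilbert_fun d (hf L H)" "\<And>n. multi_index d n \<Longrightarrow> len (fil L H (up n)) (fil L H n) = enat (hf L H n)"
    unfolding hf_def by (rule family_hilbert_act[OF L H family_up[OF F] F a order_refl family_up_le[OF F]]; assumption)+
qed

lemma fil_mono_sub: "sub L \<Longrightarrow> sub H \<Longrightarrow> H' \<subseteq> H \<Longrightarrow> L \<subseteq> H' \<Longrightarrow> sub H' \<Longrightarrow> fil L H' n \<subseteq> fil L H n"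
  unfolding fil_def by (rule plus_mono[OF pw_mono order_refl])

text \<open>
  The exact sequence \<open>0 \<rightarrow> H'/L \<rightarrow> H/L \<rightarrow> H/H' \<rightarrow> 0\<close> is exact on graded components if \<open>H'/L\<close>
  carries the filtration induced from \<open>H/L\<close>; \<open>q\<close> is the Hilbert function of that filtration.
\<close>

lemma hf_split:
  assumes L: "sub L" and H: "sub H" and H': "sub H'" and le: "L \<subseteq> H'" "H' \<subseteq> H"
  defines "q \<equiv> hlen (\<lambda>n. fil L H (up n) \<inter> H') (\<lambda>n. fil L H n \<inter> H')"
  shows "hf L H n = q n + hf H' H n" "hilbert_fun d q"
    "\<And>n. multi_index d n \<Longrightarrow> len (fil L H (up n) \<inter> H') (fil L H n \<inter> H') = enat (q n)"
proof -
  have LH: "L \<subseteq> H" using le by simp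
  note F = fil_family[OF L H]
  have V: "family L (\<lambda>n. fil L H n \<inter> H')" by (rule family_int[OF F family_const[OF H' le(1)]])
  have a: "fil L H (up n) \<subseteq> fil L H n" for n by (rule fil_antimono[OF L H]) simp
  have q: "hilbert_fun d q" "\<And>n. multi_index d n \<Longrightarrow> len (fil L H (up n) \<inter> H') (fil L H n \<inter> H') = enat (q n)"
    unfolding q_def
    by (rule family_hilbert_act[OF L H LH family_up[OF V] V Int_mono[OF a order_refl] Int_lower1 family_up_le[OF V]]; assumption)+
  have plus: "fil L H n \<^bold>+ H' = fil H' H n" for n
    unfolding fil_def plus_assoc[OF sub_pw[OF H] L H'] plus_absorb2[OF L H' le(1)] by (rule refl)
  have "hf L H = (\<lambda>n. q n + hf H' H n)"
    unfolding hf_def[of L H]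
  proof (rule hlen_eqI)
    fix n assume n: "multi_index d n"
    have "len (fil L H (up n)) (fil L H n) = len (fil L H (up n) \<inter> H') (fil L H n \<inter> H') +
        len (fil L H (up n) \<^bold>+ H') (fil L H n \<^bold>+ H')"
      by (rule len_int_plus[OF sub_fil[OF L H] sub_fil[OF L H] H' a])
    then show "len (fil L H (up n)) (fil L H n) = enat (q n + hf H' H n)"
      unfolding plus q(2)[OF n] hf_hilbert(2)[OF H' H le(2) n] by simp
  qed (simp only: q_def hf_def hlen_restrict)
  then show "hf L H n = q n + hf H' H n" by (simp only:)
  show "hilbert_fun d q" "\<And>n. multi_index d n \<Longrightarrow> len (fil L H (up n) \<inter> H') (fil L H n \<inter> H') = enat (q n)" by (rule q; assumption)+
qed

lemma const_quotient:
  assumes L: "sub L" and H: "sub H" and H': "sub H'" and le: "L \<subseteq> H'" "H' \<subseteq> H"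
    and ks: "set ks \<subseteq> {..d}" and c: "const_diff d ks (hf L H) e"
  shows "\<exists>e'. const_diff d ks (hf H' H) e'"
proof -
  note sp = hf_split[OF L H H' le]
  have "hf L H = (\<lambda>n. hlen (\<lambda>n. fil L H (up n) \<inter> H') (\<lambda>n. fil L H n \<inter> H') n + hf H' H n)"
    by (rule ext) (rule sp(1))
  then have "const_diff d ks (\<lambda>n. hlen (\<lambda>n. fil L H (up n) \<inter> H') (\<lambda>n. fil L H n \<inter> H') n + hf H' H n) e"
    using c by (simp only:)
  from const_diff_split[OF sp(2) hf_hilbert(1)[OF H' H le(2)] ks this] show ?thesis by blast
qed

text \<open>
  The filtration \<open>P\<close> of \<open>H'\<close> must be compared with the filtration \<open>K\<close> of \<open>H\<close> without knowing
  that they are close. Let \<open>V n\<close> consist of the elements of \<open>K n\<close> that lie in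
  \<open>P (n - t e\<^sub>0)\<close>; these families increase with \<open>t\<close> and become stationary, and for such \<open>t\<close>
  the family \<open>V\<close> satisfies \<open>V n \<inter> K (n + e\<^sub>0) = V (n + e\<^sub>0)\<close>. So the lengths \<open>w n\<close> of
  \<open>V n / V (n + e\<^sub>0)\<close> are a summand of \<open>hf L H\<close> and have a constant difference \<open>b \<le> e\<close>.
  Finally \<open>V (n + t e\<^sub>0) \<subseteq> P n \<subseteq> V n\<close>, so the length \<open>c1\<close> of \<open>V n / P n\<close> is a summand of a
  finite sum of shifts of \<open>w\<close> and has a constant difference too. Computing the length of
  \<open>V n / P (n + e\<^sub>0)\<close> in two ways gives \<open>hf L H' n + c1 n = c1 (n + e\<^sub>0) + w n\<close>, and \<open>c1\<close>
  cancels.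
\<close>

theorem const_submodule:
  assumes L: "sub L" and H: "sub H" and H': "sub H'" and le: "L \<subseteq> H'" "H' \<subseteq> H"
    and ks: "set ks \<subseteq> {..d}" and c: "const_diff d ks (hf L H) e"
  shows "\<exists>e'\<le>e. const_diff d ks (hf L H') e'"
proof -
  have LH: "L \<subseteq> H" using le by simp
  let ?K = "fil L H" let ?P = "fil L H'"
  \<comment> \<open>\<open>n - t e\<^sub>0\<close>, cut off at zero\<close>
  let ?dn = "\<lambda>t n. n(0 := n 0 - t)"
  note FK = fil_family[OF L H] and FP = fil_family[OF L H']
  note sK = sub_fil[OF L H] and sP = sub_fil[OF L H']
  have PK: "?P n \<subseteq> ?K n" for n by (rule fil_mono_sub[OF L H le(2,1) H'])
  have mdn: "multi_index d (?dn t n)" if "multi_index d n" for n :: "nat \<Rightarrow> nat" and t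
    by (rule multi_index_upd[OF that]) simp
  have aK: "?K (up n) \<subseteq> ?K n" for n by (rule fil_antimono[OF L H]) simp
  have aP: "?P (up n) \<subseteq> ?P n" for n by (rule fil_antimono[OF L H']) simp
  have Pdn_Suc: "?P (?dn t n) \<subseteq> ?P (?dn (Suc t) n)" for t n
  proof (cases "n 0 - t")
    case (Suc k)
    have "?dn t n = up (?dn (Suc t) n)" using Suc by (simp add: fun_eq_iff)
    then show ?thesis using aP by metis
  next
    case 0
    then have "?dn t n = ?dn (Suc t) n" by (simp add: fun_eq_iff)
    then show ?thesis by simp
  qed
  define W where "W = (\<lambda>t n. ?K n \<inter> ?P (?dn t n))"
  have sW: "sub (W t n)" for t n unfolding W_def by (rule sub_int[OF sK sP])
  have fdn: "family L (\<lambda>n. ?P (?dn t n))" for t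
  proof (rule familyI)
    fix n assume n: "multi_index d n"
    show "sub (?P (?dn t n))" "L \<subseteq> ?P (?dn t n)" by (rule familyD[OF FP mdn[OF n]])+
    fix i assume i: "i \<le> d"
    show "act i (?P (?dn t n)) \<subseteq> ?P (?dn t (n(i := Suc (n i))))"
    proof (cases "i = 0 \<and> n 0 < t")
      case True
      then have "?dn t (n(i := Suc (n i))) = ?dn t n" by (simp add: fun_eq_iff)
      then show ?thesis using act_le[OF i sP[of "?dn t n"]] by (simp only:)
    next
      case False
      then have "?dn t (n(i := Suc (n i))) = (?dn t n)(i := Suc (?dn t n i))"
        by (auto simp: fun_eq_iff Suc_diff_le)
      then show ?thesis using familyD(3)[OF FP mdn[OF n] i, of t] by (simp only:)
    qed
  qed
  have FW: "family L (W t)" for t unfolding W_def by (rule family_int[OF FK fdn])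
  have WK: "W t n \<subseteq> ?K n" for t n unfolding W_def by (rule Int_lower1)
  have "W t n \<subseteq> W (Suc t) n" for t n unfolding W_def by (rule Int_mono[OF order_refl Pdn_Suc])
  then have "\<exists>t. \<forall>s\<ge>t. \<forall>n. multi_index d n \<longrightarrow> W s n = W t n"
    by (intro family_noetherian[OF L H LH FW WK])
  then obtain t where t: "\<forall>s\<ge>t. \<forall>n. multi_index d n \<longrightarrow> W s n = W t n" by blast
  define V where "V = W t"
  have FV: "family L V" and sV: "\<And>n. sub (V n)" and VK: "\<And>n. V n \<subseteq> ?K n"
    unfolding V_def by (rule FW sW WK)+
  have V_up: "V n \<inter> ?K (up n) = V (up n)" if n: "multi_index d n" for n
  proof (rule equalityI)
    \<comment> \<open>this is where it matters that \<open>t\<close> is beyond the stationary point\<close>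
    have "?dn (Suc t) (up n) = ?dn t n" by (simp add: fun_eq_iff)
    then have "V n \<inter> ?K (up n) \<subseteq> W (Suc t) (up n)" unfolding V_def W_def by auto
    also have "\<dots> = V (up n)" unfolding V_def using t[rule_format, of "Suc t" "up n"] mi_up[OF n] by simp
    finally show "V n \<inter> ?K (up n) \<subseteq> V (up n)" .
    have "?P (?dn t (up n)) \<subseteq> ?P (?dn (Suc t) (up n))" by (rule Pdn_Suc)
    also have "?dn (Suc t) (up n) = ?dn t n" by (simp add: fun_eq_iff)
    finally have "V (up n) \<subseteq> ?P (?dn t n)" unfolding V_def W_def by blast
    moreover have "V (up n) \<subseteq> ?K (up n)" by (rule VK)
    ultimately show "V (up n) \<subseteq> V n \<inter> ?K (up n)" using aK[of n] unfolding V_def W_def by blast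
  qed
  have aV: "V (up n) \<subseteq> V n" if "multi_index d n" for n using V_up[OF that] by blast
  have PV: "?P n \<subseteq> V n" for n
  proof -
    have "?P n = ?P (?dn 0 n)" by simp
    also have "\<dots> \<subseteq> ?P (?dn t n)"
      by (rule chain_mono[of "\<lambda>t. ?P (?dn t n)", OF Pdn_Suc]) simp
    finally show ?thesis unfolding V_def W_def using PK by blast
  qed
  \<comment> \<open>\<open>w\<close> and \<open>r\<close> are the two summands of \<open>hf L H\<close> coming from \<open>V\<close>\<close>
  define w where "w = hlen (\<lambda>n. V (up n)) V"
  have w: "hilbert_fun d w" "\<And>n. multi_index d n \<Longrightarrow> len (V (up n)) (V n) = enat (w n)"
    unfolding w_def by (rule family_hilbert_act[OF L H LH family_up[OF FV] FV aV VK family_up_le[OF FV]]; assumption)+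
  define r where "r = hlen (\<lambda>n. V n \<^bold>+ ?K (up n)) ?K"
  have Fr: "family L (\<lambda>n. V n \<^bold>+ ?K (up n))" by (rule family_plus[OF FV family_up[OF FK]])
  have rK: "V n \<^bold>+ ?K (up n) \<subseteq> ?K n" for n by (rule plus_least[OF sK VK aK])
  have kr: "act 0 (?K n) \<subseteq> V n \<^bold>+ ?K (up n)" if n: "multi_index d n" for n
    by (rule order_trans[OF family_up_le[OF FK n] plus_upper2[OF sV sK]])
  have r: "hilbert_fun d r" "\<And>n. multi_index d n \<Longrightarrow> len (V n \<^bold>+ ?K (up n)) (?K n) = enat (r n)"
    unfolding r_def by (rule family_hilbert_act[OF L H LH Fr FK rK order_refl kr]; assumption)+
  have "hf L H = (\<lambda>n. w n + r n)" unfolding hf_def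
  proof (rule hlen_eqI)
    fix n assume n: "multi_index d n"
    have "len (?K (up n)) (?K n) = len (?K (up n)) (V n \<^bold>+ ?K (up n)) + len (V n \<^bold>+ ?K (up n)) (?K n)"
      by (rule len_additive[OF sK sub_plus[OF sV sK] sK plus_upper2[OF sV sK] rK])
    also have "len (?K (up n)) (V n \<^bold>+ ?K (up n)) = len (V n \<inter> ?K (up n)) (V n)"
      by (rule len_plus_eq_len_int[OF sV sK])
    finally show "len (?K (up n)) (?K n) = enat (w n + r n)"
      unfolding V_up[OF n] w(2)[OF n] r(2)[OF n] plus_enat_simps .
  qed (simp only: w_def r_def hlen_restrict)
  then have "const_diff d ks (\<lambda>n. w n + r n) e" using c by (simp only:)
  from const_diff_split[OF w(1) r(1) ks this]
  obtain b b' where "0 \<le> b'" "const_diff d ks w b" "e = b + b'" by blast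
  then have b: "b \<le> e" "const_diff d ks w b" by simp_all
  \<comment> \<open>\<open>V n / V (n + s e\<^sub>0)\<close> has length \<open>w n + \<cdots> + w (n + (s-1) e\<^sub>0)\<close>\<close>
  define S where "S = (\<lambda>s (j::nat). if j = 0 then s else (0::nat))"
  have mS: "multi_index d (S s)" for s unfolding S_def multi_index_def by simp
  have nS: "(\<lambda>i. n i + S s i) = n(0 := n 0 + s)" for n s unfolding S_def by (rule ext) simp
  have VSP: "V (n(0 := n 0 + t)) \<subseteq> ?P n" for n
  proof -
    have "?dn t (n(0 := n 0 + t)) = n" by (simp add: fun_eq_iff)
    then show ?thesis unfolding V_def W_def by auto
  qed
  have lenS: "len (V (n(0 := n 0 + s))) (V n) = enat (\<Sum>j<s. w (n(0 := n 0 + j)))" and VS: "V (n(0 := n 0 + s)) \<subseteq> V n"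
    if n: "multi_index d n" for n s
  proof (induction s)
    case 0
    { case 1 show ?case using len_same[OF sV[of n]] by (simp add: zero_enat_def) }
    { case 2 show ?case by simp }
  next
    case (Suc s)
    let ?n = "n(0 := n 0 + s)"
    have mn: "multi_index d ?n" by (rule multi_index_upd[OF n]) simp
    have eq: "n(0 := n 0 + Suc s) = up ?n" by (simp add: fun_eq_iff)
    have sub: "V (up ?n) \<subseteq> V ?n" by (rule aV[OF mn])
    { case 1
      have "len (V (up ?n)) (V n) = len (V (up ?n)) (V ?n) + len (V ?n) (V n)"
        by (rule len_additive[OF sV sV sV sub Suc(2)])
      then show ?case unfolding eq w(2)[OF mn] Suc(1) plus_enat_simps sum.lessThan_Suc by (simp only: add.commute) }
    { case 2 show ?case unfolding eq using sub Suc(2) by (rule order_trans) }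
  qed
  define c1 where "c1 = hlen ?P V"
  have finP: "len (?P n) (V n) \<noteq> \<infinity>" if n: "multi_index d n" for n
  proof -
    have "len (?P n) (V n) \<le> len (V (n(0 := n 0 + t))) (V n)"
      by (rule len_mono[OF sV VSP PV order_refl])
    then show ?thesis unfolding lenS[OF n] by (metis infinity_ileE)
  qed
  have c1: "hilbert_fun d c1" "\<And>n. multi_index d n \<Longrightarrow> len (?P n) (V n) = enat (c1 n)"
    unfolding c1_def by (rule family_hilbert[OF L H LH FP FV PV VK finP]; assumption)+
  define c2 where "c2 = hlen (\<lambda>n. V (n(0 := n 0 + t))) ?P"
  have FVS: "family L (\<lambda>n. V (n(0 := n 0 + t)))"
    using family_add[OF FV mS[of t]] unfolding nS .
  have fin2: "len (V (n(0 := n 0 + t))) (?P n) \<noteq> \<infinity>" if n: "multi_index d n" for n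
  proof -
    have "len (V (n(0 := n 0 + t))) (?P n) \<le> len (V (n(0 := n 0 + t))) (V n)"
      by (rule len_mono[OF sV order_refl VSP PV])
    then show ?thesis unfolding lenS[OF n] by (metis infinity_ileE)
  qed
  have c2: "hilbert_fun d c2" "\<And>n. multi_index d n \<Longrightarrow> len (V (n(0 := n 0 + t))) (?P n) = enat (c2 n)"
    unfolding c2_def by (rule family_hilbert[OF L H LH FVS FP VSP PK fin2]; assumption)+
  have c12: "(\<lambda>n. c2 n + c1 n) = (\<lambda>n. \<Sum>j<t. w (n(0 := n 0 + j)))"
  proof -
    have eq: "c2 n + c1 n = (\<Sum>j<t. w (n(0 := n 0 + j)))" if n: "multi_index d n" for n
    proof -
      have "len (V (n(0 := n 0 + t))) (V n) = len (V (n(0 := n 0 + t))) (?P n) + len (?P n) (V n)"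
        by (rule len_additive[OF sV sP sV VSP PV])
      then show ?thesis unfolding lenS[OF n] c1(2)[OF n] c2(2)[OF n] by simp
    qed
    show ?thesis
    proof
      fix n
      have "w ((restrict_index d n)(0 := restrict_index d n 0 + j)) = w (n(0 := n 0 + j))" for j
        by (rule hilbert_fun_ext[OF w(1)]) (simp add: restrict_index_def)
      moreover have "c1 (restrict_index d n) = c1 n" "c2 (restrict_index d n) = c2 n"
        unfolding c1_def c2_def by (rule hlen_restrict)+
      ultimately show "c2 n + c1 n = (\<Sum>j<t. w (n(0 := n 0 + j)))"
        using eq[OF multi_index_restrict, of n] by simp
    qed
  qed
  have "const_diff d ks (\<lambda>n. \<Sum>j<t. w (n(0 := n 0 + j))) (\<Sum>j<t. b)"
    by (rule const_diff_sum) (use const_diff_shift[OF b(2), of "S _"] in \<open>simp_all add: nS\<close>)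
  from const_diff_split[OF c2(1) c1(1) ks this[folded c12]]
  obtain b1 where b1: "const_diff d ks c1 b1" by blast
  \<comment> \<open>the length of \<open>V n / P (n + e\<^sub>0)\<close>, computed through \<open>P n\<close> and through \<open>V (n + e\<^sub>0)\<close>\<close>
  have "(\<lambda>n. hf L H' n + c1 n) = (\<lambda>n. c1 (up n) + w n)"
  proof
    fix n
    let ?n = "restrict_index d n"
    have n: "multi_index d ?n" by (rule multi_index_restrict)
    have "len (?P (up ?n)) (V ?n) = len (?P (up ?n)) (?P ?n) + len (?P ?n) (V ?n)"
      by (rule len_additive[OF sP sP sV aP PV])
    also have "\<dots> = enat (hf L H' ?n + c1 ?n)"
      unfolding hf_hilbert(2)[OF L H' le(1) n] c1(2)[OF n] by simp
    finally have 1: "len (?P (up ?n)) (V ?n) = enat (hf L H' ?n + c1 ?n)" .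
    have "len (?P (up ?n)) (V ?n) = len (?P (up ?n)) (V (up ?n)) + len (V (up ?n)) (V ?n)"
      by (rule len_additive[OF sP sV sV PV aV[OF n]])
    also have "\<dots> = enat (c1 (up ?n) + w ?n)"
      unfolding c1(2)[OF mi_up[OF n]] w(2)[OF n] by simp
    finally have "hf L H' ?n + c1 ?n = c1 (up ?n) + w ?n" using 1 by simp
    moreover have "c1 (up ?n) = c1 (up n)" by (rule hilbert_fun_ext[OF c1(1)]) (simp add: restrict_index_def)
    ultimately show "hf L H' n + c1 n = c1 (up n) + w n"
      unfolding hf_def c1_def w_def hlen_restrict by simp
  qed
  moreover have "const_diff d ks (\<lambda>n. c1 (up n) + w n) (b1 + b)"
    by (rule const_diff_add[OF const_diff_Suc[OF b1] b(2)])
  ultimately have "const_diff d ks (\<lambda>n. hf L H' n + c1 n) (b + b1)" by (simp add: add.commute)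
  from const_diff_cancel[OF this b1] show ?thesis using b(1) by blast
qed

lemma hf_pw: "sub L \<Longrightarrow> sub H \<Longrightarrow> L \<subseteq> H \<Longrightarrow> multi_index d m \<Longrightarrow> hf L (pw m H \<^bold>+ L) n = hf L H (\<lambda>i. n i + m i)"
proof -
  assume L: "sub L" and H: "sub H" and LH: "L \<subseteq> H" and m: "multi_index d m"
  have eq: "fil L (pw m H \<^bold>+ L) n = fil L H (\<lambda>i. n i + m i)" for n
  proof -
    have "pw n (pw m H \<^bold>+ L) \<^bold>+ L = pw n (pw m H) \<^bold>+ (pw n L \<^bold>+ L)"
      unfolding pw_plus[OF sub_pw[OF H] L] by (rule plus_assoc[OF sub_pw[OF sub_pw[OF H]] sub_pw[OF L] L])
    also have "pw n L \<^bold>+ L = L" by (rule plus_absorb2[OF sub_pw[OF L] L pw_le[OF L]])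
    finally show ?thesis unfolding fil_def pw_add[OF H] .
  qed
  have up_add: "(\<lambda>i. up n i + m i) = up (\<lambda>i. n i + m i)" for n by (rule ext) simp
  show "hf L (pw m H \<^bold>+ L) n = hf L H (\<lambda>i. n i + m i)"
    unfolding hf_def hlen_add[OF m] eq up_add by (rule refl)
qed

text \<open>
  Passing to a submodule does not increase the constant, and the Hilbert function of
  \<open>I^m H + L\<close> is a shift of that of \<open>H\<close>; the submodule \<open>H'\<close> lies between these two.
\<close>

theorem const_sandwich:
  assumes L: "sub L" and H: "sub H" and H': "sub H'" and le: "L \<subseteq> H'" "H' \<subseteq> H"
    and m: "multi_index d m" "pw m H \<subseteq> H'"
    and ks: "set ks \<subseteq> {..d}" and c: "const_diff d ks (hf L H) e"
  shows "const_diff d ks (hf L H') e"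
proof -
  have LH: "L \<subseteq> H" using le by simp
  obtain e' where e': "e' \<le> e" "const_diff d ks (hf L H') e'"
    using const_submodule[OF L H H' le ks c] by blast
  have s: "sub (pw m H \<^bold>+ L)" by (rule sub_plus[OF sub_pw[OF H] L])
  have "pw m H \<^bold>+ L \<subseteq> H'" by (rule plus_least[OF H' m(2) le(1)])
  from const_submodule[OF L H' s plus_upper2[OF sub_pw[OF H] L] this ks e'(2)]
  obtain e'' where e'': "e'' \<le> e'" "const_diff d ks (hf L (pw m H \<^bold>+ L)) e''" by blast
  have "hf L (pw m H \<^bold>+ L) = (\<lambda>n. hf L H (\<lambda>i. n i + m i))" by (rule ext) (rule hf_pw[OF L H LH m(1)])
  then have "const_diff d ks (hf L (pw m H \<^bold>+ L)) e" using const_diff_shift[OF c] by (simp only:)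
  then have "e'' = e" using e''(2) by (rule const_diff_unique[rotated])
  then show ?thesis using e' e'' by (metis order_antisym)
qed

text \<open>
  By the Artin--Rees lemma the induced filtration is, up to a shift, the filtration of a
  submodule between \<open>I^m H'\<close> and \<open>H'\<close>, and \<open>const_sandwich\<close> applies.
\<close>

theorem const_induced:
  assumes L: "sub L" and H: "sub H" and H': "sub H'" and le: "L \<subseteq> H'" "H' \<subseteq> H"
    and ks: "set ks \<subseteq> {..d}" and c: "const_diff d ks (hf L H') e"
  shows "const_diff d ks (hlen (\<lambda>n. fil L H (up n) \<inter> H') (\<lambda>n. fil L H n \<inter> H')) e"
proof -
  have LH: "L \<subseteq> H" using le by simp
  let ?V = "\<lambda>n. fil L H n \<inter> H'"
  have V: "family L ?V" by (rule family_int[OF fil_family[OF L H] family_const[OF H' le(1)]])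
  obtain m where m: "multi_index d m" and AR: "\<And>n. multi_index d n \<Longrightarrow> ?V (\<lambda>i. n i + m i) = fil L (?V m) n"
    using artin_rees[OF L H LH V Int_lower1] by blast
  have s: "sub (?V m)" and Ls: "L \<subseteq> ?V m" by (rule familyD[OF V m])+
  have pm: "pw m H' \<subseteq> ?V m"
  proof (rule Int_greatest)
    have "pw m H' \<subseteq> pw m H" by (rule pw_mono[OF H le(2)])
    then show "pw m H' \<subseteq> fil L H m" unfolding fil_def by (rule order_trans[OF _ plus_upper1[OF sub_pw[OF H] L]])
    show "pw m H' \<subseteq> H'" by (rule pw_le[OF H'])
  qed
  have *: "const_diff d ks (hf L (?V m)) e"
    by (rule const_sandwich[OF L H' s Ls Int_lower2 m pm ks c])
  have up_add: "(\<lambda>i. up n i + m i) = up (\<lambda>i. n i + m i)" for n by (rule ext) simp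
  have "hf L (?V m) = (\<lambda>n. hlen (\<lambda>n. ?V (up n)) ?V (\<lambda>i. n i + m i))"
  proof
    fix n
    show "hf L (?V m) n = hlen (\<lambda>n. ?V (up n)) ?V (\<lambda>i. n i + m i)"
      unfolding hf_def hlen_add[OF m]
    proof (rule fun_cong[OF hlen_cong])
      fix n assume n: "multi_index d n"
      show "len (fil L (?V m) (up n)) (fil L (?V m) n) = len (?V (up (\<lambda>i. n i + m i))) (?V (\<lambda>i. n i + m i))"
        using AR[OF n] AR[OF mi_up[OF n]] unfolding up_add by (simp only:)
    qed
  qed
  then have "const_diff d ks (\<lambda>n. hlen (\<lambda>n. ?V (up n)) ?V (\<lambda>i. n i + m i)) e" using * by (simp only:)
  then show ?thesis unfolding const_diff_shift_iff[OF m] .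
qed

text \<open>
  In \<open>hf_split\<close> the submodule contributes with the induced filtration, which by
  \<open>const_induced\<close> has the same constant differences as its own filtration. This is the
  additivity of mixed multiplicities.
\<close>

theorem const_extension:
  assumes L: "sub L" and H: "sub H" and H': "sub H'" and le: "L \<subseteq> H'" "H' \<subseteq> H"
    and ks: "set ks \<subseteq> {..d}" and c: "const_diff d ks (hf L H') e" "const_diff d ks (hf H' H) e'"
  shows "const_diff d ks (hf L H) (e + e')"
proof -
  have "hf L H = (\<lambda>n. hlen (\<lambda>n. fil L H (up n) \<inter> H') (\<lambda>n. fil L H n \<inter> H') n + hf H' H n)"
    by (rule ext) (rule hf_split(1)[OF L H H' le])
  then show ?thesis
    using const_diff_add[OF const_induced[OF L H H' le ks c(1)] c(2)] by (simp only:)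
qed

lemma fil_absorb:
  assumes X: "sub X" and Y: "sub Y" shows "fil X (Y \<^bold>+ X) n = pw n Y \<^bold>+ X"
  unfolding fil_def pw_plus[OF Y X] plus_assoc[OF sub_pw[OF Y] sub_pw[OF X] X]
    plus_absorb2[OF sub_pw[OF X] X pw_le[OF X]] by (rule refl)

lemma hf_scale:
  assumes y: "y \<in> carrier R" and L: "sub L" and U: "sub U"
  shows "hf L (y \<^bold>* U \<^bold>+ L) = hf (L \<^bold>: y) (U \<^bold>+ (L \<^bold>: y))"
proof -
  have yU: "sub (y \<^bold>* U)" using y U by (rule sub_scale)
  have C: "sub (L \<^bold>: y)" using y L by (rule sub_colon)
  have 1: "fil L (y \<^bold>* U \<^bold>+ L) n = y \<^bold>* pw n U \<^bold>+ L" for n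
    unfolding fil_absorb[OF L yU] unfolding pw_def ideal_act_scale[OF monomial_carrier y U] by (rule refl)
  have 2: "fil (L \<^bold>: y) (U \<^bold>+ (L \<^bold>: y)) n = pw n U \<^bold>+ (L \<^bold>: y)" for n by (rule fil_absorb[OF C U])
  show ?thesis unfolding hf_def 1 2
  proof (rule hlen_cong)
    fix n
    have "pw (up n) U \<subseteq> pw n U" unfolding pw_Suc[OF le0 U] by (rule act_le[OF le0 sub_pw[OF U]])
    then show "len (y \<^bold>* pw (up n) U \<^bold>+ L) (y \<^bold>* pw n U \<^bold>+ L) = len (pw (up n) U \<^bold>+ (L \<^bold>: y)) (pw n U \<^bold>+ (L \<^bold>: y))"
      by (rule len_scale_colon[OF y L sub_pw[OF U] sub_pw[OF U]])
  qed
qed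

lemma hf_self: "sub L \<Longrightarrow> hf L L = (\<lambda>n. 0)"
proof -
  assume L: "sub L"
  have "fil L L n = L" for n unfolding fil_def by (rule plus_absorb2[OF sub_pw[OF L] L pw_le[OF L]])
  then show ?thesis unfolding hf_def by (intro hlen_eqI) (simp_all add: len_same[OF L] zero_enat_def)
qed

abbreviation "N \<equiv> carrier M"

lemma sub_N: "sub N" by (rule carrier_is_submodule)
lemma sub_le_N: "sub U \<Longrightarrow> U \<subseteq> N" by (rule submoduleE(1))
lemma plus_N: "sub U \<Longrightarrow> N \<^bold>+ U = N" by (rule plus_absorb1[OF sub_N _ sub_le_N])

text \<open>
  By induction on \<open>t\<close>: \<open>(x^t N + L)/(x^{t+1} N + L)\<close> is a quotient of \<open>N/(xN + L)\<close>, by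
  multiplication with \<open>x^t\<close>.
\<close>

lemma const_power:
  assumes x: "x \<in> carrier R" and L: "sub L" and ks: "set ks \<subseteq> {..d}"
    and c: "const_diff d ks (hf (x \<^bold>* N \<^bold>+ L) N) e"
  shows "\<exists>e. const_diff d ks (hf ((x [^] (t::nat)) \<^bold>* N \<^bold>+ L) N) e"
proof (induction t)
  case 0
  have "(x [^] (0::nat)) \<^bold>* N \<^bold>+ L = N" by (simp add: scale_one[OF sub_N] plus_N[OF L])
  then show ?case using const_diff_zero by (simp only: hf_self[OF sub_N]) blast
next
  case (Suc t)
  let ?y = "x [^] t" let ?z = "x [^] Suc t"
  have yz: "?y \<in> carrier R" "?z \<in> carrier R" using x by simp_all
  note s = sub_scale[OF yz(1) sub_N] sub_scale[OF yz(2) sub_N] sub_scale[OF x sub_N]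
  let ?L1 = "?z \<^bold>* N \<^bold>+ L"
  have L1: "sub ?L1" by (rule sub_plus[OF s(2) L])
  have L0: "sub (?y \<^bold>* N \<^bold>+ L)" by (rule sub_plus[OF s(1) L])
  have zy: "?z \<^bold>* N = ?y \<^bold>* x \<^bold>* N" using scale_scale[OF yz(1) x sub_N] by simp
  have zyN: "?z \<^bold>* N \<subseteq> ?y \<^bold>* N" unfolding zy by (rule scale_mono[OF sub_le_N[OF s(3)]])
  have le: "?L1 \<subseteq> ?y \<^bold>* N \<^bold>+ L" by (rule plus_mono[OF zyN order_refl])
  have C: "sub (?L1 \<^bold>: ?y)" by (rule sub_colon[OF yz(1) L1])
  have "x \<^bold>* N \<^bold>+ L \<subseteq> ?L1 \<^bold>: ?y"
  proof (rule plus_least[OF C])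
    have "?y \<^bold>* x \<^bold>* N \<subseteq> ?L1" unfolding zy[symmetric] by (rule plus_upper1[OF s(2) L])
    then show "x \<^bold>* N \<subseteq> ?L1 \<^bold>: ?y" unfolding colon_elem_def using sub_le_N[OF s(3)] by blast
    show "L \<subseteq> ?L1 \<^bold>: ?y"
      by (rule order_trans[OF subset_colon[OF yz(1) L] colon_mono[OF plus_upper2[OF s(2) L]]])
  qed
  from const_quotient[OF sub_plus[OF s(3) L] sub_N C this sub_le_N[OF C] ks c]
  obtain e1 where e1: "const_diff d ks (hf (?L1 \<^bold>: ?y) N) e1" by blast
  have eq: "?y \<^bold>* N \<^bold>+ ?L1 = ?y \<^bold>* N \<^bold>+ L"
    unfolding plus_assoc[OF s(1) s(2) L, symmetric] plus_absorb1[OF s(1) s(2) zyN] by (rule refl)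
  have "hf ?L1 (?y \<^bold>* N \<^bold>+ L) = hf (?L1 \<^bold>: ?y) N"
    using hf_scale[OF yz(1) L1 sub_N] unfolding eq plus_N[OF C] .
  then have "const_diff d ks (hf ?L1 (?y \<^bold>* N \<^bold>+ L)) e1" using e1 by (simp only:)
  moreover obtain e2 where "const_diff d ks (hf (?y \<^bold>* N \<^bold>+ L) N) e2" using Suc by blast
  ultimately show ?case using const_extension[OF L1 sub_N L0 le sub_le_N[OF L0] ks] by blast
qed

text \<open>
  The chain \<open>L : x^i\<close> stabilises at some \<open>t\<close>. If \<open>x^t m + l\<close> with \<open>l \<in> L\<close> is killed by \<open>x\<close>
  modulo \<open>L\<close>, then \<open>m \<in> L : x^{t+1} = L : x^t\<close>.
\<close>

lemma colon_stable:
  assumes x: "x \<in> carrier R" and L: "sub L"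
  shows "\<exists>t. (L \<^bold>: x) \<inter> ((x [^] (t::nat)) \<^bold>* N \<^bold>+ L) \<subseteq> L"
proof -
  have xt: "x [^] (t::nat) \<in> carrier R" for t using x by simp
  have "\<exists>c::nat. \<forall>i\<ge>c. L \<^bold>: (x [^] i) = L \<^bold>: (x [^] c)"
  proof (rule ascending_chain[of "\<lambda>i::nat. L \<^bold>: (x [^] i)"])
    show "sub (L \<^bold>: (x [^] (i::nat)))" for i by (rule sub_colon[OF xt L])
    show "L \<^bold>: (x [^] (i::nat)) \<subseteq> L \<^bold>: (x [^] Suc i)" for i
    proof
      fix m assume "m \<in> L \<^bold>: (x [^] i)"
      then have m: "m \<in> N" "(x [^] i) \<odot>\<^bsub>M\<^esub> m \<in> L" by (simp_all add: colon_iff)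
      have "(x [^] Suc i) \<odot>\<^bsub>M\<^esub> m = x \<odot>\<^bsub>M\<^esub> ((x [^] i) \<odot>\<^bsub>M\<^esub> m)"
        using m(1) x by (simp add: smult_assoc1[symmetric] R.m_comm)
      then show "m \<in> L \<^bold>: (x [^] Suc i)" using m sub_smultD[OF L x m(2)] by (simp add: colon_iff)
    qed
  qed
  then obtain t :: nat where t: "\<forall>i\<ge>t. L \<^bold>: (x [^] i) = L \<^bold>: (x [^] t)" by blast
  have "(L \<^bold>: x) \<inter> ((x [^] t) \<^bold>* N \<^bold>+ L) \<subseteq> L"
  proof
    fix u assume u: "u \<in> (L \<^bold>: x) \<inter> ((x [^] t) \<^bold>* N \<^bold>+ L)"
    then obtain m l where ml: "m \<in> N" "l \<in> L" "u = (x [^] t) \<odot>\<^bsub>M\<^esub> m \<oplus>\<^bsub>M\<^esub> l" by (auto elim!: plusE)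
    have lc: "l \<in> N" by (rule sub_carrier[OF L ml(2)])
    have "x \<odot>\<^bsub>M\<^esub> u \<in> L" using u by (simp add: colon_iff)
    moreover have "x \<odot>\<^bsub>M\<^esub> u = (x [^] Suc t) \<odot>\<^bsub>M\<^esub> m \<oplus>\<^bsub>M\<^esub> x \<odot>\<^bsub>M\<^esub> l"
      unfolding ml(3) using ml(1) lc x by (simp add: smult_r_distr smult_assoc1[symmetric] R.m_comm)
    ultimately have "(x [^] Suc t) \<odot>\<^bsub>M\<^esub> m \<oplus>\<^bsub>M\<^esub> x \<odot>\<^bsub>M\<^esub> l \<in> L" by (simp only:)
    then have "(x [^] Suc t) \<odot>\<^bsub>M\<^esub> m \<in> L"
      by (rule sub_diffD[OF L smult_closed[OF xt ml(1)] sub_smultD[OF L x ml(2)]])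
    then have "m \<in> L \<^bold>: (x [^] Suc t)" using ml(1) by (simp add: colon_iff)
    also have "L \<^bold>: (x [^] Suc t) = L \<^bold>: (x [^] t)" using t[rule_format, of "Suc t"] by simp
    finally have "(x [^] t) \<odot>\<^bsub>M\<^esub> m \<in> L" by (simp add: colon_iff)
    then show "u \<in> L" unfolding ml(3) using sub_addD[OF L _ ml(2)] by blast
  qed
  then show ?thesis by blast
qed

text \<open>
  If \<open>K \<inter> Z = L\<close>, then \<open>K/L\<close> is isomorphic to \<open>(K + Z)/Z\<close>.
\<close>

lemma hf_disjoint:
  assumes L: "sub L" and K: "sub K" "L \<subseteq> K" and Z: "sub Z" "L \<subseteq> Z" and int: "K \<inter> Z \<subseteq> L"
  shows "hf Z (K \<^bold>+ Z) = hf L K"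
proof -
  have 1: "fil Z (K \<^bold>+ Z) n = fil L K n \<^bold>+ Z" for n
  proof -
    have "fil Z (K \<^bold>+ Z) n = pw n K \<^bold>+ (pw n Z \<^bold>+ Z)"
      unfolding fil_def pw_plus[OF K(1) Z(1)] by (rule plus_assoc[OF sub_pw[OF K(1)] sub_pw[OF Z(1)] Z(1)])
    also have "pw n Z \<^bold>+ Z = L \<^bold>+ Z"
      unfolding plus_absorb2[OF sub_pw[OF Z(1)] Z(1) pw_le[OF Z(1)]] plus_absorb2[OF L Z] by (rule refl)
    finally show ?thesis unfolding fil_def plus_assoc[OF sub_pw[OF K(1)] L Z(1)] .
  qed
  have int': "fil L K n \<inter> Z = L" for n
  proof -
    have "L \<subseteq> fil L K n" unfolding fil_def by (rule plus_upper2[OF sub_pw[OF K(1)] L])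
    then show ?thesis using fil_le[OF L K, of n] int Z(2) by blast
  qed
  show ?thesis unfolding hf_def 1
  proof (rule hlen_cong)
    fix n
    have "len (fil L K (up n)) (fil L K n) = len (fil L K (up n) \<inter> Z) (fil L K n \<inter> Z) +
        len (fil L K (up n) \<^bold>+ Z) (fil L K n \<^bold>+ Z)"
      by (rule len_int_plus[OF sub_fil[OF L K(1)] sub_fil[OF L K(1)] Z(1) fil_antimono[OF L K(1)]]) simp
    then show "len (fil L K (up n) \<^bold>+ Z) (fil L K n \<^bold>+ Z) = len (fil L K (up n)) (fil L K n)"
      unfolding int' len_same[OF L] by simp
  qed
qed

text \<open>
  By \<open>colon_stable\<close> and \<open>hf_disjoint\<close> the module \<open>(L : x)/L\<close> embeds into \<open>N/(x^t N + L)\<close>,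
  whose differences are constant by \<open>const_power\<close>.
\<close>

lemma const_colon:
  assumes x: "x \<in> carrier R" and L: "sub L" and ks: "set ks \<subseteq> {..d}"
    and c: "const_diff d ks (hf (x \<^bold>* N \<^bold>+ L) N) e"
  shows "\<exists>e. const_diff d ks (hf L (L \<^bold>: x)) e"
proof -
  let ?K = "L \<^bold>: x"
  have K: "sub ?K" "L \<subseteq> ?K" using x L by (simp_all add: sub_colon subset_colon)
  obtain t where t: "?K \<inter> ((x [^] (t::nat)) \<^bold>* N \<^bold>+ L) \<subseteq> L" using colon_stable[OF x L] by blast
  let ?Z = "(x [^] t) \<^bold>* N \<^bold>+ L"
  have xt: "x [^] t \<in> carrier R" using x by simp
  have Z: "sub ?Z" "L \<subseteq> ?Z" by (rule sub_plus[OF sub_scale[OF xt sub_N] L], rule plus_upper2[OF sub_scale[OF xt sub_N] L])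
  obtain e1 where "const_diff d ks (hf ?Z N) e1" using const_power[OF x L ks c] by blast
  from const_submodule[OF Z(1) sub_N sub_plus[OF K(1) Z(1)] plus_upper2[OF K(1) Z(1)] sub_le_N[OF sub_plus[OF K(1) Z(1)]] ks this]
  obtain e2 where "const_diff d ks (hf ?Z (?K \<^bold>+ ?Z)) e2" by blast
  then show ?thesis unfolding hf_disjoint[OF L K Z t] by blast
qed

text \<open>
  Let \<open>K = L : x\<close> and \<open>L' = xN + L\<close>. Split \<open>hf L N\<close> at degree \<open>n\<close> along \<open>K\<close> and at degree
  \<open>n + e\<^sub>i\<close> along \<open>L'\<close>. Superficiality identifies the part of the second splitting inside
  \<open>L'\<close> with \<open>hf K N n\<close>, which is also the quotient part of the first splitting. Subtracting
  leaves \<open>hf L' N (n + e\<^sub>i) - q n\<close>, where \<open>q\<close> belongs to the filtration induced on \<open>K\<close>.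
\<close>

theorem superficial_step:
  assumes i: "i \<le> d" and x: "x \<in> I i" and L: "sub L" and ks: "set ks \<subseteq> {..d}"
    and super: "for_all_large d (\<lambda>n. (x \<^bold>* N \<^bold>+ L) \<inter> (act i (pw n N) \<^bold>+ L) = x \<^bold>* pw n N \<^bold>+ L)"
    and c: "const_diff d ks (hf (x \<^bold>* N \<^bold>+ L) N) e'"
  shows "\<exists>e''. const_diff d ks (hf L (L \<^bold>: x)) e'' \<and> const_diff d (i # ks) (hf L N) (e' - e'')"
proof -
  have xc: "x \<in> carrier R" using I_carrier[OF i] x by blast
  let ?K = "L \<^bold>: x" let ?L' = "x \<^bold>* N \<^bold>+ L"
  have K: "sub ?K" "L \<subseteq> ?K" using xc L by (simp_all add: sub_colon subset_colon)
  have L': "sub ?L'" "L \<subseteq> ?L'" by (rule sub_plus[OF sub_scale[OF xc sub_N] L], rule plus_upper2[OF sub_scale[OF xc sub_N] L])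
  obtain e'' where e'': "const_diff d ks (hf L ?K) e''" using const_colon[OF xc L ks c] by blast
  define q where "q = hlen (\<lambda>n. fil L N (up n) \<inter> ?K) (\<lambda>n. fil L N n \<inter> ?K)"
  have q: "const_diff d ks q e''" unfolding q_def
    by (rule const_induced[OF L sub_N K(1,2) sub_le_N[OF K(1)] ks e''])
  note qs = hf_split[OF L sub_N K sub_le_N[OF K(1)], folded q_def]
  define q' where "q' = hlen (\<lambda>n. fil L N (up n) \<inter> ?L') (\<lambda>n. fil L N n \<inter> ?L')"
  note q's = hf_split[OF L sub_N L' sub_le_N[OF L'(1)], folded q'_def]
  \<comment> \<open>the intersection needed in degree \<open>n\<close> and, for the lower end of the interval, in
    degree \<open>n + e\<^sub>0\<close>\<close>
  have large: "for_all_large d (\<lambda>n. fil L N (n(i := Suc (n i))) \<inter> ?L' = x \<^bold>* pw n N \<^bold>+ L)"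
    using super by (rule for_all_large_mono) (simp only: fil_def pw_Suc[OF i sub_N] Int_commute)
  have "for_all_large d (\<lambda>n. q' (n(i := Suc (n i))) = hf ?K N n)"
  proof (rule for_all_large_mono[OF for_all_large_conj[OF large for_all_large_Suc[OF large, of 0]]])
    fix n
    assume *: "fil L N (n(i := Suc (n i))) \<inter> ?L' = x \<^bold>* pw n N \<^bold>+ L \<and>
      fil L N ((up n)(i := Suc (up n i))) \<inter> ?L' = x \<^bold>* pw (up n) N \<^bold>+ L"
    let ?n = "restrict_index d n" let ?m = "?n(i := Suc (?n i))"
    have n: "multi_index d ?n" and m: "multi_index d ?m" using i by (simp_all add: multi_index_upd)
    have comm: "up ?m = (up ?n)(i := Suc (up ?n i))" by (simp add: fun_eq_iff)
    have r: "restrict_index d (n(i := Suc (n i))) = ?m" "restrict_index d (up n) = up ?n"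
      "restrict_index d ((up n)(i := Suc (up n i))) = (up ?n)(i := Suc (up ?n i))"
      using i by (simp_all only: restrict_index_Suc le0)
    have f: "fil L N ?m \<inter> ?L' = x \<^bold>* pw ?n N \<^bold>+ L" "fil L N (up ?m) \<inter> ?L' = x \<^bold>* pw (up ?n) N \<^bold>+ L"
    proof -
      have e1: "fil L N ?m = fil L N (n(i := Suc (n i)))"
        using fil_restrict[of L N "n(i := Suc (n i))"] unfolding r(1) .
      have e2: "fil L N (up ?m) = fil L N ((up n)(i := Suc (up n i)))"
        using fil_restrict[of L N "(up n)(i := Suc (up n i))"] unfolding r(3) comm .
      have e4: "pw (up ?n) N = pw (up n) N" using pw_restrict[of "up n" N] unfolding r(2) .
      show "fil L N ?m \<inter> ?L' = x \<^bold>* pw ?n N \<^bold>+ L" "fil L N (up ?m) \<inter> ?L' = x \<^bold>* pw (up ?n) N \<^bold>+ L"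
        unfolding e1 e2 pw_restrict e4 by (rule conjunct1[OF *], rule conjunct2[OF *])
    qed
    have "pw (up ?n) N \<subseteq> pw ?n N" unfolding pw_Suc[OF le0 sub_N] by (rule act_le[OF le0 sub_pw[OF sub_N]])
    from len_scale_colon[OF xc L sub_pw[OF sub_N] sub_pw[OF sub_N] this]
    have "len (fil L N (up ?m) \<inter> ?L') (fil L N ?m \<inter> ?L') = len (fil ?K N (up ?n)) (fil ?K N ?n)"
      unfolding f unfolding fil_def .
    then have "enat (q' ?m) = enat (hf ?K N ?n)"
      unfolding q's(3)[OF m] hf_hilbert(2)[OF K(1) sub_N sub_le_N[OF K(1)] n] .
    then show "q' (n(i := Suc (n i))) = hf ?K N n"
      unfolding r(1)[symmetric] q'_def hf_def hlen_restrict by simp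
  qed
  then have eq: "for_all_large d (\<lambda>n. mdiff i (\<lambda>n. int (hf L N n)) n = int (hf ?L' N (n(i := Suc (n i)))) - int (q n))"
  proof (rule for_all_large_mono)
    fix n assume *: "q' (n(i := Suc (n i))) = hf ?K N n"
    show "mdiff i (\<lambda>n. int (hf L N n)) n = int (hf ?L' N (n(i := Suc (n i)))) - int (q n)"
      unfolding mdiff_def qs(1)[of n] q's(1)[of "n(i := Suc (n i))"] * by simp
  qed
  have "const_diff d (i # ks) (hf L N) (e' - e'')"
    unfolding const_diff_def mdiffs.simps
  proof (rule for_all_large_mono)
    show "for_all_large d (\<lambda>n. (mdiffs ks (mdiff i (\<lambda>n. int (hf L N n))) n =
        mdiffs ks (\<lambda>n. int (hf ?L' N (n(i := Suc (n i)))) - int (q n)) n) \<and>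
        mdiffs ks (\<lambda>n. int (hf ?L' N (n(i := Suc (n i))))) n = e' \<and> mdiffs ks (\<lambda>n. int (q n)) n = e'')"
      by (intro for_all_large_conj mdiffs_cong_large[OF eq] q[unfolded const_diff_def]
          const_diff_Suc[OF c, unfolded const_diff_def])
  qed (simp only: mdiffs_diff)
  then show ?thesis using e'' by blast
qed

end

section \<open>Associated primes and modules of dimension at most one\<close>

text \<open>
  The union of a chain of ideals belongs to the chain, so Zorn's lemma needs no further
  closure property.
\<close>

lemma (in noetherian_ring) maximal_ideal_in_set:
  assumes "\<I> \<noteq> {}" "\<And>A. A \<in> \<I> \<Longrightarrow> ideal A R"
  shows "\<exists>A\<in>\<I>. \<forall>B\<in>\<I>. A \<subseteq> B \<longrightarrow> B = A"
proof (rule subset_Zorn_nonempty[OF assms(1)])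
  fix \<C> assume C: "\<C> \<noteq> {}" "subset.chain \<I> \<C>"
  have "subset.chain {I. ideal I R} \<C>"
    using C(2) assms(2) unfolding subset.chain_def by blast
  then have "\<Union>\<C> \<in> \<C>" by (rule ideal_chain_is_trivial[OF C(1)])
  then show "\<Union>\<C> \<in> \<I>" using C(2) unfolding subset.chain_def by blast
qed

lemma (in cring) prime_power:
  assumes "primeideal Q R" "a \<in> carrier R" "a [^] (t::nat) \<in> Q" shows "a \<in> Q"
  using assms(3)
proof (induction t)
  case 0
  then have "\<one> \<in> Q" by simp
  then have "Q = carrier R" using ideal.one_imp_carrier[OF primeideal.axioms(1)[OF assms(1)]] by blast
  then show ?case using assms(2) by simp
next
  case (Suc t)
  then have "a [^] t \<otimes> a \<in> Q" by simp
  then show ?case using primeideal.I_prime[OF assms(1)] Suc.IH assms(2) by blast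
qed

lemma (in cring) maximal_inverse:
  assumes n: "maximalideal n R" and r: "r \<in> carrier R" "r \<notin> n"
  shows "\<exists>a\<in>n. \<exists>s\<in>carrier R. \<one> = a \<oplus> s \<otimes> r"
proof -
  have ni: "ideal n R" by (rule maximalideal.axioms(1)[OF n])
  let ?K = "n <+>\<^bsub>R\<^esub> PIdl r"
  have K: "ideal ?K R" by (rule add_ideals[OF ni cgenideal_ideal[OF r(1)]])
  have nK: "n \<subseteq> ?K"
  proof
    fix x assume x: "x \<in> n"
    then have "x \<oplus> \<zero> \<in> ?K" using additive_subgroup.zero_closed[OF ideal.axioms(1)[OF cgenideal_ideal[OF r(1)]]]
      unfolding set_add_def' by blast
    then show "x \<in> ?K" using ideal.Icarr[OF ni x] by simp
  qed
  have "\<zero> \<oplus> r \<in> ?K"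
    using additive_subgroup.zero_closed[OF ideal.axioms(1)[OF ni]] cgenideal_self[OF r(1)] unfolding set_add_def' by blast
  then have "r \<in> ?K" using r(1) by simp
  then have "?K \<noteq> n" using r(2) by blast
  then have "?K = carrier R"
    using maximalideal.I_maximal[OF n K nK] additive_subgroup.a_subset[OF ideal.axioms(1)[OF K]] by blast
  then have "\<one> \<in> ?K" by simp
  then show ?thesis unfolding set_add_def' cgenideal_def by blast
qed

context module
begin

definition ann :: "'c set \<Rightarrow> 'c \<Rightarrow> 'a set" where
  "ann C m = {a \<in> carrier R. a \<odot>\<^bsub>M\<^esub> m \<in> C}"

definition cyc :: "'c \<Rightarrow> 'c set" where
  "cyc m = (\<lambda>a. a \<odot>\<^bsub>M\<^esub> m) ` carrier R"

lemma sub_cyc: assumes m: "m \<in> carrier M" shows "sub (cyc m)"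
  unfolding cyc_def
proof (rule submoduleI)
  show "(\<lambda>a. a \<odot>\<^bsub>M\<^esub> m) ` carrier R \<subseteq> carrier M" using m by blast
  show "\<zero>\<^bsub>M\<^esub> \<in> (\<lambda>a. a \<odot>\<^bsub>M\<^esub> m) ` carrier R" by (rule image_eqI[of _ _ \<zero>]) (simp_all add: m)
next
  fix u assume "u \<in> (\<lambda>a. a \<odot>\<^bsub>M\<^esub> m) ` carrier R"
  then obtain a where "a \<in> carrier R" "u = a \<odot>\<^bsub>M\<^esub> m" by blast
  then show "\<ominus>\<^bsub>M\<^esub> u \<in> (\<lambda>a. a \<odot>\<^bsub>M\<^esub> m) ` carrier R"
    by (intro image_eqI[of _ _ "\<ominus> a"]) (simp_all add: smult_l_minus m)
next
  fix u v assume "u \<in> (\<lambda>a. a \<odot>\<^bsub>M\<^esub> m) ` carrier R" "v \<in> (\<lambda>a. a \<odot>\<^bsub>M\<^esub> m) ` carrier R"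
  then obtain a b where "a \<in> carrier R" "u = a \<odot>\<^bsub>M\<^esub> m" "b \<in> carrier R" "v = b \<odot>\<^bsub>M\<^esub> m" by blast
  then show "u \<oplus>\<^bsub>M\<^esub> v \<in> (\<lambda>a. a \<odot>\<^bsub>M\<^esub> m) ` carrier R"
    by (intro image_eqI[of _ _ "a \<oplus> b"]) (simp_all add: smult_l_distr m)
next
  fix b u assume b: "b \<in> carrier R" and "u \<in> (\<lambda>a. a \<odot>\<^bsub>M\<^esub> m) ` carrier R"
  then obtain a where "a \<in> carrier R" "u = a \<odot>\<^bsub>M\<^esub> m" by blast
  then show "b \<odot>\<^bsub>M\<^esub> u \<in> (\<lambda>a. a \<odot>\<^bsub>M\<^esub> m) ` carrier R"
    by (intro image_eqI[of _ _ "b \<otimes> a"]) (simp_all add: smult_assoc1 m b)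
qed

lemma cyc_self: "m \<in> carrier M \<Longrightarrow> m \<in> cyc m"
  unfolding cyc_def by (rule image_eqI[of _ _ \<one>]) simp_all

lemma ann_eq_residual: assumes C: "sub C" and m: "m \<in> carrier M" shows "ann C m = residual C (cyc m)"
proof -
  have "a \<odot>\<^bsub>M\<^esub> m \<in> C \<longleftrightarrow> a \<^bold>* cyc m \<subseteq> C" if a: "a \<in> carrier R" for a
  proof
    assume am: "a \<odot>\<^bsub>M\<^esub> m \<in> C"
    show "a \<^bold>* cyc m \<subseteq> C"
    proof
      fix x assume "x \<in> a \<^bold>* cyc m"
      then obtain b where b: "b \<in> carrier R" "x = a \<odot>\<^bsub>M\<^esub> (b \<odot>\<^bsub>M\<^esub> m)" unfolding cyc_def by blast
      have "x = b \<odot>\<^bsub>M\<^esub> (a \<odot>\<^bsub>M\<^esub> m)" unfolding b(2) using a b(1) m by (simp add: smult_assoc1[symmetric] R.m_comm)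
      then show "x \<in> C" using sub_smultD[OF C b(1) am] by simp
    qed
  next
    assume "a \<^bold>* cyc m \<subseteq> C" then show "a \<odot>\<^bsub>M\<^esub> m \<in> C" using cyc_self[OF m] by blast
  qed
  then show ?thesis unfolding ann_def residual_def by blast
qed

lemma ann_ideal: "sub C \<Longrightarrow> m \<in> carrier M \<Longrightarrow> ideal (ann C m) R"
  by (simp only: ann_eq_residual) (rule residual_ideal[OF _ sub_cyc])

lemma residual_le_ann:
  assumes "A \<subseteq> C" "m \<in> B" shows "residual A B \<subseteq> ann C m"
  unfolding residual_def ann_def using assms by blast

lemma residual_mono: "A \<subseteq> A' \<Longrightarrow> residual A B \<subseteq> residual A' B"
  unfolding residual_def by blast

lemma cyc_le: "sub C \<Longrightarrow> m \<in> C \<Longrightarrow> cyc m \<subseteq> C"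
  unfolding cyc_def using sub_smultD by blast

end

locale noetherian_ring_module = noetherian_module R M + noetherian_ring R for R (structure) and M (structure)
begin

text \<open>
  Annihilators of nonzero classes that are maximal among all such annihilators are prime.
\<close>

lemma associated_prime:
  assumes C: "sub C" and B: "sub B" and le: "C \<subseteq> B" "B \<noteq> C"
  obtains m where "m \<in> B" "m \<notin> C" "primeideal (ann C m) R"
proof -
  let ?\<I> = "{ann C m | m. m \<in> B \<and> m \<notin> C}"
  have ne: "?\<I> \<noteq> {}" using le by blast
  have id: "ideal A R" if "A \<in> ?\<I>" for A using that ann_ideal[OF C] sub_carrier[OF B] by blast
  obtain Q where "Q \<in> ?\<I>" and max: "\<forall>A\<in>?\<I>. Q \<subseteq> A \<longrightarrow> A = Q"
    using maximal_ideal_in_set[OF ne id] by blast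
  then obtain m where m: "m \<in> B" "m \<notin> C" "Q = ann C m" by blast
  have mc: "m \<in> carrier M" by (rule sub_carrier[OF B m(1)])
  have "primeideal Q R"
  proof (rule primeidealI)
    show "ideal Q R" unfolding m(3) by (rule ann_ideal[OF C mc])
    show "cring R" by (rule R.is_cring)
    have "\<one> \<notin> Q" unfolding m(3) ann_def using m(2) mc by simp
    then show "carrier R \<noteq> Q" by auto
    fix a b assume ab: "a \<in> carrier R" "b \<in> carrier R" "a \<otimes> b \<in> Q"
    show "a \<in> Q \<or> b \<in> Q"
    proof (rule disjCI)
      assume "b \<notin> Q"
      then have bm: "b \<odot>\<^bsub>M\<^esub> m \<notin> C" using ab unfolding m(3) ann_def by blast
      have bB: "b \<odot>\<^bsub>M\<^esub> m \<in> B" by (rule sub_smultD[OF B ab(2) m(1)])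
      have "Q \<subseteq> ann C (b \<odot>\<^bsub>M\<^esub> m)"
      proof
        fix r assume "r \<in> Q"
        then have r: "r \<in> carrier R" "r \<odot>\<^bsub>M\<^esub> m \<in> C" unfolding m(3) ann_def by blast+
        have "r \<odot>\<^bsub>M\<^esub> (b \<odot>\<^bsub>M\<^esub> m) = b \<odot>\<^bsub>M\<^esub> (r \<odot>\<^bsub>M\<^esub> m)"
          using r(1) ab(2) mc by (simp add: smult_assoc1[symmetric] R.m_comm)
        then show "r \<in> ann C (b \<odot>\<^bsub>M\<^esub> m)" using sub_smultD[OF C ab(2) r(2)] r(1) unfolding ann_def by simp
      qed
      then have eq: "ann C (b \<odot>\<^bsub>M\<^esub> m) = Q" using max bm bB by blast
      have "a \<odot>\<^bsub>M\<^esub> (b \<odot>\<^bsub>M\<^esub> m) = (a \<otimes> b) \<odot>\<^bsub>M\<^esub> m" using ab mc by (simp add: smult_assoc1)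
      then have "a \<in> ann C (b \<odot>\<^bsub>M\<^esub> m)" using ab unfolding m(3) ann_def by simp
      then show "a \<in> Q" unfolding eq .
    qed
  qed
  then show thesis using that m by blast
qed

lemma maximal_submodule:
  assumes "P A" and sub: "\<And>C. P C \<Longrightarrow> sub C"
  shows "\<exists>C. P C \<and> A \<subseteq> C \<and> (\<forall>D. P D \<longrightarrow> C \<subseteq> D \<longrightarrow> D = C)"
proof (rule ccontr)
  assume neg: "\<not> (\<exists>C. P C \<and> A \<subseteq> C \<and> (\<forall>D. P D \<longrightarrow> C \<subseteq> D \<longrightarrow> D = C))"
  have step: "\<exists>D. (P D \<and> A \<subseteq> D) \<and> C \<subset> D" if hC: "P C \<and> A \<subseteq> C" for C
  proof -
    obtain D where D: "P D" "C \<subseteq> D" "D \<noteq> C" using neg hC by metis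
    then have "A \<subseteq> D" "C \<subset> D" using hC by blast+
    then show ?thesis using D(1) by (intro exI[of _ D] conjI)
  qed
  have "\<exists>f. \<forall>n::nat. (P (f n) \<and> A \<subseteq> f n) \<and> f n \<subset> f (Suc n)"
  proof (rule dependent_nat_choice[of "\<lambda>n C. P C \<and> A \<subseteq> C" "\<lambda>n C D. C \<subset> D"])
    show "\<exists>x. P x \<and> A \<subseteq> x" using assms(1) by (intro exI[of _ A] conjI order_refl)
    show "\<exists>y. (P y \<and> A \<subseteq> y) \<and> x \<subset> y" if "P x \<and> A \<subseteq> x" for x by (rule step[OF that])
  qed
  then obtain f :: "nat \<Rightarrow> 'c set" where f: "\<And>n. P (f n)" "\<And>n. f n \<subset> f (Suc n)" by blast
  have "\<exists>c. \<forall>i\<ge>c. f i = f c"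
    by (rule ascending_chain[of f]) (rule sub[OF f(1)], rule psubset_imp_subset[OF f(2)])
  then obtain c where c: "\<forall>i\<ge>c. f i = f c" by blast
  have "f (Suc c) = f c" by (rule c[rule_format]) simp
  then show False using f(2)[of c] by simp
qed

text \<open>
  Induction along a filtration of \<open>B/A\<close> with factors \<open>R/Q\<close> for primes \<open>Q\<close> over the
  annihilator of \<open>B/A\<close>. Take a maximal submodule with the property; an associated prime of
  the rest would allow one more step.
\<close>

lemma prime_induct:
  assumes A: "sub A" and B: "sub B" and le: "A \<subseteq> B" and base: "P A"
    and step: "\<And>C m. sub C \<Longrightarrow> A \<subseteq> C \<Longrightarrow> C \<subseteq> B \<Longrightarrow> P C \<Longrightarrow> m \<in> B \<Longrightarrow> m \<notin> C \<Longrightarrow> m \<in> carrier M \<Longrightarrow>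
      primeideal (ann C m) R \<Longrightarrow> residual A B \<subseteq> ann C m \<Longrightarrow> P (cyc m \<^bold>+ C)"
  shows "P B"
proof -
  have "\<exists>C. (sub C \<and> A \<subseteq> C \<and> C \<subseteq> B \<and> P C) \<and> A \<subseteq> C \<and>
      (\<forall>D. sub D \<and> A \<subseteq> D \<and> D \<subseteq> B \<and> P D \<longrightarrow> C \<subseteq> D \<longrightarrow> D = C)"
    by (rule maximal_submodule[of "\<lambda>C. sub C \<and> A \<subseteq> C \<and> C \<subseteq> B \<and> P C" A]) (use A le base in simp_all)
  then obtain C where C: "sub C \<and> A \<subseteq> C \<and> C \<subseteq> B \<and> P C"
    and max: "\<And>D. sub D \<and> A \<subseteq> D \<and> D \<subseteq> B \<and> P D \<Longrightarrow> C \<subseteq> D \<Longrightarrow> D = C"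
    by blast
  have "C = B"
  proof (rule ccontr)
    assume "C \<noteq> B"
    then obtain m where m: "m \<in> B" "m \<notin> C" "primeideal (ann C m) R"
      using associated_prime[of C B] C B by metis
    have mc: "m \<in> carrier M" by (rule sub_carrier[OF B m(1)])
    have s: "sub (cyc m)" "sub C" using sub_cyc[OF mc] C by blast+
    have "P (cyc m \<^bold>+ C)" using C m mc residual_le_ann[of A C m B] by (intro step) blast+
    moreover have "C \<subseteq> cyc m \<^bold>+ C" by (rule plus_upper2[OF s])
    moreover have "cyc m \<^bold>+ C \<subseteq> B" using C by (intro plus_least[OF B] cyc_le[OF B m(1)]) blast
    ultimately have "cyc m \<^bold>+ C = C" using max[of "cyc m \<^bold>+ C"] C sub_plus[OF s] by blast
    then show False using m(2) plus_upper1[OF s] cyc_self[OF mc] by blast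
  qed
  then show ?thesis using C by blast
qed

text \<open>
  The factor is \<open>R/Q\<close> with \<open>Q\<close> maximal, hence simple.
\<close>

lemma len_cyclic_le:
  assumes C: "sub C" and m: "m \<in> carrier M" and max: "maximalideal (ann C m) R"
  shows "len C (cyc m \<^bold>+ C) \<noteq> \<infinity>"
proof -
  have s: "sub (cyc m)" by (rule sub_cyc[OF m])
  have dich: "X = C \<or> X = cyc m \<^bold>+ C" if X: "sub X" "C \<subseteq> X" "X \<subseteq> cyc m \<^bold>+ C" for X
  proof (rule disjCI)
    assume "X \<noteq> cyc m \<^bold>+ C"
    then have mX: "m \<notin> X" using X plus_least[OF X(1) cyc_le[OF X(1)] X(2)] by blast
    show "X = C"
    proof (rule equalityI[OF _ X(2)], rule subsetI, rule ccontr)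
      fix x assume x: "x \<in> X" "x \<notin> C"
      then obtain r c where rc: "r \<in> carrier R" "c \<in> C" "x = r \<odot>\<^bsub>M\<^esub> m \<oplus>\<^bsub>M\<^esub> c"
        using X(3) unfolding cyc_def by (auto elim!: plusE)
      have "r \<odot>\<^bsub>M\<^esub> m \<notin> C" using x(2) sub_addD[OF C _ rc(2)] unfolding rc(3) by blast
      then have "r \<notin> ann C m" unfolding ann_def by blast
      then obtain a t where at: "a \<in> ann C m" "t \<in> carrier R" "\<one> = a \<oplus> t \<otimes> r"
        using R.maximal_inverse[OF max rc(1)] by blast
      have ac: "a \<in> carrier R" "a \<odot>\<^bsub>M\<^esub> m \<in> C" using at(1) unfolding ann_def by blast+
      have rX: "r \<odot>\<^bsub>M\<^esub> m \<in> X"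
        using sub_diffD[OF X(1), of "r \<odot>\<^bsub>M\<^esub> m" c] x(1) rc m X(2) by auto
      have "m = \<one> \<odot>\<^bsub>M\<^esub> m" using m by simp
      also have "\<dots> = (a \<oplus> t \<otimes> r) \<odot>\<^bsub>M\<^esub> m" unfolding at(3) by (rule refl)
      also have "\<dots> = a \<odot>\<^bsub>M\<^esub> m \<oplus>\<^bsub>M\<^esub> t \<odot>\<^bsub>M\<^esub> (r \<odot>\<^bsub>M\<^esub> m)"
        using ac at(2) rc(1) m by (simp add: smult_l_distr smult_assoc1)
      also have "\<dots> \<in> X" using ac(2) X(2) sub_smultD[OF X(1) at(2) rX] by (intro sub_addD[OF X(1)]) blast+
      finally show False using mX by blast
    qed
  qed
  have "\<not> enat 2 \<le> len C (cyc m \<^bold>+ C)"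
  proof
    assume "enat 2 \<le> len C (cyc m \<^bold>+ C)"
    then obtain H where H: "chain_in C (cyc m \<^bold>+ C) 2 H"
      using le_len_iff[OF C plus_upper2[OF s C]] by blast
    have "H 0 \<subset> H 1" "H 1 \<subset> H 2" using H unfolding chain_in_def by (auto simp: numeral_2_eq_2)
    moreover have "H i = C \<or> H i = cyc m \<^bold>+ C" if "i \<le> 2" for i
      using H that unfolding chain_in_def by (intro dich) blast+
    ultimately show False by (metis one_le_numeral order_refl psubset_eq subset_antisym zero_le)
  qed
  then show ?thesis by (metis enat_ord_code(3))
qed

theorem finite_length_primes:
  assumes A: "sub A" and B: "sub B" and le: "A \<subseteq> B"
    and primes: "\<And>Q. primeideal Q R \<Longrightarrow> residual A B \<subseteq> Q \<Longrightarrow> maximalideal Q R"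
  shows "len A B \<noteq> \<infinity>"
proof (rule prime_induct[OF A B le, where P = "\<lambda>C. len A C \<noteq> \<infinity>"])
  show "len A A \<noteq> \<infinity>" unfolding len_same[OF A] by simp
  fix C m assume C: "sub C" "A \<subseteq> C" "len A C \<noteq> \<infinity>" and m: "m \<in> carrier M"
    and Q: "primeideal (ann C m) R" "residual A B \<subseteq> ann C m"
  have "len C (cyc m \<^bold>+ C) \<noteq> \<infinity>" by (rule len_cyclic_le[OF C(1) m primes[OF Q]])
  moreover have "len A (cyc m \<^bold>+ C) = len A C + len C (cyc m \<^bold>+ C)"
    by (rule len_additive[OF A C(1) sub_plus[OF sub_cyc[OF m] C(1)] C(2) plus_upper2[OF sub_cyc[OF m] C(1)]])
  ultimately show "len A (cyc m \<^bold>+ C) \<noteq> \<infinity>"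
    using C(3) by (metis plus_eq_infty_iff_enat)
qed

end

text \<open>
  That \<open>R\<close> is local enters as the statement that all primes lie in \<open>\<nn>\<close>, and that \<open>J = I 0\<close>
  is \<open>\<nn>\<close>-primary as the statement that \<open>\<nn>\<close> is the only prime containing it.
\<close>

locale local_family = noetherian_ring_module R M for R (structure) and M (structure) +
  fixes \<nn> :: "_ set" and d :: nat and I :: "nat \<Rightarrow> _ set"
  assumes nn: "maximalideal \<nn> R" and prime_le: "\<And>Q. primeideal Q R \<Longrightarrow> Q \<subseteq> \<nn>"
    and I_ideals: "\<And>i. i \<le> d \<Longrightarrow> ideal (I i) R"
    and I0_le: "I 0 \<subseteq> \<nn>" and I0_prime: "\<And>Q. primeideal Q R \<Longrightarrow> I 0 \<subseteq> Q \<Longrightarrow> Q = \<nn>"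

sublocale local_family \<subseteq> ideal_family R M d I
proof (intro ideal_family.intro ideal_family_axioms.intro)
  show "noetherian_module R M" by (rule noetherian_module_axioms)
  show "ideal (I i) R" if "i \<le> d" for i by (rule I_ideals[OF that])
  show "\<exists>S. finite S \<and> S \<subseteq> carrier R \<and> I i = Idl S" if "i \<le> d" for i
    using finetely_gen[OF I_ideals[OF that]] by blast
  fix U V assume U: "submodule U R M" and V: "submodule V R M" "U \<subseteq> V" "ideal_act (I 0) V \<subseteq> U"
  have "I 0 \<subseteq> residual U V"
  proof
    fix a assume a: "a \<in> I 0"
    then have "a \<in> carrier R" using additive_subgroup.a_subset[OF ideal.axioms(1)[OF I_ideals[OF le0]]] by blast
    then show "a \<in> residual U V" using order_trans[OF scale_le_ideal_act[OF a] V(3)] unfolding residual_def by blast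
  qed
  then show "interval_length R M U V \<noteq> \<infinity>"
    using I0_prime nn by (intro finite_length_primes[OF U V(1,2)]) (metis order_trans)
qed

context local_family
begin

text \<open>
  \<open>N/S\<close> has dimension at most one: in a local ring this means that a prime over the
  annihilator which is not minimal over it must be \<open>\<nn>\<close>.
\<close>

definition dim_le1 :: "'c set \<Rightarrow> bool" where
  "dim_le1 S \<longleftrightarrow> (\<forall>P Q. primeideal P R \<longrightarrow> primeideal Q R \<longrightarrow> residual S N \<subseteq> P \<longrightarrow> P \<subset> Q \<longrightarrow> Q = \<nn>)"

lemma hf_bounded_const:
  assumes L: "sub L" and H: "sub H" "L \<subseteq> H" and B: "\<And>n. multi_index d n \<Longrightarrow> len (fil L H (up n)) (fil L H n) \<le> enat B"
  shows "\<exists>a. const_diff d [] (hf L H) a"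
proof (rule hilbert_fun_bounded_const[OF hf_hilbert(1)[OF L H]])
  have "hf L H n \<le> B" for n
  proof -
    have "enat (hf L H (restrict_index d n)) \<le> enat B"
      using B[OF multi_index_restrict, of n] hf_hilbert(2)[OF L H multi_index_restrict, of n] by simp
    then show ?thesis unfolding hf_def hlen_restrict by simp
  qed
  then show "for_all_large d (\<lambda>n. hf L H n \<le> B)" by (rule for_all_large_True)
qed

text \<open>
  The module \<open>R/P\<close> with \<open>P\<close> prime. If \<open>I 0 \<subseteq> P\<close>, the graded components are zero in positive
  degree. Otherwise take \<open>a \<in> I 0\<close> outside \<open>P\<close>. For a nonzero submodule \<open>X\<close> of \<open>R/P\<close> the
  quotient \<open>X/aX\<close> has the same finite length as \<open>(R/P)/a(R/P)\<close>, since \<open>a\<close> is injective and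
  \<open>(R/P)/X\<close> has finite length by the dimension hypothesis. So the graded components, being
  quotients of such \<open>X/aX\<close>, have bounded length.
\<close>

lemma const_cyclic:
  assumes S: "sub S" and dim: "dim_le1 S" and L: "sub L" and m: "m \<in> carrier M"
    and P: "primeideal (ann L m) R" "residual S N \<subseteq> ann L m"
  shows "\<exists>a. const_diff d [] (hf L (cyc m \<^bold>+ L)) a"
proof -
  let ?H = "cyc m \<^bold>+ L" let ?P = "ann L m"
  have s: "sub (cyc m)" by (rule sub_cyc[OF m])
  have H: "sub ?H" "L \<subseteq> ?H" by (rule sub_plus[OF s L], rule plus_upper2[OF s L])
  have Pc: "?P \<subseteq> carrier R" unfolding ann_def by blast
  \<comment> \<open>an element multiplying \<open>m\<close> into \<open>X\<close> annihilates \<open>H/X\<close>\<close>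
  have res: "r \<in> residual X ?H" if X: "sub X" "L \<subseteq> X" and r: "r \<in> carrier R" "r \<odot>\<^bsub>M\<^esub> m \<in> X" for r X
  proof -
    have "r \<in> ann X m" using r unfolding ann_def by blast
    then have "r \<^bold>* cyc m \<subseteq> X" unfolding ann_eq_residual[OF X(1) m] residual_def by blast
    moreover have "r \<^bold>* L \<subseteq> X" by (rule order_trans[OF scale_subset[OF r(1) L] X(2)])
    ultimately have "r \<^bold>* ?H \<subseteq> X" unfolding scale_plus[OF r(1) s L] by (rule plus_least[OF X(1)])
    then show ?thesis using r(1) unfolding residual_def by blast
  qed
  have PX: "?P \<subseteq> residual X ?H" if X: "sub X" "L \<subseteq> X" for X
  proof
    fix r assume "r \<in> ?P"
    then show "r \<in> residual X ?H" using X(2) unfolding ann_def by (intro res[OF X]) blast+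
  qed
  \<comment> \<open>a nonzero submodule \<open>X/L\<close> has an annihilator of the quotient that is properly larger
    than \<open>P\<close>\<close>
  have fin: "len X ?H \<noteq> \<infinity>" if X: "sub X" "L \<subseteq> X" "X \<subseteq> ?H" and r: "r \<in> carrier R" "r \<odot>\<^bsub>M\<^esub> m \<in> X" "r \<notin> ?P" for X r
  proof (rule finite_length_primes[OF X(1) H(1) X(3)])
    fix Q assume Q: "primeideal Q R" "residual X ?H \<subseteq> Q"
    then have "?P \<subset> Q" using PX[OF X(1,2)] res[OF X(1,2) r(1,2)] r(3) by blast
    then have "Q = \<nn>" using dim P Q(1) unfolding dim_le1_def by blast
    then show "maximalideal Q R" using nn by simp
  qed
  note F = fil_family[OF L H(1)]
  have sF: "sub (fil L ?H n)" for n by (rule sub_fil[OF L H(1)])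
  have FH: "fil L ?H n \<subseteq> ?H" for n by (rule fil_le[OF L H])
  have LF: "L \<subseteq> fil L ?H n" for n unfolding fil_def by (rule plus_upper2[OF sub_pw[OF H(1)] L])
  have aF: "fil L ?H (up n) \<subseteq> fil L ?H n" for n by (rule fil_antimono[OF L H(1)]) simp
  show ?thesis
  proof (cases "I 0 \<subseteq> ?P")
    case True
    have "act 0 ?H \<subseteq> L"
      by (rule ideal_act_least[OF L]) (use PX[OF L order_refl] True in \<open>auto simp: residual_def\<close>)
    have zero: "fil L ?H (up n) = L" for n
    proof (rule equalityI[OF _ LF])
      have "pw (up n) ?H = pw n (act 0 ?H)" by (rule pw_Suc'[OF le0 H(1)])
      also have "\<dots> \<subseteq> pw n L" by (rule pw_mono[OF L \<open>act 0 ?H \<subseteq> L\<close>])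
      also have "\<dots> \<subseteq> L" by (rule pw_le[OF L])
      finally show "fil L ?H (up n) \<subseteq> L" unfolding fil_def by (rule plus_least[OF L _ order_refl])
    qed
    have "const_diff d [] (hf L ?H) 0"
    proof (rule const_diff_cong[OF const_diff_zero])
      show "for_all_large d (\<lambda>n. 0 = hf L ?H n)" unfolding for_all_large_def
      proof (intro exI[of _ 1] allI impI)
        fix n :: "nat \<Rightarrow> nat" assume "\<forall>i\<le>d. 1 \<le> n i"
        then have "1 \<le> n 0" by simp
        define n' where "n' = (restrict_index d n)(0 := n 0 - 1)"
        have "restrict_index d n = up n'"
          unfolding n'_def using \<open>1 \<le> n 0\<close> by (simp add: fun_eq_iff restrict_index_def)
        then have "fil L ?H (restrict_index d n) = L" "fil L ?H (up (restrict_index d n)) = L"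
          using zero[of n'] zero[of "restrict_index d n"] by (simp_all only:)
        then show "0 = hf L ?H n" unfolding hf_def hlen_def by (simp add: len_same[OF L] zero_enat_def)
      qed
    qed
    then show ?thesis by blast
  next
    case False
    then obtain a where a: "a \<in> I 0" "a \<notin> ?P" by blast
    have ac: "a \<in> carrier R" using a(1) I_carrier[OF le0] by blast
    have inj: "(L \<^bold>: a) \<inter> ?H \<subseteq> L"
    proof
      fix x assume x: "x \<in> (L \<^bold>: a) \<inter> ?H"
      then obtain r l where rl: "r \<in> carrier R" "l \<in> L" "x = r \<odot>\<^bsub>M\<^esub> m \<oplus>\<^bsub>M\<^esub> l"
        unfolding cyc_def by (auto elim!: plusE)
      have lc: "l \<in> carrier M" by (rule sub_carrier[OF L rl(2)])
      have "a \<odot>\<^bsub>M\<^esub> x \<in> L" using x by (simp add: colon_iff)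
      moreover have "a \<odot>\<^bsub>M\<^esub> x = (a \<otimes> r) \<odot>\<^bsub>M\<^esub> m \<oplus>\<^bsub>M\<^esub> a \<odot>\<^bsub>M\<^esub> l"
        unfolding rl(3) using rl(1) lc ac m by (simp add: smult_r_distr smult_assoc1)
      ultimately have "(a \<otimes> r) \<odot>\<^bsub>M\<^esub> m \<oplus>\<^bsub>M\<^esub> a \<odot>\<^bsub>M\<^esub> l \<in> L" by (simp only:)
      then have "(a \<otimes> r) \<odot>\<^bsub>M\<^esub> m \<in> L"
        by (rule sub_diffD[OF L smult_closed[OF R.m_closed[OF ac rl(1)] m] sub_smultD[OF L ac rl(2)]])
      then have "a \<otimes> r \<in> ?P" unfolding ann_def using ac rl(1) by simp
      then have "r \<in> ?P" using primeideal.I_prime[OF P(1) ac rl(1)] a(2) by blast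
      then have "r \<odot>\<^bsub>M\<^esub> m \<in> L" unfolding ann_def by blast
      then show "x \<in> L" unfolding rl(3) by (rule sub_addD[OF L _ rl(2)])
    qed
    have aX: "sub (L \<^bold>+ a \<^bold>* X)" "L \<subseteq> L \<^bold>+ a \<^bold>* X" "L \<^bold>+ a \<^bold>* X \<subseteq> X" if "sub X" "L \<subseteq> X" for X
      using that L ac by (simp_all add: sub_plus sub_scale plus_upper1 plus_least scale_subset)
    note aH = aX[OF H]
    have "a \<odot>\<^bsub>M\<^esub> m \<in> L \<^bold>+ a \<^bold>* ?H"
      using plus_upper2[OF L sub_scale[OF ac H(1)]] plus_upper1[OF s L] cyc_self[OF m] by blast
    then have "len (L \<^bold>+ a \<^bold>* ?H) ?H \<noteq> \<infinity>" by (intro fin[OF aH ac _ a(2)])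
    then obtain B where B: "len (L \<^bold>+ a \<^bold>* ?H) ?H = enat B" by auto
    have "len (fil L ?H (up n)) (fil L ?H n) \<le> enat B" if n: "multi_index d n" for n
    proof (cases "fil L ?H n = L")
      case True
      then have "fil L ?H (up n) = L" using aF[of n] LF[of "up n"] by simp
      then show ?thesis using True by (simp add: len_same[OF L])
    next
      case False
      let ?X = "fil L ?H n"
      obtain x where x: "x \<in> ?X" "x \<notin> L" using False LF[of n] by blast
      then obtain r l where rl: "r \<in> carrier R" "l \<in> L" "x = r \<odot>\<^bsub>M\<^esub> m \<oplus>\<^bsub>M\<^esub> l"
        using FH[of n] unfolding cyc_def by (blast elim!: plusE)
      have "r \<odot>\<^bsub>M\<^esub> m \<in> ?X"
      proof (rule sub_diffD[OF sF smult_closed[OF rl(1) m]])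
        show "l \<in> ?X" using rl(2) LF by blast
        show "r \<odot>\<^bsub>M\<^esub> m \<oplus>\<^bsub>M\<^esub> l \<in> ?X" using x(1) rl(3) by simp
      qed
      moreover have "r \<notin> ?P" using x(2) sub_addD[OF L _ rl(2)] unfolding rl(3) ann_def by blast
      ultimately have finX: "len ?X ?H \<noteq> \<infinity>" by (intro fin[OF sF LF FH rl(1)])
      note aXn = aX[OF sF LF, of n]
      have mono: "L \<^bold>+ a \<^bold>* ?X \<subseteq> L \<^bold>+ a \<^bold>* ?H" by (rule plus_mono[OF order_refl scale_mono[OF FH]])
      \<comment> \<open>\<open>H/aX\<close> is filtered through \<open>X\<close> and through \<open>aH\<close>, and \<open>aH/aX\<close> is as long as \<open>H/X\<close>\<close>
      have "len (L \<^bold>+ a \<^bold>* ?X) (L \<^bold>+ a \<^bold>* ?H) = len ?X ?H"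
        by (rule len_scale[OF ac L sF H(1) FH order_trans[OF inj LF]])
      then have "len ?X ?H + enat B = len (L \<^bold>+ a \<^bold>* ?X) ?H"
        using len_additive[OF aXn(1) aH(1) H(1) mono aH(3)] B by simp
      also have "\<dots> = len (L \<^bold>+ a \<^bold>* ?X) ?X + len ?X ?H"
        by (rule len_additive[OF aXn(1) sF H(1) aXn(3) FH])
      finally have "len (L \<^bold>+ a \<^bold>* ?X) ?X = enat B" using finX
        by (cases "len ?X ?H"; cases "len (L \<^bold>+ a \<^bold>* ?X) ?X") auto
      moreover have "len (fil L ?H (up n)) ?X \<le> len (L \<^bold>+ a \<^bold>* ?X) ?X"
      proof (rule len_mono[OF aXn(1) _ aF order_refl])
        show "L \<^bold>+ a \<^bold>* ?X \<subseteq> fil L ?H (up n)"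
          by (rule plus_least[OF sF LF order_trans[OF scale_le_ideal_act[OF a(1)] family_up_le[OF F n]]])
      qed
      ultimately show ?thesis by simp
    qed
    then show ?thesis by (rule hf_bounded_const[OF L H])
  qed
qed

theorem const_dim_le1:
  assumes S: "sub S" and dim: "dim_le1 S"
  shows "\<exists>a. const_diff d [] (hf S N) a"
proof (rule prime_induct[OF S sub_N sub_le_N[OF S], where P = "\<lambda>L. \<exists>a. const_diff d [] (hf S L) a"])
  show "\<exists>a. const_diff d [] (hf S S) a" unfolding hf_self[OF S] using const_diff_zero by blast
  fix L m assume L: "sub L" "S \<subseteq> L" "\<exists>a. const_diff d [] (hf S L) a" and m: "m \<in> carrier M"
    and P: "primeideal (ann L m) R" "residual S N \<subseteq> ann L m"
  obtain a where a: "const_diff d [] (hf S L) a" using L by blast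
  obtain b where b: "const_diff d [] (hf L (cyc m \<^bold>+ L)) b" using const_cyclic[OF S dim L(1) m P] by blast
  note s = sub_cyc[OF m]
  have "const_diff d [] (hf S (cyc m \<^bold>+ L)) (a + b)"
    by (rule const_extension[OF S sub_plus[OF s L(1)] L(1) L(2) plus_upper2[OF s L(1)] _ a b]) simp
  then show "\<exists>a. const_diff d [] (hf S (cyc m \<^bold>+ L)) a" by blast
qed

end

section \<open>The two constants attached to a module of dimension at most one\<close>

context ideal_family
begin

text \<open>
  Telescoping in the direction of \<open>I 0\<close>.
\<close>

lemma len_fil_sum:
  assumes L: "sub L" and H: "sub H" "L \<subseteq> H" and n: "multi_index d n"
  shows "len (fil L H (n(0 := k))) (fil L H (n(0 := 0))) = enat (\<Sum>j<k. hf L H (n(0 := j)))"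
    and "fil L H (n(0 := k)) \<subseteq> fil L H (n(0 := 0))"
proof (induction k)
  case 0
  { case 1 show ?case by (simp add: len_same[OF sub_fil[OF L H(1)]] zero_enat_def) }
  { case 2 show ?case by simp }
next
  case (Suc k)
  let ?n = "n(0 := k)"
  have mn: "multi_index d ?n" by (rule multi_index_upd[OF n]) simp
  have eq: "n(0 := Suc k) = up ?n" by (simp add: fun_eq_iff)
  have a: "fil L H (up ?n) \<subseteq> fil L H ?n" by (rule fil_antimono[OF L H(1)]) simp
  note s = sub_fil[OF L H(1)]
  { case 1
    have "len (fil L H (up ?n)) (fil L H (n(0 := 0))) = len (fil L H (up ?n)) (fil L H ?n) + len (fil L H ?n) (fil L H (n(0 := 0)))"
      by (rule len_additive[OF s s s a Suc(2)])
    then show ?case unfolding eq hf_hilbert(2)[OF L H mn] Suc(1) plus_enat_simps sum.lessThan_Suc by (simp only: add.commute) }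
  { case 2 show ?case unfolding eq using a Suc(2) by (rule order_trans) }
qed

end

context local_family
begin

text \<open>
  The exponent of the product of all the ideals. It vanishes beyond \<open>d\<close>, so that it is a
  multi-index.
\<close>

definition ones :: "nat \<Rightarrow> nat" where "ones = (\<lambda>i. if i \<le> d then 1 else 0)"
definition mult_ones :: "nat \<Rightarrow> nat \<Rightarrow> nat" where "mult_ones t = (\<lambda>i. t * ones i)"

text \<open>
  What passing to the saturation achieves; it excludes \<open>\<nn>\<close> from the associated primes of
  \<open>N/S\<close>.
\<close>

definition torsion_free :: "'c set \<Rightarrow> bool" where
  "torsion_free S \<longleftrightarrow> (\<forall>m\<in>N. pw ones (cyc m) \<subseteq> S \<longrightarrow> m \<in> S)"

lemma mult_ones_0: "mult_ones 0 = (\<lambda>_. 0)" by (simp add: mult_ones_def)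
lemma mult_ones_Suc: "mult_ones (Suc t) = (\<lambda>i. ones i + mult_ones t i)" by (simp add: mult_ones_def)

lemma prime_one: "primeideal Q R \<Longrightarrow> \<one> \<notin> Q"
  using ideal.one_imp_carrier[OF primeideal.axioms(1)] primeideal.I_notcarr by blast

lemma prime_prod: "primeideal Q R \<Longrightarrow> a \<in> carrier R \<Longrightarrow> b \<in> carrier R \<Longrightarrow> a \<notin> Q \<Longrightarrow> b \<notin> Q \<Longrightarrow> a \<otimes> b \<notin> Q"
  using primeideal.I_prime[of Q R a b] by auto

lemma pw_ones_cyc_iff:
  assumes S: "sub S" and m: "m \<in> N"
  shows "pw ones (cyc m) \<subseteq> S \<longleftrightarrow> ideal_monomial R d I ones \<subseteq> ann S m"
proof
  assume *: "pw ones (cyc m) \<subseteq> S"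
  show "ideal_monomial R d I ones \<subseteq> ann S m"
  proof
    fix a assume a: "a \<in> ideal_monomial R d I ones"
    have "a \<odot>\<^bsub>M\<^esub> m \<in> pw ones (cyc m)" unfolding pw_def by (rule ideal_actI[OF a cyc_self[OF m]])
    then show "a \<in> ann S m" using * subsetD[OF monomial_carrier a] unfolding ann_def by blast
  qed
next
  assume *: "ideal_monomial R d I ones \<subseteq> ann S m"
  show "pw ones (cyc m) \<subseteq> S" unfolding pw_def
    by (rule ideal_act_least[OF S]) (use * in \<open>auto simp: ann_eq_residual[OF S m] residual_def\<close>)
qed

lemma pw_ones_le: "sub U \<Longrightarrow> pw ones U \<subseteq> act 0 U"
proof -
  assume U: "sub U"
  define n where "n = ones(0 := 0)"
  have "ones = up n" unfolding n_def ones_def by (simp add: fun_eq_iff)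
  then have "pw ones U = act 0 (pw n U)" using pw_Suc[OF le0 U, of n] by (simp only:)
  also have "\<dots> \<subseteq> act 0 U" by (rule act_mono[OF le0 U pw_le[OF U]])
  finally show ?thesis .
qed

lemma torsion_free_prime:
  assumes S: "sub S" and tf: "torsion_free S" and m: "m \<in> N" "m \<notin> S" and Q: "primeideal (ann S m) R"
  shows "ann S m \<noteq> \<nn>"
proof
  assume eq: "ann S m = \<nn>"
  have s: "sub (cyc m)" by (rule sub_cyc[OF m(1)])
  have "act 0 (cyc m) \<subseteq> S"
    by (rule ideal_act_least[OF S]) (use I0_le eq in \<open>auto simp: ann_eq_residual[OF S m(1)] residual_def\<close>)
  then have "pw ones (cyc m) \<subseteq> S" using pw_ones_le[OF s] by simp
  then show False using tf m unfolding torsion_free_def by blast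
qed

text \<open>
  Let \<open>S\<^sub>Q\<close> be the kernel of the localisation \<open>N/S \<rightarrow> (N/S)\<^sub>Q\<close>, pulled back to \<open>N\<close>; one
  element \<open>s\<close> outside \<open>Q\<close> multiplies it into \<open>S\<close>. As \<open>S\<^sub>Q\<close> is not \<open>N\<close>, there is an
  associated prime of \<open>N/S\<^sub>Q\<close>; it is contained in \<open>Q\<close> and hence equal to \<open>Q\<close> by the
  dimension hypothesis, being the annihilator of some \<open>m\<close>. If the product of the ideals were
  in \<open>Q\<close>, it would multiply \<open>m\<close> into \<open>S\<^sub>Q\<close> and \<open>s m\<close> into \<open>S\<close>, so \<open>s m \<in> S\<close>, which is
  impossible for \<open>m\<close> outside \<open>S\<^sub>Q\<close>.
\<close>

lemma product_not_in_prime: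
  assumes S: "sub S" and dim: "dim_le1 S" and tf: "torsion_free S"
    and Q: "primeideal Q R" "residual S N \<subseteq> Q" "Q \<noteq> \<nn>"
  shows "\<not> ideal_monomial R d I ones \<subseteq> Q"
proof
  assume prod: "ideal_monomial R d I ones \<subseteq> Q"
  define SQ where "SQ = {m \<in> N. \<exists>s\<in>carrier R. s \<notin> Q \<and> s \<odot>\<^bsub>M\<^esub> m \<in> S}"
  have SQI: "m \<in> SQ" if "m \<in> N" "s \<in> carrier R" "s \<notin> Q" "s \<odot>\<^bsub>M\<^esub> m \<in> S" for m s
    using that unfolding SQ_def by blast
  have S_SQ: "S \<subseteq> SQ"
  proof
    fix m assume m: "m \<in> S"
    then have mN: "m \<in> N" by (rule sub_carrier[OF S])
    show "m \<in> SQ" by (rule SQI[OF mN R.one_closed prime_one[OF Q(1)]]) (simp add: m mN)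
  qed
  have subSQ: "sub SQ"
  proof (rule submoduleI)
    show "SQ \<subseteq> carrier M" unfolding SQ_def by blast
    show "\<zero>\<^bsub>M\<^esub> \<in> SQ" using S_SQ sub_zero[OF S] by blast
  next
    fix m assume "m \<in> SQ"
    then obtain s where s: "m \<in> N" "s \<in> carrier R" "s \<notin> Q" "s \<odot>\<^bsub>M\<^esub> m \<in> S" unfolding SQ_def by blast
    show "\<ominus>\<^bsub>M\<^esub> m \<in> SQ"
      by (rule SQI[OF _ s(2,3)]) (use s sub_minusD[OF S s(4)] in \<open>simp_all add: smult_r_minus\<close>)
  next
    fix m m' assume "m \<in> SQ" "m' \<in> SQ"
    then obtain s s' where s: "m \<in> N" "s \<in> carrier R" "s \<notin> Q" "s \<odot>\<^bsub>M\<^esub> m \<in> S"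
      and s': "m' \<in> N" "s' \<in> carrier R" "s' \<notin> Q" "s' \<odot>\<^bsub>M\<^esub> m' \<in> S" unfolding SQ_def by blast
    have "(s \<otimes> s') \<odot>\<^bsub>M\<^esub> (m \<oplus>\<^bsub>M\<^esub> m') = s' \<odot>\<^bsub>M\<^esub> (s \<odot>\<^bsub>M\<^esub> m) \<oplus>\<^bsub>M\<^esub> s \<odot>\<^bsub>M\<^esub> (s' \<odot>\<^bsub>M\<^esub> m')"
      using s s' by (simp add: smult_r_distr smult_assoc1[symmetric] R.m_comm)
    also have "\<dots> \<in> S" by (rule sub_addD[OF S sub_smultD[OF S s'(2) s(4)] sub_smultD[OF S s(2) s'(4)]])
    finally show "m \<oplus>\<^bsub>M\<^esub> m' \<in> SQ"
      using s s' by (intro SQI[OF _ _ prime_prod[OF Q(1) s(2) s'(2) s(3) s'(3)]]) simp_all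
  next
    fix a m assume a: "a \<in> carrier R" and "m \<in> SQ"
    then obtain s where s: "m \<in> N" "s \<in> carrier R" "s \<notin> Q" "s \<odot>\<^bsub>M\<^esub> m \<in> S" unfolding SQ_def by blast
    have "s \<odot>\<^bsub>M\<^esub> (a \<odot>\<^bsub>M\<^esub> m) = a \<odot>\<^bsub>M\<^esub> (s \<odot>\<^bsub>M\<^esub> m)"
      using s a by (simp add: smult_assoc1[symmetric] R.m_comm)
    then show "a \<odot>\<^bsub>M\<^esub> m \<in> SQ"
      using s a sub_smultD[OF S a s(4)] by (intro SQI[OF _ s(2,3)]) simp_all
  qed
  \<comment> \<open>a uniform denominator \<open>s\<close> for \<open>S\<^sub>Q\<close>, by taking a largest submodule that has one\<close>
  define P where "P = (\<lambda>U. sub U \<and> U \<subseteq> SQ \<and> (\<exists>s\<in>carrier R. s \<notin> Q \<and> s \<^bold>* U \<subseteq> S))"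
  have "P S" unfolding P_def using S S_SQ prime_one[OF Q(1)] scale_one[OF S] by (intro conjI bexI[of _ \<one>]) simp_all
  then have "\<exists>U. P U \<and> S \<subseteq> U \<and> (\<forall>D. P D \<longrightarrow> U \<subseteq> D \<longrightarrow> D = U)"
    by (rule maximal_submodule) (simp add: P_def)
  then obtain U where U: "P U" and max: "\<And>D. P D \<Longrightarrow> U \<subseteq> D \<Longrightarrow> D = U" by metis
  obtain s where s: "s \<in> carrier R" "s \<notin> Q" "s \<^bold>* U \<subseteq> S" and sU: "sub U" "U \<subseteq> SQ" using U unfolding P_def by blast
  have "SQ \<subseteq> U"
  proof
    fix m assume m: "m \<in> SQ"
    then obtain s' where s': "m \<in> N" "s' \<in> carrier R" "s' \<notin> Q" "s' \<odot>\<^bsub>M\<^esub> m \<in> S" unfolding SQ_def by blast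
    have c: "sub (cyc m)" by (rule sub_cyc[OF s'(1)])
    let ?D = "cyc m \<^bold>+ U"
    have ss: "s \<otimes> s' \<in> carrier R" "s \<otimes> s' \<notin> Q" using s s' prime_prod[OF Q(1)] by simp_all
    have "s' \<in> ann S m" unfolding ann_def using s' by blast
    then have "s' \<^bold>* cyc m \<subseteq> S" unfolding ann_eq_residual[OF S s'(1)] residual_def by blast
    then have "s \<^bold>* s' \<^bold>* cyc m \<subseteq> S" using scale_mono[of _ S s] scale_subset[OF s(1) S] by (meson order_trans)
    then have 1: "(s \<otimes> s') \<^bold>* cyc m \<subseteq> S" unfolding scale_scale[OF s(1) s'(2) c] .
    have "s' \<^bold>* s \<^bold>* U \<subseteq> S" using scale_mono[OF s(3), of s'] scale_subset[OF s'(2) S] by (meson order_trans)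
    then have 2: "(s \<otimes> s') \<^bold>* U \<subseteq> S" unfolding scale_scale[OF s'(2) s(1) sU(1)] R.m_comm[OF s'(2) s(1)] .
    have "(s \<otimes> s') \<^bold>* ?D \<subseteq> S" unfolding scale_plus[OF ss(1) c sU(1)] by (rule plus_least[OF S 1 2])
    moreover have "?D \<subseteq> SQ" by (rule plus_least[OF subSQ cyc_le[OF subSQ m] sU(2)])
    ultimately have "P ?D" unfolding P_def using sub_plus[OF c sU(1)] ss by blast
    then have "?D = U" by (rule max) (rule plus_upper2[OF c sU(1)])
    then show "m \<in> U" using plus_upper1[OF c sU(1)] cyc_self[OF s'(1)] by blast
  qed
  then have sSQ: "s \<^bold>* SQ \<subseteq> S" using s(3) scale_mono[of SQ U s] by blast
  have "N \<noteq> SQ"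
  proof
    assume "N = SQ"
    then have "s \<in> residual S N" using sSQ s(1) unfolding residual_def by simp
    then show False using Q(2) s(2) by blast
  qed
  then obtain m where m: "m \<in> N" "m \<notin> SQ" "primeideal (ann SQ m) R"
    using associated_prime[OF subSQ sub_N sub_le_N[OF subSQ]] by blast
  have PQ: "ann SQ m \<subseteq> Q"
  proof
    fix r assume "r \<in> ann SQ m"
    then have r: "r \<in> carrier R" "r \<odot>\<^bsub>M\<^esub> m \<in> SQ" unfolding ann_def by blast+
    show "r \<in> Q"
    proof (rule ccontr)
      assume rQ: "r \<notin> Q"
      obtain s' where s': "s' \<in> carrier R" "s' \<notin> Q" "s' \<odot>\<^bsub>M\<^esub> (r \<odot>\<^bsub>M\<^esub> m) \<in> S" using r(2) unfolding SQ_def by blast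
      have "m \<in> SQ"
        by (rule SQI[OF m(1) _ prime_prod[OF Q(1) s'(1) r(1) s'(2) rQ]]) (use s' r m in \<open>simp_all add: smult_assoc1\<close>)
      then show False using m(2) by blast
    qed
  qed
  have "residual S N \<subseteq> ann SQ m" by (rule residual_le_ann[OF S_SQ m(1)])
  then have "\<not> ann SQ m \<subset> Q" using dim m(3) Q unfolding dim_le1_def by blast
  then have "ann SQ m = Q" using PQ by blast
  then have aSQ: "a \<odot>\<^bsub>M\<^esub> m \<in> SQ" if "a \<in> ideal_monomial R d I ones" for a
    using that prod unfolding ann_def by blast
  have sm: "s \<odot>\<^bsub>M\<^esub> m \<in> N" using s(1) m(1) by simp
  have "ideal_monomial R d I ones \<subseteq> ann S (s \<odot>\<^bsub>M\<^esub> m)"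
  proof
    fix a assume a: "a \<in> ideal_monomial R d I ones"
    then have ac: "a \<in> carrier R" by (rule subsetD[OF monomial_carrier])
    have "a \<odot>\<^bsub>M\<^esub> (s \<odot>\<^bsub>M\<^esub> m) = s \<odot>\<^bsub>M\<^esub> (a \<odot>\<^bsub>M\<^esub> m)"
      using s(1) m(1) ac by (simp add: smult_assoc1[symmetric] R.m_comm)
    also have "\<dots> \<in> S" using sSQ aSQ[OF a] by blast
    finally show "a \<in> ann S (s \<odot>\<^bsub>M\<^esub> m)" using ac unfolding ann_def by blast
  qed
  then have "s \<odot>\<^bsub>M\<^esub> m \<in> S"
    using tf sm unfolding torsion_free_def pw_ones_cyc_iff[OF S sm, symmetric] by blast
  then show False using SQI[OF m(1) s(1,2)] m(2) by blast
qed

definition only0 :: "nat \<Rightarrow> nat \<Rightarrow> nat" where "only0 t = (\<lambda>i. if i = 0 then t else 0)"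

lemma only0_Suc: "only0 (Suc t) = up (only0 t)" by (simp add: only0_def fun_eq_iff)
lemma only0_0: "only0 0 = (\<lambda>_. 0)" by (simp add: only0_def fun_eq_iff)

text \<open>
  Along a filtration with factors \<open>R/\<nn>\<close> each step costs one factor \<open>J\<close>.
\<close>

lemma power_into:
  assumes Z: "sub Z" and primes: "\<And>Q. primeideal Q R \<Longrightarrow> residual Z N \<subseteq> Q \<Longrightarrow> Q = \<nn>"
  shows "\<exists>t. pw (only0 t) N \<subseteq> Z"
proof (rule prime_induct[OF Z sub_N sub_le_N[OF Z], where P = "\<lambda>C. \<exists>t. pw (only0 t) C \<subseteq> Z"])
  show "\<exists>t. pw (only0 t) Z \<subseteq> Z" using pw_le[OF Z] by blast
  fix C m assume C: "sub C" "Z \<subseteq> C" "\<exists>t. pw (only0 t) C \<subseteq> Z" and m: "m \<in> carrier M"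
    and Q: "primeideal (ann C m) R" "residual Z N \<subseteq> ann C m"
  obtain t where t: "pw (only0 t) C \<subseteq> Z" using C by blast
  have s: "sub (cyc m)" "sub (cyc m \<^bold>+ C)" using sub_cyc[OF m] C(1) by (simp_all add: sub_plus)
  have "act 0 (cyc m \<^bold>+ C) \<subseteq> C"
  proof (rule ideal_act_least[OF C(1)])
    fix a assume a: "a \<in> I 0"
    then have ac: "a \<in> carrier R" using I_carrier[OF le0] by blast
    have "a \<in> ann C m" using primes[OF Q] I0_le a by blast
    then have "a \<^bold>* cyc m \<subseteq> C" unfolding ann_eq_residual[OF C(1) m] residual_def by blast
    then show "a \<^bold>* (cyc m \<^bold>+ C) \<subseteq> C"
      unfolding scale_plus[OF ac s(1) C(1)] by (rule plus_least[OF C(1) _ scale_subset[OF ac C(1)]])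
  qed
  then have "pw (only0 (Suc t)) (cyc m \<^bold>+ C) \<subseteq> pw (only0 t) C"
    unfolding only0_Suc pw_Suc'[OF le0 s(2)] by (rule pw_mono[OF C(1)])
  then show "\<exists>t. pw (only0 t) (cyc m \<^bold>+ C) \<subseteq> Z" using t by (meson order_trans)
qed

text \<open>
  The same module with \<open>J\<close> as the only ideal: its Hilbert function is the first difference
  of the Hilbert--Samuel function.
\<close>

lemma local_family_zero: "local_family R M \<nn> 0 I"
proof (intro local_family.intro local_family_axioms.intro)
  show "noetherian_ring_module R M" by (rule noetherian_ring_module_axioms)
  show "ideal (I i) R" if "i \<le> 0" for i using I_ideals[of i] that by simp
qed (rule nn prime_le I0_le I0_prime; assumption?)+

lemma element_power_le: "b \<in> ideal_monomial R d I ones \<Longrightarrow> (b [^] (t::nat)) \<^bold>* N \<subseteq> pw (mult_ones t) N"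
proof (induction t)
  case 0
  show ?case unfolding mult_ones_0 pw_zero[OF sub_N] using scale_one[OF sub_N] by simp
next
  case (Suc t)
  have bc: "b \<in> carrier R" by (rule subsetD[OF monomial_carrier Suc.prems])
  have "(b [^] Suc t) \<^bold>* N = b \<^bold>* (b [^] t) \<^bold>* N" by (rule scale_pow_Suc[OF bc sub_N, symmetric])
  also have "\<dots> \<subseteq> b \<^bold>* pw (mult_ones t) N" by (rule scale_mono[OF Suc.IH[OF Suc.prems]])
  also have "\<dots> \<subseteq> pw ones (pw (mult_ones t) N)"
    unfolding pw_def[of ones] by (rule scale_le_ideal_act[OF Suc.prems])
  also have "\<dots> = pw (mult_ones (Suc t)) N" unfolding mult_ones_Suc pw_add[OF sub_N] by (rule refl)
  finally show ?case .
qed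

text \<open>
  Both Hilbert functions are eventually constant; it remains to see that the constants
  agree. Fix exponents \<open>n' = (0, c, \<dots>, c)\<close> so large that \<open>hf S N\<close> has its final value beyond
  them, and let \<open>H = I^{n'} N + S\<close>. The powers of \<open>J\<close> alone, applied to \<open>H\<close>, give this
  value. By \<open>product_not_in_prime\<close> the only prime over the annihilator of \<open>N/H\<close> is \<open>\<nn>\<close>, so
  \<open>J^t N \<subseteq> H\<close> for some \<open>t\<close> by \<open>power_into\<close>, and \<open>const_sandwich\<close> for the single ideal \<open>J\<close>
  shows that \<open>H\<close> and \<open>N\<close> give the same constant.
\<close>

theorem const_value:
  assumes S: "sub S" and dim: "dim_le1 S" and tf: "torsion_free S"
  shows "\<exists>e. const_diff d [] (hf S N) e \<and> const_diff 0 [] (ideal_family.hf R M 0 I S N) e"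
proof -
  interpret Z: local_family R M \<nn> 0 I by (rule local_family_zero)
  obtain e where e: "const_diff d [] (hf S N) e" using const_dim_le1[OF S dim] by blast
  have "Z.dim_le1 S" using dim unfolding dim_le1_def Z.dim_le1_def .
  then obtain e0 where e0: "const_diff 0 [] (Z.hf S N) e0" using Z.const_dim_le1[OF S] by blast
  obtain c where c: "\<And>n. (\<And>i. i \<le> d \<Longrightarrow> c \<le> n i) \<Longrightarrow> int (hf S N n) = e"
    using e unfolding const_diff_def for_all_large_def by auto
  define n' where "n' = (\<lambda>i. if 1 \<le> i \<and> i \<le> d then c else 0)"
  have mn': "multi_index d n'" unfolding n'_def multi_index_def by simp
  define H where "H = pw n' N \<^bold>+ S"
  have H: "sub H" "S \<subseteq> H" unfolding H_def by (rule sub_plus[OF sub_pw[OF sub_N] S], rule plus_upper2[OF sub_pw[OF sub_N] S])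
  have Zpw: "Z.pw n U = pw (only0 (n 0)) U" if U: "sub U" for n U
  proof -
    have "Z.pw n U = pw (only0 (n 0)) U" if "multi_index 0 n" for n
      using that
    proof (induction rule: index_induct)
      case zero
      show ?case by (simp add: Z.pw_zero[OF U] only0_0 pw_zero[OF U])
    next
      case (Suc n i)
      then have i: "i = 0" by simp
      show ?case unfolding i Z.pw_Suc[OF le0 U] fun_upd_same only0_Suc pw_Suc[OF le0 U] using Suc(3) by simp
    qed
    from this[of "restrict_index 0 n"] show ?thesis unfolding Z.pw_restrict by (simp add: restrict_index_def multi_index_def)
  qed
  have Zfil: "Z.fil S H n = fil S N (\<lambda>i. only0 (n 0) i + n' i)" for n
    unfolding H_def Z.fil_absorb[OF S sub_pw[OF sub_N]] Zpw[OF sub_pw[OF sub_N]] pw_add[OF sub_N, symmetric] fil_def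
    by (rule refl)
  have Zhf: "Z.hf S H n = hf S N (\<lambda>i. only0 (n 0) i + n' i)" for n
  proof -
    have r: "restrict_index 0 n 0 = n 0" by (simp add: restrict_index_def)
    have u: "(\<lambda>i. only0 (Suc (n 0)) i + n' i) = up (\<lambda>i. only0 (n 0) i + n' i)"
      by (simp add: only0_def fun_eq_iff)
    have mi: "multi_index d (\<lambda>i. only0 (n 0) i + n' i)" using mn' by (simp add: multi_index_def only0_def)
    show ?thesis unfolding Z.hf_def hf_def Z.hlen_def hlen_def Zfil fun_upd_same r u restrict_index_id[OF mi] by (rule refl)
  qed
  have "const_diff 0 [] (Z.hf S H) e" unfolding const_diff_def for_all_large_def
  proof (intro exI[of _ c] allI impI)
    fix n :: "nat \<Rightarrow> nat" assume "\<forall>i\<le>0. c \<le> n i"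
    then have "int (hf S N (\<lambda>i. only0 (n 0) i + n' i)) = e"
      by (intro c) (auto simp: only0_def n'_def)
    then show "mdiffs [] (\<lambda>n. int (Z.hf S H n)) n = e" by (simp add: Zhf)
  qed
  moreover have "const_diff 0 [] (Z.hf S H) e0"
  proof -
    have "\<exists>t. pw (only0 t) N \<subseteq> H"
    proof (rule power_into[OF H(1)])
      fix Q assume Q: "primeideal Q R" "residual H N \<subseteq> Q"
      show "Q = \<nn>"
      proof (rule ccontr)
        assume "Q \<noteq> \<nn>"
        moreover have "residual S N \<subseteq> Q" using residual_mono[OF H(2)] Q(2) by blast
        ultimately obtain b where b: "b \<in> ideal_monomial R d I ones" "b \<notin> Q"
          using product_not_in_prime[OF S dim tf Q(1)] by blast
        have bc: "b \<in> carrier R" by (rule subsetD[OF monomial_carrier b(1)])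
        have "(b [^] c) \<^bold>* N \<subseteq> pw (mult_ones c) N" by (rule element_power_le[OF b(1)])
        also have "mult_ones c = (\<lambda>i. n' i + only0 c i)"
          by (auto simp: fun_eq_iff mult_ones_def ones_def n'_def only0_def)
        also have "pw (\<lambda>i. n' i + only0 c i) N \<subseteq> pw n' N"
          unfolding pw_add[OF sub_N] by (rule pw_mono[OF sub_N pw_le[OF sub_N]])
        also have "\<dots> \<subseteq> H" unfolding H_def by (rule plus_upper1[OF sub_pw[OF sub_N] S])
        finally have "b [^] c \<in> residual H N" unfolding residual_def using bc by simp
        then have "b \<in> Q" using R.prime_power[OF Q(1) bc, of c] Q(2) by blast
        then show False using b(2) by blast
      qed
    qed
    then obtain t where t: "pw (only0 t) N \<subseteq> H" by blast
    show ?thesis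
    proof (rule Z.const_sandwich[OF S sub_N H(1,2) sub_le_N[OF H(1)] _ _ _ e0])
      show "multi_index 0 (only0 t)" by (simp add: multi_index_def only0_def)
      show "Z.pw (only0 t) N \<subseteq> H" unfolding Zpw[OF sub_N] using t by (simp add: only0_def)
    qed simp
  qed
  ultimately have "e = e0" by (rule const_diff_unique)
  then show ?thesis using e e0 by blast
qed

text \<open>
  The Hilbert function of \<open>S/L\<close> vanishes for large arguments, so \<open>const_extension\<close> adds
  nothing to \<open>e\<close>.
\<close>

lemma const_saturation:
  assumes L: "sub L" and S: "sub S" "L \<subseteq> S" and t: "pw (mult_ones t) S \<subseteq> L" and e: "const_diff d [] (hf S N) e"
  shows "const_diff d [] (hf L N) e"
proof -
  have zero: "fil L S n = L" if n: "\<forall>i\<le>d. t \<le> n i" for n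
  proof (rule equalityI)
    have "restrict_index d n = (\<lambda>i. (restrict_index d n i - mult_ones t i) + mult_ones t i)"
      using n by (auto simp: fun_eq_iff restrict_index_def mult_ones_def ones_def)
    then have "pw n S = pw (\<lambda>i. (restrict_index d n i - mult_ones t i) + mult_ones t i) S"
      using pw_restrict[of n S] by simp
    also have "\<dots> \<subseteq> L" unfolding pw_add[OF S(1)]
      by (rule order_trans[OF pw_mono[OF L t] pw_le[OF L]])
    finally show "fil L S n \<subseteq> L" unfolding fil_def by (rule plus_least[OF L _ order_refl])
    show "L \<subseteq> fil L S n" unfolding fil_def by (rule plus_upper2[OF sub_pw[OF S(1)] L])
  qed
  have "const_diff d [] (hf L S) 0"
  proof (rule const_diff_cong[OF const_diff_zero])
    show "for_all_large d (\<lambda>n. 0 = hf L S n)" unfolding for_all_large_def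
    proof (intro exI[of _ t] allI impI)
      fix n assume n: "\<forall>i\<le>d. t \<le> n i"
      then have 1: "fil L S (restrict_index d n) = L" by (intro zero) (simp add: restrict_index_def)
      have 2: "fil L S (up (restrict_index d n)) = L"
        using n by (intro zero) (auto simp: restrict_index_def le_SucI)
      show "0 = hf L S n" unfolding hf_def hlen_def 1 2 by (simp add: len_same[OF L] zero_enat_def)
    qed
  qed
  from const_extension[OF L sub_N S sub_le_N[OF S(1)] _ this e] show ?thesis by simp
qed

end

section \<open>Presentations of quotients and subquotients\<close>

text \<open>
  Every module axiom is transported along the surjection \<open>\<pi>\<close>; no structure on \<open>Q\<close> has to be
  known beforehand.
\<close>

lemma (in module) module_image:
  assumes H: "sub H" and Q: "carrier Q = \<pi> ` H" "\<zero>\<^bsub>Q\<^esub> = \<pi> \<zero>\<^bsub>M\<^esub>"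
    and add: "\<And>x y. x \<in> H \<Longrightarrow> y \<in> H \<Longrightarrow> \<pi> (x \<oplus>\<^bsub>M\<^esub> y) = \<pi> x \<oplus>\<^bsub>Q\<^esub> \<pi> y"
    and smult: "\<And>a x. a \<in> carrier R \<Longrightarrow> x \<in> H \<Longrightarrow> \<pi> (a \<odot>\<^bsub>M\<^esub> x) = a \<odot>\<^bsub>Q\<^esub> \<pi> x"
  shows "module R Q"
proof -
  note c = sub_carrier[OF H]
  note add' = add[symmetric] and smult' = smult[symmetric]
  note aH = sub_addD[OF H] and sH = sub_smultD[OF H] and zH = sub_zero[OF H]
  have QE: "\<exists>u\<in>H. x = \<pi> u" if "x \<in> carrier Q" for x using that Q(1) by blast
  have "abelian_group Q"
  proof (rule abelian_groupI)
    fix x y assume "x \<in> carrier Q" "y \<in> carrier Q"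
    then obtain u v where u: "u \<in> H" "x = \<pi> u" and v: "v \<in> H" "y = \<pi> v" using QE by metis
    show "x \<oplus>\<^bsub>Q\<^esub> y \<in> carrier Q" unfolding u(2) v(2) add'[OF u(1) v(1)] Q(1) by (rule imageI[OF aH[OF u(1) v(1)]])
    show "x \<oplus>\<^bsub>Q\<^esub> y = y \<oplus>\<^bsub>Q\<^esub> x"
      unfolding u(2) v(2) add'[OF u(1) v(1)] add'[OF v(1) u(1)] M.a_comm[OF c[OF u(1)] c[OF v(1)]] by (rule refl)
    fix z assume "z \<in> carrier Q"
    then obtain w where w: "w \<in> H" "z = \<pi> w" using QE by metis
    show "x \<oplus>\<^bsub>Q\<^esub> y \<oplus>\<^bsub>Q\<^esub> z = x \<oplus>\<^bsub>Q\<^esub> (y \<oplus>\<^bsub>Q\<^esub> z)"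
      unfolding u(2) v(2) w(2) add'[OF u(1) v(1)] add'[OF v(1) w(1)] add'[OF aH[OF u(1) v(1)] w(1)]
        add'[OF u(1) aH[OF v(1) w(1)]] M.a_assoc[OF c[OF u(1)] c[OF v(1)] c[OF w(1)]] by (rule refl)
  next
    show "\<zero>\<^bsub>Q\<^esub> \<in> carrier Q" unfolding Q using zH by (rule imageI)
  next
    fix x assume "x \<in> carrier Q"
    then obtain u where u: "u \<in> H" "x = \<pi> u" using QE by metis
    show "\<zero>\<^bsub>Q\<^esub> \<oplus>\<^bsub>Q\<^esub> x = x"
      unfolding u(2) Q(2) add'[OF zH u(1)] using c[OF u(1)] by simp
    have mu: "\<ominus>\<^bsub>M\<^esub> u \<in> H" by (rule sub_minusD[OF H u(1)])
    have "\<pi> (\<ominus>\<^bsub>M\<^esub> u) \<oplus>\<^bsub>Q\<^esub> x = \<zero>\<^bsub>Q\<^esub>"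
      unfolding u(2) Q(2) add'[OF mu u(1)] using c[OF u(1)] by (simp add: M.l_neg)
    then show "\<exists>y\<in>carrier Q. y \<oplus>\<^bsub>Q\<^esub> x = \<zero>\<^bsub>Q\<^esub>" unfolding Q(1) using mu by blast
  qed
  then show ?thesis
  proof (rule moduleI[OF R.is_cring])
    fix a x assume a: "a \<in> carrier R" and "x \<in> carrier Q"
    then obtain u where u: "u \<in> H" "x = \<pi> u" using QE by metis
    show "a \<odot>\<^bsub>Q\<^esub> x \<in> carrier Q" unfolding u(2) smult'[OF a u(1)] Q(1) by (rule imageI[OF sH[OF a u(1)]])
    {
      fix b assume b: "b \<in> carrier R"
      have ab: "a \<oplus> b \<in> carrier R" "a \<otimes> b \<in> carrier R" using a b by simp_all
      show "(a \<oplus> b) \<odot>\<^bsub>Q\<^esub> x = a \<odot>\<^bsub>Q\<^esub> x \<oplus>\<^bsub>Q\<^esub> b \<odot>\<^bsub>Q\<^esub> x"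
        unfolding u(2) smult'[OF ab(1) u(1)] smult'[OF a u(1)] smult'[OF b u(1)] add'[OF sH[OF a u(1)] sH[OF b u(1)]]
          smult_l_distr[OF a b c[OF u(1)]] by (rule refl)
      show "(a \<otimes> b) \<odot>\<^bsub>Q\<^esub> x = a \<odot>\<^bsub>Q\<^esub> (b \<odot>\<^bsub>Q\<^esub> x)"
        unfolding u(2) smult'[OF ab(2) u(1)] smult'[OF b u(1)] smult'[OF a sH[OF b u(1)]]
          smult_assoc1[OF a b c[OF u(1)]] by (rule refl)
    }
    fix y assume "y \<in> carrier Q"
    then obtain v where v: "v \<in> H" "y = \<pi> v" using QE by metis
    show "a \<odot>\<^bsub>Q\<^esub> (x \<oplus>\<^bsub>Q\<^esub> y) = a \<odot>\<^bsub>Q\<^esub> x \<oplus>\<^bsub>Q\<^esub> a \<odot>\<^bsub>Q\<^esub> y"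
      unfolding u(2) v(2) add'[OF u(1) v(1)] smult'[OF a u(1)] smult'[OF a v(1)] smult'[OF a aH[OF u(1) v(1)]]
        add'[OF sH[OF a u(1)] sH[OF a v(1)]] smult_r_distr[OF a c[OF u(1)] c[OF v(1)]] by (rule refl)
  next
    fix x assume "x \<in> carrier Q"
    then obtain u where u: "u \<in> H" "x = \<pi> u" using QE by metis
    show "\<one> \<odot>\<^bsub>Q\<^esub> x = x" unfolding u(2) smult'[OF R.one_closed u(1)] using c[OF u(1)] by simp
  qed
qed

lemma (in module) zero_is_submodule: "sub {\<zero>\<^bsub>M\<^esub>}"
  by (rule submoduleI) auto

lemma module_length_eq: 
  assumes "module R M" shows "module_length R M = interval_length R M {\<zero>\<^bsub>M\<^esub>} (carrier M)"
proof -
  interpret module R M by (rule assms)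
  have "submodule U R M \<longleftrightarrow> submodule U R M \<and> {\<zero>\<^bsub>M\<^esub>} \<subseteq> U \<and> U \<subseteq> carrier M" for U
    using sub_zero[of U] submoduleE(1)[of U] by blast
  then show ?thesis unfolding module_length_def interval_length_def by (simp only:)
qed

text \<open>
  An isomorphism of \<open>H/L\<close> with \<open>Q\<close>, given by a surjection on \<open>H\<close> with kernel \<open>L\<close>. The
  definitions speak about the module itself, about quotients \<open>N/L\<close>, and about subquotients
  \<open>H/L\<close>, all of which have presentations by submodules of \<open>N\<close>; so one translation of the
  definitions into intervals of submodules suffices.
\<close>

locale presentation = module R M + Q: module R Q
  for R (structure) and M (structure) and Q +
  fixes H L and \<pi>
  assumes sub_H: "submodule H R M" and sub_L: "submodule L R M" and L_le: "L \<subseteq> H"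
    and onto: "carrier Q = \<pi> ` H"
    and pi_add: "\<And>x y. x \<in> H \<Longrightarrow> y \<in> H \<Longrightarrow> \<pi> (x \<oplus>\<^bsub>M\<^esub> y) = \<pi> x \<oplus>\<^bsub>Q\<^esub> \<pi> y"
    and pi_smult: "\<And>a x. a \<in> carrier R \<Longrightarrow> x \<in> H \<Longrightarrow> \<pi> (a \<odot>\<^bsub>M\<^esub> x) = a \<odot>\<^bsub>Q\<^esub> \<pi> x"
    and kernel: "\<And>x. x \<in> H \<Longrightarrow> \<pi> x = \<zero>\<^bsub>Q\<^esub> \<longleftrightarrow> x \<in> L"
begin

definition lift where "lift Z = {x \<in> H. \<pi> x \<in> Z}"

lemma liftI: "x \<in> H \<Longrightarrow> \<pi> x \<in> Z \<Longrightarrow> x \<in> lift Z" unfolding lift_def by simp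
lemma liftD: "x \<in> lift Z \<Longrightarrow> x \<in> H" "x \<in> lift Z \<Longrightarrow> \<pi> x \<in> Z" unfolding lift_def by simp_all

lemma pi_zero: "\<pi> \<zero>\<^bsub>M\<^esub> = \<zero>\<^bsub>Q\<^esub>" using kernel[OF sub_zero[OF sub_H]] sub_zero[OF sub_L] by simp
lemma pi_carrier: "x \<in> H \<Longrightarrow> \<pi> x \<in> carrier Q" unfolding onto by (rule imageI)

lemma pi_minus: assumes x: "x \<in> H" shows "\<pi> (\<ominus>\<^bsub>M\<^esub> x) = \<ominus>\<^bsub>Q\<^esub> \<pi> x"
proof -
  have mx: "\<ominus>\<^bsub>M\<^esub> x \<in> H" by (rule sub_minusD[OF sub_H x])
  have "\<pi> (\<ominus>\<^bsub>M\<^esub> x) \<oplus>\<^bsub>Q\<^esub> \<pi> x = \<zero>\<^bsub>Q\<^esub>"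
    unfolding pi_add[OF mx x, symmetric] pi_zero[symmetric] using sub_carrier[OF sub_H x] by (simp add: M.l_neg)
  then show ?thesis by (rule Q.M.minus_equality[symmetric, OF _ pi_carrier[OF x] pi_carrier[OF mx]])
qed

lemma sub_lift: assumes Z: "Q.sub Z" shows "sub (lift Z)"
proof (rule submoduleI)
  show "lift Z \<subseteq> carrier M" using liftD(1) sub_carrier[OF sub_H] by blast
  show "\<zero>\<^bsub>M\<^esub> \<in> lift Z" by (rule liftI[OF sub_zero[OF sub_H]]) (simp add: pi_zero Z)
next
  fix x assume x: "x \<in> lift Z"
  show "\<ominus>\<^bsub>M\<^esub> x \<in> lift Z"
    by (rule liftI[OF sub_minusD[OF sub_H liftD(1)[OF x]]])
      (simp only: pi_minus[OF liftD(1)[OF x]] Q.sub_minusD[OF Z liftD(2)[OF x]])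
next
  fix x y assume x: "x \<in> lift Z" and y: "y \<in> lift Z"
  show "x \<oplus>\<^bsub>M\<^esub> y \<in> lift Z"
    by (rule liftI[OF sub_addD[OF sub_H liftD(1)[OF x] liftD(1)[OF y]]])
      (simp only: pi_add[OF liftD(1)[OF x] liftD(1)[OF y]] Q.sub_addD[OF Z liftD(2)[OF x] liftD(2)[OF y]])
next
  fix a x assume a: "a \<in> carrier R" and x: "x \<in> lift Z"
  show "a \<odot>\<^bsub>M\<^esub> x \<in> lift Z"
    by (rule liftI[OF sub_smultD[OF sub_H a liftD(1)[OF x]]])
      (simp only: pi_smult[OF a liftD(1)[OF x]] Q.sub_smultD[OF Z a liftD(2)[OF x]])
qed

lemma lift_le: "lift Z \<subseteq> H" unfolding lift_def by blast
lemma L_le_lift: "\<zero>\<^bsub>Q\<^esub> \<in> Z \<Longrightarrow> L \<subseteq> lift Z"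
proof
  fix x assume Z: "\<zero>\<^bsub>Q\<^esub> \<in> Z" and x: "x \<in> L"
  then have xH: "x \<in> H" using L_le by blast
  then have "\<pi> x = \<zero>\<^bsub>Q\<^esub>" using kernel x by simp
  then show "x \<in> lift Z" using Z xH by (simp add: lift_def)
qed
lemma lift_mono: "Z \<subseteq> W \<Longrightarrow> lift Z \<subseteq> lift W" unfolding lift_def by blast
lemma lift_int: "lift (Z \<inter> W) = lift Z \<inter> lift W" unfolding lift_def by blast
lemma lift_zero: "lift {\<zero>\<^bsub>Q\<^esub>} = L"
proof (rule equalityI)
  show "lift {\<zero>\<^bsub>Q\<^esub>} \<subseteq> L" unfolding lift_def using kernel by blast
qed (rule L_le_lift, simp)
lemma lift_carrier: "lift (carrier Q) = H" unfolding lift_def onto by blast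

lemma image_lift: "Z \<subseteq> carrier Q \<Longrightarrow> \<pi> ` lift Z = Z" unfolding onto lift_def by blast

lemma lift_image: assumes U: "sub U" "L \<subseteq> U" "U \<subseteq> H" shows "lift (\<pi> ` U) = U"
proof (rule equalityI)
  show "U \<subseteq> lift (\<pi> ` U)" unfolding lift_def using U(3) by blast
  show "lift (\<pi> ` U) \<subseteq> U"
  proof
    fix x assume "x \<in> lift (\<pi> ` U)"
    then obtain u where x: "x \<in> H" and u: "u \<in> U" "\<pi> x = \<pi> u" unfolding lift_def by blast
    have uH: "u \<in> H" using u U by blast
    have mu: "\<ominus>\<^bsub>M\<^esub> u \<in> H" by (rule sub_minusD[OF sub_H uH])
    have "\<pi> (x \<oplus>\<^bsub>M\<^esub> \<ominus>\<^bsub>M\<^esub> u) = \<zero>\<^bsub>Q\<^esub>"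
      unfolding pi_add[OF x mu] pi_minus[OF uH] u(2) by (rule Q.M.r_neg[OF pi_carrier[OF uH]])
    then have "x \<oplus>\<^bsub>M\<^esub> \<ominus>\<^bsub>M\<^esub> u \<in> L" using kernel[OF sub_addD[OF sub_H x mu]] by simp
    then have "x \<oplus>\<^bsub>M\<^esub> \<ominus>\<^bsub>M\<^esub> u \<in> U" using U by blast
    then show "x \<in> U" by (rule sub_diffD[OF U(1) sub_carrier[OF sub_H x] sub_minusD[OF U(1) u(1)]])
  qed
qed

lemma sub_image: assumes U: "sub U" "U \<subseteq> H" shows "Q.sub (\<pi> ` U)"
proof (rule Q.submoduleI)
  note h = subsetD[OF U(2)]
  show "\<pi> ` U \<subseteq> carrier Q" unfolding onto using U(2) by (rule image_mono)
  show "\<zero>\<^bsub>Q\<^esub> \<in> \<pi> ` U" unfolding pi_zero[symmetric] by (rule imageI[OF sub_zero[OF U(1)]])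
  show "\<ominus>\<^bsub>Q\<^esub> x \<in> \<pi> ` U" if "x \<in> \<pi> ` U" for x
    using that pi_minus[OF h] sub_minusD[OF U(1)] by (elim imageE) (metis imageI)
  show "x \<oplus>\<^bsub>Q\<^esub> y \<in> \<pi> ` U" if "x \<in> \<pi> ` U" "y \<in> \<pi> ` U" for x y
    using that pi_add[OF h h] sub_addD[OF U(1)] by (elim imageE) (metis imageI)
  show "a \<odot>\<^bsub>Q\<^esub> x \<in> \<pi> ` U" if "a \<in> carrier R" "x \<in> \<pi> ` U" for a x
    using that pi_smult[OF that(1) h] sub_smultD[OF U(1) that(1)] by (elim imageE) (metis imageI)
qed

text \<open>
  Submodules of \<open>Q\<close> correspond to submodules of \<open>M\<close> between \<open>L\<close> and \<open>H\<close>.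
\<close>

lemma len_lift: assumes A: "Q.sub A" and B: "Q.sub B" shows "Q.len A B = len (lift A) (lift B)"
proof (rule interval_length_eq[where f = lift and g = "image \<pi>"])
  fix Z assume Z: "Q.sub Z" "A \<subseteq> Z" "Z \<subseteq> B"
  show "sub (lift Z) \<and> lift A \<subseteq> lift Z \<and> lift Z \<subseteq> lift B \<and> \<pi> ` lift Z = Z"
    by (intro conjI sub_lift Z(1) lift_mono Z(2,3) image_lift Q.submoduleE(1))
next
  fix Z assume Z: "sub Z" "lift A \<subseteq> Z" "Z \<subseteq> lift B"
  have ZH: "Z \<subseteq> H" using Z(3) lift_le by (rule order_trans)
  have LZ: "L \<subseteq> Z" using L_le_lift[OF Q.sub_zero[OF A]] Z(2) by (rule order_trans)
  show "Q.sub (\<pi> ` Z) \<and> A \<subseteq> \<pi> ` Z \<and> \<pi> ` Z \<subseteq> B \<and> lift (\<pi> ` Z) = Z"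
  proof (intro conjI sub_image lift_image Z(1) ZH LZ)
    show "A \<subseteq> \<pi> ` Z" using image_mono[OF Z(2), of \<pi>] unfolding image_lift[OF Q.submoduleE(1)[OF A]] .
    show "\<pi> ` Z \<subseteq> B" using image_mono[OF Z(3), of \<pi>] unfolding image_lift[OF Q.submoduleE(1)[OF B]] .
  qed
qed (rule lift_mono, assumption, rule image_mono)

lemma module_length: "module_length R Q = len L H"
  unfolding module_length_eq[OF Q.module_axioms]
    len_lift[OF Q.zero_is_submodule Q.carrier_is_submodule] lift_zero lift_carrier by (rule refl)

lemma lift_ideal_act:
  assumes A: "A \<subseteq> carrier R" shows "lift (Q.ideal_act A (carrier Q)) = ideal_act A H \<^bold>+ L"
proof (rule equalityI)
  note s = sub_ideal_act[OF A sub_H]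
  have sp: "sub (ideal_act A H \<^bold>+ L)" by (rule sub_plus[OF s sub_L])
  have le: "ideal_act A H \<^bold>+ L \<subseteq> H" by (rule plus_least[OF sub_H ideal_act_subset[OF A sub_H] L_le])
  have up: "L \<subseteq> ideal_act A H \<^bold>+ L" by (rule plus_upper2[OF s sub_L])
  have "Q.ideal_act A (carrier Q) \<subseteq> \<pi> ` (ideal_act A H \<^bold>+ L)"
  proof (rule Q.ideal_act_least[OF sub_image[OF sp le]])
    fix a assume a: "a \<in> A"
    then have ac: "a \<in> carrier R" using A by blast
    show "(\<odot>\<^bsub>Q\<^esub>) a ` carrier Q \<subseteq> \<pi> ` (ideal_act A H \<^bold>+ L)"
    proof
      fix y assume "y \<in> (\<odot>\<^bsub>Q\<^esub>) a ` carrier Q"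
      then obtain x where x: "x \<in> H" "y = a \<odot>\<^bsub>Q\<^esub> \<pi> x" unfolding onto by blast
      have "a \<odot>\<^bsub>M\<^esub> x \<in> ideal_act A H \<^bold>+ L" using ideal_actI[OF a x(1)] plus_upper1[OF s sub_L] by blast
      then show "y \<in> \<pi> ` (ideal_act A H \<^bold>+ L)" unfolding x(2) pi_smult[OF ac x(1), symmetric] by (rule imageI)
    qed
  qed
  from lift_mono[OF this] show "lift (Q.ideal_act A (carrier Q)) \<subseteq> ideal_act A H \<^bold>+ L"
    unfolding lift_image[OF sp up le] .
  have sq: "Q.sub (Q.ideal_act A (carrier Q))" by (rule Q.sub_ideal_act[OF A Q.carrier_is_submodule])
  show "ideal_act A H \<^bold>+ L \<subseteq> lift (Q.ideal_act A (carrier Q))"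
  proof (rule plus_least[OF sub_lift[OF sq] ideal_act_least[OF sub_lift[OF sq]] L_le_lift[OF Q.sub_zero[OF sq]]])
    fix a assume a: "a \<in> A"
    then have ac: "a \<in> carrier R" using A by blast
    show "a \<^bold>* H \<subseteq> lift (Q.ideal_act A (carrier Q))"
    proof
      fix y assume "y \<in> a \<^bold>* H"
      then obtain x where x: "x \<in> H" "y = a \<odot>\<^bsub>M\<^esub> x" by blast
      show "y \<in> lift (Q.ideal_act A (carrier Q))" unfolding x(2)
        by (rule liftI[OF sub_smultD[OF sub_H ac x(1)]])
          (unfold pi_smult[OF ac x(1)], rule Q.ideal_actI[OF a pi_carrier[OF x(1)]])
    qed
  qed
qed

lemma lift_scale:
  assumes a: "a \<in> carrier R" and Z: "Q.sub Z" shows "lift ((\<odot>\<^bsub>Q\<^esub>) a ` Z) = a \<^bold>* lift Z \<^bold>+ L"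
proof -
  note s = sub_scale[OF a sub_lift[OF Z]]
  have le: "a \<^bold>* lift Z \<^bold>+ L \<subseteq> H"
    by (rule plus_least[OF sub_H order_trans[OF scale_subset[OF a sub_lift[OF Z]] lift_le] L_le])
  have h: "\<pi> (a \<odot>\<^bsub>M\<^esub> z) = a \<odot>\<^bsub>Q\<^esub> \<pi> z" if "z \<in> lift Z" for z by (rule pi_smult[OF a liftD(1)[OF that]])
  have "(\<odot>\<^bsub>Q\<^esub>) a ` Z = \<pi> ` (a \<^bold>* lift Z \<^bold>+ L)"
  proof (rule equalityI; rule subsetI)
    fix y assume "y \<in> (\<odot>\<^bsub>Q\<^esub>) a ` Z"
    then have "y \<in> (\<odot>\<^bsub>Q\<^esub>) a ` \<pi> ` lift Z" unfolding image_lift[OF Q.submoduleE(1)[OF Z]] .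
    then obtain z where z: "z \<in> lift Z" "y = a \<odot>\<^bsub>Q\<^esub> \<pi> z" by (elim imageE) simp
    have "a \<odot>\<^bsub>M\<^esub> z \<in> a \<^bold>* lift Z \<^bold>+ L" using plus_upper1[OF s sub_L] z(1) by blast
    then show "y \<in> \<pi> ` (a \<^bold>* lift Z \<^bold>+ L)" unfolding z(2) h[OF z(1), symmetric] by (rule imageI)
  next
    fix y assume "y \<in> \<pi> ` (a \<^bold>* lift Z \<^bold>+ L)"
    then obtain x where x: "x \<in> a \<^bold>* lift Z \<^bold>+ L" "y = \<pi> x" by (elim imageE)
    from x(1) obtain z l where z: "z \<in> lift Z" and l: "l \<in> L" and xe: "x = a \<odot>\<^bsub>M\<^esub> z \<oplus>\<^bsub>M\<^esub> l"
      by (rule plusE) blast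
    have zH: "z \<in> H" "\<pi> z \<in> Z" by (rule liftD[OF z])+
    have lH: "l \<in> H" using l L_le by blast
    have "y = a \<odot>\<^bsub>Q\<^esub> \<pi> z \<oplus>\<^bsub>Q\<^esub> \<pi> l" unfolding x(2) xe pi_add[OF sub_smultD[OF sub_H a zH(1)] lH] h[OF z] by (rule refl)
    also have "\<pi> l = \<zero>\<^bsub>Q\<^esub>" using kernel[OF lH] l by simp
    also have "a \<odot>\<^bsub>Q\<^esub> \<pi> z \<oplus>\<^bsub>Q\<^esub> \<zero>\<^bsub>Q\<^esub> = a \<odot>\<^bsub>Q\<^esub> \<pi> z" using a pi_carrier[OF zH(1)] by simp
    finally show "y \<in> (\<odot>\<^bsub>Q\<^esub>) a ` Z" using zH(2) by (rule image_eqI)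
  qed
  then show ?thesis using lift_image[OF sub_plus[OF s sub_L] plus_upper2[OF s sub_L] le] by simp
qed

lemma annihilator_eq: "annihilator R Q = residual L H"
proof -
  have "(\<forall>m\<in>carrier Q. a \<odot>\<^bsub>Q\<^esub> m = \<zero>\<^bsub>Q\<^esub>) \<longleftrightarrow> a \<^bold>* H \<subseteq> L" if a: "a \<in> carrier R" for a
    unfolding onto using pi_smult[OF a] kernel[OF sub_smultD[OF sub_H a]] by (auto simp: image_subset_iff)
  then show ?thesis unfolding annihilator_def residual_def by blast
qed

lemma carrier_trivial: "carrier Q = {\<zero>\<^bsub>Q\<^esub>} \<longleftrightarrow> L = H"
proof
  assume "carrier Q = {\<zero>\<^bsub>Q\<^esub>}"
  then show "L = H" using lift_zero lift_carrier by simp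
next
  assume "L = H"
  then show "carrier Q = {\<zero>\<^bsub>Q\<^esub>}"
    using image_lift[of "carrier Q"] image_lift[of "{\<zero>\<^bsub>Q\<^esub>}"] lift_zero lift_carrier by simp
qed

end

context module
begin

theorem subquot_presentation:
  assumes H: "sub H" and L: "sub L" "L \<subseteq> H"
  shows "presentation R M (subquot_module M H L) H L (\<lambda>x. L +>\<^bsub>M\<^esub> x)"
proof -
  let ?Q = "subquot_module M H L"
  have rc: "L +>\<^bsub>M\<^esub> x = {l \<oplus>\<^bsub>M\<^esub> x | l. l \<in> L}" for x
    unfolding a_r_coset_def' by blast
  have carr: "carrier ?Q = (\<lambda>x. L +>\<^bsub>M\<^esub> x) ` H"
    by (auto simp: subquot_module_def quot_module_def A_RCOSETS_def' a_r_coset_def')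
  have zero: "\<zero>\<^bsub>?Q\<^esub> = L" by (simp add: subquot_module_def quot_module_def)
  have addQ: "X \<oplus>\<^bsub>?Q\<^esub> Y = X \<^bold>+ Y" for X Y
    by (simp add: subquot_module_def quot_module_def set_add_def')
  have smQ: "a \<odot>\<^bsub>?Q\<^esub> X = (\<Union>x\<in>X. L +>\<^bsub>M\<^esub> (a \<odot>\<^bsub>M\<^esub> x))" for a X
    by (simp add: subquot_module_def quot_module_def a_r_coset_def')
  have "subgroup L (add_monoid M)" by (rule submodule.axioms(1)[OF L(1)])
  then have asub: "abelian_subgroup L M"
    by (intro abelian_subgroupI3 additive_subgroup.intro M.abelian_group_axioms)
  interpret A: abelian_subgroup L M by (rule asub)
  have eqI: "L +>\<^bsub>M\<^esub> y = L +>\<^bsub>M\<^esub> x" if "x \<in> carrier M" "y \<in> L +>\<^bsub>M\<^esub> x" for x y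
    using M.a_repr_independence[OF that(2,1) A.a_subgroup] by (rule sym)
  have Lx: "L +>\<^bsub>M\<^esub> x = L \<longleftrightarrow> x \<in> L" if "x \<in> carrier M" for x
    using A.a_rcos_const A.a_rcos_self that by metis
  have add: "L +>\<^bsub>M\<^esub> (x \<oplus>\<^bsub>M\<^esub> y) = (L +>\<^bsub>M\<^esub> x) \<oplus>\<^bsub>?Q\<^esub> (L +>\<^bsub>M\<^esub> y)" if "x \<in> H" "y \<in> H" for x y
    unfolding addQ by (rule A.a_rcos_sum[symmetric]) (use that sub_carrier[OF H] in simp_all)
  have smult: "L +>\<^bsub>M\<^esub> (a \<odot>\<^bsub>M\<^esub> x) = a \<odot>\<^bsub>?Q\<^esub> (L +>\<^bsub>M\<^esub> x)" if a: "a \<in> carrier R" and x: "x \<in> H" for a x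
  proof -
    have xc: "x \<in> carrier M" by (rule sub_carrier[OF H x])
    have "L +>\<^bsub>M\<^esub> (a \<odot>\<^bsub>M\<^esub> y) = L +>\<^bsub>M\<^esub> (a \<odot>\<^bsub>M\<^esub> x)" if y: "y \<in> L +>\<^bsub>M\<^esub> x" for y
    proof -
      obtain l where l: "l \<in> L" "y = l \<oplus>\<^bsub>M\<^esub> x" using y unfolding rc by blast
      have "a \<odot>\<^bsub>M\<^esub> y = a \<odot>\<^bsub>M\<^esub> l \<oplus>\<^bsub>M\<^esub> a \<odot>\<^bsub>M\<^esub> x"
        unfolding l(2) by (rule smult_r_distr[OF a sub_carrier[OF L(1) l(1)] xc])
      then have "a \<odot>\<^bsub>M\<^esub> y \<in> L +>\<^bsub>M\<^esub> (a \<odot>\<^bsub>M\<^esub> x)" unfolding rc using sub_smultD[OF L(1) a l(1)] by blast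
      then show ?thesis by (rule eqI[OF smult_closed[OF a xc]])
    qed
    moreover have "x \<in> L +>\<^bsub>M\<^esub> x" by (rule A.a_rcos_self[OF xc])
    ultimately show ?thesis unfolding smQ by blast
  qed
  have LL: "L +>\<^bsub>M\<^esub> \<zero>\<^bsub>M\<^esub> = L" using Lx[of "\<zero>\<^bsub>M\<^esub>"] sub_zero[OF L(1)] by simp
  have mod: "module R ?Q"
    by (rule module_image[OF H carr _ add smult]) (simp_all only: zero LL)
  show ?thesis
  proof (intro presentation.intro presentation_axioms.intro mod module_axioms H L carr add smult)
    show "(L +>\<^bsub>M\<^esub> x = \<zero>\<^bsub>?Q\<^esub>) = (x \<in> L)" if "x \<in> H" for x
      unfolding zero by (rule Lx[OF sub_carrier[OF H that]])
  qed
qed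

lemma quot_presentation:
  assumes L: "sub L" shows "presentation R M (quot_module M L) (carrier M) L (\<lambda>x. L +>\<^bsub>M\<^esub> x)"
proof -
  have "subquot_module M (carrier M) L = quot_module M L" unfolding subquot_module_def by simp
  then show ?thesis using subquot_presentation[OF carrier_is_submodule L submoduleE(1)[OF L]] by simp
qed

lemma self_presentation: "presentation R M M (carrier M) {\<zero>\<^bsub>M\<^esub>} (\<lambda>x. x)"
  by (intro presentation.intro presentation_axioms.intro module_axioms carrier_is_submodule zero_is_submodule) auto

end

section \<open>Graded components and superficial elements of a presented module\<close>

context ideal_family
begin

text \<open>
  Two presentations are composed: the graded component is a subquotient of \<open>Q\<close>, and \<open>Q\<close> is
  presented by \<open>H\<close> and \<open>L\<close>.
\<close>

lemma graded_length:
  assumes P: "presentation R M Q H L \<pi>"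
  shows "module_length R (graded_component R d I Q n) = enat (hf L H n)"
proof -
  interpret P: presentation R M Q H L \<pi> by (rule P)
  define A where "A = P.Q.ideal_act (ideal_monomial R d I n) (carrier Q)"
  define B where "B = P.Q.ideal_act (ideal_monomial R d I (up n)) (carrier Q)"
  have s: "P.Q.sub A" "P.Q.sub B"
    unfolding A_def B_def by (rule P.Q.sub_ideal_act[OF monomial_carrier P.Q.carrier_is_submodule])+
  have lA: "P.lift A = fil L H n" and lB: "P.lift B = fil L H (up n)"
    unfolding A_def B_def P.lift_ideal_act[OF monomial_carrier] fil_def pw_def by (rule refl)+
  have "P.lift B \<subseteq> P.lift A" unfolding lA lB by (rule fil_antimono[OF P.sub_L P.sub_H le0])
  from image_mono[OF this, of \<pi>] have BA: "B \<subseteq> A"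
    unfolding P.image_lift[OF P.Q.submoduleE(1)[OF s(1)]] P.image_lift[OF P.Q.submoduleE(1)[OF s(2)]] .
  have g: "graded_component R d I Q n = subquot_module Q A B"
    unfolding graded_component_def A_def B_def P.Q.ideal_act_def ideal_smult_def Suc_eq_plus1 by (rule refl)
  have "module_length R (graded_component R d I Q n) = len (fil L H (up n)) (fil L H n)"
    unfolding g presentation.module_length[OF P.Q.subquot_presentation[OF s BA]] P.len_lift[OF s(2,1)] lA lB by (rule refl)
  also have "\<dots> = len (fil L H (up (restrict_index d n))) (fil L H (restrict_index d n))"
    unfolding fil_restrict using fil_restrict[of L H "up n"] unfolding restrict_index_Suc[OF le0] by simp
  also have "\<dots> = enat (hf L H (restrict_index d n))"
    by (rule hf_hilbert(2)[OF P.sub_L P.sub_H P.L_le multi_index_restrict])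
  also have "\<dots> = enat (hf L H n)" unfolding hf_def hlen_restrict by (rule refl)
  finally show ?thesis .
qed

text \<open>
  The coefficients exist because Hilbert functions are of Hilbert type and are unique, so
  the description in \<open>hilbert_coeff\<close> is proper; a constant difference determines the
  coefficient and annihilates the larger ones.
\<close>

lemma mixed_mult_const_diff:
  assumes P: "presentation R M Q H L \<pi>" and ks: "set ks \<subseteq> {..d}" and a: "const_diff d ks (hf L H) a"
  shows "mixed_mult_defined R d I Q (count_list ks)" "mixed_mult R d I Q (count_list ks) = a"
proof -
  have iff: "has_hilbert_coeffs R d I Q e \<longleftrightarrow> has_coeffs d (\<lambda>n. int (hf L H n)) e" for e
    unfolding has_hilbert_coeffs_def has_coeffs_def graded_length[OF P] by simp
  have "hilbert_fun d (hf L H)"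
    by (rule hf_hilbert(1)) (rule presentation.sub_L[OF P] presentation.sub_H[OF P] presentation.L_le[OF P])+
  then obtain e where e: "has_coeffs d (\<lambda>n. int (hf L H n)) e" using hilbert_fun_coeffs by metis
  have he: "hilbert_coeff R d I Q = e"
    unfolding hilbert_coeff_def iff by (rule the_equality) (rule e, rule has_coeffs_unique[OF _ e])
  note m = mdiffs_const_coeffs[OF e ks a[unfolded const_diff_def]]
  show "mixed_mult R d I Q (count_list ks) = a" unfolding mixed_mult_def he by (rule m(1))
  show "mixed_mult_defined R d I Q (count_list ks)"
    unfolding mixed_mult_defined_def he using m(2) count_list_multi_index[OF ks] by blast
qed

text \<open>
  Preimages in \<open>M\<close> of the two sides of the equation in the definition.
\<close>

lemma rees_superficial_quot:
  assumes L: "sub L" and x: "rees_superficial_elem R d I (quot_module M L) i x"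
  shows "i \<le> d" "x \<in> I i"
    "for_all_large d (\<lambda>n. (x \<^bold>* N \<^bold>+ L) \<inter> (act i (pw n N) \<^bold>+ L) = x \<^bold>* pw n N \<^bold>+ L)"
proof -
  let ?Q = "quot_module M L"
  interpret P: presentation R M ?Q N L "\<lambda>x. L +>\<^bsub>M\<^esub> x" by (rule quot_presentation[OF L])
  show i: "i \<le> d" and xi: "x \<in> I i" using x unfolding rees_superficial_elem_def by blast+
  have xc: "x \<in> carrier R" using I_carrier[OF i] xi by blast
  let ?a = "\<lambda>n. P.Q.ideal_act (ideal_monomial R d I n) (carrier ?Q)"
  let ?b = "\<lambda>n. P.Q.ideal_act (ideal_monomial R d I n \<cdot>\<^bsub>R\<^esub> I i) (carrier ?Q)"
  have "for_all_large d (\<lambda>n. (\<odot>\<^bsub>?Q\<^esub>) x ` carrier ?Q \<inter> ?b n = (\<odot>\<^bsub>?Q\<^esub>) x ` ?a n)"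
    using x unfolding rees_superficial_elem_def P.Q.ideal_act_def ideal_smult_def by blast
  then show "for_all_large d (\<lambda>n. (x \<^bold>* N \<^bold>+ L) \<inter> (act i (pw n N) \<^bold>+ L) = x \<^bold>* pw n N \<^bold>+ L)"
  proof (rule for_all_large_mono)
    fix n assume eq: "(\<odot>\<^bsub>?Q\<^esub>) x ` carrier ?Q \<inter> ?b n = (\<odot>\<^bsub>?Q\<^esub>) x ` ?a n"
    have mono_up: "ideal_monomial R d I n \<cdot>\<^bsub>R\<^esub> I i = ideal_monomial R d I (n(i := Suc (n i)))"
      by (rule R.ideal_monomial_Suc[OF _ i, symmetric]) (rule I_ideal)
    have sa: "P.Q.sub (?a n)" by (rule P.Q.sub_ideal_act[OF monomial_carrier P.Q.carrier_is_submodule])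
    have "P.lift ((\<odot>\<^bsub>?Q\<^esub>) x ` carrier ?Q \<inter> ?b n) = (x \<^bold>* N \<^bold>+ L) \<inter> (act i (pw n N) \<^bold>+ L)"
      unfolding P.lift_int P.lift_scale[OF xc P.Q.carrier_is_submodule] P.lift_carrier mono_up
        P.lift_ideal_act[OF monomial_carrier] pw_def[symmetric] pw_Suc[OF i sub_N] by (rule refl)
    moreover have "P.lift ((\<odot>\<^bsub>?Q\<^esub>) x ` ?a n) = x \<^bold>* (pw n N \<^bold>+ L) \<^bold>+ L"
      unfolding P.lift_scale[OF xc sa] P.lift_ideal_act[OF monomial_carrier] pw_def by (rule refl)
    moreover have "x \<^bold>* (pw n N \<^bold>+ L) \<^bold>+ L = x \<^bold>* pw n N \<^bold>+ L"
      unfolding scale_plus[OF xc sub_pw[OF sub_N] L]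
        plus_assoc[OF sub_scale[OF xc sub_pw[OF sub_N]] sub_scale[OF xc L] L]
        plus_absorb2[OF sub_scale[OF xc L] L scale_subset[OF xc L]] by (rule refl)
    ultimately show "(x \<^bold>* N \<^bold>+ L) \<inter> (act i (pw n N) \<^bold>+ L) = x \<^bold>* pw n N \<^bold>+ L" using eq by simp
  qed
qed

end

context module
begin

lemma seq_submodule_eq: "seq_submodule R M xs = ideal_act (Idl (snd ` set xs)) (carrier M)"
  unfolding seq_submodule_def ideal_smult_def ideal_act_def by (rule refl)

lemma genideal_carrier: "S \<subseteq> carrier R \<Longrightarrow> Idl S \<subseteq> carrier R"
  by (rule additive_subgroup.a_subset[OF ideal.axioms(1)[OF R.genideal_ideal]])

lemma sub_seq: "snd ` set xs \<subseteq> carrier R \<Longrightarrow> sub (seq_submodule R M xs)"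
  unfolding seq_submodule_eq by (rule sub_ideal_act[OF genideal_carrier carrier_is_submodule])

lemma seq_submodule_Nil: "seq_submodule R M [] = {\<zero>\<^bsub>M\<^esub>}"
proof (rule equalityI)
  show "seq_submodule R M [] \<subseteq> {\<zero>\<^bsub>M\<^esub>}" unfolding seq_submodule_eq
    by (rule ideal_act_genideal_le[OF _ zero_is_submodule carrier_is_submodule]) simp_all
  show "{\<zero>\<^bsub>M\<^esub>} \<subseteq> seq_submodule R M []" using sub_zero[OF sub_seq[of "[]"]] by simp
qed

text \<open>
  This recursion is what lets \<open>superficial_step\<close> run through the sequence.
\<close>

lemma seq_submodule_snoc:
  assumes xs: "snd ` set xs \<subseteq> carrier R" and x: "snd p \<in> carrier R"
  shows "seq_submodule R M (xs @ [p]) = snd p \<^bold>* carrier M \<^bold>+ seq_submodule R M xs"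
proof (rule equalityI)
  note s = sub_scale[OF x carrier_is_submodule]
  have xp: "snd ` set (xs @ [p]) \<subseteq> carrier R" using xs x by simp
  show "seq_submodule R M (xs @ [p]) \<subseteq> snd p \<^bold>* carrier M \<^bold>+ seq_submodule R M xs"
    unfolding seq_submodule_eq[of "xs @ [p]"]
  proof (rule ideal_act_genideal_le[OF xp sub_plus[OF s sub_seq[OF xs]] carrier_is_submodule])
    fix a assume "a \<in> snd ` set (xs @ [p])"
    then have "a = snd p \<or> a \<in> snd ` set xs" by auto
    then show "a \<^bold>* carrier M \<subseteq> snd p \<^bold>* carrier M \<^bold>+ seq_submodule R M xs"
    proof
      assume a: "a = snd p"
      show ?thesis unfolding a by (rule plus_upper1[OF s sub_seq[OF xs]])
    next
      assume a: "a \<in> snd ` set xs"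
      have "a \<^bold>* carrier M \<subseteq> seq_submodule R M xs" unfolding seq_submodule_eq
        by (rule scale_le_ideal_act[OF subsetD[OF R.genideal_self[OF xs] a]])
      then show ?thesis by (rule order_trans[OF _ plus_upper2[OF s sub_seq[OF xs]]])
    qed
  qed
  show "snd p \<^bold>* carrier M \<^bold>+ seq_submodule R M xs \<subseteq> seq_submodule R M (xs @ [p])"
  proof (rule plus_least[OF sub_seq[OF xp]])
    show "snd p \<^bold>* carrier M \<subseteq> seq_submodule R M (xs @ [p])" unfolding seq_submodule_eq
      by (rule scale_le_ideal_act[OF subsetD[OF R.genideal_self[OF xp]]]) simp
    have "Idl (snd ` set xs) \<subseteq> Idl (snd ` set (xs @ [p]))"
      by (rule R.subset_Idl_subset[OF xp]) (simp add: subset_insertI)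
    then show "seq_submodule R M xs \<subseteq> seq_submodule R M (xs @ [p])" unfolding seq_submodule_eq
      by (rule ideal_act_mono[OF _ order_refl genideal_carrier[OF xp] carrier_is_submodule])
  qed
qed

end

section \<open>Saturation and the Hilbert--Samuel multiplicity\<close>

lemma (in cring) ideal_monomial_zero_power:
  assumes I: "ideal (I 0) R"
  shows "ideal_monomial R 0 I ((\<lambda>_::nat. 0::nat)(0 := k)) = I 0 [^]\<^bsub>ideals_set R\<^esub> k"
proof (induction k)
  case 0
  have "(\<lambda>_::nat. 0::nat)(0 := 0) = (\<lambda>_. 0)" by (rule fun_upd_idem) (rule refl)
  then have "ideal_monomial R 0 I ((\<lambda>_::nat. 0::nat)(0 := 0)) = carrier R" by (simp only: ideal_monomial_zero)
  also have "\<dots> = I 0 [^]\<^bsub>ideals_set R\<^esub> (0::nat)" by (simp add: ideals_set_simps)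
  finally show ?case .
next
  case (Suc k)
  let ?n = "(\<lambda>_::nat. 0::nat)(0 := k)"
  have "(\<lambda>_::nat. 0::nat)(0 := Suc k) = ?n(0 := Suc (?n 0))" by simp
  then have "ideal_monomial R 0 I ((\<lambda>_::nat. 0::nat)(0 := Suc k)) = ideal_monomial R 0 I (?n(0 := Suc (?n 0)))" by (simp only:)
  also have "\<dots> = ideal_monomial R 0 I ?n \<cdot> I 0" by (rule ideal_monomial_Suc) (use I in simp_all)
  finally show ?case unfolding Suc ideal_power_Suc .
qed

context local_family
begin

lemma monomial_ones: "ideal_monomial R d I ones = (\<Otimes>\<^bsub>ideals_set R\<^esub> i \<in> {..d}. I i)"
proof -
  interpret S: comm_monoid "ideals_set R" by (rule R.ideals_set_is_comm_monoid)
  have "I i [^]\<^bsub>ideals_set R\<^esub> ones i = I i" if "i \<le> d" for i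
    using S.nat_pow_eone[of "I i"] I_ideals[OF that] that by (simp add: ones_def R.ideals_set_simps)
  then show ?thesis unfolding ideal_monomial_def
    by (intro S.finprod_cong') (auto simp: R.ideals_set_simps I_ideals)
qed

lemma pw_mult_ones: "sub U \<Longrightarrow> pw (mult_ones t) U = ideal_act (ideal_monomial R d I ones [^]\<^bsub>ideals_set R\<^esub> t) U"
proof (induction t arbitrary: U)
  case 0
  show ?case by (simp add: mult_ones_0 pw_zero[OF 0] R.ideals_set_simps ideal_act_carrier[OF 0])
next
  case (Suc t)
  let ?a = "ideal_monomial R d I ones"
  have "pw (mult_ones (Suc t)) U = pw (mult_ones t) (pw ones U)"
    unfolding pw_add[OF Suc.prems, symmetric] mult_ones_Suc by (simp only: add.commute)
  also have "\<dots> = ideal_act (?a [^]\<^bsub>ideals_set R\<^esub> t) (ideal_act ?a U)"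
    unfolding Suc.IH[OF sub_pw[OF Suc.prems]] unfolding pw_def by (rule refl)
  also have "\<dots> = ideal_act (?a [^]\<^bsub>ideals_set R\<^esub> Suc t) U"
    unfolding R.ideal_power_Suc
    by (rule ideal_act_prod[OF R.ideal_power[OF monomial_ideal] monomial_ideal Suc.prems, symmetric])
  finally show ?case .
qed

definition sat :: "'c set \<Rightarrow> 'c set" where "sat L = colon_sat R M L (ideal_monomial R d I ones)"
definition sat_stage :: "'c set \<Rightarrow> nat \<Rightarrow> 'c set" where
  "sat_stage L t = {m \<in> N. \<forall>a \<in> ideal_monomial R d I ones [^]\<^bsub>ideals_set R\<^esub> t. a \<odot>\<^bsub>M\<^esub> m \<in> L}"

lemma sat_Union: "sat L = (\<Union>t. sat_stage L t)" unfolding sat_def colon_sat_def sat_stage_def by (rule refl)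

lemma power_carrier: "ideal_monomial R d I ones [^]\<^bsub>ideals_set R\<^esub> (t::nat) \<subseteq> carrier R"
  by (rule additive_subgroup.a_subset[OF ideal.axioms(1)[OF R.ideal_power[OF monomial_ideal]]])

text \<open>
  The elementwise condition in \<open>colon_sat\<close> is a statement about the cyclic submodule of \<open>m\<close>,
  which makes the calculus of powers of ideals available.
\<close>

lemma sat_stage_pw:
  assumes L: "sub L" and m: "m \<in> N" shows "m \<in> sat_stage L t \<longleftrightarrow> pw (mult_ones t) (cyc m) \<subseteq> L"
proof
  assume *: "m \<in> sat_stage L t"
  show "pw (mult_ones t) (cyc m) \<subseteq> L" unfolding pw_mult_ones[OF sub_cyc[OF m]]
  proof (rule ideal_act_least[OF L])
    fix a assume a: "a \<in> ideal_monomial R d I ones [^]\<^bsub>ideals_set R\<^esub> t"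
    have "a \<in> ann L m" using * a subsetD[OF power_carrier a] unfolding sat_stage_def ann_def by blast
    then show "a \<^bold>* cyc m \<subseteq> L" unfolding ann_eq_residual[OF L m] residual_def by blast
  qed
next
  assume *: "pw (mult_ones t) (cyc m) \<subseteq> L"
  show "m \<in> sat_stage L t" unfolding sat_stage_def
  proof (intro CollectI conjI ballI m)
    fix a assume a: "a \<in> ideal_monomial R d I ones [^]\<^bsub>ideals_set R\<^esub> t"
    show "a \<odot>\<^bsub>M\<^esub> m \<in> L"
      by (rule subsetD[OF *[unfolded pw_mult_ones[OF sub_cyc[OF m]]] ideal_actI[OF a cyc_self[OF m]]])
  qed
qed

lemma sub_sat_stage: assumes L: "sub L" shows "sub (sat_stage L t)"
proof -
  note p = subsetD[OF power_carrier[of t]]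
  show ?thesis
  proof (rule submoduleI)
    show "sat_stage L t \<subseteq> carrier M" unfolding sat_stage_def by blast
    show "\<zero>\<^bsub>M\<^esub> \<in> sat_stage L t" unfolding sat_stage_def using p sub_zero[OF L] by simp
    show "\<ominus>\<^bsub>M\<^esub> m \<in> sat_stage L t" if "m \<in> sat_stage L t" for m
      using that p sub_minusD[OF L] unfolding sat_stage_def by (simp add: smult_r_minus)
    show "m \<oplus>\<^bsub>M\<^esub> m' \<in> sat_stage L t" if "m \<in> sat_stage L t" "m' \<in> sat_stage L t" for m m'
      using that p sub_addD[OF L] unfolding sat_stage_def by (simp add: smult_r_distr)
  next
    fix b m assume b: "b \<in> carrier R" and m: "m \<in> sat_stage L t"
    have mN: "m \<in> N" using m unfolding sat_stage_def by blast
    have "a \<odot>\<^bsub>M\<^esub> (b \<odot>\<^bsub>M\<^esub> m) \<in> L" if a: "a \<in> ideal_monomial R d I ones [^]\<^bsub>ideals_set R\<^esub> t" for a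
    proof -
      have "a \<odot>\<^bsub>M\<^esub> (b \<odot>\<^bsub>M\<^esub> m) = b \<odot>\<^bsub>M\<^esub> (a \<odot>\<^bsub>M\<^esub> m)"
        using p[OF a] b mN by (simp add: smult_assoc1[symmetric] R.m_comm)
      also have "\<dots> \<in> L" using m a unfolding sat_stage_def by (intro sub_smultD[OF L b]) blast
      finally show ?thesis .
    qed
    then show "b \<odot>\<^bsub>M\<^esub> m \<in> sat_stage L t" unfolding sat_stage_def using b mN by simp
  qed
qed

lemma sat_stage_Suc: assumes L: "sub L" shows "sat_stage L t \<subseteq> sat_stage L (Suc t)"
proof
  fix m assume m: "m \<in> sat_stage L t"
  then have mN: "m \<in> N" unfolding sat_stage_def by blast
  note c = sub_cyc[OF mN]
  have "pw (mult_ones (Suc t)) (cyc m) = pw ones (pw (mult_ones t) (cyc m))"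
    unfolding mult_ones_Suc pw_add[OF c] by (rule refl)
  also have "\<dots> \<subseteq> pw (mult_ones t) (cyc m)" by (rule pw_le[OF sub_pw[OF c]])
  also have "\<dots> \<subseteq> L" using m unfolding sat_stage_pw[OF L mN] .
  finally show "m \<in> sat_stage L (Suc t)" unfolding sat_stage_pw[OF L mN] .
qed

text \<open>
  The stages increase and stabilise at some \<open>c\<close>. An element that the product of the ideals
  multiplies into stage \<open>c\<close> lies in stage \<open>c + 1\<close>.
\<close>

theorem sat_properties:
  assumes L: "sub L"
  shows "sub (sat L)" "L \<subseteq> sat L" "\<exists>t. pw (mult_ones t) (sat L) \<subseteq> L" "torsion_free (sat L)"
proof -
  obtain c where c: "\<forall>i\<ge>c. sat_stage L i = sat_stage L c"
    using ascending_chain[of "sat_stage L"] sub_sat_stage[OF L] sat_stage_Suc[OF L] by metis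
  have mono: "sat_stage L i \<subseteq> sat_stage L j" if "i \<le> j" for i j
    by (rule lift_Suc_mono_le[of "sat_stage L", OF sat_stage_Suc[OF L] that])
  have "sat_stage L i \<subseteq> sat_stage L c" for i
  proof (cases "i \<le> c")
    case True then show ?thesis by (rule mono)
  next
    case False
    then have "c \<le> i" by simp
    from c[rule_format, OF this] show ?thesis by (rule equalityD1)
  qed
  then have S: "sat L = sat_stage L c" unfolding sat_Union by blast
  show sub: "sub (sat L)" unfolding S by (rule sub_sat_stage[OF L])
  show "L \<subseteq> sat L"
  proof
    fix m assume m: "m \<in> L"
    have mN: "m \<in> N" by (rule sub_carrier[OF L m])
    show "m \<in> sat L" unfolding S sat_stage_pw[OF L mN]
      by (rule order_trans[OF pw_le[OF sub_cyc[OF mN]] cyc_le[OF L m]])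
  qed
  have le: "pw (mult_ones c) (sat L) \<subseteq> L" unfolding pw_mult_ones[OF sub]
    by (rule ideal_act_least[OF L]) (auto simp: S sat_stage_def)
  then show "\<exists>t. pw (mult_ones t) (sat L) \<subseteq> L" by blast
  show "torsion_free (sat L)" unfolding torsion_free_def
  proof (intro ballI impI)
    fix m assume m: "m \<in> N" and pw: "pw ones (cyc m) \<subseteq> sat L"
    note s = sub_cyc[OF m]
    have "pw (mult_ones (Suc c)) (cyc m) = pw (mult_ones c) (pw ones (cyc m))"
      unfolding pw_add[OF s, symmetric] mult_ones_Suc by (simp only: add.commute)
    also have "\<dots> \<subseteq> L" by (rule order_trans[OF pw_mono[OF sub pw] le])
    finally have "m \<in> sat_stage L (Suc c)" unfolding sat_stage_pw[OF L m] .
    then show "m \<in> sat L" unfolding S c[rule_format, OF le_SucI[OF order_refl]] .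
  qed
qed

lemma nn_prime: "primeideal \<nn> R" by (rule R.maximalideal_prime[OF nn])

lemma module_dim_chain:
  assumes P: "presentation R M Q N S \<pi>"
    and p: "\<And>i. i \<le> l \<Longrightarrow> primeideal (p i) R" "\<And>i. i < l \<Longrightarrow> p i \<subset> p (Suc i)" "residual S N \<subseteq> p 0"
  shows "ereal (real l) \<le> module_dim R Q"
  unfolding module_dim_def
proof (rule Sup_upper, intro CollectI exI conjI allI impI)
  have mono: "i \<le> l \<Longrightarrow> p 0 \<subseteq> p i" for i
  proof (induction i)
    case (Suc i)
    then show ?case using p(2)[of i] by simp
  qed simp
  fix i assume i: "i \<le> l"
  show "primeideal (p i) R" by (rule p(1)[OF i])
  show "annihilator R Q \<subseteq> p i"
    unfolding presentation.annihilator_eq[OF P] by (rule order_trans[OF p(3) mono[OF i]])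
next
  fix i assume "i < l"
  then show "p i \<subset> p (Suc i)" by (rule p(2))
qed (rule refl)

text \<open>
  A prime \<open>q \<noteq> \<nn>\<close> properly above \<open>p\<close> would give the chain \<open>p \<subset> q \<subset> \<nn>\<close> of length two.
\<close>

lemma dim_le1_of_module_dim:
  assumes P: "presentation R M Q N S \<pi>" and dim: "module_dim R Q \<le> 1"
  shows "dim_le1 S"
  unfolding dim_le1_def
proof (intro allI impI)
  fix p q assume p: "primeideal p R" and q: "primeideal q R" and le: "residual S N \<subseteq> p" and pq: "p \<subset> q"
  show "q = \<nn>"
  proof (rule ccontr)
    assume "q \<noteq> \<nn>"
    then have qn: "q \<subset> \<nn>" using prime_le[OF q] by blast
    define c where "c = (\<lambda>i::nat. if i = 0 then p else if i = 1 then q else \<nn>)"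
    have "ereal (real 2) \<le> module_dim R Q"
    proof (rule module_dim_chain[OF P, where p = c])
      show "primeideal (c i) R" for i unfolding c_def using p q nn_prime by simp
      show "c i \<subset> c (Suc i)" if "i < 2" for i
      proof -
        have "i = 0 \<or> i = 1" using that by auto
        then show ?thesis unfolding c_def using pq qn by auto
      qed
      show "residual S N \<subseteq> c 0" unfolding c_def using le by simp
    qed
    then have "ereal (real 2) \<le> 1" using dim by (rule order_trans)
    then show False by (simp add: one_ereal_def)
  qed
qed

text \<open>
  If \<open>S \<noteq> N\<close>, the dimension is exactly one, since an associated prime of \<open>N/S\<close> is not \<open>\<nn>\<close>:
  otherwise \<open>J\<close>, and with it the product of the ideals, would multiply some element outside
  \<open>S\<close> into \<open>S\<close>. By \<open>len_fil_sum\<close> the length of \<open>N/(J^{n+1} N + S)\<close> is the sum of \<open>n + 1\<close>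
  values of the Hilbert function for the ideal \<open>J\<close> alone, which is eventually \<open>e\<close>; so the
  Hilbert--Samuel polynomial is linear with leading coefficient \<open>e\<close>. For \<open>S = N\<close> both sides
  are zero.
\<close>

theorem multiplicity_value:
  assumes P: "presentation R M Q N S \<pi>" and tf: "torsion_free S" and dim: "module_dim R Q \<le> 1"
    and e: "const_diff d [] (hf S N) e"
  shows "multiplicity_HS R (I 0) Q = of_int e"
proof (cases "S = N")
  case True
  have "const_diff d [] (hf S N) 0" unfolding True hf_self[OF sub_N] by (rule const_diff_zero)
  then have "e = 0" by (rule const_diff_unique[OF e])
  moreover have "carrier Q = {\<zero>\<^bsub>Q\<^esub>}" unfolding presentation.carrier_trivial[OF P] by (rule True)
  ultimately show ?thesis unfolding multiplicity_HS_def by simp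
next
  case False
  interpret P: presentation R M Q N S \<pi> by (rule P)
  interpret Z: local_family R M \<nn> 0 I by (rule local_family_zero)
  note S = P.sub_L
  have nontriv: "carrier Q \<noteq> {\<zero>\<^bsub>Q\<^esub>}" unfolding P.carrier_trivial by (rule False)
  have dim1: "dim_le1 S" by (rule dim_le1_of_module_dim[OF P dim])
  obtain e' where e': "const_diff d [] (hf S N) e'" "const_diff 0 [] (Z.hf S N) e'"
    using const_value[OF S dim1 tf] by blast
  have e0: "const_diff 0 [] (Z.hf S N) e" using e'(2) unfolding const_diff_unique[OF e e'(1)] .
  have D: "(THE D::nat. module_dim R Q = ereal (real D)) = 1"
  proof -
    obtain m where m: "m \<in> N" "m \<notin> S" "primeideal (ann S m) R"
      using associated_prime[OF S sub_N sub_le_N[OF S]] False by metis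
    have strict: "ann S m \<subset> \<nn>" using torsion_free_prime[OF S tf m] prime_le[OF m(3)] by blast
    define c where "c = (\<lambda>i::nat. if i = 0 then ann S m else \<nn>)"
    have "ereal (real 1) \<le> module_dim R Q"
    proof (rule module_dim_chain[OF P, where p = c])
      show "primeideal (c i) R" for i unfolding c_def using m(3) nn_prime by simp
      show "c i \<subset> c (Suc i)" if "i < 1" for i unfolding c_def using that strict by simp
      show "residual S N \<subseteq> c 0" unfolding c_def using residual_le_ann[OF order_refl m(1)] by simp
    qed
    then have "module_dim R Q = 1" using dim by (simp add: one_ereal_def)
    then show ?thesis by (intro the_equality) (simp_all add: one_ereal_def)
  qed
  define h where "h = (\<lambda>j. Z.hf S N ((\<lambda>_::nat. 0::nat)(0 := j)))"
  have len: "module_length R (quot_module Q (ideal_smult R Q (I 0 [^]\<^bsub>ideals_set R\<^esub> k))) = enat (\<Sum>j<k. h j)" for k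
  proof -
    have J: "I 0 [^]\<^bsub>ideals_set R\<^esub> k = ideal_monomial R 0 I ((\<lambda>_::nat. 0::nat)(0 := k))"
      by (rule sym, rule R.ideal_monomial_zero_power) (rule I_ideals[OF le0])
    define A where "A = P.Q.ideal_act (ideal_monomial R 0 I ((\<lambda>_::nat. 0::nat)(0 := k))) (carrier Q)"
    have A: "P.Q.sub A" unfolding A_def by (rule P.Q.sub_ideal_act[OF Z.monomial_carrier P.Q.carrier_is_submodule])
    have lA: "P.lift A = Z.fil S N ((\<lambda>_::nat. 0::nat)(0 := k))"
      unfolding A_def P.lift_ideal_act[OF Z.monomial_carrier] Z.fil_def Z.pw_def by (rule refl)
    have z: "(\<lambda>_::nat. 0::nat)(0 := 0) = (\<lambda>_. 0)" by (rule fun_upd_idem) (rule refl)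
    have lN: "Z.fil S N ((\<lambda>_::nat. 0::nat)(0 := 0)) = N"
      unfolding z Z.fil_def Z.pw_zero[OF sub_N] by (rule plus_N[OF S])
    have "module_length R (quot_module Q (ideal_smult R Q (I 0 [^]\<^bsub>ideals_set R\<^esub> k))) = module_length R (quot_module Q A)"
      unfolding J A_def P.Q.ideal_act_def ideal_smult_def by (rule refl)
    also have "\<dots> = len (Z.fil S N ((\<lambda>_::nat. 0::nat)(0 := k))) (Z.fil S N ((\<lambda>_::nat. 0::nat)(0 := 0)))"
      unfolding presentation.module_length[OF P.Q.quot_presentation[OF A]]
        P.len_lift[OF A P.Q.carrier_is_submodule] P.lift_carrier lA lN by (rule refl)
    also have "\<dots> = enat (\<Sum>j<k. h j)" unfolding h_def
      by (rule Z.len_fil_sum(1)[OF S sub_N sub_le_N[OF S]]) (simp add: multi_index_def)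
    finally show ?thesis .
  qed
  obtain c where c0: "\<forall>n. (\<forall>i\<le>0. c \<le> n i) \<longrightarrow> int (Z.hf S N n) = e"
    using e0 unfolding const_diff_def for_all_large_def by auto
  have c: "int (h j) = e" if "c \<le> j" for j
    unfolding h_def by (rule c0[rule_format]) (simp add: that)
  \<comment> \<open>the constant term: the first \<open>c\<close> values, followed by \<open>n + 1 - c\<close> values \<open>e\<close>\<close>
  define C where "C = (of_nat (\<Sum>j<c. h j) :: rat) + of_int e * (1 - of_nat c)"
  have val: "of_nat (\<Sum>j<Suc n. h j) = poly [:C, of_int e:] (of_nat n)" if "c \<le> n" for n
    using that
  proof (induction n rule: dec_induct)
    case base
    have "of_nat (h c) = (of_int e :: rat)" using c[of c] by (metis of_int_of_nat_eq order_refl)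
    then show ?case by (simp add: C_def algebra_simps)
  next
    case (step n)
    have "of_nat (h (Suc n)) = (of_int e :: rat)" using c[of "Suc n"] step(1) by (metis of_int_of_nat_eq le_SucI)
    then show ?case using step by (simp add: algebra_simps)
  qed
  have "hilbert_samuel_poly R (I 0) Q = [:C, of_int e:]"
    unfolding hilbert_samuel_poly_def len
  proof (rule the_equality)
    show "\<exists>c. \<forall>n\<ge>c. \<exists>l::nat. enat (\<Sum>j<Suc n. h j) = enat l \<and> of_nat l = poly [:C, of_int e:] (of_nat n)"
      using val by blast
    fix p :: "rat poly"
    assume "\<exists>c. \<forall>n\<ge>c. \<exists>l::nat. enat (\<Sum>j<Suc n. h j) = enat l \<and> of_nat l = poly p (of_nat n)"
    then obtain b where b: "\<And>n. b \<le> n \<Longrightarrow> of_nat (\<Sum>j<Suc n. h j) = poly p (of_nat n)" by auto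
    show "p = [:C, of_int e:]"
    proof (rule ccontr)
      assume "p \<noteq> [:C, of_int e:]"
      then have "finite {x. poly (p - [:C, of_int e:]) x = 0}" by (intro poly_roots_finite) simp
      moreover have "of_nat ` {max b c..} \<subseteq> {x. poly (p - [:C, of_int e:]) x = 0}"
      proof (rule image_subsetI)
        fix n assume "n \<in> {max b c..}"
        then have "poly p (of_nat n) = poly [:C, of_int e:] (of_nat n)" using b[of n] val[of n] by simp
        then show "of_nat n \<in> {x. poly (p - [:C, of_int e:]) x = 0}" by (simp only: mem_Collect_eq poly_diff diff_self)
      qed
      moreover have "infinite (of_nat ` {max b c..} :: rat set)"
        using infinite_Ici[of "max b c"] by (simp add: finite_image_iff inj_on_def)
      ultimately show False using finite_subset by blast
    qed
  qed
  then show ?thesis unfolding multiplicity_HS_def using nontriv D by (simp add: Let_def)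
qed

end

section \<open>The formula\<close>

context local_family
begin

text \<open>
  Write \<open>L j\<close> for the submodule generated by the first \<open>j\<close> elements. Descending induction on
  \<open>j\<close> shows that the difference of \<open>hf (L j) N\<close> along the remaining indices is constant and
  equals the final multiplicity minus the terms with index greater than \<open>j\<close>. The step from
  \<open>j + 1\<close> to \<open>j\<close> is \<open>superficial_step\<close>.
\<close>

theorem mixed_multiplicity_formula:
  assumes sys: "mixed_mult_system R d I M k xs"
  shows "mixed_mult_defined R d I M k \<and>
    (\<forall>i\<in>{1..length xs}.
       mixed_mult_defined R d I (colon_quotient R M xs i) (\<lambda>j. k j - seq_type (take i xs) j)) \<and>
    of_int (mixed_mult R d I M k) =
      multiplicity_HS R (I 0) (sat_quotient R d I M xs) -
      (\<Sum>i = 1..length xs. of_int (mixed_mult R d I (colon_quotient R M xs i)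
                                    (\<lambda>j. k j - seq_type (take i xs) j)))"
proof -
  let ?s = "length xs"
  define L where "L = (\<lambda>j. seq_submodule R M (take j xs))"
  have k: "seq_type xs = k" and dim: "module_dim R (sat_quotient R d I M xs) \<le> 1"
    and seq: "\<And>j. j < ?s \<Longrightarrow> rees_superficial_elem R d I (quot_module M (L j)) (fst (xs ! j)) (snd (xs ! j))"
    using sys unfolding mixed_mult_system_def rees_superficial_seq_def L_def by blast+
  have ix: "fst (xs ! j) \<le> d" "snd (xs ! j) \<in> I (fst (xs ! j))" if "j < ?s" for j
    using seq[OF that] unfolding rees_superficial_elem_def by blast+
  have xc: "snd (xs ! j) \<in> carrier R" if "j < ?s" for j
    by (rule subsetD[OF I_carrier[OF ix(1)[OF that]] ix(2)[OF that]])
  have xs: "snd ` set xs \<subseteq> carrier R" using xc by (metis image_subsetI in_set_conv_nth)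
  have tk: "snd ` set (take j xs) \<subseteq> carrier R" for j
    by (rule order_trans[OF image_mono[OF set_take_subset] xs])
  have L: "sub (L j)" for j unfolding L_def by (rule sub_seq[OF tk])
  have "fst ` set xs \<subseteq> {..d}" using ix(1) by (metis atMost_iff image_subsetI in_set_conv_nth)
  then have ks: "set (map fst (drop j xs)) \<subseteq> {..d}" for j
    unfolding set_map by (rule order_trans[OF image_mono[OF set_drop_subset]])
  have L0: "L 0 = {\<zero>\<^bsub>M\<^esub>}" unfolding L_def by (simp add: seq_submodule_Nil)
  have LS: "L (Suc j) = snd (xs ! j) \<^bold>* N \<^bold>+ L j" if "j < ?s" for j
    unfolding L_def take_Suc_conv_app_nth[OF that] by (rule seq_submodule_snoc[OF tk xc[OF that]])
  \<comment> \<open>\<open>k - (m\<^sub>i, h\<^sub>i)\<close> is the type of the part of the sequence after its \<open>i\<close>-th element\<close>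
  have idx: "(\<lambda>j. k j - seq_type (take i xs) j) = count_list (map fst (drop i xs))" for i
  proof
    fix j
    have "k j = count_list (map fst (take i xs)) j + count_list (map fst (drop i xs)) j"
      unfolding k[symmetric] seq_type_def count_list_append[symmetric] map_append[symmetric] append_take_drop_id by (rule refl)
    then show "k j - seq_type (take i xs) j = count_list (map fst (drop i xs)) j" unfolding seq_type_def by simp
  qed
  define S where "S = sat (L ?s)"
  note satp = sat_properties[OF L[of ?s], folded S_def]
  have Q: "sat_quotient R d I M xs = quot_module M S"
    unfolding sat_quotient_def S_def sat_def monomial_ones L_def by simp
  have P: "presentation R M (sat_quotient R d I M xs) N S (\<lambda>x. S +>\<^bsub>M\<^esub> x)"
    unfolding Q by (rule quot_presentation[OF satp(1)])
  obtain e where eS: "const_diff d [] (hf S N) e"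
    using const_dim_le1[OF satp(1) dim_le1_of_module_dim[OF P dim]] by blast
  have mult: "multiplicity_HS R (I 0) (sat_quotient R d I M xs) = of_int e"
    by (rule multiplicity_value[OF P satp(4) dim eS])
  obtain t where t: "pw (mult_ones t) S \<subseteq> L ?s" using satp(3) by blast
  have e: "const_diff d [] (hf (L ?s) N) e" by (rule const_saturation[OF L satp(1,2) t eS])
  let ?ks = "\<lambda>i. map fst (drop i xs)"
  define q where "q = (\<lambda>i. mixed_mult R d I (colon_quotient R M xs i) (count_list (?ks i)))"
  have main: "const_diff d (?ks j) (hf (L j) N) (e - (\<Sum>i = Suc j..?s. q i)) \<and>
      (\<forall>i\<in>{Suc j..?s}. mixed_mult_defined R d I (colon_quotient R M xs i) (count_list (?ks i)))" if "j \<le> ?s" for j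
    using that
  proof (induction j rule: inc_induct)
    case base
    show ?case using e by simp
  next
    case (step j)
    have j: "j < ?s" by (rule step.hyps(2))
    let ?i = "fst (xs ! j)" let ?x = "snd (xs ! j)"
    note sup = rees_superficial_quot[OF L seq[OF j]]
    obtain e'' where e'': "const_diff d (?ks (Suc j)) (hf (L j) (L j \<^bold>: ?x)) e''"
      "const_diff d (?i # ?ks (Suc j)) (hf (L j) N) (e - (\<Sum>i = Suc (Suc j)..?s. q i) - e'')"
      using superficial_step[OF sup(1,2) L ks sup(3) conjunct1[OF step.IH, unfolded LS[OF j]]] by blast
    have drop: "?ks j = ?i # ?ks (Suc j)" using Cons_nth_drop_Suc[OF j] by (metis list.simps(9))
    have cq: "colon_quotient R M xs (Suc j) = subquot_module M (L j \<^bold>: ?x) (L j)"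
      unfolding colon_quotient_def L_def by (simp add: Let_def)
    have pres: "presentation R M (colon_quotient R M xs (Suc j)) (L j \<^bold>: ?x) (L j) (\<lambda>y. L j +>\<^bsub>M\<^esub> y)"
      unfolding cq by (rule subquot_presentation[OF sub_colon[OF xc[OF j] L] L subset_colon[OF xc[OF j] L]])
    note mm = mixed_mult_const_diff[OF pres ks e''(1)]
    have qj: "q (Suc j) = e''" unfolding q_def by (rule mm(2))
    have set: "{Suc j..?s} = insert (Suc j) {Suc (Suc j)..?s}" using j by auto
    have sum: "e - (\<Sum>i = Suc (Suc j)..?s. q i) - e'' = e - (\<Sum>i = Suc j..?s. q i)"
      unfolding set using qj by simp
    show ?case
    proof
      show "const_diff d (?ks j) (hf (L j) N) (e - (\<Sum>i = Suc j..?s. q i))"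
        using e''(2) unfolding drop sum .
      show "\<forall>i\<in>{Suc j..?s}. mixed_mult_defined R d I (colon_quotient R M xs i) (count_list (?ks i))"
        unfolding set ball_simps using mm(1) conjunct2[OF step.IH] by blast
    qed
  qed
  have m0: "const_diff d (?ks 0) (hf {\<zero>\<^bsub>M\<^esub>} N) (e - (\<Sum>i = Suc 0..?s. q i))"
    using conjunct1[OF main[OF le0]] unfolding L0 .
  have k0: "count_list (?ks 0) = k" unfolding k[symmetric] seq_type_def by simp
  note mm0 = mixed_mult_const_diff[OF self_presentation ks m0, unfolded k0]
  show ?thesis unfolding idx
  proof (intro conjI)
    show "mixed_mult_defined R d I M k" by (rule mm0(1))
    show "\<forall>i\<in>{1..?s}. mixed_mult_defined R d I (colon_quotient R M xs i) (count_list (?ks i))"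
      using conjunct2[OF main[OF le0]] unfolding One_nat_def .
    show "of_int (mixed_mult R d I M k) = multiplicity_HS R (I 0) (sat_quotient R d I M xs) -
        (\<Sum>i = 1..?s. of_int (mixed_mult R d I (colon_quotient R M xs i) (count_list (?ks i))))"
      unfolding mult mm0(2) q_def One_nat_def by simp
  qed
qed

end

lemma (in noetherian_ring) ideal_sequence_stable:
  assumes A: "\<And>i::nat. ideal (A i) R" "\<And>i. A i \<subseteq> A (Suc i)"
  shows "\<exists>c. \<forall>i\<ge>c. A i = A c"
proof -
  have "\<exists>B\<in>range A. \<forall>C\<in>range A. B \<subseteq> C \<longrightarrow> C = B"
    by (rule maximal_ideal_in_set) (auto simp: A(1))
  then obtain c where c: "\<And>i. A c \<subseteq> A i \<Longrightarrow> A i = A c" by (elim bexE imageE) auto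
  have "A i = A c" if "c \<le> i" for i by (rule c) (rule lift_Suc_mono_le[of A, OF A(2) that])
  then show ?thesis by blast
qed

context module
begin

lemma span_empty: "submodule_span R M {} = {\<zero>\<^bsub>M\<^esub>}"
  using span_least[OF zero_is_submodule, of "{}"] sub_zero[OF sub_span[of "{}"]] by auto

lemma span_insert:
  assumes m: "m \<in> carrier M" and S: "S \<subseteq> carrier M"
  shows "submodule_span R M (insert m S) = cyc m \<^bold>+ submodule_span R M S"
proof (rule equalityI)
  note s = sub_cyc[OF m] sub_span[OF S]
  have mS: "insert m S \<subseteq> carrier M" using m S by simp
  show "submodule_span R M (insert m S) \<subseteq> cyc m \<^bold>+ submodule_span R M S"
  proof (rule span_least[OF sub_plus[OF s]], rule insert_subsetI)
    show "m \<in> cyc m \<^bold>+ submodule_span R M S" by (rule subsetD[OF plus_upper1[OF s] cyc_self[OF m]])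
    show "S \<subseteq> cyc m \<^bold>+ submodule_span R M S" by (rule order_trans[OF span_superset plus_upper2[OF s]])
  qed
  note t = sub_span[OF mS]
  show "cyc m \<^bold>+ submodule_span R M S \<subseteq> submodule_span R M (insert m S)"
  proof (rule plus_least[OF t cyc_le[OF t] span_least[OF t]])
    show "m \<in> submodule_span R M (insert m S)" using span_superset[of "insert m S"] by simp
    show "S \<subseteq> submodule_span R M (insert m S)" using span_superset[of "insert m S"] by simp
  qed
qed

text \<open>
  Modulo \<open>C\<close> the chain becomes a chain of submodules of a cyclic module, that is, of ideals.
  If \<open>f i\<close> and \<open>f c\<close> have the same intersection with \<open>C\<close> and the same image modulo \<open>C\<close>, they
  agree.
\<close>

lemma chain_step:
  assumes noeth: "noetherian_ring R" and m: "m \<in> carrier M" and C: "sub C"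
    and f: "\<And>i::nat. sub (f i)" "\<And>i. f i \<subseteq> f (Suc i)"
    and c: "\<exists>c. \<forall>i\<ge>c. f i \<inter> C = f c \<inter> C"
  shows "\<exists>c. \<forall>i\<ge>c. f i \<inter> (cyc m \<^bold>+ C) = f c \<inter> (cyc m \<^bold>+ C)"
proof -
  have mono: "f i \<subseteq> f j" if "i \<le> j" for i j by (rule lift_Suc_mono_le[of f, OF f(2) that])
  let ?A = "\<lambda>i. ann (f i \<^bold>+ C) m"
  have "\<exists>c. \<forall>i\<ge>c. ?A i = ?A c"
  proof (rule noetherian_ring.ideal_sequence_stable[OF noeth])
    show "ideal (?A i) R" for i by (rule ann_ideal[OF sub_plus[OF f(1) C] m])
    show "?A i \<subseteq> ?A (Suc i)" for i
      using plus_mono[OF f(2)[of i] order_refl[of C]] unfolding ann_def by blast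
  qed
  then obtain a where a: "\<forall>i\<ge>a. ?A i = ?A a" by blast
  obtain b where b: "\<forall>i\<ge>b. f i \<inter> C = f b \<inter> C" using c by blast
  let ?c = "max a b"
  have "f i \<inter> (cyc m \<^bold>+ C) \<subseteq> f ?c" if i: "?c \<le> i" for i
  proof
    fix u assume u: "u \<in> f i \<inter> (cyc m \<^bold>+ C)"
    then have "u \<in> cyc m \<^bold>+ C" by blast
    then obtain y v where y: "y \<in> cyc m" and v: "v \<in> C" "u = y \<oplus>\<^bsub>M\<^esub> v" by (rule plusE) blast
    obtain r where r: "r \<in> carrier R" "y = r \<odot>\<^bsub>M\<^esub> m" using y unfolding cyc_def by blast
    have uc: "u \<in> carrier M" using u sub_carrier[OF f(1)] by blast
    have vc: "v \<in> carrier M" by (rule sub_carrier[OF C v(1)])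
    have yc: "y \<in> carrier M" using r m by simp
    have mv: "\<ominus>\<^bsub>M\<^esub> v \<in> C" by (rule sub_minusD[OF C v(1)])
    have "y = u \<oplus>\<^bsub>M\<^esub> (\<ominus>\<^bsub>M\<^esub> v)" unfolding v(2) using yc vc by (simp add: M.a_assoc M.r_neg)
    then have "y \<in> f i \<^bold>+ C" using plusI[of u "f i" "\<ominus>\<^bsub>M\<^esub> v" C] u mv by simp
    then have "r \<in> ?A i" using r unfolding ann_def by simp
    also have "?A i = ?A a" using a i by (meson max.bounded_iff)
    also have "?A a \<subseteq> ?A ?c"
      using plus_mono[OF mono[of a ?c] order_refl[of C]] unfolding ann_def by auto
    finally have "y \<in> f ?c \<^bold>+ C" using r(2) unfolding ann_def by simp
    then obtain w v' where w: "w \<in> f ?c" and v': "v' \<in> C" "y = w \<oplus>\<^bsub>M\<^esub> v'" by (rule plusE) blast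
    have wc: "w \<in> carrier M" by (rule sub_carrier[OF f(1) w])
    have v'c: "v' \<in> carrier M" by (rule sub_carrier[OF C v'(1)])
    have z: "v' \<oplus>\<^bsub>M\<^esub> v \<in> C" by (rule sub_addD[OF C v'(1) v(1)])
    have uw: "u = (v' \<oplus>\<^bsub>M\<^esub> v) \<oplus>\<^bsub>M\<^esub> w" unfolding v(2) v'(2) using wc v'c vc by (simp add: M.a_ac)
    have wi: "w \<in> f i" using w mono[OF i] by blast
    have ui: "u \<in> f i" using u by blast
    have "v' \<oplus>\<^bsub>M\<^esub> v \<in> f i"
      by (rule sub_diffD[OF f(1) sub_carrier[OF C z] wi]) (simp only: uw[symmetric] ui)
    then have "v' \<oplus>\<^bsub>M\<^esub> v \<in> f i \<inter> C" using z by blast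
    also have "f i \<inter> C = f b \<inter> C" using b i by (meson max.bounded_iff)
    also have "\<dots> \<subseteq> f ?c" using mono[of b ?c] by auto
    finally show "u \<in> f ?c" unfolding uw using w by (rule sub_addD[OF f(1)])
  qed
  moreover have "f ?c \<subseteq> f i" if "?c \<le> i" for i by (rule mono[OF that])
  ultimately have "\<forall>i\<ge>?c. f i \<inter> (cyc m \<^bold>+ C) = f ?c \<inter> (cyc m \<^bold>+ C)" by blast
  then show ?thesis by blast
qed

theorem fin_gen_noetherian:
  assumes noeth: "noetherian_ring R" and fg: "fin_gen_module R M" shows "noetherian_module R M"
proof (intro noetherian_module.intro noetherian_module_axioms.intro module_axioms)
  fix f :: "nat \<Rightarrow> 'c set" assume f: "\<And>i. sub (f i)" "\<And>i. f i \<subseteq> f (Suc i)"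
  obtain S where S: "finite S" "S \<subseteq> carrier M" "submodule_span R M S = carrier M"
    using fg unfolding fin_gen_module_def by blast
  have "\<exists>c. \<forall>i\<ge>c. f i \<inter> submodule_span R M S = f c \<inter> submodule_span R M S"
    using S(1,2)
  proof (induction S rule: finite_induct)
    case empty
    have "f i \<inter> {\<zero>\<^bsub>M\<^esub>} = {\<zero>\<^bsub>M\<^esub>}" for i using sub_zero[OF f(1)] by simp
    then show ?case unfolding span_empty by simp
  next
    case (insert m S)
    then have m: "m \<in> carrier M" and S: "S \<subseteq> carrier M" by simp_all
    show ?case unfolding span_insert[OF m S]
      by (rule chain_step[OF noeth m sub_span[OF S] f insert.IH[OF S]])
  qed
  moreover have "f i \<inter> carrier M = f i" for i using submoduleE(1)[OF f(1)] by blast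
  ultimately show "\<exists>c. \<forall>i\<ge>c. f i = f c" unfolding S(3) by simp
qed

end

text \<open>
  A proper ideal that is maximal among those containing \<open>Q\<close> is a maximal ideal.
\<close>

lemma prime_le_maximal:
  assumes R: "noetherian_local_ring R \<nn>" and Q: "primeideal Q R" shows "Q \<subseteq> \<nn>"
proof -
  interpret cring R using R unfolding noetherian_local_ring_def by blast
  interpret noetherian_ring R using R unfolding noetherian_local_ring_def by blast
  let ?\<I> = "{A. ideal A R \<and> Q \<subseteq> A \<and> A \<noteq> carrier R}"
  have "Q \<in> ?\<I>" using primeideal.axioms(1)[OF Q] primeideal.I_notcarr[OF Q] by blast
  then have ne: "?\<I> \<noteq> {}" by (metis empty_iff)
  have "\<exists>A\<in>?\<I>. \<forall>B\<in>?\<I>. A \<subseteq> B \<longrightarrow> B = A" by (rule maximal_ideal_in_set[OF ne]) simp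
  then obtain A where A: "A \<in> ?\<I>" and max: "\<forall>B\<in>?\<I>. A \<subseteq> B \<longrightarrow> B = A" by (elim bexE)
  have "maximalideal A R"
  proof (rule maximalidealI)
    show "ideal A R" "carrier R \<noteq> A" using A by auto
    fix B assume B: "ideal B R" "A \<subseteq> B" "B \<subseteq> carrier R"
    have "Q \<subseteq> B" using A B(2) by blast
    then show "B = A \<or> B = carrier R" using max B by blast
  qed
  then have "A = \<nn>" using R unfolding noetherian_local_ring_def by blast
  then show ?thesis using A by blast
qed

theorem theorem3p5:
  fixes R :: "('a, 'r) ring_scheme"
    and N :: "('a, 'b, 'm) module_scheme"
    and \<nn> J :: "'a set"
    and d :: nat
    and I :: "nat \<Rightarrow> 'a set"
    and xs :: "(nat \<times> 'a) list"
    and k :: "nat \<Rightarrow> nat"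
  assumes "noetherian_local_ring R \<nn>"
    and "infinite (carrier (R Quot \<nn>))"
    and "module R N"
    and "fin_gen_module R N"
    and "d \<ge> 1"
    and "\<And>i. i \<in> {1..d} \<Longrightarrow> ideal (I i) R"
    and "primary_ideal R J"
    and "ideal_radical R J = \<nn>"
    and "I 0 = J"
    and "mixed_mult_system R d I N k xs"
  shows "mixed_mult_defined R d I N k \<and>
    (\<forall>i\<in>{1..length xs}.
       mixed_mult_defined R d I (colon_quotient R N xs i) (\<lambda>j. k j - seq_type (take i xs) j)) \<and>
    of_int (mixed_mult R d I N k) =
      multiplicity_HS R J (sat_quotient R d I N xs) -
      (\<Sum>i = 1..length xs. of_int (mixed_mult R d I (colon_quotient R N xs i)
                                    (\<lambda>j. k j - seq_type (take i xs) j)))"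
proof -
  interpret cring R using assms(1) unfolding noetherian_local_ring_def by blast
  have noeth: "noetherian_ring R" and max: "maximalideal \<nn> R"
    using assms(1) unfolding noetherian_local_ring_def by blast+
  have J: "ideal J R" using assms(7) unfolding primary_ideal_def by blast
  have "local_family R N \<nn> d I"
  proof (intro local_family.intro noetherian_ring_module.intro local_family_axioms.intro)
    show "noetherian_module R N" by (rule module.fin_gen_noetherian[OF assms(3) noeth assms(4)])
    show "noetherian_ring R" by (rule noeth)
    show "maximalideal \<nn> R" by (rule max)
    show "Q \<subseteq> \<nn>" if "primeideal Q R" for Q by (rule prime_le_maximal[OF assms(1) that])
    show "ideal (I i) R" if "i \<le> d" for i
    proof (cases "i = 0")
      case True then show ?thesis using J assms(9) by simp
    next
      case False then show ?thesis using that by (intro assms(6)) simp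
    qed
    show "I 0 \<subseteq> \<nn>"
    proof
      fix a assume "a \<in> I 0"
      then have a: "a \<in> J" "a \<in> carrier R" using assms(9) ideal.Icarr[OF J] by simp_all
      then have "a [^]\<^bsub>R\<^esub> (1::nat) \<in> J" by simp
      then show "a \<in> \<nn>" using a(2) unfolding assms(8)[symmetric] ideal_radical_def by blast
    qed
    show "Q = \<nn>" if Q: "primeideal Q R" "I 0 \<subseteq> Q" for Q
    proof (rule equalityI[OF prime_le_maximal[OF assms(1) Q(1)]], rule subsetI)
      fix a assume "a \<in> \<nn>"
      then obtain t :: nat where a: "a \<in> carrier R" "a [^]\<^bsub>R\<^esub> t \<in> J"
        unfolding assms(8)[symmetric] ideal_radical_def by blast
      show "a \<in> Q" by (rule prime_power[OF Q(1) a(1)]) (use a(2) Q(2) assms(9) in blast)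
    qed
  qed
  then show ?thesis using local_family.mixed_multiplicity_formula[OF _ assms(10)] unfolding assms(9) by blast
qed

end
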